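(* In the $m$-sample semiparametric density model ($m\ge1$) described in the context, suppose Assumptions 1 to 8 (written out in the context) hold. Let $\hat\tau=(\hat\theta,\hat h)$ be the penalized likelihood estimator and $\tilde\tau=(\tilde\theta,\tilde h)$ the minimizer of the quadratic criterion $\sum_{l}\tilde{\mathfrak L}_{n_l}(\theta,h)+\frac\lambda2J(h)$. Then, as $n=\min_{1\le l\le m}n_l\to\infty$, $\lambda\to0$ and $n\lambda^{1/r}\to\infty$, $$\sum_{l=1}^mV_{l,\tau_0}\big[L_{l,\theta}(\hat\theta-\tilde\theta)+L_{l,h}(\hat h-\tilde h)\big]+\lambda J(\hat h-\tilde h)=O_p\big(n^{-1}\lambda^{-1/r}+\lambda\big),$$ and therefore $$\sum_{l=1}^mV_{l,\tau_0}\big[L_{l,\theta}(\hat\theta-\theta_0)+L_{l,h}(\hat h-h_0)\big]+\lambda J(\hat h-h_0)=O_p\big(n^{-1}\lambda^{-1/r}+\lambda\big).$$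
   Context: Setting. $p,m\ge1$; for $l=1,\dots,m$, $\mathcal X_l$ is a sample space (integrals are with respect to a reference measure $dx$); $\mathcal H$ is a real Hilbert space of functions with norm $\|\cdot\|$; $\mathcal Q=\mathbb R^p\times\mathcal H$. Write $\tau=(\theta,h)\in\mathcal Q$. For each $l$, $\eta_l:\mathcal Q\to L^2_0(\mathcal X_l)$ is a known map, with values written $\eta_l(x;\tau)$, and $f_l(x;\tau)=e^{\eta_l(x;\tau)}/\int_{\mathcal X_l}e^{\eta_l(t;\tau)}dt$. The true parameter is $\tau_0=(\theta_0,h_0)$; $L^2_{\tau_0}(\mathcal X_l)$ is the space of functions with finite second moment under $f_l(\cdot;\tau_0)$ and $L^2_0(\mathcal X_l)=L^2_{\tau_0}(\mathcal X_l)\ominus\{1\}$. The samples are independent, $X_{l1},\dots,X_{ln_l}$ iid from $f_l(\cdot;\tau_0)$; $n=\min_ln_l$; $\lambda>0$ is a smoothing parameter. $D_\theta,D_h$ are Fréchet partial derivatives. Put $\mu_{l,\tau}(\varphi)=\int\varphi f_l(\cdot;\tau)$, $V_{l,\tau}(\varphi_1,\varphi_2)=\mu_{l,\tau}(\varphi_1\varphi_2)-\mu_{l,\tau}(\varphi_1)\mu_{l,\tau}(\varphi_2)$, $V_{l,\tau}(\varphi)=V_{l,\tau}(\varphi,\varphi)$. $O_p$ statements are along arbitrary deterministic sequences of $(n_1,\dots,n_m,\lambda)$ with the stated limits. Criteria. $\mathfrak L_{n_l}(\theta,h)=-\frac1{n_l}\sum_{i=1}^{n_l}\eta_l(X_{li};\theta,h)+\log\int_{\mathcal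 X_l}e^{\eta_l(x;\theta,h)}dx$. It is assumed that $\sum_l\mathfrak L_{n_l}$ is convex and that the penalized criterion $\sum_l\mathfrak L_{n_l}(\theta,h)+\frac\lambda2J(h)$ has a unique local minimum $\hat\tau=(\hat\theta,\hat h)$ in $\mathcal N_{\theta_0}\times\mathcal N_{h_0}$, which is its unique critical point there (both $D_\theta$ and $D_h$ derivatives zero). The quadratic criterion is $\sum_l\tilde{\mathfrak L}_{n_l}(\theta,h)+\frac\lambda2J(h)$ with $$\tilde{\mathfrak L}_{n_l}(\theta,h)=-\tfrac1{n_l}\sum_{i}[D_\theta\eta_l(X_{li};\tau_0)\theta+D_h\eta_l(X_{li};\tau_0)h]+\mu_{l,\tau_0}[D_\theta\eta_l(\tau_0)\theta+D_h\eta_l(\tau_0)h]+\tfrac12V_{l,\tau_0}[D_\theta\eta_l(\tau_0)(\theta-\theta_0)+D_h\eta_l(\tau_0)(h-h_0)],$$ and its minimizer is $\tilde\tau=(\tilde\theta,\tilde h)$; it is assumed that $\tilde\tau\in\mathcal N_{\theta_0}\times\mathcal N_{h_0}$. Assumption 1. $J$ is a square seminorm on $\mathcal H$ with finite-dimensional null space and semi-inner product $J(\cdot,\cdot)$; $J(h_0)<\infty$. Assumption 2. For each $l$ there are bounded linear operators $L_{l,\theta}:\mathbb R^p\to L^2_0(\mathcal X_l)$, $L_{l,h}:\mathcal H\to L^2_0(\mathcal X_l)$ with zero null spaces such that (i) there are positive constants $M_1,M_2$ (possibly depending on $\lambda$) with $M_1\|g\|^2\le\sum_lV_{l,\tau_0}(L_{l,h}g)+\lambda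 J(g)\le M_2\|g\|^2$ for all $g\in\mathcal H$; (ii) there is $c_\delta>0$ with $\sum_lV_{l,\tau_0}(L_{l,\theta}\zeta-L_{l,h}g)>c_\delta$ for all $\zeta\in\mathbb R^p$ with $\|\zeta\|_{l^2}=1$ and all $g\in\mathcal H$. There are neighborhoods $\mathcal N_{\theta_0}\subset\mathbb R^p$ of $\theta_0$ and $\mathcal N_{h_0}\subset\mathcal H$ of $h_0$ for which Assumptions 3–6 hold. Assumption 3. Each $\eta_l$ is one-to-one and three times continuously Fréchet differentiable on $\mathcal N_{\theta_0}\times\mathcal N_{h_0}$, and $\tau_0$ is the unique root there of $E[D_\theta\sum_l\mathfrak L_{n_l}(\theta,h)]=0$, $E[D_h\sum_l\mathfrak L_{n_l}(\theta,h)]=0$. Assumption 4. For all $(\theta_*,h_* )\in\mathcal N_{\theta_0}\times\mathcal N_{h_0}$ and all $l$, $D_\theta\eta_l(\theta_*,h_* ):\mathbb R^p\to L_0^2(\mathcal X_l)$ and $D_h\eta_l(\theta_*,h_* ):\mathcal H\to L_0^2(\mathcal X_l)$ are bounded linear, and there are constants $C_1,C_2>0$ with $C_1\sum_lV_{l,\tau_0}(L_{l,\theta}\zeta+L_{l,h}g)\le\sum_lV_{l,\tau_0}(D_\theta\eta_l(\theta_*,h_* )\zeta+D_h\eta_l(\theta_*,h_* )g)\le C_2\sum_lV_{l,\tau_0}(L_{l,\theta}\zeta+L_{l,h}g)$ for all $(\zeta,g)\in\mathcal Q$. Assumption 5. There is a positive constant $C_d<2C_1$ such that for all $(\theta_1,h_1),(\theta_2,h_2)$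 and $(\zeta,g)$ in $\mathcal N_{\theta_0}\times\mathcal N_{h_0}$, $\sum_lV_{l,\tau_0}[(D_\theta\eta_l(\theta_1,h_1)-D_\theta\eta_l(\theta_2,h_2))\zeta+(D_h\eta_l(\theta_1,h_1)-D_h\eta_l(\theta_2,h_2))g]\le C_d\sum_lV_{l,\tau_0}(L_{l,\theta}\zeta+L_{l,h}g)$. Assumption 6. $\mathcal N_{\theta_0}\times\mathcal N_{h_0}$ is convex and contains $\hat\tau$, and there are $C_3,C_4>0$ with $C_3\sum_lV_{l,\tau_0}(f_l)\le\sum_lV_{l,\tau}(f_l)\le C_4\sum_lV_{l,\tau_0}(f_l)$ for all $\tau\in\mathcal N_{\theta_0}\times\mathcal N_{h_0}$ and all $f_l\in L_0^2(\mathcal X_l)$, $l=1,\dots,m$. Assumption 7. The quadratic functional $g\mapsto\sum_lV_{l,\tau_0}(L_{l,h}g)$ is completely continuous with respect to $J$ (for every $\epsilon>0$ there are finitely many continuous linear functionals $\ell_1,\dots,\ell_k$ such that $\ell_1(g)=\dots=\ell_k(g)=0$ implies $\sum_lV_{l,\tau_0}(L_{l,h}g)\le\epsilon J(g)$). This yields eigenfunctions $\phi_\nu$ and eigenvalues $0\le\rho_\nu\to\infty$, $\nu=1,2,\dots$, with $\sum_lV_{l,\tau_0}(L_{l,h}\phi_\nu,L_{l,h}\phi_\mu)=\delta_{\nu\mu}$, $J(\phi_\nu,\phi_\mu)=\rho_\nu\delta_{\nu\mu}$. Assumption 8. $\rho_\nu=\kappa_\nu\nu^r$ with $r>1$ and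 $\kappa_\nu\in(\beta_1,\beta_2)\subset(0,\infty)$. *)

theory Defs
  imports "HOL-Probability.Probability"
begin

section \<open>Square-integrable functions\<close>

text \<open>
  Elements of \<open>L\<^sup>2\<close> are represented by functions rather than by classes, because the
  criteria below evaluate them at the observations. Identities between elements of \<open>L\<^sup>2\<close>
  are therefore almost-everywhere identities.
\<close>

definition L2 :: "'x measure \<Rightarrow> ('x \<Rightarrow> real) set" where
  "L2 P = {f \<in> borel_measurable P. integrable P (\<lambda>x. (f x)\<^sup>2)}"

definition L2_0 :: "'x measure \<Rightarrow> ('x \<Rightarrow> real) set" where
  "L2_0 P = {f \<in> L2 P. (LINT x|P. f x) = 0}"

definition L2_norm :: "'x measure \<Rightarrow> ('x \<Rightarrow> real) \<Rightarrow> real" where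
  "L2_norm P f = sqrt (LINT x|P. (f x)\<^sup>2)"

definition cov :: "'x measure \<Rightarrow> ('x \<Rightarrow> real) \<Rightarrow> ('x \<Rightarrow> real) \<Rightarrow> real" where
  "cov P f g = (LINT x|P. f x * g x) - (LINT x|P. f x) * (LINT x|P. g x)"

abbreviation sum_cov ::
  "nat \<Rightarrow> (nat \<Rightarrow> 'x measure) \<Rightarrow> (nat \<Rightarrow> 'x \<Rightarrow> real) \<Rightarrow> (nat \<Rightarrow> 'x \<Rightarrow> real) \<Rightarrow> real" where
  "sum_cov m P f g \<equiv> (\<Sum>l=1..m. cov (P l) (f l) (g l))"

abbreviation sum_var :: "nat \<Rightarrow> (nat \<Rightarrow> 'x measure) \<Rightarrow> (nat \<Rightarrow> 'x \<Rightarrow> real) \<Rightarrow> real" where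
  "sum_var m P f \<equiv> sum_cov m P f f"


section \<open>Operators into the mean-zero functions and Frechet smoothness\<close>

definition L2_bounded_linear :: "'x measure \<Rightarrow> ('v::real_normed_vector \<Rightarrow> 'x \<Rightarrow> real) \<Rightarrow> bool" where
  "L2_bounded_linear P T \<longleftrightarrow>
     (\<forall>v. T v \<in> L2_0 P) \<and>
     (\<forall>u v. AE x in P. T (u + v) x = T u x + T v x) \<and>
     (\<forall>c v. AE x in P. T (c *\<^sub>R v) x = c * T v x) \<and>
     (\<exists>K. \<forall>v. L2_norm P (T v) \<le> K * norm v)"

definition L2_zero_null_space :: "'x measure \<Rightarrow> ('v::real_normed_vector \<Rightarrow> 'x \<Rightarrow> real) \<Rightarrow> bool" where
  "L2_zero_null_space P T \<longleftrightarrow> (\<forall>v. (AE x in P. T v x = 0) \<longrightarrow> v = 0)"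

definition L2_bounded_multilinear ::
  "'x measure \<Rightarrow> nat \<Rightarrow> ('v::real_normed_vector list \<Rightarrow> 'x \<Rightarrow> real) \<Rightarrow> bool" where
  "L2_bounded_multilinear P j T \<longleftrightarrow>
     (\<forall>vs. length vs = j \<longrightarrow> T vs \<in> L2_0 P \<and>
        (\<forall>i<j. \<forall>u v. AE x in P. T (vs[i := u + v]) x = T (vs[i := u]) x + T (vs[i := v]) x) \<and>
        (\<forall>i<j. \<forall>c u. AE x in P. T (vs[i := c *\<^sub>R u]) x = c * T (vs[i := u]) x)) \<and>
     (\<exists>K. \<forall>vs. length vs = j \<longrightarrow> L2_norm P (T vs) \<le> K * prod_list (map norm vs))"

text \<open>
  \<open>k\<close> times continuously Frechet differentiable on the open set \<open>S\<close>, as a map into the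
  mean-zero functions. \<open>D j \<tau>\<close> is the \<open>j\<close>-th derivative at \<open>\<tau>\<close>, a bounded \<open>j\<close>-linear map;
  differentiability of \<open>D j\<close> and continuity of \<open>D k\<close> are with respect to the operator norm
  of multilinear maps, written out as uniformity in the arguments \<open>vs\<close>.
\<close>

definition L2_Ck_on ::
  "'x measure \<Rightarrow> nat \<Rightarrow> 'v::real_normed_vector set \<Rightarrow> ('v \<Rightarrow> 'x \<Rightarrow> real) \<Rightarrow> bool" where
  "L2_Ck_on P k S F \<longleftrightarrow> (\<exists>D :: nat \<Rightarrow> 'v \<Rightarrow> 'v list \<Rightarrow> 'x \<Rightarrow> real.
     (\<forall>\<tau>\<in>S. D 0 \<tau> [] = F \<tau>) \<and>
     (\<forall>j\<le>k. \<forall>\<tau>\<in>S. L2_bounded_multilinear P j (D j \<tau>)) \<and>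
     (\<forall>j<k. \<forall>\<tau>\<in>S. \<forall>\<epsilon>>0. \<exists>\<delta>>0. \<forall>\<sigma>\<in>S. norm (\<sigma> - \<tau>) < \<delta> \<longrightarrow>
        (\<forall>vs. length vs = j \<longrightarrow>
           L2_norm P (\<lambda>x. D j \<sigma> vs x - D j \<tau> vs x - D (Suc j) \<tau> ((\<sigma> - \<tau>) # vs) x)
             \<le> \<epsilon> * norm (\<sigma> - \<tau>) * prod_list (map norm vs))) \<and>
     (\<forall>\<tau>\<in>S. \<forall>\<epsilon>>0. \<exists>\<delta>>0. \<forall>\<sigma>\<in>S. norm (\<sigma> - \<tau>) < \<delta> \<longrightarrow>
        (\<forall>vs. length vs = k \<longrightarrow>
           L2_norm P (\<lambda>x. D k \<sigma> vs x - D k \<tau> vs x) \<le> \<epsilon> * prod_list (map norm vs))))"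

definition D_fst ::
  "('a::real_normed_vector \<times> 'b::real_normed_vector \<Rightarrow> real) \<Rightarrow> 'a \<times> 'b \<Rightarrow> 'a \<Rightarrow> real" where
  "D_fst F \<tau> = frechet_derivative (\<lambda>t. F (t, snd \<tau>)) (at (fst \<tau>))"

definition D_snd ::
  "('a::real_normed_vector \<times> 'b::real_normed_vector \<Rightarrow> real) \<Rightarrow> 'a \<times> 'b \<Rightarrow> 'b \<Rightarrow> real" where
  "D_snd F \<tau> = frechet_derivative (\<lambda>u. F (fst \<tau>, u)) (at (snd \<tau>))"

definition critical_point ::
  "('a::real_normed_vector \<times> 'b::real_normed_vector \<Rightarrow> real) \<Rightarrow> 'a \<times> 'b \<Rightarrow> bool" where
  "critical_point F \<tau> \<longleftrightarrow>
     ((\<lambda>t. F (t, snd \<tau>)) has_derivative (\<lambda>_. 0)) (at (fst \<tau>)) \<and>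
     ((\<lambda>u. F (fst \<tau>, u)) has_derivative (\<lambda>_. 0)) (at (snd \<tau>))"

definition local_minimum :: "('a::topological_space \<Rightarrow> real) \<Rightarrow> 'a \<Rightarrow> bool" where
  "local_minimum F \<tau> \<longleftrightarrow> (\<forall>\<^sub>F \<sigma> in nhds \<tau>. F \<tau> \<le> F \<sigma>)"


section \<open>The density model\<close>

text \<open>
  In this section \<open>M\<close> is the reference measure of one sample space, \<open>\<eta> \<tau> x\<close> is the log density
  at \<open>x\<close> up to normalization, and \<open>xs i\<close>, \<open>i = 1, \<dots>, n\<close>, are the observed values.
\<close>

definition model_density :: "'x measure \<Rightarrow> ('t \<Rightarrow> 'x \<Rightarrow> real) \<Rightarrow> 't \<Rightarrow> 'x \<Rightarrow> real" where
  "model_density M \<eta> \<tau> x = exp (\<eta> \<tau> x) / (LINT t|M. exp (\<eta> \<tau> t))"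

definition model_law :: "'x measure \<Rightarrow> ('t \<Rightarrow> 'x \<Rightarrow> real) \<Rightarrow> 't \<Rightarrow> 'x measure" where
  "model_law M \<eta> \<tau> = density M (\<lambda>x. ennreal (model_density M \<eta> \<tau> x))"

text \<open>
  The derivatives of \<open>\<tau> \<mapsto> \<eta> \<tau>\<close> are evaluated at observations, so they are represented by the
  derivatives of the point values \<open>\<tau> \<mapsto> \<eta> \<tau> x\<close>. Where both exist on an open set, they agree
  almost everywhere, in each direction, with the derivative in the \<open>L\<^sup>2\<close> sense (a sequence of
  difference quotients converges to either one).
\<close>

abbreviation D_theta ::
  "('a::real_normed_vector \<times> 'b::real_normed_vector \<Rightarrow> 'x \<Rightarrow> real) \<Rightarrow> 'a \<times> 'b \<Rightarrow> 'a \<Rightarrow> 'x \<Rightarrow> real" where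
  "D_theta \<eta> \<tau> \<zeta> x \<equiv> D_fst (\<lambda>\<sigma>. \<eta> \<sigma> x) \<tau> \<zeta>"

abbreviation D_h ::
  "('a::real_normed_vector \<times> 'b::real_normed_vector \<Rightarrow> 'x \<Rightarrow> real) \<Rightarrow> 'a \<times> 'b \<Rightarrow> 'b \<Rightarrow> 'x \<Rightarrow> real" where
  "D_h \<eta> \<tau> g x \<equiv> D_snd (\<lambda>\<sigma>. \<eta> \<sigma> x) \<tau> g"

definition neg_loglik ::
  "'x measure \<Rightarrow> ('t \<Rightarrow> 'x \<Rightarrow> real) \<Rightarrow> nat \<Rightarrow> (nat \<Rightarrow> 'x) \<Rightarrow> 't \<Rightarrow> real" where
  "neg_loglik M \<eta> n xs \<tau> =
     - (1 / real n) * (\<Sum>i=1..n. \<eta> \<tau> (xs i)) + ln (LINT x|M. exp (\<eta> \<tau> x))"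

definition quad_loglik ::
  "'x measure \<Rightarrow> ('a::real_normed_vector \<times> 'b::real_normed_vector \<Rightarrow> 'x \<Rightarrow> real) \<Rightarrow> 'a \<times> 'b \<Rightarrow>
   nat \<Rightarrow> (nat \<Rightarrow> 'x) \<Rightarrow> 'a \<times> 'b \<Rightarrow> real" where
  "quad_loglik M \<eta> \<tau>0 n xs \<tau> =
     (let P0 = model_law M \<eta> \<tau>0;
          D = (\<lambda>v x. D_theta \<eta> \<tau>0 (fst v) x + D_h \<eta> \<tau>0 (snd v) x)
      in - (1 / real n) * (\<Sum>i=1..n. D \<tau> (xs i)) + (LINT x|P0. D \<tau> x)
         + 1 / 2 * cov P0 (D (\<tau> - \<tau>0)) (D (\<tau> - \<tau>0)))"

definition sum_loglik ::
  "nat \<Rightarrow> (nat \<Rightarrow> 'x measure) \<Rightarrow> (nat \<Rightarrow> 't \<Rightarrow> 'x \<Rightarrow> real) \<Rightarrow> (nat \<Rightarrow> nat) \<Rightarrow> (nat \<Rightarrow> nat \<Rightarrow> 'x)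
   \<Rightarrow> 't \<Rightarrow> real" where
  "sum_loglik m M \<eta> n xs \<tau> = (\<Sum>l=1..m. neg_loglik (M l) (\<eta> l) (n l) (xs l) \<tau>)"

definition pen_crit ::
  "nat \<Rightarrow> (nat \<Rightarrow> 'x measure) \<Rightarrow> (nat \<Rightarrow> 'a \<times> 'b \<Rightarrow> 'x \<Rightarrow> real) \<Rightarrow> ('b \<Rightarrow> 'b \<Rightarrow> real) \<Rightarrow> real \<Rightarrow>
   (nat \<Rightarrow> nat) \<Rightarrow> (nat \<Rightarrow> nat \<Rightarrow> 'x) \<Rightarrow> 'a \<times> 'b \<Rightarrow> real" where
  "pen_crit m M \<eta> J lam n xs \<tau> =
     sum_loglik m M \<eta> n xs \<tau> + lam / 2 * J (snd \<tau>) (snd \<tau>)"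

definition quad_crit ::
  "nat \<Rightarrow> (nat \<Rightarrow> 'x measure) \<Rightarrow>
   (nat \<Rightarrow> 'a::real_normed_vector \<times> 'b::real_normed_vector \<Rightarrow> 'x \<Rightarrow> real) \<Rightarrow> ('b \<Rightarrow> 'b \<Rightarrow> real) \<Rightarrow>
   'a \<times> 'b \<Rightarrow> real \<Rightarrow> (nat \<Rightarrow> nat) \<Rightarrow> (nat \<Rightarrow> nat \<Rightarrow> 'x) \<Rightarrow> 'a \<times> 'b \<Rightarrow> real" where
  "quad_crit m M \<eta> J \<tau>0 lam n xs \<tau> =
     (\<Sum>l=1..m. quad_loglik (M l) (\<eta> l) \<tau>0 (n l) (xs l) \<tau>) + lam / 2 * J (snd \<tau>) (snd \<tau>)"


section \<open>Penalty\<close>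

definition semi_inner_product :: "('v::real_vector \<Rightarrow> 'v \<Rightarrow> real) \<Rightarrow> bool" where
  "semi_inner_product J \<longleftrightarrow> bilinear J \<and> (\<forall>f g. J f g = J g f) \<and> (\<forall>g. 0 \<le> J g g)"

definition completely_continuous_wrt ::
  "('v::real_normed_vector \<Rightarrow> real) \<Rightarrow> ('v \<Rightarrow> real) \<Rightarrow> bool" where
  "completely_continuous_wrt A B \<longleftrightarrow>
     (\<forall>\<epsilon>>0. \<exists>F :: ('v \<Rightarrow> real) set. finite F \<and> (\<forall>f\<in>F. bounded_linear f) \<and>
        (\<forall>g. (\<forall>f\<in>F. f g = 0) \<longrightarrow> A g \<le> \<epsilon> * B g))"


section \<open>Probabilistic asymptotics\<close>

text \<open>
  \<open>Z k = O\<^sub>p(a k)\<close>. The bound is required on an event of probability at least \<open>1 - \<epsilon>\<close>; for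
  measurable \<open>Z k\<close> this is the usual definition, and it stays meaningful when \<open>Z k\<close> is
  built from minimizers that are not known to be measurable.
\<close>

definition bigO_prob :: "'w measure \<Rightarrow> (nat \<Rightarrow> 'w \<Rightarrow> real) \<Rightarrow> (nat \<Rightarrow> real) \<Rightarrow> bool" where
  "bigO_prob P Z a \<longleftrightarrow>
     (\<forall>\<epsilon>>0. \<exists>C. \<forall>\<^sub>F k in sequentially.
        \<exists>A\<in>sets P. measure P A \<ge> 1 - \<epsilon> \<and> (\<forall>\<omega>\<in>A. \<bar>Z k \<omega>\<bar> \<le> C * a k))"

definition with_prob_tendsto_1 :: "'w measure \<Rightarrow> (nat \<Rightarrow> 'w \<Rightarrow> bool) \<Rightarrow> bool" where
  "with_prob_tendsto_1 P E \<longleftrightarrow>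
     (\<exists>A. (\<forall>k. A k \<in> sets P \<and> (\<forall>\<omega>\<in>A k. E k \<omega>)) \<and> (\<lambda>k. measure P (A k)) \<longlonglongrightarrow> 1)"

end

theory Submission
  imports Defs
begin

text \<open>
  In the coordinates \<open>v = \<tau> - \<tau>0\<close> write \<open>g l v - A l v\<close> for the log density ratio and \<open>W\<close> for the quadratic form of
  the operators \<open>L\<close>. Convexity of the criterion for almost every sample makes each \<open>g l\<close> concave up to the gap in
  \<open>\<Sum>l. A l\<close>, and Assumption 6 bounds the ratio uniformly on the neighbourhood. Concavity at midpoints then gives
  \<open>W v \<le> K * (\<Sum>l. A l v)\<close>, that is, the Kullback-Leibler divergence dominates \<open>W\<close> on the whole neighbourhood, and it
  controls \<open>g v - g p\<close> by the derivative at \<open>p\<close> up to a small error.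

  On the ellipsoid \<open>W + \<lambda> J \<le> C R\<close>, \<open>R = K (d / n + \<lambda>)\<close>, \<open>d\<close> the effective dimension, take a net with \<open>exp (O (d))\<close> points.
  A Chernoff bound at the net points and an exponential bound for the clipped linear process around each of them (averaging
  over biased random signs in the eigenbasis) show that the log-likelihood ratio is at most \<open>- c R\<close> where \<open>W \<ge> R / 4\<close>, with
  probability close to one. If the estimator lay outside the ellipsoid, the segment from \<open>\<tau>0\<close> to it would cross the shell
  at a point where the penalized criterion is not larger than at \<open>\<tau>0\<close>; there the score bound makes the penalty negligible,
  so \<open>W\<close> is large, a contradiction. The quadratic minimizer is bounded by the score alone, and the first claim follows from
  the triangle inequality.
\<close>

section \<open>Gibbs variational inequality for independent biased signs\<close>

section \<open>Averages over biased signs\<close>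

text \<open>The derivatives \<open>D\<close> are controlled only in mean square under the true laws,
  and nothing bounds the eigenfunctions in sup norm, so the linear process has no envelope for
  Bernstein bounds or chaining. Clipping replaces the envelope: only upper bounds on the likelihood
  ratio are wanted, and its increments are bounded by \<open>4 * B\<close> anyway, so the clipped
  process still dominates them. A single expansion at the truth would not do. Linearizing at
  \<open>p\<close> costs about \<open>sqrt (W p) * sqrt (W (v - p)) + W (v - p)\<close>, which for
  \<open>p = 0\<close> is as large as the divergence to be gained; hence a net whose mesh is a small
  fraction of the radius, where this error and the local fluctuation use up only part of the
  negative drift at the centre. The factor \<open>K\<close> pays for the union bound over the
  centres. Random signs instead of a Gaussian prior make every average a finite sum, so that neither
  product measures nor joint measurability enter. Events are built for rational coefficient vectors
  with finite support and reach all other points by continuity.\<close>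

fun sign_avg :: "('j \<Rightarrow> real) \<Rightarrow> 'j list \<Rightarrow> (('j \<Rightarrow> real) \<Rightarrow> real) \<Rightarrow> real" where
  "sign_avg t [] f = f (\<lambda>_. 0)"
| "sign_avg t (j # js) f =
     (1 + t j) / 2 * sign_avg t js (\<lambda>e. f (e(j := 1))) +
     (1 - t j) / 2 * sign_avg t js (\<lambda>e. f (e(j := -1)))"

lemma sign_avg_mono:
  assumes "\<And>j. j \<in> set js \<Longrightarrow> \<bar>t j\<bar> \<le> 1" "\<And>e. f e \<le> h e"
  shows "sign_avg t js f \<le> sign_avg t js h"
  using assms
proof (induction js arbitrary: f h)
  case (Cons j js)
  have "sign_avg t js (\<lambda>e. f (e(j := s))) \<le> sign_avg t js (\<lambda>e. h (e(j := s)))" for s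
    using Cons by (intro Cons.IH) auto
  moreover have "0 \<le> (1 + t j) / 2" "0 \<le> (1 - t j) / 2"
    using Cons.prems(1)[of j] by auto
  ultimately show ?case
    unfolding sign_avg.simps by (intro add_mono mult_left_mono)
qed simp

lemma sign_avg_add: "sign_avg t js (\<lambda>e. f e + h e) = sign_avg t js f + sign_avg t js h"
  by (induction js arbitrary: f h) (simp_all add: algebra_simps)

lemma sign_avg_cmult: "sign_avg t js (\<lambda>e. c * f e) = c * sign_avg t js f"
  by (induction js arbitrary: f) (simp_all add: algebra_simps)

lemma sign_avg_const: "sign_avg t js (\<lambda>_. c) = c"
  by (induction js) (simp_all add: field_simps)

lemma sign_avg_diff: "sign_avg t js (\<lambda>e. f e - h e) = sign_avg t js f - sign_avg t js h"
  using sign_avg_add[of t js f "\<lambda>e. (-1) * h e"] sign_avg_cmult[of t js "-1" h] by simp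

lemma sign_avg_sum: "sign_avg t js (\<lambda>e. \<Sum>i\<in>I. f i e) = (\<Sum>i\<in>I. sign_avg t js (f i))"
  by (induction I rule: infinite_finite_induct) (simp_all add: sign_avg_const sign_avg_add)

lemma sign_avg_affine:
  assumes "distinct js"
  shows "sign_avg t js (\<lambda>e. c + (\<Sum>j\<in>set js. a j * e j)) = c + (\<Sum>j\<in>set js. a j * t j)"
  using assms
proof (induction js arbitrary: c)
  case (Cons j js)
  have "(\<Sum>i\<in>set (j # js). a i * (e(j := s)) i) = a j * s + (\<Sum>i\<in>set js. a i * e i)" for e :: "'a \<Rightarrow> real" and s
    using Cons.prems by (subst set_simps, subst sum.insert) (auto intro!: sum.cong)
  then have *: "sign_avg t js (\<lambda>e. c + (\<Sum>i\<in>set (j # js). a i * (e(j := s)) i)) =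
      (c + a j * s) + (\<Sum>i\<in>set js. a i * t i)" for s
    using Cons.IH[of "c + a j * s"] Cons.prems by (simp add: add.assoc)
  have "sign_avg t (j # js) (\<lambda>e. c + (\<Sum>j\<in>set (j # js). a j * e j)) =
      c + (a j * t j + (\<Sum>i\<in>set js. a i * t i))"
    unfolding sign_avg.simps * by (simp add: field_simps)
  then show ?case
    using Cons.prems by simp
qed simp

text \<open>A sign of bias \<open>t j\<close> has mean \<open>t j\<close> and variance
  \<open>1 - (t j)\<^sup>2\<close>, and different signs are independent; each variance is bounded by
  one.\<close>

lemma sign_avg_square:
  assumes "distinct js" "\<And>j. j \<in> set js \<Longrightarrow> \<bar>t j\<bar> \<le> 1"
  shows "sign_avg t js (\<lambda>e. (c + (\<Sum>j\<in>set js. a j * e j))\<^sup>2) \<le>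
    (c + (\<Sum>j\<in>set js. a j * t j))\<^sup>2 + (\<Sum>j\<in>set js. (a j)\<^sup>2)"
  using assms
proof (induction js arbitrary: c)
  case (Cons j js)
  let ?r = "\<Sum>i\<in>set js. a i * t i"
  have "(\<Sum>i\<in>set (j # js). a i * (e(j := s)) i) = a j * s + (\<Sum>i\<in>set js. a i * e i)" for e :: "'a \<Rightarrow> real" and s
    using Cons.prems by (subst set_simps, subst sum.insert) (auto intro!: sum.cong)
  then have *: "sign_avg t js (\<lambda>e. (c + (\<Sum>i\<in>set (j # js). a i * (e(j := s)) i))\<^sup>2) \<le>
      ((c + a j * s) + ?r)\<^sup>2 + (\<Sum>i\<in>set js. (a i)\<^sup>2)" for s
    using Cons.IH[of "c + a j * s"] Cons.prems by (simp add: add.assoc)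
  have t: "\<bar>t j\<bar> \<le> 1" using Cons.prems by simp
  have "sign_avg t (j # js) (\<lambda>e. (c + (\<Sum>j\<in>set (j # js). a j * e j))\<^sup>2) \<le>
      (1 + t j) / 2 * (((c + a j * 1) + ?r)\<^sup>2 + (\<Sum>i\<in>set js. (a i)\<^sup>2)) +
      (1 - t j) / 2 * (((c + a j * (-1)) + ?r)\<^sup>2 + (\<Sum>i\<in>set js. (a i)\<^sup>2))"
    unfolding sign_avg.simps using t
    by (intro add_mono mult_left_mono *) auto
  also have "\<dots> = (c + (a j * t j + ?r))\<^sup>2 + (a j)\<^sup>2 * (1 - (t j)\<^sup>2) + (\<Sum>i\<in>set js. (a i)\<^sup>2)"
    by (simp add: field_simps power2_eq_square)
  also have "(a j)\<^sup>2 * (1 - (t j)\<^sup>2) \<le> (a j)\<^sup>2"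
    by (simp add: mult_left_le)
  finally show ?case
    using Cons.prems by simp
qed simp

text \<open>Relative to the uniform law the biased sign has the density values \<open>1 + t\<close>
  and \<open>1 - t\<close>, and its relative entropy is at most \<open>t\<^sup>2\<close>; the rest
  is the entropy inequality for a change of measure on two points.\<close>

lemma two_point_gibbs:
  fixes a b t :: real
  assumes "\<bar>t\<bar> < 1"
  shows "(1 + t) / 2 * a + (1 - t) / 2 * b \<le> ln ((exp a + exp b) / 2) + t\<^sup>2"
proof -
  define Z where "Z = (exp a + exp b) / 2"
  have Z: "Z > 0" unfolding Z_def by (simp add: add_pos_pos)
  have t: "1 + t > 0" "1 - t > 0" using assms by auto
  \<comment> \<open>Entropy inequality at one point, with \<open>s\<close> the density there.
    Replacing \<open>ln s\<close> by \<open>s - 1\<close> leaves \<open>s * (s - 1)\<close>, and its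
    values at \<open>1 + t\<close> and \<open>1 - t\<close> add up to
    \<open>2 * t\<^sup>2\<close>.\<close>
  have 1: "s * (y - ln Z - (s - 1)) \<le> exp y / Z - s" if "s > 0" for s y :: real
  proof -
    have "y - ln Z - ln s = ln (exp y / (Z * s))"
      using Z that by (simp add: ln_div ln_mult)
    also have "\<dots> \<le> exp y / (Z * s) - 1"
      using Z that by (intro ln_le_minus_one) simp
    finally have "y - ln Z - (s - 1) \<le> exp y / (Z * s) - 1"
      using ln_le_minus_one[OF that] by linarith
    then have "s * (y - ln Z - (s - 1)) \<le> s * (exp y / (Z * s) - 1)"
      using that by (intro mult_left_mono) auto
    also have "\<dots> = exp y / Z - s"
      using that by (simp add: field_simps)
    finally show ?thesis .
  qed
  have "exp a / Z + exp b / Z = 2"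
    using Z unfolding add_divide_distrib[symmetric] by (simp add: Z_def divide_eq_eq)
  then have "(1 + t) * (a - ln Z - t) + (1 - t) * (b - ln Z + t) \<le> 0"
    using 1[OF t(1), of a] 1[OF t(2), of b] by simp
  then show ?thesis
    by (fold Z_def) (simp add: algebra_simps power2_eq_square add_divide_distrib diff_divide_distrib)
qed

lemma sign_avg_exp_pos: "sign_avg (\<lambda>_. 0) js (\<lambda>e. exp (f e)) > 0"
  by (induction js arbitrary: f) (simp_all add: add_pos_pos)

text \<open>The Gibbs variational principle: reweighting the uniform signs costs the relative entropy
  of the biased signs.\<close>

lemma sign_avg_gibbs:
  assumes "\<And>j. j \<in> set js \<Longrightarrow> \<bar>t j\<bar> < 1" "distinct js"
  shows "sign_avg t js f \<le> ln (sign_avg (\<lambda>_. 0) js (\<lambda>e. exp (f e))) + (\<Sum>j\<in>set js. (t j)\<^sup>2)"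
  using assms
proof (induction js arbitrary: f)
  case (Cons j js)
  let ?A = "\<lambda>s. ln (sign_avg (\<lambda>_. 0) js (\<lambda>e. exp (f (e(j := s)))))"
  have *: "sign_avg t js (\<lambda>e. f (e(j := s))) \<le> ?A s + (\<Sum>j\<in>set js. (t j)\<^sup>2)" for s
    using Cons by (intro Cons.IH) auto
  have t: "\<bar>t j\<bar> < 1" using Cons.prems by simp
  have "sign_avg t (j # js) f \<le> (1 + t j) / 2 * (?A 1 + (\<Sum>j\<in>set js. (t j)\<^sup>2)) +
      (1 - t j) / 2 * (?A (-1) + (\<Sum>j\<in>set js. (t j)\<^sup>2))"
    unfolding sign_avg.simps using t by (intro add_mono mult_left_mono *) auto
  also have "\<dots> = (1 + t j) / 2 * ?A 1 + (1 - t j) / 2 * ?A (-1) + (\<Sum>j\<in>set js. (t j)\<^sup>2)"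
    by (simp add: field_simps)
  also have "\<dots> \<le> ln ((exp (?A 1) + exp (?A (-1))) / 2) + (t j)\<^sup>2 + (\<Sum>j\<in>set js. (t j)\<^sup>2)"
    using two_point_gibbs[OF t] by auto
  also have "(exp (?A 1) + exp (?A (-1))) / 2 = sign_avg (\<lambda>_. 0) (j # js) (\<lambda>e. exp (f e))"
    using sign_avg_exp_pos[of js "\<lambda>e. f (e(j := 1))"] sign_avg_exp_pos[of js "\<lambda>e. f (e(j := -1))"]
    by simp
  finally show ?case
    using Cons.prems by simp
qed simp

lemma sign_avg_measurable:
  assumes "\<And>e. (\<lambda>x. f e x) \<in> borel_measurable M"
  shows "(\<lambda>x. sign_avg t js (\<lambda>e. f e x)) \<in> borel_measurable M"
  using assms by (induction js arbitrary: f) auto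

text \<open>The average is a finite convex combination, so a moment bound that is uniform in the
  sign pattern survives it, without any product measure.\<close>

lemma nn_integral_sign_avg_le:
  assumes meas: "\<And>e. (\<lambda>x. f e x) \<in> borel_measurable M" and nonneg: "\<And>e x. 0 \<le> f e x"
    and le: "\<And>e. (\<integral>\<^sup>+x. ennreal (f e x) \<partial>M) \<le> ennreal c" and c: "0 \<le> c"
  shows "(\<integral>\<^sup>+x. ennreal (sign_avg (\<lambda>_. 0) js (\<lambda>e. f e x)) \<partial>M) \<le> ennreal c"
  using meas nonneg le
proof (induction js arbitrary: f)
  case (Cons j js)
  let ?S = "\<lambda>s x. sign_avg (\<lambda>_. 0) js (\<lambda>e. f (e(j := s)) x)"
  have nn: "0 \<le> ?S s x" for s x
    using sign_avg_mono[of js "\<lambda>_. 0" "\<lambda>_. 0" "\<lambda>e. f (e(j := s)) x"] Cons.prems(2)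
    by (simp add: sign_avg_const)
  have m: "(\<lambda>x. ?S s x) \<in> borel_measurable M" for s
    by (intro sign_avg_measurable Cons.prems)
  have *: "(\<integral>\<^sup>+x. ennreal (?S s x) \<partial>M) \<le> ennreal c" for s
    by (intro Cons.IH Cons.prems)
  have "(\<integral>\<^sup>+x. ennreal (sign_avg (\<lambda>_. 0) (j # js) (\<lambda>e. f e x)) \<partial>M) =
      (\<integral>\<^sup>+x. ennreal (1/2) * ennreal (?S 1 x) + ennreal (1/2) * ennreal (?S (-1) x) \<partial>M)"
  proof (intro nn_integral_cong)
    fix x
    show "ennreal (sign_avg (\<lambda>_. 0) (j # js) (\<lambda>e. f e x)) =
        ennreal (1/2) * ennreal (?S 1 x) + ennreal (1/2) * ennreal (?S (-1) x)"
      using nn[of 1 x] nn[of "-1" x]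
      by (simp only: sign_avg.simps flip: ennreal_mult' ennreal_plus) simp
  qed
  also have "\<dots> = ennreal (1/2) * (\<integral>\<^sup>+x. ennreal (?S 1 x) \<partial>M) + ennreal (1/2) * (\<integral>\<^sup>+x. ennreal (?S (-1) x) \<partial>M)"
    using m by (subst nn_integral_add) (simp_all add: nn_integral_cmult)
  also have "\<dots> \<le> ennreal (1/2) * ennreal c + ennreal (1/2) * ennreal c"
    by (intro add_mono mult_left_mono *) auto
  also have "\<dots> = ennreal c"
    using c by (simp only: flip: ennreal_mult' ennreal_plus) (simp flip: ennreal_mult' ennreal_plus)
  finally show ?case .
qed simp

section \<open>Exponential moments of clipped square-integrable variables\<close>

section \<open>Clipping\<close>

text \<open>Truncation gives exponential moments to functions that are merely square integrable,
  while mean and variance remain visible in \<open>exp_clip_le\<close>.\<close>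

definition clip :: "real \<Rightarrow> real" where
  "clip y = max (-1) (min y 1)"

lemma clip_measurable [measurable]: "clip \<in> borel_measurable borel"
  unfolding clip_def by measurable

lemma clip_bounds: "-1 \<le> clip y" "clip y \<le> 1"
  by (auto simp: clip_def)

text \<open>Convexity of exp on the chord from 0 to \<open>y\<close>. The factor \<open>s\<close>
  will be the ratio of a common sample size to the individual one, which puts samples of different
  sizes on one scale.\<close>

lemma exp_scale_le:
  fixes s y :: real
  assumes "0 \<le> s" "s \<le> 1"
  shows "exp (s * y) \<le> 1 + s * (exp y - 1)"
  using convex_onD[OF exp_convex, of s 0 y] assms by (simp add: algebra_simps)

lemma exp_le_quadratic:
  fixes y :: real
  assumes "y \<le> 1"
  shows "exp y \<le> 1 + y + y\<^sup>2"
  using assms exp_bound_lemma[of y] exp_bound[of y]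
proof (cases "0 \<le> y")
  case False
  then have "exp y \<le> 1 / (1 - y)"
    using exp_ge_add_one_self[of "-y"] by (simp add: exp_minus field_simps)
  also have "\<dots> \<le> 1 + y + y\<^sup>2"
  proof -
    have "1 \<le> (1 + y + y\<^sup>2) * (1 - y)"
      using False by (simp add: algebra_simps power2_eq_square mult_le_0_iff)
    then show ?thesis using False by (simp add: divide_le_eq)
  qed
  finally show ?thesis .
qed simp

text \<open>The parabola grows away from the interval between -1 and 1 on both sides, so outside it
  the endpoint values suffice. The bound involves the unclipped \<open>y\<close>, whose mean will
  vanish and whose second moment is known.\<close>

lemma exp_clip_le: "exp (clip y) \<le> 1 + y + y\<^sup>2"
proof -
  consider "y < -1" | "-1 \<le> y" "y \<le> 1" | "y > 1" by linarith
  then show ?thesis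
  proof cases
    case 1
    have "exp (-1::real) \<le> 1 + (-1) + (-1)\<^sup>2" by (rule exp_le_quadratic) simp
    also have "\<dots> \<le> 1 + y + y\<^sup>2"
      using mult_nonneg_nonneg[of "-1 - y" "-y"] 1 by (simp add: power2_eq_square algebra_simps)
    finally show ?thesis using 1 by (simp add: clip_def)
  next
    case 2
    then show ?thesis using exp_le_quadratic[of y] by (simp add: clip_def)
  next
    case 3
    have "exp (1::real) \<le> 1 + 1 + 1\<^sup>2" by (rule exp_le_quadratic) simp
    also have "\<dots> \<le> 1 + y + y\<^sup>2" using mult_mono[of 1 y 1 y] 3
      by (simp add: power2_eq_square algebra_simps)
    finally show ?thesis using 3 by (simp add: clip_def)
  qed
qed

lemma exp_scaled_clip_le:
  assumes "0 \<le> s" "s \<le> 1"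
  shows "exp (s * clip y) \<le> 1 + s * (y + y\<^sup>2)"
proof -
  have "exp (s * clip y) \<le> 1 + s * (exp (clip y) - 1)"
    by (rule exp_scale_le[OF assms])
  also have "\<dots> \<le> 1 + s * (y + y\<^sup>2)"
    using exp_clip_le[of y] assms by (intro add_left_mono mult_left_mono) auto
  finally show ?thesis .
qed

text \<open>Clipping lowers \<open>y\<close> only above 1. If \<open>a \<le> 1/2\<close>, then
  \<open>y > 1\<close> forces \<open>y - a > 1/2\<close>, and there
  \<open>2 * (y - a)\<^sup>2\<close> covers the loss. A larger \<open>a\<close> is shifted down to
  1/2.\<close>

lemma clip_lower_bound:
  assumes "-1/2 \<le> a"
  shows "min a (1/2) + (y - a) - 2 * (y - a)\<^sup>2 \<le> clip y"
proof -
  have sq: "x - 1/2 \<le> 2 * x\<^sup>2" for x :: real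
    using zero_le_power2[of "2 * x - 1/2"] zero_le_power2[of x] by (simp add: power2_eq_square algebra_simps)
  have *: "z - 2 * (z - b)\<^sup>2 \<le> clip z" if "b \<le> 1/2" for z b :: real
  proof (cases "z \<le> 1")
    case True
    then have "z \<le> clip z" by (simp add: clip_def)
    then show ?thesis using zero_le_power2[of "z - b"] by linarith
  next
    case False
    then have "clip z = 1" by (simp add: clip_def)
    then show ?thesis using sq[of "z - b"] that by linarith
  qed
  show ?thesis
  proof (cases "a \<le> 1/2")
    case True
    then show ?thesis using *[of a y] by simp
  next
    case False
    have "y - a + 1/2 - 2 * (y - a)\<^sup>2 \<le> clip (y - a + 1/2)"
      using *[of "1/2" "y - a + 1/2"] by simp
    also have "\<dots> \<le> clip y" using False by (auto simp: clip_def)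
    finally show ?thesis using False by simp
  qed
qed

text \<open>Under the biased signs the linear form has mean \<open>a\<close> and variance at most
  the sum of the \<open>(z j)\<^sup>2\<close>, so averaging \<open>clip_lower_bound\<close> gives
  the estimate; \<open>clip \<ge> -1\<close> takes over when the variance is large. The resulting
  \<open>min 1\<close> keeps the variance term exponentially integrable.\<close>

lemma sign_avg_clip_ge:
  assumes js: "distinct js" "\<And>j. j \<in> set js \<Longrightarrow> \<bar>t j\<bar> \<le> 1"
    and a: "a = (\<Sum>j\<in>set js. z j * t j)" "-1/2 \<le> a"
  shows "min a (1/2) - 2 * min 1 (\<Sum>j\<in>set js. (z j)\<^sup>2) \<le> sign_avg t js (\<lambda>e. clip (\<Sum>j\<in>set js. z j * e j))"
    (is "_ \<le> ?R")
proof -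
  let ?y = "\<lambda>e. \<Sum>j\<in>set js. z j * e j"
  have "-1 \<le> ?R"
    using sign_avg_mono[of js t "\<lambda>_. -1" "\<lambda>e. clip (?y e)"] js clip_bounds(1)
    by (simp add: sign_avg_const)
  moreover have "min a (1/2) - 2 * (\<Sum>j\<in>set js. (z j)\<^sup>2) \<le> ?R"
  proof -
    have "sign_avg t js (\<lambda>e. (-a + ?y e)\<^sup>2) \<le> (\<Sum>j\<in>set js. (z j)\<^sup>2)"
      using sign_avg_square[of js t "-a" z] js a by simp
    moreover have "sign_avg t js (\<lambda>e. -a + ?y e) = 0"
      using sign_avg_affine[OF js(1), where t = t and c = "-a" and a = z] a by simp
    ultimately have "min a (1/2) - 2 * (\<Sum>j\<in>set js. (z j)\<^sup>2) \<le>
        sign_avg t js (\<lambda>e. min a (1/2) + (-a + ?y e) - 2 * (-a + ?y e)\<^sup>2)"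
      by (simp only: sign_avg_diff sign_avg_add sign_avg_const sign_avg_cmult)
    also have "\<dots> \<le> ?R"
      using clip_lower_bound[OF a(2)] js by (intro sign_avg_mono) auto
    finally show ?thesis .
  qed
  ultimately show ?thesis by (auto simp: min_def)
qed

section \<open>Lattice points in an l1 ball\<close>

section \<open>Counting\<close>

text \<open>Weigh an integer \<open>k\<close> by \<open>(1/2) ^ nat \<bar>k\<bar>\<close>. All
  integers together weigh 3, so all functions on \<open>I\<close> weigh at most
  \<open>3 ^ card I\<close>, while every member of \<open>S\<close> weighs at least
  \<open>(1/2) ^ R\<close>.\<close>

lemma card_int_functions_le:
  fixes S :: "('i \<Rightarrow> int) set" and R :: nat
  assumes I: "finite I"
    and S: "\<And>k. k \<in> S \<Longrightarrow> k \<in> extensional I \<and> (\<Sum>i\<in>I. \<bar>k i\<bar>) \<le> int R"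
  shows "finite S" "real (card S) \<le> 2 ^ R * 3 ^ card I"
proof -
  let ?Z = "{- int R..int R}"
  let ?w = "\<lambda>k :: int. (1/2::real) ^ nat \<bar>k\<bar>"
  have sub: "S \<subseteq> PiE I (\<lambda>_. ?Z)"
  proof
    fix k assume k: "k \<in> S"
    have "\<bar>k i\<bar> \<le> int R" if "i \<in> I" for i
      using member_le_sum[of i I "\<lambda>i. \<bar>k i\<bar>"] S[OF k] that I by auto
    then show "k \<in> PiE I (\<lambda>_. ?Z)"
      using S[OF k] by (auto simp: PiE_def abs_le_iff) force
  qed
  have fin: "finite (PiE I (\<lambda>_. ?Z))" using I by (intro finite_PiE) auto
  then show "finite S" using sub by (rule finite_subset[rotated])
  have w: "sum ?w {- int N..int N} \<le> 3 - 2 * (1/2) ^ N" for N :: nat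
  proof (induction N)
    case (Suc N)
    have "{- int (Suc N)..int (Suc N)} = insert (- int (Suc N)) (insert (int (Suc N)) {- int N..int N})"
      by auto
    then have "sum ?w {- int (Suc N)..int (Suc N)} = 2 * (1/2) ^ Suc N + sum ?w {- int N..int N}"
      by (simp add: nat_add_distrib)
    then show ?case using Suc by simp
  qed simp
  have "real (card S) * (1/2) ^ R = (\<Sum>k\<in>S. (1/2) ^ R)" by simp
  also have "\<dots> \<le> (\<Sum>k\<in>S. \<Prod>i\<in>I. ?w (k i))"
  proof (rule sum_mono)
    fix k assume k: "k \<in> S"
    have "(\<Prod>i\<in>I. ?w (k i)) = (1/2) ^ (\<Sum>i\<in>I. nat \<bar>k i\<bar>)"
      by (simp add: power_sum)
    moreover have "(\<Sum>i\<in>I. nat \<bar>k i\<bar>) \<le> R"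
    proof -
      have "int (\<Sum>i\<in>I. nat \<bar>k i\<bar>) = (\<Sum>i\<in>I. \<bar>k i\<bar>)" by simp
      then show ?thesis using S[OF k] by linarith
    qed
    ultimately show "(1/2::real) ^ R \<le> (\<Prod>i\<in>I. ?w (k i))"
      by (simp only:) (rule power_decreasing, auto)
  qed
  also have "\<dots> \<le> (\<Sum>k\<in>PiE I (\<lambda>_. ?Z). \<Prod>i\<in>I. ?w (k i))"
    using fin sub by (intro sum_mono2) (auto intro!: prod_nonneg)
  also have "\<dots> = (\<Prod>i\<in>I. sum ?w ?Z)"
    using I by (subst prod_sum_PiE) auto
  also have "\<dots> \<le> (\<Prod>i\<in>I. 3)"
    using w[of R] by (intro prod_mono) (auto intro!: sum_nonneg order_trans[OF w])
  finally show "real (card S) \<le> 2 ^ R * 3 ^ card I"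
    by (simp add: field_simps power_one_over)
qed

section \<open>Events\<close>

text \<open>Passage from finitely many coordinates to all: a bound is proved on an event for each of
  increasing finite coordinate sets, and a given finitely supported vector only needs the outcome to
  lie in infinitely many of these events.\<close>

lemma (in prob_space) prob_frequently_ge:
  fixes A :: "nat \<Rightarrow> 'a set"
  assumes meas: "\<And>k. A k \<in> events" and ge: "\<And>k. c \<le> prob (A k)"
  shows "(\<Inter>n. \<Union>k\<in>{n..}. A k) \<in> events" "c \<le> prob (\<Inter>n. \<Union>k\<in>{n..}. A k)"
proof -
  let ?U = "\<lambda>n::nat. \<Union>k\<in>{n..}. A k"
  have U: "?U n \<in> events" for n using meas by auto
  then show "(\<Inter>n. ?U n) \<in> events" by auto
  have "(\<lambda>n. prob (?U n)) \<longlonglongrightarrow> prob (\<Inter>n. ?U n)"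
    using U by (intro finite_Lim_measure_decseq) (auto simp: decseq_def, meson atLeast_iff order_trans)
  moreover have "c \<le> prob (?U n)" for n
  proof -
    have "c \<le> prob (A n)" by (rule ge)
    also have "\<dots> \<le> prob (?U n)" using U meas by (intro finite_measure_mono) auto
    finally show ?thesis .
  qed
  ultimately show "c \<le> prob (\<Inter>n. ?U n)" by (intro LIMSEQ_le_const) auto
qed

lemma (in prob_space) prob_le_of_nn_integral:
  assumes f: "f \<in> borel_measurable M" "\<And>x. 0 \<le> f x"
    and le: "(\<integral>\<^sup>+x. ennreal (f x) \<partial>M) \<le> ennreal c" and c: "0 \<le> c" and a: "0 < a"
  shows "1 - c / a \<le> prob {x\<in>space M. f x \<le> a}"
proof -
  have [measurable]: "f \<in> borel_measurable M" by fact
  have int: "integrable M f"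
    using f le by (intro integrableI_nonneg) (auto simp: le_less_trans)
  have "expectation f \<le> c"
    using f le c int by (subst (asm) nn_integral_eq_integral) auto
  then have "prob {x\<in>space M. f x \<ge> a} \<le> c / a"
    using integral_Markov_inequality_measure[OF int, of "{}" a] f a
    by (intro order_trans[OF integral_Markov_inequality_measure[OF int, of "space M" a]])
      (auto intro!: divide_right_mono)
  moreover have "prob {x\<in>space M. f x > a} \<le> prob {x\<in>space M. f x \<ge> a}"
    by (intro finite_measure_mono) auto
  moreover have "{x\<in>space M. f x > a} = space M - {x\<in>space M. f x \<le> a}" by auto
  ultimately show ?thesis
    using prob_compl[of "{x\<in>space M. f x \<le> a}"] by simp
qed

section \<open>Chernoff and PAC-Bayes bounds for independent samples\<close>

section \<open>Independent samples\<close>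

lemma (in prob_space) prob_Int_ge:
  assumes "A \<in> events" "B \<in> events"
  shows "prob A + prob B - 1 \<le> prob (A \<inter> B)"
proof -
  have "prob (space M - A \<inter> B) \<le> prob (space M - A) + prob (space M - B)"
    using assms by (subst Diff_Int) (intro measure_Un_le; auto)
  then show ?thesis using assms by (simp add: prob_compl)
qed

locale indep_samples = prob_space P for P :: "'w measure" +
  fixes m :: nat and Q :: "nat \<Rightarrow> 'x measure" and X :: "nat \<Rightarrow> nat \<Rightarrow> 'w \<Rightarrow> 'x"
  assumes X_measurable: "l \<in> {1..m} \<Longrightarrow> 1 \<le> i \<Longrightarrow> X l i \<in> measurable P (Q l)"
    and X_law: "l \<in> {1..m} \<Longrightarrow> 1 \<le> i \<Longrightarrow> distr P (Q l) (X l i) = Q l"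
    and X_indep: "indep_vars (\<lambda>(l, i). Q l) (\<lambda>(l, i). X l i) ({1..m} \<times> {1..})"
begin

lemma prob_space_Q: "l \<in> {1..m} \<Longrightarrow> prob_space (Q l)"
  using prob_space_distr[OF X_measurable[of l 1]] X_law[of l 1] by simp

lemma AE_sample:
  assumes "l \<in> {1..m}" "1 \<le> i" "AE x in Q l. R x"
  shows "AE \<omega> in P. R (X l i \<omega>)"
  using assms X_measurable[of l i] X_law[of l i] by (metis AE_distrD)

lemma AE_samples:
  assumes "\<And>l. l \<in> {1..m} \<Longrightarrow> AE x in Q l. R l x"
  shows "AE \<omega> in P. \<forall>l\<in>{1..m}. \<forall>i\<ge>1. R l (X l i \<omega>)"
proof -
  have "AE \<omega> in P. \<forall>i. 1 \<le> i \<longrightarrow> R l (X l i \<omega>)" if "l \<in> {1..m}" for l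
    unfolding AE_all_countable using AE_sample[OF that _ assms[OF that]] by auto
  then show ?thesis by (subst AE_ball_countable) auto
qed

lemma sample_comp_measurable [measurable (raw)]:
  assumes "l \<in> {1..m}" "1 \<le> i" "f \<in> borel_measurable (Q l)"
  shows "(\<lambda>\<omega>. f (X l i \<omega>)) \<in> borel_measurable P"
  using measurable_compose[OF X_measurable assms(3)] assms by simp

lemma nn_integral_sample:
  assumes "l \<in> {1..m}" "1 \<le> i" "f \<in> borel_measurable (Q l)"
  shows "(\<integral>\<^sup>+\<omega>. f (X l i \<omega>) \<partial>P) = (\<integral>\<^sup>+x. f x \<partial>Q l)"
  using nn_integral_distr[OF X_measurable, of l i f] X_law[of l i] assms by simp

lemma integral_sample:
  fixes f :: "'x \<Rightarrow> real"
  assumes "l \<in> {1..m}" "1 \<le> i" "f \<in> borel_measurable (Q l)"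
  shows "expectation (\<lambda>\<omega>. f (X l i \<omega>)) = (LINT x|Q l. f x)"
  using integral_distr[OF X_measurable, of l i f] X_law[of l i] assms by simp

lemma integrable_sample:
  fixes f :: "'x \<Rightarrow> real"
  assumes "l \<in> {1..m}" "1 \<le> i" "integrable (Q l) f"
  shows "integrable P (\<lambda>\<omega>. f (X l i \<omega>))"
  using integrable_distr[OF X_measurable, of l i f] X_law[of l i] assms by simp

lemma indep_sample_funs:
  fixes f :: "nat \<Rightarrow> 'x \<Rightarrow> 'b :: topological_space"
  assumes I: "I \<subseteq> {1..m} \<times> {1..}" and f: "\<And>l. l \<in> {1..m} \<Longrightarrow> f l \<in> borel_measurable (Q l)"
  shows "indep_vars (\<lambda>_. borel) (\<lambda>k \<omega>. f (fst k) (X (fst k) (snd k) \<omega>)) I"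
proof -
  have "indep_vars (\<lambda>k. borel) (\<lambda>k \<omega>. (\<lambda>(l, i). f l) k ((\<lambda>(l, i). X l i) k \<omega>)) ({1..m} \<times> {1..})"
    by (rule indep_vars_compose2[OF X_indep]) (use f in auto)
  then have "indep_vars (\<lambda>_. borel) (\<lambda>k \<omega>. f (fst k) (X (fst k) (snd k) \<omega>)) ({1..m} \<times> {1..})"
    by (simp add: case_prod_beta)
  then show ?thesis using I by (rule indep_vars_subset)
qed

lemma nn_integral_prod_samples:
  fixes f :: "nat \<Rightarrow> 'x \<Rightarrow> real"
  assumes f: "\<And>l. l \<in> {1..m} \<Longrightarrow> f l \<in> borel_measurable (Q l)" "\<And>l x. 0 \<le> f l x"
  shows "(\<integral>\<^sup>+\<omega>. (\<Prod>l=1..m. \<Prod>i=1..n l. ennreal (f l (X l i \<omega>))) \<partial>P) =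
    (\<Prod>l=1..m. (\<integral>\<^sup>+x. ennreal (f l x) \<partial>Q l) ^ n l)"
proof -
  let ?I = "SIGMA l:{1..m}. {1..n l}"
  have "(\<integral>\<^sup>+\<omega>. (\<Prod>l=1..m. \<Prod>i=1..n l. ennreal (f l (X l i \<omega>))) \<partial>P) =
      (\<integral>\<^sup>+\<omega>. (\<Prod>k\<in>?I. ennreal (f (fst k) (X (fst k) (snd k) \<omega>))) \<partial>P)"
    by (subst prod.Sigma) (auto simp: case_prod_beta)
  also have "\<dots> = (\<Prod>k\<in>?I. \<integral>\<^sup>+\<omega>. ennreal (f (fst k) (X (fst k) (snd k) \<omega>)) \<partial>P)"
    by (intro indep_vars_nn_integral indep_sample_funs[of ?I "\<lambda>l x. ennreal (f l x)"]) (use f in auto)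
  also have "\<dots> = (\<Prod>k\<in>?I. \<integral>\<^sup>+x. ennreal (f (fst k) x) \<partial>Q (fst k))"
    using f by (intro prod.cong refl) (auto intro!: nn_integral_sample)
  also have "\<dots> = (\<Prod>l=1..m. \<Prod>i=1..n l. \<integral>\<^sup>+x. ennreal (f l x) \<partial>Q l)"
    by (subst prod.Sigma) (auto simp: case_prod_beta)
  finally show ?thesis by simp
qed

lemma nn_integral_exp_samples_le:
  assumes f: "\<And>l. l \<in> {1..m} \<Longrightarrow> f l \<in> borel_measurable (Q l)"
    and le: "\<And>l. l \<in> {1..m} \<Longrightarrow> (\<integral>\<^sup>+x. ennreal (exp (f l x)) \<partial>Q l) \<le> ennreal (exp (c l))"
  shows "(\<integral>\<^sup>+\<omega>. ennreal (exp (\<Sum>l=1..m. \<Sum>i=1..n l. f l (X l i \<omega>))) \<partial>P) \<le>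
    ennreal (exp (\<Sum>l=1..m. real (n l) * c l))"
proof -
  have "(\<integral>\<^sup>+\<omega>. ennreal (exp (\<Sum>l=1..m. \<Sum>i=1..n l. f l (X l i \<omega>))) \<partial>P) =
      (\<integral>\<^sup>+\<omega>. (\<Prod>l=1..m. \<Prod>i=1..n l. ennreal (exp (f l (X l i \<omega>)))) \<partial>P)"
    by (simp add: exp_sum prod_ennreal prod_nonneg)
  also have "\<dots> = (\<Prod>l=1..m. (\<integral>\<^sup>+x. ennreal (exp (f l x)) \<partial>Q l) ^ n l)"
    using f by (intro nn_integral_prod_samples) auto
  also have "\<dots> \<le> (\<Prod>l=1..m. ennreal (exp (c l)) ^ n l)"
    using le by (intro prod_mono_ennreal power_mono) auto
  also have "\<dots> = ennreal (exp (\<Sum>l=1..m. real (n l) * c l))"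
    by (simp add: exp_sum ennreal_power exp_of_nat_mult prod_ennreal)
  finally show ?thesis .
qed

lemma chernoff_samples:
  assumes f: "\<And>l. l \<in> {1..m} \<Longrightarrow> f l \<in> borel_measurable (Q l)"
    and le: "\<And>l. l \<in> {1..m} \<Longrightarrow> (\<integral>\<^sup>+x. ennreal (exp (f l x)) \<partial>Q l) \<le> ennreal (exp (c l))"
  obtains E where "E \<in> events" "1 - exp (- t) \<le> prob E"
    "\<And>\<omega>. \<omega> \<in> E \<Longrightarrow> (\<Sum>l=1..m. \<Sum>i=1..n l. f l (X l i \<omega>)) \<le> (\<Sum>l=1..m. real (n l) * c l) + t"
proof
  let ?S = "\<lambda>\<omega>. \<Sum>l=1..m. \<Sum>i=1..n l. f l (X l i \<omega>)"
  let ?c = "\<Sum>l=1..m. real (n l) * c l"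
  let ?E = "{\<omega>\<in>space P. exp (?S \<omega>) \<le> exp (?c + t)}"
  have [measurable]: "?S \<in> borel_measurable P"
    using f by (intro borel_measurable_sum sample_comp_measurable) auto
  show "?E \<in> events" by measurable
  have "1 - exp ?c / exp (?c + t) \<le> prob ?E"
  proof (rule prob_le_of_nn_integral)
    show "(\<lambda>\<omega>. exp (?S \<omega>)) \<in> borel_measurable P" by measurable
  qed (use nn_integral_exp_samples_le[OF f le, of n] in simp_all)
  then show "1 - exp (- t) \<le> prob ?E"
    by (simp add: exp_add exp_minus field_simps)
qed simp

text \<open>A PAC-Bayes bound: smoothing the coefficient vector by random signs with scales \<open>\<sigma>\<close> turns a
  supremum over an infinite-dimensional ellipsoid into one exponential moment.\<close>

lemma clipped_linear_process_bound:
  fixes F :: "'i set" and y :: "nat \<Rightarrow> 'i \<Rightarrow> 'x \<Rightarrow> real" and \<sigma> :: "'i \<Rightarrow> real"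
  assumes F: "finite F" and \<sigma>: "\<And>i. i \<in> F \<Longrightarrow> 0 < \<sigma> i"
    and N: "0 \<le> N" "\<And>l. l \<in> {1..m} \<Longrightarrow> N \<le> real (n l) \<and> 1 \<le> n l"
    and y: "\<And>l i. l \<in> {1..m} \<Longrightarrow> i \<in> F \<Longrightarrow> y l i \<in> borel_measurable (Q l)"
    and y2: "\<And>l i. l \<in> {1..m} \<Longrightarrow> i \<in> F \<Longrightarrow> integrable (Q l) (\<lambda>x. (y l i x)\<^sup>2)"
    and y0: "\<And>l i. l \<in> {1..m} \<Longrightarrow> i \<in> F \<Longrightarrow> (LINT x|Q l. y l i x) = 0"
    and var: "\<And>c. (\<Sum>l=1..m. LINT x|Q l. (\<Sum>i\<in>F. c i * y l i x)\<^sup>2) \<le> \<kappa> * (\<Sum>i\<in>F. (c i)\<^sup>2)"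
    and R: "0 \<le> R"
  obtains E where "E \<in> events" "1 - 2 * exp (- t) \<le> prob E"
    "\<And>\<omega> c. \<omega> \<in> E \<Longrightarrow> (\<Sum>i\<in>F. (c i / \<sigma> i)\<^sup>2) \<le> R \<Longrightarrow>
       (\<And>l k. l \<in> {1..m} \<Longrightarrow> k \<in> {1..n l} \<Longrightarrow> -1/2 \<le> (\<Sum>i\<in>F. c i * y l i (X l k \<omega>))) \<Longrightarrow>
       (\<Sum>l=1..m. N / real (n l) * (\<Sum>k=1..n l. min (\<Sum>i\<in>F. c i * y l i (X l k \<omega>)) (1/2)))
        \<le> R + N * \<kappa> * (\<Sum>i\<in>F. (c i)\<^sup>2) + 5 * N * \<kappa> * (\<Sum>i\<in>F. (\<sigma> i)\<^sup>2) + 3 * t"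
proof -
  \<comment> \<open>Every coordinate is split into \<open>q\<close> copies of scale
    \<open>\<sigma> i / sqrt (real q)\<close>. Since
    \<open>(c i / \<sigma> i)\<^sup>2 \<le> R < real q\<close>, the biases that shift the mean to
    \<open>c\<close> stay below 1 in modulus.\<close>
  define q where "q = nat \<lceil>R\<rceil> + 1"
  have q: "0 < q" "R < real q" unfolding q_def using R by linarith+
  define J where "J = F \<times> {..<q}"
  have "finite J" unfolding J_def using F by auto
  then obtain js where js: "set js = J" "distinct js" using finite_distinct_list by metis
  define \<sigma>q where "\<sigma>q = (\<lambda>i. \<sigma> i / sqrt (real q))"
  have \<sigma>q: "(\<Sum>j<q. (\<sigma>q i)\<^sup>2) = (\<sigma> i)\<^sup>2" for i
    using q by (simp add: \<sigma>q_def power_divide)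
  \<comment> \<open>With this weight the \<open>n l\<close> observations of a sample count as
    \<open>N\<close>, and \<open>s l \<le> 1\<close> is what \<open>exp_scale_le\<close> asks
    for.\<close>
  define s where "s = (\<lambda>l. N / real (n l))"
  have s: "0 \<le> s l" "s l \<le> 1" "real (n l) * s l = N" if "l \<in> {1..m}" for l
    using N(1) N(2)[OF that] by (auto simp: s_def field_simps)
  \<comment> \<open>\<open>c' e\<close> is the coefficient vector built from the signs
    \<open>e\<close>; \<open>z l x k\<close> is the contribution of sign \<open>k\<close> to the
    linear form at \<open>x\<close>.\<close>
  define c' where "c' = (\<lambda>(e :: 'i \<times> nat \<Rightarrow> real) i. \<Sum>j<q. \<sigma>q i * e (i, j))"
  define z where "z = (\<lambda>l x (k :: 'i \<times> nat). \<sigma>q (fst k) * y l (fst k) x)"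
  have zsum: "(\<Sum>k\<in>J. z l x k * e k) = (\<Sum>i\<in>F. c' e i * y l i x)" for l x and e :: "'i \<times> nat \<Rightarrow> real"
    unfolding J_def z_def c'_def 
    by (simp add: sum.cartesian_product' sum_distrib_right sum_distrib_left mult_ac)
  have z2: "(\<Sum>k\<in>J. (z l x k)\<^sup>2) = (\<Sum>i\<in>F. (\<sigma> i)\<^sup>2 * (y l i x)\<^sup>2)" for l x
    unfolding J_def z_def using \<sigma>q
    by (simp add: sum.cartesian_product' power_mult_distrib sum_distrib_right[symmetric] del: sum_constant)
  have int1: "integrable (Q l) (y l i)" if "l \<in> {1..m}" "i \<in> F" for l i
  proof -
    interpret Q: prob_space "Q l" using prob_space_Q[OF that(1)] .
    show ?thesis using Q.square_integrable_imp_integrable[OF y y2] that by simp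
  qed
  have int2: "integrable (Q l) (\<lambda>x. (\<Sum>i\<in>F. c i * y l i x)\<^sup>2)" if l: "l \<in> {1..m}" for l c
  proof -
    have "integrable (Q l) (\<lambda>x. (c i * y l i x) * (c j * y l j x))" if "i \<in> F" "j \<in> F" for i j
    proof (rule Bochner_Integration.integrable_bound)
      show "integrable (Q l) (\<lambda>x. \<bar>c i * c j\<bar> * ((y l i x)\<^sup>2 + (y l j x)\<^sup>2))"
        using y2[OF l] that by auto
      show "AE x in Q l. norm (c i * y l i x * (c j * y l j x)) \<le> norm (\<bar>c i * c j\<bar> * ((y l i x)\<^sup>2 + (y l j x)\<^sup>2))"
      proof (intro AE_I2)
        fix x
        have "\<bar>y l i x * y l j x\<bar> \<le> (y l i x)\<^sup>2 + (y l j x)\<^sup>2"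
          using sum_squares_bound[of "\<bar>y l i x\<bar>" "\<bar>y l j x\<bar>"] mult_nonneg_nonneg[OF abs_ge_zero abs_ge_zero, of "y l i x" "y l j x"]
          unfolding abs_mult power2_abs by linarith
        then have "\<bar>c i * c j\<bar> * \<bar>y l i x * y l j x\<bar> \<le> \<bar>c i * c j\<bar> * ((y l i x)\<^sup>2 + (y l j x)\<^sup>2)"
          by (intro mult_left_mono) auto
        then show "norm (c i * y l i x * (c j * y l j x)) \<le> norm (\<bar>c i * c j\<bar> * ((y l i x)\<^sup>2 + (y l j x)\<^sup>2))"
          by (simp add: abs_mult mult_ac)
      qed
    qed (use y[OF l] that in measurable)
    then show ?thesis
      by (simp add: power2_eq_square sum_product)
  qed
  have V0: "0 \<le> (LINT x|Q l. (\<Sum>i\<in>F. c i * y l i x)\<^sup>2)" for l c by (intro integral_nonneg_AE) auto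

  \<comment> \<open>Clipped linear process minus its variance budget. For every fixed sign pattern
    its exponential has expectation at most 1: \<open>exp_scaled_clip_le\<close> sees only the
    vanishing mean and the second moment, which \<open>var\<close> bounds.\<close>
  define \<Phi> where "\<Phi> = (\<lambda>e \<omega>. (\<Sum>l=1..m. \<Sum>k=1..n l. s l * clip (\<Sum>i\<in>F. c' e i * y l i (X l k \<omega>)))
      - N * \<kappa> * (\<Sum>i\<in>F. (c' e i)\<^sup>2))"
  have Y_meas: "(\<lambda>x. s l * clip (\<Sum>i\<in>F. c' e i * y l i x)) \<in> borel_measurable (Q l)" if "l \<in> {1..m}" for l e
  proof -
    have "(\<lambda>x. \<Sum>i\<in>F. c' e i * y l i x) \<in> borel_measurable (Q l)"
      using y[OF that] by (intro borel_measurable_sum borel_measurable_times) auto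
    then show ?thesis by measurable
  qed
  have S_meas: "(\<lambda>\<omega>. \<Sum>l=1..m. \<Sum>k=1..n l. s l * clip (\<Sum>i\<in>F. c' e i * y l i (X l k \<omega>))) \<in> borel_measurable P" for e
    by (intro borel_measurable_sum sample_comp_measurable[OF _ _ Y_meas]) auto
  have \<Phi>_meas [measurable]: "\<Phi> e \<in> borel_measurable P" for e
    unfolding \<Phi>_def using S_meas by (intro borel_measurable_diff) auto
  have \<Phi>_int: "(\<integral>\<^sup>+\<omega>. ennreal (exp (\<Phi> e \<omega>)) \<partial>P) \<le> ennreal 1" for e
  proof -
    let ?v = "\<lambda>l. LINT x|Q l. (\<Sum>i\<in>F. c' e i * y l i x)\<^sup>2"
    have le: "(\<integral>\<^sup>+x. ennreal (exp (s l * clip (\<Sum>i\<in>F. c' e i * y l i x))) \<partial>Q l) \<le> ennreal (exp (s l * ?v l))"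
      if l: "l \<in> {1..m}" for l
    proof -
      interpret Q: prob_space "Q l" using prob_space_Q[OF l] .
      let ?Y = "\<lambda>x. \<Sum>i\<in>F. c' e i * y l i x"
      have i1: "integrable (Q l) ?Y" using int1[OF l] by auto
      have i: "integrable (Q l) (\<lambda>x. 1 + s l * (?Y x + (?Y x)\<^sup>2))"
        using i1 int2[OF l] by auto
      have "(LINT x|Q l. ?Y x) = 0" using int1[OF l] y0[OF l] by (simp add: Bochner_Integration.integral_sum)
      then have v: "(LINT x|Q l. 1 + s l * (?Y x + (?Y x)\<^sup>2)) = 1 + s l * ?v l"
        using i1 int2[OF l] by (simp add: Q.prob_space)
      have "(\<integral>\<^sup>+x. ennreal (exp (s l * clip (?Y x))) \<partial>Q l) \<le> (\<integral>\<^sup>+x. ennreal (1 + s l * (?Y x + (?Y x)\<^sup>2)) \<partial>Q l)"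
        by (intro nn_integral_mono ennreal_leI exp_scaled_clip_le s[OF l])
      also have "\<dots> = ennreal (LINT x|Q l. 1 + s l * (?Y x + (?Y x)\<^sup>2))"
        by (intro nn_integral_eq_integral i AE_I2 order_trans[OF _ exp_scaled_clip_le[OF s(1,2)[OF l]]]) auto
      also have "\<dots> \<le> ennreal (exp (s l * ?v l))"
        unfolding v by (intro ennreal_leI exp_ge_add_one_self)
      finally show ?thesis .
    qed
    have "(\<integral>\<^sup>+\<omega>. ennreal (exp (\<Phi> e \<omega>)) \<partial>P) =
        (\<integral>\<^sup>+\<omega>. ennreal (exp (- (N * \<kappa> * (\<Sum>i\<in>F. (c' e i)\<^sup>2)))) *
          ennreal (exp (\<Sum>l=1..m. \<Sum>k=1..n l. s l * clip (\<Sum>i\<in>F. c' e i * y l i (X l k \<omega>)))) \<partial>P)"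
      by (simp add: \<Phi>_def exp_diff exp_minus divide_inverse mult_ac flip: ennreal_mult)
    also have "\<dots> = ennreal (exp (- (N * \<kappa> * (\<Sum>i\<in>F. (c' e i)\<^sup>2)))) *
        (\<integral>\<^sup>+\<omega>. ennreal (exp (\<Sum>l=1..m. \<Sum>k=1..n l. s l * clip (\<Sum>i\<in>F. c' e i * y l i (X l k \<omega>)))) \<partial>P)"
      by (intro nn_integral_cmult measurable_compose[OF S_meas] measurable_compose[OF _ measurable_ennreal] borel_measurable_exp)
    also have "\<dots> \<le> ennreal (exp (- (N * \<kappa> * (\<Sum>i\<in>F. (c' e i)\<^sup>2)))) * ennreal (exp (\<Sum>l=1..m. real (n l) * (s l * ?v l)))"
      by (rule mult_left_mono[OF nn_integral_exp_samples_le[OF Y_meas le]]) simp_all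
    also have "\<dots> \<le> ennreal 1"
    proof -
      have "(\<Sum>l=1..m. real (n l) * (s l * ?v l)) = (\<Sum>l=1..m. N * ?v l)"
        by (intro sum.cong refl) (simp add: s(3) flip: mult.assoc)
      also have "\<dots> = N * (\<Sum>l=1..m. ?v l)" by (simp add: sum_distrib_left)
      also have "\<dots> \<le> N * (\<kappa> * (\<Sum>i\<in>F. (c' e i)\<^sup>2))" using var N(1) by (intro mult_left_mono) auto
      finally show ?thesis
        by (simp add: exp_add[symmetric] mult.assoc flip: ennreal_mult)
    qed
    finally show ?thesis .
  qed
  \<comment> \<open>The uniform average does not involve \<open>c\<close>, so one application of
    Markov's inequality serves all \<open>c\<close>; they enter later through the change of
    measure.\<close>
  define E1 where "E1 = {\<omega>\<in>space P. sign_avg (\<lambda>_. 0) js (\<lambda>e. exp (\<Phi> e \<omega>)) \<le> exp t}"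
  have [measurable]: "(\<lambda>\<omega>. sign_avg (\<lambda>_. 0) js (\<lambda>e. exp (\<Phi> e \<omega>))) \<in> borel_measurable P"
    by (intro sign_avg_measurable) measurable
  have E1: "E1 \<in> events" "1 - exp (- t) \<le> prob E1"
  proof -
    show "E1 \<in> events" unfolding E1_def by measurable
    have "1 - 1 / exp t \<le> prob E1" unfolding E1_def
    proof (rule prob_le_of_nn_integral)
      show "0 \<le> sign_avg (\<lambda>_. 0) js (\<lambda>e. exp (\<Phi> e \<omega>))" for \<omega>
        by (rule less_imp_le[OF sign_avg_exp_pos])
      show "(\<integral>\<^sup>+\<omega>. ennreal (sign_avg (\<lambda>_. 0) js (\<lambda>e. exp (\<Phi> e \<omega>))) \<partial>P) \<le> ennreal 1"
        by (rule nn_integral_sign_avg_le) (use \<Phi>_int in auto)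
    qed simp_all
    then show "1 - exp (- t) \<le> prob E1" by (simp add: exp_minus field_simps)
  qed
  \<comment> \<open>Bound for the variance of the random linear form at \<open>x\<close>. Clipping
    loses at most twice its truncation \<open>min 1 (\<tau> l x)\<close>, which gets a Chernoff
    bound of its own.\<close>
  define \<tau> where "\<tau> = (\<lambda>l x. \<Sum>i\<in>F. (\<sigma> i)\<^sup>2 * (y l i x)\<^sup>2)"
  have \<tau>0: "0 \<le> \<tau> l x" for l x unfolding \<tau>_def by (intro sum_nonneg) auto
  have \<tau>_int: "integrable (Q l) (\<tau> l)" if "l \<in> {1..m}" for l
    unfolding \<tau>_def using y2[OF that] by auto
  have var1: "(\<Sum>l=1..m. LINT x|Q l. (y l i x)\<^sup>2) \<le> \<kappa>" if "i \<in> F" for i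
  proof -
    have *: "(\<Sum>j\<in>F. of_bool (j = i) * f j) = f i" for f :: "'i \<Rightarrow> real"
    proof -
      have "(\<Sum>j\<in>F. of_bool (j = i) * f j) = (\<Sum>j\<in>F. if j = i then f j else 0)"
        by (intro sum.cong) auto
      then show ?thesis using F that by simp
    qed
    have "(\<Sum>j\<in>F. (of_bool (j = i) :: real)\<^sup>2) = 1"
      using *[of "\<lambda>j. of_bool (j = i)"] by (simp add: power2_eq_square)
    then show ?thesis
      using var[of "\<lambda>j. of_bool (j = i)"] unfolding * by simp
  qed
  have \<tau>sum: "(\<Sum>l=1..m. LINT x|Q l. \<tau> l x) \<le> \<kappa> * (\<Sum>i\<in>F. (\<sigma> i)\<^sup>2)"
  proof -
    have "(\<Sum>l=1..m. LINT x|Q l. \<tau> l x) = (\<Sum>l=1..m. \<Sum>i\<in>F. (\<sigma> i)\<^sup>2 * (LINT x|Q l. (y l i x)\<^sup>2))"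
      unfolding \<tau>_def using y2 by (intro sum.cong refl) (simp add: Bochner_Integration.integral_sum)
    also have "\<dots> = (\<Sum>i\<in>F. (\<sigma> i)\<^sup>2 * (\<Sum>l=1..m. LINT x|Q l. (y l i x)\<^sup>2))"
      by (subst sum.swap) (simp add: sum_distrib_left)
    also have "\<dots> \<le> (\<Sum>i\<in>F. (\<sigma> i)\<^sup>2 * \<kappa>)" using var1 by (intro sum_mono mult_left_mono) auto
    finally show ?thesis by (simp add: sum_distrib_left mult.commute)
  qed
  have \<tau>_exp: "(\<integral>\<^sup>+x. ennreal (exp (s l * min 1 (\<tau> l x))) \<partial>Q l) \<le> ennreal (exp (2 * s l * (LINT x|Q l. \<tau> l x)))"
    if l: "l \<in> {1..m}" for l
  proof -
    interpret Q: prob_space "Q l" using prob_space_Q[OF l] .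
    have "exp (s l * min 1 (\<tau> l x)) \<le> 1 + 2 * s l * \<tau> l x" for x
    proof -
      let ?u = "min 1 (\<tau> l x)"
      have u: "0 \<le> ?u" "?u \<le> 1" using \<tau>0 by auto
      have "exp u - 1 \<le> 2 * u" if "0 \<le> u" "u \<le> 1" for u :: real
        using exp_le_quadratic[of u] mult_left_le[of u u] that by (simp add: power2_eq_square)
      from this[OF u] have "exp ?u - 1 \<le> 2 * ?u" .
      then have "exp ?u - 1 \<le> 2 * \<tau> l x" by simp
      then have "s l * (exp ?u - 1) \<le> s l * (2 * \<tau> l x)" using s(1)[OF l] by (intro mult_left_mono)
      then show ?thesis using exp_scale_le[OF s(1,2)[OF l], of ?u] by simp
    qed
    then have "(\<integral>\<^sup>+x. ennreal (exp (s l * min 1 (\<tau> l x))) \<partial>Q l) \<le> (\<integral>\<^sup>+x. ennreal (1 + 2 * s l * \<tau> l x) \<partial>Q l)"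
      by (intro nn_integral_mono ennreal_leI)
    also have "\<dots> = ennreal (LINT x|Q l. 1 + 2 * s l * \<tau> l x)"
      using \<tau>_int[OF l] \<tau>0 s(1)[OF l] by (intro nn_integral_eq_integral) auto
    also have "(LINT x|Q l. 1 + 2 * s l * \<tau> l x) = 1 + 2 * s l * (LINT x|Q l. \<tau> l x)"
      using \<tau>_int[OF l] by (simp add: Q.prob_space)
    also have "ennreal \<dots> \<le> ennreal (exp (2 * s l * (LINT x|Q l. \<tau> l x)))"
      by (intro ennreal_leI exp_ge_add_one_self)
    finally show ?thesis .
  qed
  have \<tau>_meas: "\<tau> l \<in> borel_measurable (Q l)" if "l \<in> {1..m}" for l
    using \<tau>_int[OF that] by auto
  obtain E2 where E2: "E2 \<in> events" "1 - exp (- t) \<le> prob E2"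
    "\<And>\<omega>. \<omega> \<in> E2 \<Longrightarrow> (\<Sum>l=1..m. \<Sum>k=1..n l. s l * min 1 (\<tau> l (X l k \<omega>))) \<le>
      (\<Sum>l=1..m. real (n l) * (2 * s l * (LINT x|Q l. \<tau> l x))) + t"
    by (rule chernoff_samples[where f = "\<lambda>l x. s l * min 1 (\<tau> l x)" and n = n and t = t
          and c = "\<lambda>l. 2 * s l * (LINT x|Q l. \<tau> l x)"])
      (use \<tau>_meas \<tau>_exp in auto)
  have E2': "(\<Sum>l=1..m. \<Sum>k=1..n l. s l * min 1 (\<tau> l (X l k \<omega>))) \<le> 2 * N * \<kappa> * (\<Sum>i\<in>F. (\<sigma> i)\<^sup>2) + t" if "\<omega> \<in> E2" for \<omega>
  proof -
    have "(\<Sum>l=1..m. real (n l) * (2 * s l * (LINT x|Q l. \<tau> l x))) = (\<Sum>l=1..m. 2 * N * (LINT x|Q l. \<tau> l x))"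
    proof (intro sum.cong refl)
      fix l assume "l \<in> {1..m}"
      then have "real (n l) * s l = N" by (rule s(3))
      then show "real (n l) * (2 * s l * (LINT x|Q l. \<tau> l x)) = 2 * N * (LINT x|Q l. \<tau> l x)"
        by (simp add: mult_ac)
    qed
    also have "\<dots> = 2 * N * (\<Sum>l=1..m. (LINT x|Q l. \<tau> l x))" by (simp add: sum_distrib_left)
    also have "\<dots> \<le> 2 * N * (\<kappa> * (\<Sum>i\<in>F. (\<sigma> i)\<^sup>2))" using \<tau>sum N(1) by (intro mult_left_mono) auto
    finally show ?thesis using E2(3)[OF that] by (simp add: mult.assoc)
  qed
  show thesis
  proof (rule that[of "E1 \<inter> E2"])
    show "E1 \<inter> E2 \<in> events" using E1(1) E2(1) by (rule sets.Int)
    show "1 - 2 * exp (- t) \<le> prob (E1 \<inter> E2)"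
      using E1(2) E2(2) prob_Int_ge[OF E1(1) E2(1)] by linarith
    fix \<omega> c
    assume \<omega>: "\<omega> \<in> E1 \<inter> E2" and c: "(\<Sum>i\<in>F. (c i / \<sigma> i)\<^sup>2) \<le> R"
      and low: "\<And>l k. l \<in> {1..m} \<Longrightarrow> k \<in> {1..n l} \<Longrightarrow> -1/2 \<le> (\<Sum>i\<in>F. c i * y l i (X l k \<omega>))"
    \<comment> \<open>Biases under which the random vector \<open>c'\<close> has mean
      \<open>c\<close>. Their squares, the entropy cost, add up to the sum of the
      \<open>(c i / \<sigma> i)\<^sup>2\<close>.\<close>
    define b where "b = (\<lambda>k :: 'i \<times> nat. c (fst k) / (\<sigma> (fst k) * sqrt (real q)))"
    have b: "\<bar>b j\<bar> < 1" if "j \<in> set js" for j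
    proof -
      have i: "fst j \<in> F" using that unfolding js(1) J_def by (rule mem_Times_iff[THEN iffD1, THEN conjunct1])
      have "(c (fst j) / \<sigma> (fst j))\<^sup>2 \<le> (\<Sum>i\<in>F. (c i / \<sigma> i)\<^sup>2)"
        using F i by (intro member_le_sum) auto
      then have "(c (fst j) / \<sigma> (fst j))\<^sup>2 \<le> R" using c by linarith
      then have "(c (fst j) / \<sigma> (fst j))\<^sup>2 / real q < 1" using q by simp
      moreover have "(b j)\<^sup>2 = (c (fst j) / \<sigma> (fst j))\<^sup>2 / real q"
        unfolding b_def power_divide power_mult_distrib by simp
      ultimately have "(b j)\<^sup>2 < 1" by simp
      then show ?thesis by (simp only: abs_square_less_1)
    qed
    have b': "\<bar>b j\<bar> \<le> 1" if "j \<in> set js" for j using b[OF that] by simp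
    have b2: "(\<Sum>j\<in>set js. (b j)\<^sup>2) \<le> R"
    proof -
      have "(\<Sum>j\<in>set js. (b j)\<^sup>2) = (\<Sum>i\<in>F. \<Sum>j<q. (c i / (\<sigma> i * sqrt (real q)))\<^sup>2)"
        unfolding js J_def b_def by (simp add: sum.cartesian_product')
      also have "\<dots> = (\<Sum>i\<in>F. (c i / \<sigma> i)\<^sup>2)"
        unfolding power_divide power_mult_distrib using q by simp
      finally show ?thesis using c by simp
    qed
    have \<sigma>b: "\<sigma>q (fst j) * b j = c (fst j) / real q" if "j \<in> J" for j
    proof -
      have "\<sigma> (fst j) \<noteq> 0" using that \<sigma>[of "fst j"] by (auto simp: J_def)
      then have "\<sigma>q (fst j) * b j = c (fst j) / (sqrt (real q) * sqrt (real q))"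
        by (simp add: \<sigma>q_def b_def)
      then show ?thesis by simp
    qed
    have c'b: "c' b i = c i" if "i \<in> F" for i
      unfolding c'_def using \<sigma>b[of "(i, _)"] that q by (simp add: J_def)
    have "sign_avg b js (\<lambda>e. \<Phi> e \<omega>) \<le> ln (sign_avg (\<lambda>_. 0) js (\<lambda>e. exp (\<Phi> e \<omega>))) + (\<Sum>j\<in>set js. (b j)\<^sup>2)"
      using b js by (intro sign_avg_gibbs) auto
    also have "\<dots> \<le> t + R"
    proof -
      have "ln (sign_avg (\<lambda>_. 0) js (\<lambda>e. exp (\<Phi> e \<omega>))) \<le> ln (exp t)"
        using \<omega> sign_avg_exp_pos by (intro ln_mono) (auto simp: E1_def)
      then show ?thesis using b2 by simp
    qed
    finally have up: "sign_avg b js (\<lambda>e. \<Phi> e \<omega>) \<le> t + R" .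
    have eq: "sign_avg b js (\<lambda>e. \<Phi> e \<omega>) =
        (\<Sum>l=1..m. \<Sum>k=1..n l. s l * sign_avg b js (\<lambda>e. clip (\<Sum>i\<in>F. c' e i * y l i (X l k \<omega>))))
        - N * \<kappa> * (\<Sum>i\<in>F. sign_avg b js (\<lambda>e. (c' e i)\<^sup>2))"
      unfolding \<Phi>_def by (simp only: sign_avg_diff sign_avg_sum sign_avg_cmult)
    have sq: "sign_avg b js (\<lambda>e. (c' e i)\<^sup>2) \<le> (c i)\<^sup>2 + (\<sigma> i)\<^sup>2" if i: "i \<in> F" for i
    proof -
      let ?a = "\<lambda>k :: 'i \<times> nat. if fst k = i then \<sigma>q i else 0"
      have delta: "(\<Sum>i'\<in>F. if i' = i then f i' else 0) = f i" for f :: "'i \<Rightarrow> real"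
        using F i by simp
      have *: "(\<Sum>j\<in>set js. ?a j * e j) = c' e i" for e :: "'i \<times> nat \<Rightarrow> real"
      proof -
        have "(\<Sum>j\<in>set js. ?a j * e j) = (\<Sum>i'\<in>F. \<Sum>j<q. ?a (i', j) * e (i', j))"
          unfolding js J_def sum.cartesian_product' ..
        also have "\<dots> = (\<Sum>i'\<in>F. if i' = i then \<Sum>j<q. \<sigma>q i' * e (i', j) else 0)"
          by (intro sum.cong) auto
        finally show ?thesis unfolding delta c'_def .
      qed
      have **: "(\<Sum>j\<in>set js. (?a j)\<^sup>2) = (\<sigma> i)\<^sup>2"
      proof -
        have "(\<Sum>j\<in>set js. (?a j)\<^sup>2) = (\<Sum>i'\<in>F. \<Sum>j<q. (?a (i', j))\<^sup>2)"
          unfolding js J_def sum.cartesian_product' ..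
        also have "\<dots> = (\<Sum>i'\<in>F. if i' = i then \<Sum>j<q. (\<sigma>q i')\<^sup>2 else 0)"
          by (intro sum.cong) auto
        finally show ?thesis unfolding delta \<sigma>q .
      qed
      show ?thesis
        using sign_avg_square[where t = b and c = 0 and a = ?a, OF js(2) b'] unfolding * ** by (simp add: c'b[OF i])
    qed
    define T where "T = (\<lambda>l k. \<Sum>i\<in>F. c i * y l i (X l k \<omega>))"
    define U where "U = (\<lambda>l k. sign_avg b js (\<lambda>e. clip (\<Sum>i\<in>F. c' e i * y l i (X l k \<omega>))))"
    have cl: "min (T l k) (1/2) - 2 * min 1 (\<tau> l (X l k \<omega>)) \<le> U l k" if "l \<in> {1..m}" "k \<in> {1..n l}" for l k
    proof -
      have "T l k = (\<Sum>j\<in>set js. z l (X l k \<omega>) j * b j)"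
        unfolding js(1) zsum T_def using c'b by simp
      moreover have "-1/2 \<le> T l k" unfolding T_def by (rule low[OF that])
      ultimately show ?thesis
        using sign_avg_clip_ge[where t = b and a = "T l k" and z = "z l (X l k \<omega>)", OF js(2) b']
        unfolding js(1) zsum z2 \<tau>_def U_def by simp
    qed
    \<comment> \<open>For empty \<open>F\<close> the hypothesis \<open>var\<close> says nothing
      about the sign of \<open>\<kappa>\<close>.\<close>
    have \<kappa>: "0 \<le> \<kappa>" if F0: "F \<noteq> {}"
    proof -
      obtain i where i: "i \<in> F" using F0 by auto
      have "0 \<le> (\<Sum>l=1..m. LINT x|Q l. (y l i x)\<^sup>2)" by (intro sum_nonneg integral_nonneg_AE) auto
      then show ?thesis using var1[OF i] by linarith
    qed
    have "N * \<kappa> * (\<Sum>i\<in>F. sign_avg b js (\<lambda>e. (c' e i)\<^sup>2)) \<le> N * \<kappa> * (\<Sum>i\<in>F. (c i)\<^sup>2 + (\<sigma> i)\<^sup>2)"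
    proof (cases "F = {}")
      case False
      then show ?thesis using N(1) \<kappa> by (intro mult_left_mono sum_mono sq) auto
    qed simp
    then have pen: "N * \<kappa> * (\<Sum>i\<in>F. sign_avg b js (\<lambda>e. (c' e i)\<^sup>2)) \<le>
        N * \<kappa> * (\<Sum>i\<in>F. (c i)\<^sup>2) + N * \<kappa> * (\<Sum>i\<in>F. (\<sigma> i)\<^sup>2)"
      by (simp add: sum.distrib distrib_left)
    have "(\<Sum>l=1..m. \<Sum>k=1..n l. s l * (min (T l k) (1/2) - 2 * min 1 (\<tau> l (X l k \<omega>)))) \<le>
        (\<Sum>l=1..m. \<Sum>k=1..n l. s l * U l k)"
      using s(1) by (intro sum_mono mult_left_mono cl) auto
    moreover have "(\<Sum>l=1..m. \<Sum>k=1..n l. s l * (min (T l k) (1/2) - 2 * min 1 (\<tau> l (X l k \<omega>)))) =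
        (\<Sum>l=1..m. s l * (\<Sum>k=1..n l. min (T l k) (1/2))) -
        2 * (\<Sum>l=1..m. \<Sum>k=1..n l. s l * min 1 (\<tau> l (X l k \<omega>)))"
      unfolding right_diff_distrib sum_subtractf sum_distrib_left by (simp add: mult.left_commute)
    ultimately have "(\<Sum>l=1..m. s l * (\<Sum>k=1..n l. min (T l k) (1/2))) \<le>
        2 * (2 * N * \<kappa> * (\<Sum>i\<in>F. (\<sigma> i)\<^sup>2) + t) + (\<Sum>l=1..m. \<Sum>k=1..n l. s l * U l k)"
      using E2'[of \<omega>] \<omega> by simp
    also have "(\<Sum>l=1..m. \<Sum>k=1..n l. s l * U l k) \<le>
        t + R + (N * \<kappa> * (\<Sum>i\<in>F. (c i)\<^sup>2) + N * \<kappa> * (\<Sum>i\<in>F. (\<sigma> i)\<^sup>2))"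
      using up eq pen unfolding U_def by linarith
    \<comment> \<open>\<open>5 = 1 + 4\<close>: one share is the variance of \<open>c'\<close>
      around \<open>c\<close>, the other four are twice the bound on \<open>E2\<close>, which
      carries a factor 2. Likewise \<open>3 * t = t + 2 * t\<close>.\<close>
    finally show "(\<Sum>l=1..m. N / real (n l) * (\<Sum>k=1..n l. min (\<Sum>i\<in>F. c i * y l i (X l k \<omega>)) (1/2)))
        \<le> R + N * \<kappa> * (\<Sum>i\<in>F. (c i)\<^sup>2) + 5 * N * \<kappa> * (\<Sum>i\<in>F. (\<sigma> i)\<^sup>2) + 3 * t"
      unfolding s_def T_def by (simp add: algebra_simps)
  qed
qed

end

section \<open>Kullback-Leibler divergence against the quadratic form \<open>W\<close>\<close>

section \<open>Almost concave log-likelihood ratios\<close>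

lemma exp_taylor_bounds:
  fixes y R :: real
  assumes "\<bar>y\<bar> \<le> R"
  shows "exp y \<le> 1 + y + exp R * y\<^sup>2" "1 + y + exp (- R) / 2 * y\<^sup>2 \<le> exp y"
proof -
  obtain t where t: "\<bar>t\<bar> \<le> \<bar>y\<bar>" "exp y = (\<Sum>m<2. y ^ m / fact m) + exp t / fact 2 * y ^ 2"
    using Maclaurin_exp_le[of y 2] by auto
  then have eq: "exp y = 1 + y + exp t / 2 * y\<^sup>2"
    by (simp add: lessThan_Suc numeral_2_eq_2)
  have "exp t / 2 \<le> exp R" "exp (- R) / 2 \<le> exp t / 2"
  proof -
    have "exp t \<le> exp R" "exp (- R) \<le> exp t" using t assms by auto
    then show "exp t / 2 \<le> exp R" "exp (- R) / 2 \<le> exp t / 2"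
      using exp_gt_zero[of t] by linarith+
  qed
  then show "exp y \<le> 1 + y + exp R * y\<^sup>2" "1 + y + exp (- R) / 2 * y\<^sup>2 \<le> exp y"
    unfolding eq by (simp_all only: add_le_cancel_left mult_right_mono zero_le_power2)
qed

lemma abs_le_power2_le:
  fixes y R :: real
  shows "\<bar>y\<bar> \<le> R \<Longrightarrow> y\<^sup>2 \<le> R\<^sup>2"
  using power_mono[of "\<bar>y\<bar>" R 2] by simp

lemma (in prob_space) mean_zero_cauchy_schwarz:
  fixes f h :: "'a \<Rightarrow> real"
  assumes "f \<in> borel_measurable M" "h \<in> borel_measurable M"
    "integrable M (\<lambda>x. (f x)\<^sup>2)" "integrable M (\<lambda>x. (h x)\<^sup>2)"
  shows "integrable M (\<lambda>x. f x * h x)"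
    "\<bar>\<integral>x. f x * h x \<partial>M\<bar> \<le> sqrt (\<integral>x. (f x)\<^sup>2 \<partial>M) * sqrt (\<integral>x. (h x)\<^sup>2 \<partial>M)"
proof -
  show i: "integrable M (\<lambda>x. f x * h x)"
  proof (rule Bochner_Integration.integrable_bound)
    show "integrable M (\<lambda>x. (f x)\<^sup>2 + (h x)\<^sup>2)" using assms by auto
    show "AE x in M. norm (f x * h x) \<le> norm ((f x)\<^sup>2 + (h x)\<^sup>2)"
    proof (intro AE_I2)
      fix x
      show "norm (f x * h x) \<le> norm ((f x)\<^sup>2 + (h x)\<^sup>2)"
        using sum_squares_bound[of "\<bar>f x\<bar>" "\<bar>h x\<bar>"] mult_nonneg_nonneg[OF abs_ge_zero abs_ge_zero, of "f x" "h x"]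
        unfolding power2_abs real_norm_def abs_mult by linarith
    qed
  qed (use assms in measurable)
  let ?a = "\<integral>x. (f x)\<^sup>2 \<partial>M" and ?b = "\<integral>x. (h x)\<^sup>2 \<partial>M" and ?c = "\<integral>x. f x * h x \<partial>M"
  have quad: "0 \<le> s\<^sup>2 * ?a - 2 * s * t * ?c + t\<^sup>2 * ?b" for s t :: real
  proof -
    have "0 \<le> (\<integral>x. (s * f x - t * h x)\<^sup>2 \<partial>M)" by (intro integral_nonneg_AE) auto
    also have "\<dots> = (\<integral>x. s\<^sup>2 * (f x)\<^sup>2 - 2 * s * t * (f x * h x) + t\<^sup>2 * (h x)\<^sup>2 \<partial>M)"
      by (intro Bochner_Integration.integral_cong) (auto simp: power2_eq_square algebra_simps)
    also have "\<dots> = s\<^sup>2 * ?a - 2 * s * t * ?c + t\<^sup>2 * ?b"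
      using assms i by simp
    finally show ?thesis .
  qed
  have a: "0 \<le> ?a" and b: "0 \<le> ?b" by (intro integral_nonneg_AE; simp)+
  have "?c\<^sup>2 \<le> ?a * ?b"
  proof (cases "?b = 0")
    case True
    have "?c = 0"
    proof (rule ccontr)
      assume "?c \<noteq> 0"
      then show False
        using quad[of 1 "(?a + 1) / ?c"] True a by simp
    qed
    then show ?thesis using True by simp
  next
    case False
    then have "0 < ?b" using b by linarith
    have "0 \<le> ?b * (?a * ?b - ?c\<^sup>2)"
      using quad[of ?b ?c] by (simp add: power2_eq_square algebra_simps)
    then show ?thesis using \<open>0 < ?b\<close> by (simp add: zero_le_mult_iff)
  qed
  then have "sqrt (?c\<^sup>2) \<le> sqrt (?a * ?b)" by (rule real_sqrt_le_mono)
  then show "\<bar>?c\<bar> \<le> sqrt ?a * sqrt ?b" by (simp add: real_sqrt_mult)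
qed

text \<open>The analytic part, free of densities and of a basis. Derivatives enter through
  difference quotients along the steps \<open>1 / (j + 1)\<close>. In \<open>concave\<close> the
  defect of a single \<open>g l\<close> is measured by the gap of the whole sum of the
  \<open>A l\<close>, because convexity is known only for the sum of the criteria.\<close>

locale log_concave_model = indep_samples P m Q X
  for P :: "'w measure" and m :: nat and Q :: "nat \<Rightarrow> 'x measure" and X :: "nat \<Rightarrow> nat \<Rightarrow> 'w \<Rightarrow> 'x" +
  fixes g :: "nat \<Rightarrow> 'q :: real_normed_vector \<Rightarrow> 'x \<Rightarrow> real" and A :: "nat \<Rightarrow> 'q \<Rightarrow> real"
    and N :: "'q set" and D :: "nat \<Rightarrow> 'q \<Rightarrow> 'q \<Rightarrow> 'x \<Rightarrow> real" and W :: "'q \<Rightarrow> real"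
    and B C1 C2 :: real
  assumes m1: "1 \<le> m"
    and N_convex: "convex N" and N_zero: "0 \<in> N"
    and const_pos: "0 \<le> B" "0 < C1" "0 < C2"
    and g_measurable: "l \<in> {1..m} \<Longrightarrow> g l v \<in> borel_measurable (Q l)"
    and g_mean: "l \<in> {1..m} \<Longrightarrow> v \<in> N \<Longrightarrow> (LINT x|Q l. g l v x) = 0"
    and g_zero: "g l 0 x = 0"
    and exp_normalized: "l \<in> {1..m} \<Longrightarrow> v \<in> N \<Longrightarrow> (LINT x|Q l. exp (g l v x - A l v)) = 1"
    and ratio_bounded: "l \<in> {1..m} \<Longrightarrow> v \<in> N \<Longrightarrow> AE x in Q l. \<bar>g l v x - A l v\<bar> \<le> B"
    and concave: "l \<in> {1..m} \<Longrightarrow> u \<in> N \<Longrightarrow> v \<in> N \<Longrightarrow> 0 \<le> t \<Longrightarrow> t \<le> 1 \<Longrightarrow> AE x in Q l.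
        t * g l u x + (1 - t) * g l v x -
        (t * (\<Sum>l=1..m. A l u) + (1 - t) * (\<Sum>l=1..m. A l v) - (\<Sum>l=1..m. A l (t *\<^sub>R u + (1 - t) *\<^sub>R v)))
        \<le> g l (t *\<^sub>R u + (1 - t) *\<^sub>R v) x"
    and D_lim: "l \<in> {1..m} \<Longrightarrow> p \<in> N \<Longrightarrow> AE x in Q l.
        (\<lambda>j. (g l (p + inverse (real (Suc j)) *\<^sub>R w) x - g l p x) * real (Suc j)) \<longlonglongrightarrow> D l p w x"
    and D_measurable: "l \<in> {1..m} \<Longrightarrow> p \<in> N \<Longrightarrow> D l p w \<in> borel_measurable (Q l)"
    and D_square_integrable: "l \<in> {1..m} \<Longrightarrow> p \<in> N \<Longrightarrow> integrable (Q l) (\<lambda>x. (D l p w x)\<^sup>2)"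
    and D_mean: "l \<in> {1..m} \<Longrightarrow> p \<in> N \<Longrightarrow> (LINT x|Q l. D l p w x) = 0"
    and D_add: "l \<in> {1..m} \<Longrightarrow> p \<in> N \<Longrightarrow> AE x in Q l. D l p (u + w) x = D l p u x + D l p w x"
    and D_scale: "l \<in> {1..m} \<Longrightarrow> p \<in> N \<Longrightarrow> AE x in Q l. D l p (c *\<^sub>R w) x = c * D l p w x"
    and D_lower: "p \<in> N \<Longrightarrow> C1 * W w \<le> (\<Sum>l=1..m. LINT x|Q l. (D l p w x)\<^sup>2)"
    and D_upper: "p \<in> N \<Longrightarrow> (\<Sum>l=1..m. LINT x|Q l. (D l p w x)\<^sup>2) \<le> C2 * W w"
    and W_scale: "W (t *\<^sub>R v) = t\<^sup>2 * W v" and W_nonneg: "0 \<le> W v"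
    and g_lipschitz: "u \<in> N \<Longrightarrow> v \<in> N \<Longrightarrow> (\<Sum>l=1..m. LINT x|Q l. (g l u x - g l v x)\<^sup>2) \<le> C2 * W (u - v)"
begin

abbreviation "total_A v \<equiv> \<Sum>l=1..m. A l v"

lemma segment_in_N: "u \<in> N \<Longrightarrow> v \<in> N \<Longrightarrow> 0 \<le> t \<Longrightarrow> t \<le> 1 \<Longrightarrow> t *\<^sub>R u + (1 - t) *\<^sub>R v \<in> N"
  using N_convex by (simp add: convex_alt add.commute)

lemma ray_in_N: "v \<in> N \<Longrightarrow> 0 \<le> t \<Longrightarrow> t \<le> 1 \<Longrightarrow> t *\<^sub>R v \<in> N"
  using segment_in_N[OF _ N_zero, of v t] by simp

lemma integrable_AE_bounded:
  fixes f :: "'x \<Rightarrow> real"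
  assumes "l \<in> {1..m}" "f \<in> borel_measurable (Q l)" "AE x in Q l. \<bar>f x\<bar> \<le> c"
  shows "integrable (Q l) f"
proof -
  interpret Q: prob_space "Q l" using prob_space_Q assms by simp
  show ?thesis by (rule Q.integrable_const_bound[of f c]) (use assms in auto)
qed

lemma ratio_integrable:
  assumes "l \<in> {1..m}" "v \<in> N"
  shows "integrable (Q l) (\<lambda>x. g l v x - A l v)" "integrable (Q l) (g l v)"
    "integrable (Q l) (\<lambda>x. exp (g l v x - A l v))"
proof -
  interpret Q: prob_space "Q l" using prob_space_Q assms by simp
  note [measurable] = g_measurable[OF assms(1)]
  show 1: "integrable (Q l) (\<lambda>x. g l v x - A l v)"
    by (rule integrable_AE_bounded[OF assms(1) _ ratio_bounded[OF assms]]) measurable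
  have "integrable (Q l) (\<lambda>x. (g l v x - A l v) + A l v)" using 1 by (intro Bochner_Integration.integrable_add) auto
  then show "integrable (Q l) (g l v)" by simp
  show "integrable (Q l) (\<lambda>x. exp (g l v x - A l v))"
    by (rule integrable_AE_bounded[OF assms(1), of _ "exp B"]) (use ratio_bounded[OF assms] in \<open>measurable, auto\<close>)
qed

text \<open>\<open>A l v\<close> is the Kullback-Leibler divergence from the true law to the law at
  \<open>v\<close>: \<open>g l v - A l v\<close> is the log density ratio and \<open>g l v\<close>
  has mean zero. The lower bound is Jensen's inequality, the upper one the uniform bound on the
  ratio.\<close>

lemma A_bounds:
  assumes "l \<in> {1..m}" "v \<in> N"
  shows "0 \<le> A l v" "A l v \<le> B"
proof -
  interpret Q: prob_space "Q l" using prob_space_Q assms by simp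
  note i = ratio_integrable[OF assms]
  have e: "(LINT x|Q l. g l v x - A l v) = - A l v"
    using i(2) g_mean[OF assms] by (simp add: Q.prob_space)
  have "(LINT x|Q l. 1 + (g l v x - A l v)) \<le> (LINT x|Q l. exp (g l v x - A l v))"
    using i by (intro integral_mono) auto
  then show "0 \<le> A l v"
    using e i(1) exp_normalized[OF assms] by (simp add: Q.prob_space del: Bochner_Integration.integral_diff)
  have "(LINT x|Q l. - B) \<le> (LINT x|Q l. g l v x - A l v)"
    using i ratio_bounded[OF assms] by (intro integral_mono_AE) auto
  then show "A l v \<le> B" using e by (simp add: Q.prob_space)
qed

lemma A_zero: "l \<in> {1..m} \<Longrightarrow> A l 0 = 0"
  using exp_normalized[OF _ N_zero, of l] prob_space.prob_space[OF prob_space_Q, of l]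
  by (simp add: g_zero)

lemma total_A_bounds:
  assumes "v \<in> N"
  shows "0 \<le> total_A v" "total_A v \<le> real m * B"
  using A_bounds(1)[OF _ assms] sum_bounded_above[of "{1..m}" "\<lambda>l. A l v" B] A_bounds(2)[OF _ assms]
  by (auto intro!: sum_nonneg)

lemma g_bounded:
  assumes "l \<in> {1..m}" "v \<in> N"
  shows "AE x in Q l. \<bar>g l v x\<bar> \<le> 2 * B"
  using ratio_bounded[OF assms] by eventually_elim (use A_bounds[OF assms] in auto)

lemma g_square_integrable:
  assumes "l \<in> {1..m}" "v \<in> N"
  shows "integrable (Q l) (\<lambda>x. (g l v x)\<^sup>2)"
proof -
  note [measurable] = g_measurable[OF assms(1)]
  have "AE x in Q l. \<bar>(g l v x)\<^sup>2\<bar> \<le> (2 * B)\<^sup>2"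
    using g_bounded[OF assms] by eventually_elim (simp only: abs_power2 abs_le_power2_le)
  then show ?thesis by (intro integrable_AE_bounded[OF assms(1)]) measurable
qed

lemma exp_g_integral:
  assumes "l \<in> {1..m}" "v \<in> N"
  shows "integrable (Q l) (\<lambda>x. exp (g l v x))" "(LINT x|Q l. exp (g l v x)) = exp (A l v)"
proof -
  have eq: "exp (g l v x) = exp (A l v) * exp (g l v x - A l v)" for x by (simp flip: exp_add)
  show "integrable (Q l) (\<lambda>x. exp (g l v x))" "(LINT x|Q l. exp (g l v x)) = exp (A l v)"
    unfolding eq using ratio_integrable(3)[OF assms] exp_normalized[OF assms] by auto
qed

text \<open>On the bounded range of \<open>g\<close> the exponential lies between two parabolas, so
  \<open>exp (A l v)\<close>, the mean of \<open>exp (g l v x)\<close>, is comparable to one plus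
  the variance. This lemma and the next are the two directions.\<close>

lemma A_le_variance:
  assumes "l \<in> {1..m}" "v \<in> N"
  shows "A l v \<le> exp (2 * B) * (LINT x|Q l. (g l v x)\<^sup>2)"
proof -
  interpret Q: prob_space "Q l" using prob_space_Q assms by simp
  have "exp (A l v) \<le> (LINT x|Q l. 1 + g l v x + exp (2 * B) * (g l v x)\<^sup>2)"
    unfolding exp_g_integral(2)[OF assms, symmetric]
  proof (rule integral_mono_AE)
    show "AE x in Q l. exp (g l v x) \<le> 1 + g l v x + exp (2 * B) * (g l v x)\<^sup>2"
      using g_bounded[OF assms] by eventually_elim (rule exp_taylor_bounds)
  qed (use exp_g_integral[OF assms] ratio_integrable(2)[OF assms] g_square_integrable[OF assms] in auto)
  also have "\<dots> = 1 + exp (2 * B) * (LINT x|Q l. (g l v x)\<^sup>2)"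
    using ratio_integrable(2)[OF assms] g_square_integrable[OF assms] g_mean[OF assms] by (simp add: Q.prob_space)
  finally show ?thesis using exp_ge_add_one_self[of "A l v"] by linarith
qed

lemma variance_le_A:
  assumes "l \<in> {1..m}" "v \<in> N"
  shows "(LINT x|Q l. (g l v x)\<^sup>2) \<le> 2 * exp (3 * B) * A l v"
proof -
  interpret Q: prob_space "Q l" using prob_space_Q assms by simp
  let ?V = "LINT x|Q l. (g l v x)\<^sup>2"
  have "1 + exp (- (2 * B)) / 2 * ?V = (LINT x|Q l. 1 + g l v x + exp (- (2 * B)) / 2 * (g l v x)\<^sup>2)"
    using ratio_integrable(2)[OF assms] g_square_integrable[OF assms] g_mean[OF assms] by (simp add: Q.prob_space)
  also have "\<dots> \<le> exp (A l v)"
    unfolding exp_g_integral(2)[OF assms, symmetric]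
  proof (rule integral_mono_AE)
    show "AE x in Q l. 1 + g l v x + exp (- (2 * B)) / 2 * (g l v x)\<^sup>2 \<le> exp (g l v x)"
      using g_bounded[OF assms] by eventually_elim (rule exp_taylor_bounds)
  qed (use exp_g_integral[OF assms] ratio_integrable(2)[OF assms] g_square_integrable[OF assms] in auto)
  \<comment> \<open>Back from the exponential to \<open>A l v\<close> itself;
    \<open>A l v \<le> B\<close> makes the price a factor \<open>exp B\<close>, whence
    \<open>3 * B\<close> in the conclusion.\<close>
  also have "exp (A l v) \<le> 1 + exp B * A l v"
  proof -
    have "exp (A l v) - 1 \<le> A l v * exp (A l v)"
      using exp_ge_add_one_self[of "- A l v"] by (simp add: exp_minus field_simps)
    also have "\<dots> \<le> A l v * exp B" using A_bounds[OF assms] by (intro mult_left_mono) auto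
    finally show ?thesis by (simp add: mult.commute)
  qed
  finally have "exp (- (2 * B)) / 2 * ?V \<le> exp B * A l v" by simp
  then have "(2 * exp (2 * B)) * (exp (- (2 * B)) / 2 * ?V) \<le> (2 * exp (2 * B)) * (exp B * A l v)"
    by (intro mult_left_mono) auto
  moreover have "(2 * exp (2 * B)) * (exp (- (2 * B)) / 2 * ?V) = ?V"
    by (simp add: exp_minus)
  moreover have "(2 * exp (2 * B)) * (exp B * A l v) = 2 * exp (3 * B) * A l v"
    by (simp flip: exp_add mult.assoc)
  ultimately show ?thesis by linarith
qed

text \<open>Integrating \<open>concave\<close> for a single \<open>l\<close> is enough: the means of
  \<open>g\<close> vanish and only the gap of the sum remains.\<close>

lemma total_A_convex:
  assumes "u \<in> N" "v \<in> N" "0 \<le> t" "t \<le> 1"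
  shows "total_A (t *\<^sub>R u + (1 - t) *\<^sub>R v) \<le> t * total_A u + (1 - t) * total_A v"
proof -
  obtain l where l: "l \<in> {1..m}" using m1 by fastforce
  interpret Q: prob_space "Q l" using prob_space_Q l by simp
  let ?c = "t * total_A u + (1 - t) * total_A v - total_A (t *\<^sub>R u + (1 - t) *\<^sub>R v)"
  note i = ratio_integrable(2)[OF l]
  have "(LINT x|Q l. t * g l u x + (1 - t) * g l v x - ?c) \<le> (LINT x|Q l. g l (t *\<^sub>R u + (1 - t) *\<^sub>R v) x)"
    using i[OF assms(1)] i[OF assms(2)] i[OF segment_in_N[OF assms]] concave[OF l assms]
    by (intro integral_mono_AE) auto
  then show ?thesis
    using i[OF assms(1)] i[OF assms(2)] g_mean[OF l assms(1)] g_mean[OF l assms(2)] g_mean[OF l segment_in_N[OF assms]]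
    by (simp add: Q.prob_space)
qed

lemma total_A_ray:
  assumes "v \<in> N" "0 \<le> t" "t \<le> 1"
  shows "total_A (t *\<^sub>R v) \<le> t * total_A v"
  using total_A_convex[OF assms(1) N_zero assms(2,3)] by (simp add: A_zero)

text \<open>By concavity the derivative at the midpoint of a segment is squeezed between the chords, so
  \<open>D_lower\<close> at the midpoint bounds \<open>W v\<close> by the values of \<open>g\<close> at \<open>v\<close> and \<open>v / 2\<close>.\<close>

lemma midpoint_derivative_bounds:
  assumes l: "l \<in> {1..m}" and v: "v \<in> N"
  shows "AE x in Q l. \<bar>D l ((1/2) *\<^sub>R v) v x\<bar> \<le> 2 * \<bar>g l v x\<bar> + 2 * \<bar>g l ((1/2) *\<^sub>R v) x\<bar> + 4 * total_A v"
proof -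
  define p where "p = (1/2) *\<^sub>R v"
  define h where "h = (\<lambda>j. inverse (real (Suc j)))"
  define ph where "ph = (\<lambda>j. p + h j *\<^sub>R v)"
  have p: "p \<in> N" unfolding p_def using ray_in_N[OF v] by simp
  \<comment> \<open>For \<open>j = 0\<close> the step is 1 and the point would pass beyond
    \<open>v\<close>; up to 1/2 it stays on the segment.\<close>
  have h: "0 < h j" "h j \<le> 1/2" if "1 \<le> j" for j using that by (auto simp: h_def field_simps)
  have phv: "ph j = (1/2 + h j) *\<^sub>R v" for j by (simp add: ph_def p_def scaleR_add_left)
  have phN: "ph j \<in> N" if "1 \<le> j" for j
    unfolding phv using ray_in_N[OF v, of "1/2 + h j"] h[OF that] by simp
  \<comment> \<open>The moved point lies between \<open>p\<close> and \<open>v\<close>, so concavity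
    there bounds the difference quotient from below.\<close>
  have ph1: "ph j = (2 * h j) *\<^sub>R v + (1 - 2 * h j) *\<^sub>R p" for j
    unfolding phv p_def by (simp add: algebra_simps flip: scaleR_add_left)
  \<comment> \<open>Weight that exhibits \<open>p\<close> as a point between 0 and the moved point;
    concavity at \<open>p\<close> then bounds the difference quotient from above.\<close>
  define s where "s = (\<lambda>j. 1 / (1 + 2 * h j))"
  have s: "0 \<le> s j" "s j \<le> 1" "0 < s j" if "1 \<le> j" for j using h[OF that] by (auto simp: s_def field_simps)
  have p1: "p = s j *\<^sub>R ph j + (1 - s j) *\<^sub>R 0" if "1 \<le> j" for j
  proof -
    have "s j * (1/2 + h j) = 1/2" using h[OF that] by (simp add: s_def field_simps)
    then show ?thesis unfolding phv p_def by simp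
  qed
  have Ap: "total_A p \<le> total_A (ph j)" if "1 \<le> j" for j
  proof -
    have "total_A p \<le> s j * total_A (ph j)"
      using total_A_ray[OF phN[OF that] s(1,2)[OF that]] p1[OF that] by simp
    also have "\<dots> \<le> total_A (ph j)"
      using s[OF that] total_A_bounds(1)[OF phN[OF that]] by (simp add: mult_left_le_one_le)
    finally show ?thesis .
  qed
  have Aph: "total_A (ph j) \<le> 2 * h j * total_A v + (1 - 2 * h j) * total_A p" if "1 \<le> j" for j
    using total_A_convex[OF v p, of "2 * h j"] h[OF that] unfolding ph1[of j] by simp
  have lo: "AE x in Q l. \<forall>j\<ge>1. 2 * (g l v x - g l p x) - 2 * total_A v \<le> (g l (ph j) x - g l p x) * real (Suc j)"
    unfolding AE_all_countable
  proof (intro allI AE_impI)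
    fix j :: nat assume j: "1 \<le> j"
    have "AE x in Q l. 2 * h j * g l v x + (1 - 2 * h j) * g l p x -
        (2 * h j * total_A v + (1 - 2 * h j) * total_A p - total_A (ph j)) \<le> g l (ph j) x"
      using concave[OF l v p, of "2 * h j"] h[OF j] unfolding ph1[symmetric] by simp
    then show "AE x in Q l. 2 * (g l v x - g l p x) - 2 * total_A v \<le> (g l (ph j) x - g l p x) * real (Suc j)"
    proof eventually_elim
      fix x
      assume c: "2 * h j * g l v x + (1 - 2 * h j) * g l p x - (2 * h j * total_A v + (1 - 2 * h j) * total_A p - total_A (ph j)) \<le> g l (ph j) x"
      have "2 * h j * total_A v + (1 - 2 * h j) * total_A p - total_A (ph j) \<le> 2 * h j * total_A v"
        using Ap[OF j] mult_nonneg_nonneg[of "2 * h j" "total_A p"] h[OF j] total_A_bounds(1)[OF p]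
        unfolding left_diff_distrib by linarith
      then have "h j * (2 * (g l v x - g l p x) - 2 * total_A v) \<le> g l (ph j) x - g l p x"
        using c by (simp add: algebra_simps)
      then have "real (Suc j) * (h j * (2 * (g l v x - g l p x) - 2 * total_A v)) \<le> real (Suc j) * (g l (ph j) x - g l p x)"
        by (intro mult_left_mono) auto
      moreover have "real (Suc j) * (h j * z) = z" for z by (simp add: h_def)
      ultimately show "2 * (g l v x - g l p x) - 2 * total_A v \<le> (g l (ph j) x - g l p x) * real (Suc j)"
        by (simp only: mult.commute)
    qed
  qed
  have hi: "AE x in Q l. \<forall>j\<ge>1. (g l (ph j) x - g l p x) * real (Suc j) \<le> 2 * g l p x + 4 * total_A v"
    unfolding AE_all_countable
  proof (intro allI AE_impI)
    fix j :: nat assume j: "1 \<le> j"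
    have "AE x in Q l. s j * g l (ph j) x - (s j * total_A (ph j) - total_A p) \<le> g l p x"
      using concave[OF l phN[OF j] N_zero s(1,2)[OF j]] unfolding p1[OF j, symmetric]
      by (simp add: g_zero A_zero)
    then show "AE x in Q l. (g l (ph j) x - g l p x) * real (Suc j) \<le> 2 * g l p x + 4 * total_A v"
    proof eventually_elim
      fix x
      assume c: "s j * g l (ph j) x - (s j * total_A (ph j) - total_A p) \<le> g l p x"
      have "s j * total_A (ph j) \<le> total_A (ph j)"
        using s[OF j] total_A_bounds(1)[OF phN[OF j]] by (simp add: mult_left_le_one_le)
      then have "s j * total_A (ph j) - total_A p \<le> 2 * h j * total_A v"
        using Aph[OF j] mult_nonneg_nonneg[of "2 * h j" "total_A p"] h[OF j] total_A_bounds(1)[OF p]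
        unfolding left_diff_distrib by linarith
      then have "s j * g l (ph j) x \<le> g l p x + 2 * h j * total_A v" using c by linarith
      then have "(1 + 2 * h j) * (s j * g l (ph j) x) \<le> (1 + 2 * h j) * (g l p x + 2 * h j * total_A v)"
        using h[OF j] by (intro mult_left_mono) auto
      moreover have "(1 + 2 * h j) * (s j * g l (ph j) x) = g l (ph j) x"
        using h[OF j] by (simp add: s_def field_simps)
      ultimately have "g l (ph j) x - g l p x \<le> h j * (2 * g l p x + 2 * (1 + 2 * h j) * total_A v)"
        by (simp add: algebra_simps)
      also have "\<dots> \<le> h j * (2 * g l p x + 4 * total_A v)"
      proof -
        have "2 * (1 + 2 * h j) * total_A v \<le> 4 * total_A v"
          using h[OF j] total_A_bounds(1)[OF v] by (intro mult_right_mono) auto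
        then show ?thesis using h[OF j] by (intro mult_left_mono) auto
      qed
      finally have "real (Suc j) * (g l (ph j) x - g l p x) \<le> real (Suc j) * (h j * (2 * g l p x + 4 * total_A v))"
        by (intro mult_left_mono) auto
      moreover have "real (Suc j) * (h j * z) = z" for z by (simp add: h_def)
      ultimately show "(g l (ph j) x - g l p x) * real (Suc j) \<le> 2 * g l p x + 4 * total_A v"
        by (simp only: mult.commute)
    qed
  qed
  show ?thesis
    using lo hi D_lim[OF l p, of v] unfolding p_def[symmetric]
  proof eventually_elim
    fix x
    assume lo: "\<forall>j\<ge>1. 2 * (g l v x - g l p x) - 2 * total_A v \<le> (g l (ph j) x - g l p x) * real (Suc j)"
      and hi: "\<forall>j\<ge>1. (g l (ph j) x - g l p x) * real (Suc j) \<le> 2 * g l p x + 4 * total_A v"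
      and lim: "(\<lambda>j. (g l (p + inverse (real (Suc j)) *\<^sub>R v) x - g l p x) * real (Suc j)) \<longlonglongrightarrow> D l p v x"
    have lim': "(\<lambda>j. (g l (ph j) x - g l p x) * real (Suc j)) \<longlonglongrightarrow> D l p v x"
      using lim by (simp add: ph_def h_def)
    have "2 * (g l v x - g l p x) - 2 * total_A v \<le> D l p v x"
      using lo by (intro LIMSEQ_le_const[OF lim']) blast
    moreover have "D l p v x \<le> 2 * g l p x + 4 * total_A v"
      using hi by (intro LIMSEQ_le_const2[OF lim']) blast
    ultimately show "\<bar>D l p v x\<bar> \<le> 2 * \<bar>g l v x\<bar> + 2 * \<bar>g l p x\<bar> + 4 * total_A v"
      using total_A_bounds(1)[OF v] abs_ge_self[of "g l p x"] abs_ge_minus_self[of "g l v x"] abs_ge_zero[of "g l v x"]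
      unfolding right_diff_distrib by (intro abs_leI) argo+
  qed
qed

text \<open>The midpoint bound is linear in \<open>g\<close> but contains \<open>total_A v\<close>
  itself. Squaring is harmless: the variances are bounded by the \<open>A l\<close>, and
  \<open>(total_A v)\<^sup>2\<close> is linear in \<open>total_A v\<close> because
  \<open>total_A\<close> is bounded on \<open>N\<close>.\<close>

lemma W_le_total_A: "\<exists>K>0. \<forall>v\<in>N. W v \<le> K * total_A v"
proof -
  \<comment> \<open>The square of twice a three-term sum is at most 12 times the sum of squares, and
    the third term is \<open>2 * total_A v\<close>, hence 12 and 48. The variances at
    \<open>v\<close> and at \<open>v / 2\<close> each contribute
    \<open>24 * exp (3 * B)\<close>.\<close>
  define K where "K = (48 * exp (3 * B) + 48 * real m * (real m * B) + 1) / C1"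
  have "W v \<le> K * total_A v" if v: "v \<in> N" for v
  proof -
    define p where "p = (1/2) *\<^sub>R v"
    have p: "p \<in> N" unfolding p_def using ray_in_N[OF v] by simp
    have Apv: "total_A p \<le> total_A v"
      using total_A_ray[OF v, of "1/2"] total_A_bounds(1)[OF v] by (simp add: p_def)
    let ?V = "\<lambda>l v. LINT x|Q l. (g l v x)\<^sup>2"
    have sumV: "(\<Sum>l=1..m. ?V l v) \<le> 2 * exp (3 * B) * total_A v" if "v \<in> N" for v
      using variance_le_A[OF _ that] by (subst sum_distrib_left) (intro sum_mono, auto)
    have "C1 * W v \<le> (\<Sum>l=1..m. LINT x|Q l. (D l p v x)\<^sup>2)" by (rule D_lower[OF p])
    also have "\<dots> \<le> (\<Sum>l=1..m. 12 * ?V l v + 12 * ?V l p + 48 * (total_A v)\<^sup>2)"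
    proof (rule sum_mono)
      fix l assume l: "l \<in> {1..m}"
      interpret Q: prob_space "Q l" using prob_space_Q l by simp
      have "(LINT x|Q l. (D l p v x)\<^sup>2) \<le> (LINT x|Q l. 12 * (g l v x)\<^sup>2 + 12 * (g l p x)\<^sup>2 + 48 * (total_A v)\<^sup>2)"
      proof (rule integral_mono_AE)
        show "AE x in Q l. (D l p v x)\<^sup>2 \<le> 12 * (g l v x)\<^sup>2 + 12 * (g l p x)\<^sup>2 + 48 * (total_A v)\<^sup>2"
          using midpoint_derivative_bounds[OF l v] unfolding p_def[symmetric]
        proof eventually_elim
          fix x
          let ?a = "\<bar>g l v x\<bar>" and ?b = "\<bar>g l p x\<bar>" and ?c = "2 * total_A v"
          assume "\<bar>D l p v x\<bar> \<le> 2 * ?a + 2 * ?b + 4 * total_A v"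
          then have "(D l p v x)\<^sup>2 \<le> (2 * (?a + ?b + ?c))\<^sup>2"
            by (intro abs_le_square_iff[THEN iffD1]) auto
          also have "\<dots> = 4 * (?a + ?b + ?c)\<^sup>2" by (simp add: power2_eq_square algebra_simps)
          also have "(?a + ?b + ?c)\<^sup>2 \<le> 3 * (?a\<^sup>2 + ?b\<^sup>2 + ?c\<^sup>2)"
            using sum_squares_bound[of ?a ?b] sum_squares_bound[of ?a ?c] sum_squares_bound[of ?b ?c]
            by (simp add: power2_eq_square algebra_simps)
          finally show "(D l p v x)\<^sup>2 \<le> 12 * (g l v x)\<^sup>2 + 12 * (g l p x)\<^sup>2 + 48 * (total_A v)\<^sup>2"
            by (simp add: power_mult_distrib)
        qed
      qed (use D_square_integrable[OF l p] g_square_integrable[OF l] v p in auto)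
      also have "\<dots> = 12 * ?V l v + 12 * ?V l p + 48 * (total_A v)\<^sup>2"
        using g_square_integrable[OF l] v p by (simp add: Q.prob_space)
      finally show "(LINT x|Q l. (D l p v x)\<^sup>2) \<le> \<dots>" .
    qed
    also have "\<dots> = 12 * (\<Sum>l=1..m. ?V l v) + 12 * (\<Sum>l=1..m. ?V l p) + 48 * real m * (total_A v)\<^sup>2"
      by (simp add: sum.distrib sum_distrib_left)
    also have "\<dots> \<le> 12 * (2 * exp (3 * B) * total_A v) + 12 * (2 * exp (3 * B) * total_A v) + 48 * real m * (real m * B * total_A v)"
    proof (intro add_mono mult_left_mono)
      show "(\<Sum>l=1..m. ?V l p) \<le> 2 * exp (3 * B) * total_A v"
        by (rule order_trans[OF sumV[OF p]]) (use Apv in auto)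
      show "(total_A v)\<^sup>2 \<le> real m * B * total_A v"
        unfolding power2_eq_square using total_A_bounds[OF v] by (intro mult_right_mono)
    qed (use sumV[OF v] in auto)
    also have "\<dots> \<le> (48 * exp (3 * B) + 48 * real m * (real m * B) + 1) * total_A v"
      using total_A_bounds(1)[OF v] by (simp add: algebra_simps)
    finally show ?thesis
      using const_pos by (simp add: K_def field_simps)
  qed
  moreover have "K > 0"
    unfolding K_def using const_pos by (intro divide_pos_pos add_nonneg_pos add_nonneg_nonneg mult_nonneg_nonneg) auto
  ultimately show ?thesis by blast
qed

lemma variance_le_W:
  assumes "l \<in> {1..m}" "u \<in> N" "v \<in> N"
  shows "(LINT x|Q l. (g l u x - g l v x)\<^sup>2) \<le> C2 * W (u - v)"
proof -
  have "(LINT x|Q l. (g l u x - g l v x)\<^sup>2) \<le> (\<Sum>l=1..m. LINT x|Q l. (g l u x - g l v x)\<^sup>2)"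
    using assms(1) by (intro member_le_sum integral_nonneg_AE) auto
  then show ?thesis using g_lipschitz[OF assms(2,3)] by linarith
qed

lemma increment_facts:
  assumes l: "l \<in> {1..m}" and u: "u \<in> N" and v: "v \<in> N"
  shows "AE x in Q l. \<bar>g l u x - g l v x\<bar> \<le> 4 * B" "integrable (Q l) (\<lambda>x. (g l u x - g l v x)\<^sup>2)"
    "(LINT x|Q l. g l u x - g l v x) = 0"
proof -
  note [measurable] = g_measurable[OF l]
  show b: "AE x in Q l. \<bar>g l u x - g l v x\<bar> \<le> 4 * B"
    using g_bounded[OF l u] g_bounded[OF l v] by eventually_elim auto
  have "AE x in Q l. \<bar>(g l u x - g l v x)\<^sup>2\<bar> \<le> (4 * B)\<^sup>2"
    using b by eventually_elim (simp only: abs_power2 abs_le_power2_le)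
  then show "integrable (Q l) (\<lambda>x. (g l u x - g l v x)\<^sup>2)"
    by (intro integrable_AE_bounded[OF l]) measurable
  show "(LINT x|Q l. g l u x - g l v x) = 0"
    using ratio_integrable(2)[OF l] u v g_mean[OF l] by simp
qed

definition tilt_const :: real where
  "tilt_const = exp B * sqrt (C2 * (1 + B * exp (2 * B))) * sqrt C2"

lemma tilt_const_nonneg: "0 \<le> tilt_const"
  unfolding tilt_const_def using const_pos by (intro mult_nonneg_nonneg real_sqrt_ge_zero) auto

text \<open>Under the true law the increment has mean zero, so only the deviation of the tilting
  density from 1 contributes. That deviation is of size \<open>sqrt (W p)\<close> in mean square,
  and Cauchy-Schwarz gives the product.\<close>

lemma tilted_mean_bound:
  assumes l: "l \<in> {1..m}" and p: "p \<in> N" and u: "u \<in> N"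
  shows "integrable (Q l) (\<lambda>x. exp (g l p x - A l p) * (g l u x - g l p x))"
    "\<bar>LINT x|Q l. exp (g l p x - A l p) * (g l u x - g l p x)\<bar> \<le> tilt_const * (sqrt (W p) * sqrt (W (u - p)))"
proof -
  interpret Q: prob_space "Q l" using prob_space_Q l by simp
  note [measurable] = g_measurable[OF l]
  let ?u = "\<lambda>x. g l p x - A l p" and ?y = "\<lambda>x. g l u x - g l p x"
  have sq: "AE x in Q l. (exp (?u x) - 1)\<^sup>2 \<le> exp (2 * B) * (?u x)\<^sup>2"
    using ratio_bounded[OF l p]
  proof eventually_elim
    fix x assume "\<bar>?u x\<bar> \<le> B"
    have "\<bar>exp (?u x) - 1\<bar> \<le> exp B * \<bar>?u x\<bar>"
    proof -
      have *: "exp y - 1 \<le> y * exp y" for y :: real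
        using exp_ge_add_one_self[of "- y"] by (simp add: exp_minus field_simps)
      have "exp (?u x) - 1 \<le> exp B * \<bar>?u x\<bar>"
      proof (cases "0 \<le> ?u x")
        case True
        then have "?u x * exp (?u x) \<le> ?u x * exp B" using \<open>\<bar>?u x\<bar> \<le> B\<close> by (intro mult_left_mono) auto
        then show ?thesis using *[of "?u x"] True by (simp add: mult.commute)
      next
        case False
        then have "exp (?u x) \<le> 1" by simp
        moreover have "0 \<le> exp B * \<bar>?u x\<bar>" by simp
        ultimately show ?thesis by linarith
      qed
      moreover have "1 - exp (?u x) \<le> exp B * \<bar>?u x\<bar>"
      proof -
        have "1 - exp (?u x) \<le> \<bar>?u x\<bar>" using exp_ge_add_one_self[of "?u x"] by linarith
        also have "\<dots> \<le> exp B * \<bar>?u x\<bar>" using const_pos mult_right_mono[of 1 "exp B" "\<bar>?u x\<bar>"] by simp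
        finally show ?thesis .
      qed
      ultimately show ?thesis by linarith
    qed
    then have "(exp (?u x) - 1)\<^sup>2 \<le> (exp B * \<bar>?u x\<bar>)\<^sup>2"
      by (intro abs_le_square_iff[THEN iffD1]) auto
    then show "(exp (?u x) - 1)\<^sup>2 \<le> exp (2 * B) * (?u x)\<^sup>2"
      by (simp add: power_mult_distrib exp_double)
  qed
  have u2: "integrable (Q l) (\<lambda>x. (?u x)\<^sup>2)" "(LINT x|Q l. (?u x)\<^sup>2) = (LINT x|Q l. (g l p x)\<^sup>2) + (A l p)\<^sup>2"
  proof -
    have eq: "(?u x)\<^sup>2 = (g l p x)\<^sup>2 - 2 * A l p * g l p x + (A l p)\<^sup>2" for x
      by (simp add: power2_eq_square algebra_simps)
    show "integrable (Q l) (\<lambda>x. (?u x)\<^sup>2)" "(LINT x|Q l. (?u x)\<^sup>2) = (LINT x|Q l. (g l p x)\<^sup>2) + (A l p)\<^sup>2"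
      unfolding eq using g_square_integrable[OF l p] ratio_integrable(2)[OF l p] g_mean[OF l p] by (auto simp: Q.prob_space)
  qed
  have ie: "integrable (Q l) (\<lambda>x. (exp (?u x) - 1)\<^sup>2)"
    by (rule Bochner_Integration.integrable_bound[of _ "\<lambda>x. exp (2 * B) * (?u x)\<^sup>2"]) (use u2 sq in auto)
  note cs = Q.mean_zero_cauchy_schwarz[of "\<lambda>x. exp (?u x) - 1" ?y, OF _ _ ie increment_facts(2)[OF l u p]]
  have i: "integrable (Q l) (\<lambda>x. (exp (?u x) - 1) * ?y x)" by (rule cs(1)) measurable
  have iy: "integrable (Q l) ?y" using ratio_integrable(2)[OF l] u p by auto
  have eq: "exp (?u x) * ?y x = (exp (?u x) - 1) * ?y x + ?y x" for x by (simp add: algebra_simps)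
  show "integrable (Q l) (\<lambda>x. exp (?u x) * ?y x)" unfolding eq using i iy by auto
  have "(LINT x|Q l. exp (?u x) * ?y x) = (LINT x|Q l. (exp (?u x) - 1) * ?y x)"
    unfolding eq using i iy increment_facts(3)[OF l u p] by (simp del: Bochner_Integration.integral_diff)
  also have "\<bar>\<dots>\<bar> \<le> sqrt (LINT x|Q l. (exp (?u x) - 1)\<^sup>2) * sqrt (LINT x|Q l. (?y x)\<^sup>2)"
    by (rule cs(2)) measurable
  also have "\<dots> \<le> (exp B * sqrt (C2 * (1 + B * exp (2 * B)) * W p)) * sqrt (C2 * W (u - p))"
  proof (intro mult_mono real_sqrt_le_mono variance_le_W[OF l u p])
    have V: "(LINT x|Q l. (g l p x)\<^sup>2) \<le> C2 * W p"
      using variance_le_W[OF l p N_zero] by (simp add: g_zero)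
    have V0: "0 \<le> (LINT x|Q l. (g l p x)\<^sup>2)" by (intro integral_nonneg_AE) auto
    have "(LINT x|Q l. (exp (?u x) - 1)\<^sup>2) \<le> (LINT x|Q l. exp (2 * B) * (?u x)\<^sup>2)"
      using ie u2 sq by (intro integral_mono_AE) auto
    also have "\<dots> = exp (2 * B) * ((LINT x|Q l. (g l p x)\<^sup>2) + (A l p)\<^sup>2)" using u2 by simp
    also have "(A l p)\<^sup>2 \<le> B * (exp (2 * B) * (LINT x|Q l. (g l p x)\<^sup>2))"
      unfolding power2_eq_square[of "A l p"]
      using A_bounds[OF l p] A_le_variance[OF l p] const_pos by (intro mult_mono) auto
    also have "(LINT x|Q l. (g l p x)\<^sup>2) + B * (exp (2 * B) * (LINT x|Q l. (g l p x)\<^sup>2)) = (1 + B * exp (2 * B)) * (LINT x|Q l. (g l p x)\<^sup>2)"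
      by (simp add: algebra_simps)
    also have "\<dots> \<le> (1 + B * exp (2 * B)) * (C2 * W p)" using V const_pos by (intro mult_left_mono) auto
    finally have "(LINT x|Q l. (exp (?u x) - 1)\<^sup>2) \<le> exp (2 * B) * (C2 * (1 + B * exp (2 * B)) * W p)"
      by (simp add: mult_ac)
    then have "sqrt (LINT x|Q l. (exp (?u x) - 1)\<^sup>2) \<le> sqrt (exp (2 * B) * (C2 * (1 + B * exp (2 * B)) * W p))"
      by (rule real_sqrt_le_mono)
    also have "\<dots> = exp B * sqrt (C2 * (1 + B * exp (2 * B)) * W p)"
      by (simp add: real_sqrt_mult exp_double)
    finally show "sqrt (LINT x|Q l. (exp (?u x) - 1)\<^sup>2) \<le> exp B * sqrt (C2 * (1 + B * exp (2 * B)) * W p)" .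
  qed (use const_pos W_nonneg in \<open>auto intro!: mult_nonneg_nonneg add_nonneg_nonneg\<close>)
  also have "\<dots> = tilt_const * (sqrt (W p) * sqrt (W (u - p)))"
    by (simp add: tilt_const_def real_sqrt_mult mult_ac)
  finally show "\<bar>LINT x|Q l. exp (?u x) * ?y x\<bar> \<le> tilt_const * (sqrt (W p) * sqrt (W (u - p)))" .
qed

text \<open>\<open>A l u - A l p\<close> is the logarithm of the mean of
  \<open>exp (g l u x - g l p x)\<close> under the law at \<open>p\<close>. Jensen's inequality
  gives the lower bound and a second-order expansion the upper one, with
  \<open>5 * B = B + 4 * B\<close> from the bounds on the density and on the increment.\<close>

lemma A_increment_bounds:
  assumes l: "l \<in> {1..m}" and p: "p \<in> N" and u: "u \<in> N"
  shows "(LINT x|Q l. exp (g l p x - A l p) * (g l u x - g l p x)) \<le> A l u - A l p"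
    "A l u - A l p \<le> (LINT x|Q l. exp (g l p x - A l p) * (g l u x - g l p x)) + exp (5 * B) * C2 * W (u - p)"
proof -
  interpret Q: prob_space "Q l" using prob_space_Q l by simp
  note [measurable] = g_measurable[OF l]
  let ?e = "\<lambda>x. exp (g l p x - A l p)" and ?y = "\<lambda>x. g l u x - g l p x"
  let ?c = "LINT x|Q l. ?e x * ?y x"
  have i1: "integrable (Q l) (\<lambda>x. ?e x * ?y x)" by (rule tilted_mean_bound(1)[OF l p u])
  have i0: "integrable (Q l) ?e" "(LINT x|Q l. ?e x) = 1"
    using ratio_integrable(3)[OF l p] exp_normalized[OF l p] by auto
  have eq: "?e x * exp (?y x) = exp (A l u - A l p) * exp (g l u x - A l u)" for x by (simp flip: exp_add)
  have i2: "integrable (Q l) (\<lambda>x. ?e x * exp (?y x))" "(LINT x|Q l. ?e x * exp (?y x)) = exp (A l u - A l p)"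
    unfolding eq using ratio_integrable(3)[OF l u] exp_normalized[OF l u] by auto
  \<comment> \<open>Jensen's inequality for the tilted law, through the tangent of exp at the mean
    \<open>?c\<close>.\<close>
  have "exp ?c = (LINT x|Q l. exp ?c * ((1 - ?c) * ?e x + ?e x * ?y x))"
    using i0 i1 by simp
  also have "\<dots> \<le> (LINT x|Q l. ?e x * exp (?y x))"
  proof (rule integral_mono)
    fix x
    have "exp ?c * (1 + (?y x - ?c)) \<le> exp ?c * exp (?y x - ?c)"
      by (intro mult_left_mono exp_ge_add_one_self) auto
    then have "exp ?c * (1 - ?c + ?y x) \<le> exp (?y x)" by (simp add: algebra_simps flip: exp_add)
    then have "?e x * (exp ?c * (1 - ?c + ?y x)) \<le> ?e x * exp (?y x)" by (intro mult_left_mono) auto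
    then show "exp ?c * ((1 - ?c) * ?e x + ?e x * ?y x) \<le> ?e x * exp (?y x)" by (simp add: algebra_simps)
  qed (use i0 i1 i2 in auto)
  finally show "?c \<le> A l u - A l p" unfolding i2 by simp
  have i3: "integrable (Q l) (\<lambda>x. exp (5 * B) * (?y x)\<^sup>2)" using increment_facts(2)[OF l u p] by auto
  have "exp (A l u - A l p) \<le> (LINT x|Q l. ?e x + ?e x * ?y x + exp (5 * B) * (?y x)\<^sup>2)"
    unfolding i2(2)[symmetric]
  proof (rule integral_mono_AE)
    show "AE x in Q l. ?e x * exp (?y x) \<le> ?e x + ?e x * ?y x + exp (5 * B) * (?y x)\<^sup>2"
      using ratio_bounded[OF l p] increment_facts(1)[OF l u p]
    proof eventually_elim
      fix x assume a: "\<bar>g l p x - A l p\<bar> \<le> B" "\<bar>?y x\<bar> \<le> 4 * B"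
      have "?e x * exp (?y x) \<le> ?e x * (1 + ?y x + exp (4 * B) * (?y x)\<^sup>2)"
        using exp_taylor_bounds(1)[OF a(2)] by (intro mult_left_mono) auto
      moreover have "?e x * (exp (4 * B) * (?y x)\<^sup>2) \<le> exp B * (exp (4 * B) * (?y x)\<^sup>2)"
        using a by (intro mult_right_mono) auto
      moreover have "exp B * (exp (4 * B) * (?y x)\<^sup>2) = exp (5 * B) * (?y x)\<^sup>2"
        by (simp flip: exp_add mult.assoc)
      ultimately show "?e x * exp (?y x) \<le> ?e x + ?e x * ?y x + exp (5 * B) * (?y x)\<^sup>2"
        unfolding distrib_left by linarith
    qed
  qed (use i0 i1 i2 i3 in auto)
  also have "\<dots> = 1 + ?c + exp (5 * B) * (LINT x|Q l. (?y x)\<^sup>2)" using i0 i1 i3 by simp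
  also have "\<dots> \<le> 1 + ?c + exp (5 * B) * (C2 * W (u - p))"
    using variance_le_W[OF l u p] by (intro add_left_mono mult_left_mono) auto
  finally show "A l u - A l p \<le> ?c + exp (5 * B) * C2 * W (u - p)"
    using exp_ge_add_one_self[of "A l u - A l p"] unfolding mult.assoc by linarith
qed

lemma A_decrement_bound:
  assumes "l \<in> {1..m}" "p \<in> N" "u \<in> N"
  shows "A l p - A l u \<le> tilt_const * (sqrt (W p) * sqrt (W (u - p)))"
  using A_increment_bounds(1)[OF assms] tilted_mean_bound(2)[OF assms] by linarith

definition lin_const :: real where
  "lin_const = real m * (2 * tilt_const + exp (5 * B) * C2)"

lemma lin_const_nonneg: "0 \<le> lin_const"
  unfolding lin_const_def using tilt_const_nonneg const_pos by auto

text \<open>Concavity along the segment from \<open>p\<close> to \<open>v\<close> bounds the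
  difference quotients at \<open>p\<close> below by \<open>g l v x - g l p x\<close>, up to the gap
  of the sum of the \<open>A l\<close> divided by the step, and the quotients tend to
  \<open>D\<close>. The factor \<open>real m\<close> in \<open>lin_const\<close> is there because a
  single \<open>g l\<close> has to carry the gap of all samples.\<close>

lemma linearization:
  assumes l: "l \<in> {1..m}" and p: "p \<in> N" and v: "v \<in> N"
  shows "AE x in Q l. g l v x - g l p x \<le>
    D l p (v - p) x + lin_const * (sqrt (W p) * sqrt (W (v - p)) + W (v - p))"
proof -
  define h where "h = (\<lambda>j. inverse (real (Suc j)))"
  define ph where "ph = (\<lambda>j. p + h j *\<^sub>R (v - p))"
  define G where "G = lin_const * (sqrt (W p) * sqrt (W (v - p)) + W (v - p))"
  have h: "0 < h j" "h j \<le> 1" for j by (auto simp: h_def field_simps)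
  have ph: "ph j = h j *\<^sub>R v + (1 - h j) *\<^sub>R p" for j by (simp add: ph_def algebra_simps)
  have phN: "ph j \<in> N" for j unfolding ph using segment_in_N[OF v p] h[of j] by simp
  have Suc_h: "real (Suc j) * (h j * z) = z" for j z by (simp add: h_def)
  let ?S = "sqrt (W p) * sqrt (W (v - p))"
  \<comment> \<open>The gap must be linear in the step. The decrease
    \<open>A l p - A l (ph j)\<close> is, because \<open>A_decrement_bound\<close> contains
    \<open>sqrt (W (ph j - p)) = h j * sqrt (W (v - p))\<close>; the other part already has the
    factor \<open>h j\<close>. Each part uses \<open>tilt_const\<close> once.\<close>
  have gap: "h j * total_A v + (1 - h j) * total_A p - total_A (ph j) \<le> h j * G" for j
  proof -
    have "h j * (A l v - A l p) - (A l (ph j) - A l p) \<le> h j * (2 * tilt_const * ?S + exp (5 * B) * C2 * W (v - p))"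
      if l: "l \<in> {1..m}" for l
    proof -
      have "ph j - p = h j *\<^sub>R (v - p)" by (simp add: ph_def)
      then have "sqrt (W (ph j - p)) = h j * sqrt (W (v - p))"
        using h[of j] by (simp add: W_scale real_sqrt_mult)
      then have "A l p - A l (ph j) \<le> h j * (tilt_const * ?S)"
        using A_decrement_bound[OF l p phN[of j]] by (simp add: mult_ac)
      moreover have "A l v - A l p \<le> tilt_const * ?S + exp (5 * B) * C2 * W (v - p)"
        using A_increment_bounds(2)[OF l p v] tilted_mean_bound(2)[OF l p v] by linarith
      then have "h j * (A l v - A l p) \<le> h j * (tilt_const * ?S + exp (5 * B) * C2 * W (v - p))"
        using h[of j] by (intro mult_left_mono) auto
      ultimately show ?thesis by (simp add: algebra_simps)
    qed
    then have "(\<Sum>l=1..m. h j * (A l v - A l p) - (A l (ph j) - A l p)) \<le>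
        (\<Sum>l=1..m. h j * (2 * tilt_const * ?S + exp (5 * B) * C2 * W (v - p)))"
      by (intro sum_mono) auto
    also have "\<dots> = h j * (real m * (2 * tilt_const * ?S + exp (5 * B) * C2 * W (v - p)))" by simp
    also have "\<dots> \<le> h j * G"
    proof (rule mult_left_mono)
      have "2 * tilt_const * ?S + exp (5 * B) * C2 * W (v - p) \<le>
          (2 * tilt_const + exp (5 * B) * C2) * ?S + (2 * tilt_const + exp (5 * B) * C2) * W (v - p)"
        using const_pos tilt_const_nonneg W_nonneg by (intro add_mono mult_right_mono) (auto intro!: mult_nonneg_nonneg)
      then show "real m * (2 * tilt_const * ?S + exp (5 * B) * C2 * W (v - p)) \<le> G"
        unfolding G_def lin_const_def by (simp add: mult.assoc mult_left_mono flip: distrib_left)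
    qed (use h[of j] in auto)
    also have "(\<Sum>l=1..m. h j * (A l v - A l p) - (A l (ph j) - A l p)) =
        h j * (total_A v - total_A p) - (total_A (ph j) - total_A p)"
      by (simp add: sum_subtractf sum_distrib_left right_diff_distrib)
    finally show ?thesis by (simp add: algebra_simps)
  qed
  have "AE x in Q l. \<forall>j. g l v x - g l p x - G \<le> (g l (ph j) x - g l p x) * real (Suc j)"
    unfolding AE_all_countable
  proof
    fix j
    have "AE x in Q l. h j * g l v x + (1 - h j) * g l p x -
        (h j * total_A v + (1 - h j) * total_A p - total_A (ph j)) \<le> g l (ph j) x"
      using concave[OF l v p, of "h j"] h[of j] unfolding ph[symmetric] by simp
    then show "AE x in Q l. g l v x - g l p x - G \<le> (g l (ph j) x - g l p x) * real (Suc j)"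
    proof eventually_elim
      fix x
      assume "h j * g l v x + (1 - h j) * g l p x - (h j * total_A v + (1 - h j) * total_A p - total_A (ph j)) \<le> g l (ph j) x"
      then have "h j * (g l v x - g l p x - G) \<le> g l (ph j) x - g l p x"
        using gap[of j] by (simp add: algebra_simps)
      then have "real (Suc j) * (h j * (g l v x - g l p x - G)) \<le> real (Suc j) * (g l (ph j) x - g l p x)"
        by (intro mult_left_mono) auto
      then show "g l v x - g l p x - G \<le> (g l (ph j) x - g l p x) * real (Suc j)"
        unfolding Suc_h by (simp only: mult.commute)
    qed
  qed
  then show ?thesis
    using D_lim[OF l p, of "v - p"] unfolding G_def[symmetric]
  proof eventually_elim
    fix x
    assume lo: "\<forall>j. g l v x - g l p x - G \<le> (g l (ph j) x - g l p x) * real (Suc j)"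
      and lim: "(\<lambda>j. (g l (p + inverse (real (Suc j)) *\<^sub>R (v - p)) x - g l p x) * real (Suc j)) \<longlonglongrightarrow> D l p (v - p) x"
    have lim': "(\<lambda>j. (g l (ph j) x - g l p x) * real (Suc j)) \<longlonglongrightarrow> D l p (v - p) x"
      using lim by (simp add: ph_def h_def)
    have "g l v x - g l p x - G \<le> D l p (v - p) x"
      using lo by (intro LIMSEQ_le_const[OF lim']) blast
    then show "g l v x - g l p x \<le> D l p (v - p) x + G" by linarith
  qed
qed

text \<open>The full density ratio has mean one and would give no decay. Its square root has mean
  one minus half the squared Hellinger distance, and for a bounded log ratio this distance dominates
  the variance.\<close>

lemma exp_half_ratio_le:
  assumes l: "l \<in> {1..m}" and v: "v \<in> N" and s: "0 \<le> s" "s \<le> 1"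
  shows "(\<integral>\<^sup>+x. ennreal (exp (s * ((g l v x - A l v) / 2))) \<partial>Q l) \<le>
    ennreal (exp (- (s * (exp (- B) / 8 * (LINT x|Q l. (g l v x)\<^sup>2)))))"
proof -
  interpret Q: prob_space "Q l" using prob_space_Q l by simp
  note [measurable] = g_measurable[OF l]
  let ?u = "\<lambda>x. g l v x - A l v" and ?V = "LINT x|Q l. (g l v x)\<^sup>2"
  have ih: "integrable (Q l) (\<lambda>x. exp (?u x / 2))"
    by (rule integrable_AE_bounded[OF l, of _ "exp (B / 2)"]) (use ratio_bounded[OF l v] in \<open>measurable, auto\<close>)
  \<comment> \<open>With \<open>u\<close> the log ratio, \<open>exp (u / 2)\<close> equals
    \<open>(exp u + 1) / 2\<close> minus half of \<open>(exp (u / 2) - 1)\<^sup>2\<close>, and this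
    square is at least \<open>exp (- B) / 4 * u\<^sup>2\<close>.\<close>
  have pt: "AE x in Q l. exp (?u x / 2) \<le> (exp (?u x) + 1) / 2 - exp (- B) / 8 * (?u x)\<^sup>2"
    using ratio_bounded[OF l v]
  proof eventually_elim
    fix x assume u: "\<bar>?u x\<bar> \<le> B"
    let ?y = "?u x / 2"
    have "\<bar>?y\<bar> * exp (- (B / 2)) \<le> \<bar>exp ?y - 1\<bar>"
    proof (cases "0 \<le> ?y")
      case True
      have "?y * exp (- (B / 2)) \<le> ?y" using True const_pos by (intro mult_left_le) auto
      also have "\<dots> \<le> exp ?y - 1" using exp_ge_add_one_self[of ?y] by linarith
      finally show ?thesis using True by simp
    next
      case False
      have "- ?y * exp (- (B / 2)) \<le> - ?y * exp ?y" using False u by (intro mult_left_mono) auto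
      also have "\<dots> \<le> 1 - exp ?y"
        using exp_ge_add_one_self[of "- ?y"] by (simp add: exp_minus field_simps)
      finally show ?thesis using False by (simp add: abs_if)
    qed
    then have "(\<bar>?y\<bar> * exp (- (B / 2)))\<^sup>2 \<le> (exp ?y - 1)\<^sup>2"
      using abs_le_square_iff[of "\<bar>?y\<bar> * exp (- (B / 2))" "exp ?y - 1"] by (simp add: abs_mult)
    moreover have "(\<bar>?y\<bar> * exp (- (B / 2)))\<^sup>2 = exp (- B) / 4 * (?u x)\<^sup>2"
      by (simp add: power_mult_distrib power_divide flip: exp_double)
    moreover have "(exp ?y - 1)\<^sup>2 = exp (?u x) - 2 * exp ?y + 1"
    proof -
      have "exp (?u x) = exp ?y * exp ?y" unfolding exp_add[symmetric] by simp
      then show ?thesis by (simp add: power2_eq_square algebra_simps)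
    qed
    moreover have "exp (- B) / 4 * (?u x)\<^sup>2 = 2 * (exp (- B) / 8 * (?u x)\<^sup>2)" by simp
    ultimately show "exp (?u x / 2) \<le> (exp (?u x) + 1) / 2 - exp (- B) / 8 * (?u x)\<^sup>2"
      unfolding add_divide_distrib by linarith
  qed
  have u2: "integrable (Q l) (\<lambda>x. (?u x)\<^sup>2)" "?V \<le> (LINT x|Q l. (?u x)\<^sup>2)"
  proof -
    have eq: "(?u x)\<^sup>2 = (g l v x)\<^sup>2 - 2 * A l v * g l v x + (A l v)\<^sup>2" for x
      by (simp add: power2_eq_square algebra_simps)
    show "integrable (Q l) (\<lambda>x. (?u x)\<^sup>2)" "?V \<le> (LINT x|Q l. (?u x)\<^sup>2)"
      unfolding eq using g_square_integrable[OF l v] ratio_integrable(2)[OF l v] g_mean[OF l v] by (auto simp: Q.prob_space)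
  qed
  have "(LINT x|Q l. exp (?u x / 2)) \<le> (LINT x|Q l. (exp (?u x) + 1) / 2 - exp (- B) / 8 * (?u x)\<^sup>2)"
    using ih pt ratio_integrable(3)[OF l v] u2 by (intro integral_mono_AE) auto
  also have "\<dots> = 1 - exp (- B) / 8 * (LINT x|Q l. (?u x)\<^sup>2)"
    using ratio_integrable(3)[OF l v] u2 exp_normalized[OF l v] by (simp add: Q.prob_space add_divide_distrib)
  also have "\<dots> \<le> 1 - exp (- B) / 8 * ?V"
    using u2(2) by (intro diff_left_mono mult_left_mono) auto
  finally have h: "(LINT x|Q l. exp (?u x / 2)) - 1 \<le> - (exp (- B) / 8 * ?V)" by linarith
  have "(\<integral>\<^sup>+x. ennreal (exp (s * (?u x / 2))) \<partial>Q l) \<le> (\<integral>\<^sup>+x. ennreal (1 + s * (exp (?u x / 2) - 1)) \<partial>Q l)"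
    using s by (intro nn_integral_mono ennreal_leI exp_scale_le)
  also have "\<dots> = ennreal (LINT x|Q l. 1 + s * (exp (?u x / 2) - 1))"
    using ih by (intro nn_integral_eq_integral AE_I2 order_trans[OF _ exp_scale_le[OF s]]) auto
  also have "(LINT x|Q l. 1 + s * (exp (?u x / 2) - 1)) = 1 + s * ((LINT x|Q l. exp (?u x / 2)) - 1)"
    using ih by (simp add: Q.prob_space)
  also have "ennreal \<dots> \<le> ennreal (exp (- (s * (exp (- B) / 8 * ?V))))"
  proof (rule ennreal_leI)
    have "1 + s * ((LINT x|Q l. exp (?u x / 2)) - 1) \<le> 1 + s * (- (exp (- B) / 8 * ?V))"
      using h s by (intro add_left_mono mult_left_mono) auto
    also have "\<dots> \<le> exp (- (s * (exp (- B) / 8 * ?V)))"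
      using exp_ge_add_one_self[of "- (s * (exp (- B) / 8 * ?V))"] by simp
    finally show "1 + s * ((LINT x|Q l. exp (?u x / 2)) - 1) \<le> exp (- (s * (exp (- B) / 8 * ?V)))" .
  qed
  finally show ?thesis .
qed

end

section \<open>Coordinates, effective dimension and the size of the score\<close>

section \<open>Expansion in an eigenbasis\<close>

lemma (in prob_space) AE_event:
  assumes "AE x in M. R x"
  obtains E where "E \<in> events" "prob E = 1" "\<And>x. x \<in> E \<Longrightarrow> R x"
proof -
  obtain Z where Z: "{x \<in> space M. \<not> R x} \<subseteq> Z" "emeasure M Z = 0" "Z \<in> events"
    using AE_E[OF assms] by blast
  then have "prob Z = 0" by (simp add: measure_def)
  then have "prob (space M - Z) = 1" using Z(3) by (simp add: prob_compl)
  then show thesis using Z that[of "space M - Z"] by auto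
qed

lemma (in prob_space) prob_finite_Int_ge:
  assumes "finite I" "\<And>i. i \<in> I \<Longrightarrow> A i \<in> events" "\<And>i. i \<in> I \<Longrightarrow> 1 - \<epsilon> \<le> prob (A i)"
  shows "(\<Inter>i\<in>I. A i) \<inter> space M \<in> events" "1 - real (card I) * \<epsilon> \<le> prob ((\<Inter>i\<in>I. A i) \<inter> space M)"
proof -
  have "(\<Inter>i\<in>I. A i) \<inter> space M \<in> events \<and> 1 - real (card I) * \<epsilon> \<le> prob ((\<Inter>i\<in>I. A i) \<inter> space M)"
    using assms
  proof (induction I rule: finite_induct)
    case empty
    then show ?case by (simp add: prob_space)
  next
    case (insert i I)
    let ?B = "(\<Inter>i\<in>I. A i) \<inter> space M"
    have B: "?B \<in> events" "1 - real (card I) * \<epsilon> \<le> prob ?B" using insert by auto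
    have eq: "(\<Inter>i\<in>insert i I. A i) \<inter> space M = A i \<inter> ?B" by auto
    have "prob (A i) + prob ?B - 1 \<le> prob (A i \<inter> ?B)"
      using insert.prems(1)[of i] B(1) by (intro prob_Int_ge) auto
    moreover have "1 - \<epsilon> \<le> prob (A i)" using insert.prems(2)[of i] by simp
    moreover have "real (card (insert i I)) * \<epsilon> = real (card I) * \<epsilon> + \<epsilon>"
      using insert.hyps by (simp add: distrib_right)
    moreover have "A i \<inter> ?B \<in> events" using insert.prems(1)[of i] B(1) by auto
    ultimately show ?case unfolding eq using B(2) by auto
  qed
  then show "(\<Inter>i\<in>I. A i) \<inter> space M \<in> events" "1 - real (card I) * \<epsilon> \<le> prob ((\<Inter>i\<in>I. A i) \<inter> space M)"
    by auto
qed

text \<open>Below one half everything is rounded to 0; from there on, rounding at most doubles the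
  modulus.\<close>

lemma round_square_le: "(of_int (round x) :: real)\<^sup>2 \<le> 4 * x\<^sup>2"
proof (cases "\<bar>x\<bar> < 1/2")
  case True
  then have "round x = 0" by (auto simp: round_def floor_eq_iff abs_less_iff)
  then show ?thesis by simp
next
  case False
  have "\<bar>of_int (round x) - x\<bar> \<le> 1/2" by (rule of_int_round_abs_le)
  then have "\<bar>of_int (round x)\<bar> \<le> 2 * \<bar>x\<bar>" using False by linarith
  then have "(of_int (round x) :: real)\<^sup>2 \<le> (2 * \<bar>x\<bar>)\<^sup>2" by (rule abs_le_power2_le)
  then show ?thesis by (simp add: power_mult_distrib)
qed

lemma abs_int_le_square: "\<bar>k :: int\<bar> \<le> k\<^sup>2"
proof (cases "k = 0")
  case False
  then have "\<bar>k\<bar> * 1 \<le> \<bar>k\<bar> * \<bar>k\<bar>" by (intro mult_left_mono) auto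
  then show ?thesis by (simp add: power2_eq_square)
qed simp

context indep_samples
begin

text \<open>The summands are centred and pairwise independent, so the cross terms of the square have
  expectation zero.\<close>

lemma second_moment_samples:
  fixes f :: "nat \<Rightarrow> 'x \<Rightarrow> real" and a :: "nat \<Rightarrow> real"
  assumes f: "\<And>l. l \<in> {1..m} \<Longrightarrow> f l \<in> borel_measurable (Q l)"
    and f2: "\<And>l. l \<in> {1..m} \<Longrightarrow> integrable (Q l) (\<lambda>x. (f l x)\<^sup>2)"
    and f0: "\<And>l. l \<in> {1..m} \<Longrightarrow> (LINT x|Q l. f l x) = 0"
  shows "integrable P (\<lambda>\<omega>. (\<Sum>l=1..m. a l * (\<Sum>k=1..n l. f l (X l k \<omega>)))\<^sup>2)"
    and "expectation (\<lambda>\<omega>. (\<Sum>l=1..m. a l * (\<Sum>k=1..n l. f l (X l k \<omega>)))\<^sup>2) =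
      (\<Sum>l=1..m. (a l)\<^sup>2 * real (n l) * (LINT x|Q l. (f l x)\<^sup>2))"
proof -
  let ?I = "SIGMA l:{1..m}. {1..n l}"
  define Z where "Z = (\<lambda>k \<omega>. a (fst k) * f (fst k) (X (fst k) (snd k) \<omega>))"
  have I: "?I \<subseteq> {1..m} \<times> {1..}" by auto
  have f1: "integrable (Q l) (f l)" if "l \<in> {1..m}" for l
  proof -
    interpret Q: prob_space "Q l" using prob_space_Q[OF that] .
    show ?thesis by (rule Q.square_integrable_imp_integrable[OF f[OF that] f2[OF that]])
  qed
  have Zint: "integrable P (Z k)" "expectation (Z k) = 0" if k: "k \<in> ?I" for k
  proof -
    have l: "fst k \<in> {1..m}" "1 \<le> snd k" using k by auto
    show "integrable P (Z k)" "expectation (Z k) = 0"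
      unfolding Z_def using integrable_sample[OF l f1[OF l(1)]] integral_sample[OF l f[OF l(1)]] f0[OF l(1)] by auto
  qed
  have eq: "(\<Sum>l=1..m. a l * (\<Sum>k=1..n l. f l (X l k \<omega>))) = (\<Sum>k\<in>?I. Z k \<omega>)" for \<omega>
    unfolding sum_distrib_left Z_def by (subst sum.Sigma) (auto simp: case_prod_beta)
  have ZZ: "integrable P (\<lambda>\<omega>. Z k \<omega> * Z k' \<omega>)"
    "expectation (\<lambda>\<omega>. Z k \<omega> * Z k' \<omega>) = (if k = k' then (a (fst k))\<^sup>2 * (LINT x|Q (fst k). (f (fst k) x)\<^sup>2) else 0)"
    if k: "k \<in> ?I" "k' \<in> ?I" for k k'
  proof -
    have "integrable P (\<lambda>\<omega>. Z k \<omega> * Z k' \<omega>) \<and> expectation (\<lambda>\<omega>. Z k \<omega> * Z k' \<omega>) =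
      (if k = k' then (a (fst k))\<^sup>2 * (LINT x|Q (fst k). (f (fst k) x)\<^sup>2) else 0)"
    proof (cases "k = k'")
      case True
      have l: "fst k \<in> {1..m}" "1 \<le> snd k" using k by auto
      have "(\<lambda>\<omega>. Z k \<omega> * Z k' \<omega>) = (\<lambda>\<omega>. (a (fst k))\<^sup>2 * (f (fst k) (X (fst k) (snd k) \<omega>))\<^sup>2)"
        using True by (simp add: Z_def power2_eq_square mult_ac)
      moreover have "integrable P (\<lambda>\<omega>. (f (fst k) (X (fst k) (snd k) \<omega>))\<^sup>2)"
        by (rule integrable_sample[OF l f2[OF l(1)]])
      moreover have "expectation (\<lambda>\<omega>. (f (fst k) (X (fst k) (snd k) \<omega>))\<^sup>2) = (LINT x|Q (fst k). (f (fst k) x)\<^sup>2)"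
        by (rule integral_sample[OF l]) (use f[OF l(1)] in measurable)
      ultimately show ?thesis using True by simp
    next
      case False
      have "indep_vars (\<lambda>_. borel) (\<lambda>k \<omega>. (\<lambda>l x. a l * f l x) (fst k) (X (fst k) (snd k) \<omega>)) {k, k'}"
        using k I f by (intro indep_sample_funs) auto
      then have ind: "indep_vars (\<lambda>_. borel) Z {k, k'}" by (simp add: Z_def)
      have "expectation (\<lambda>\<omega>. \<Prod>i\<in>{k, k'}. Z i \<omega>) = (\<Prod>i\<in>{k, k'}. expectation (Z i))"
        using Zint(1) k by (intro indep_vars_lebesgue_integral ind) auto
      moreover have "integrable P (\<lambda>\<omega>. \<Prod>i\<in>{k, k'}. Z i \<omega>)"
        using Zint(1) k by (intro indep_vars_integrable ind) auto
      ultimately show ?thesis using False Zint(2)[OF k(1)] by simp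
    qed
    then show "integrable P (\<lambda>\<omega>. Z k \<omega> * Z k' \<omega>)"
      "expectation (\<lambda>\<omega>. Z k \<omega> * Z k' \<omega>) = (if k = k' then (a (fst k))\<^sup>2 * (LINT x|Q (fst k). (f (fst k) x)\<^sup>2) else 0)"
      by auto
  qed
  have sq: "(\<Sum>k\<in>?I. Z k \<omega>)\<^sup>2 = (\<Sum>k\<in>?I. \<Sum>k'\<in>?I. Z k \<omega> * Z k' \<omega>)" for \<omega>
    by (simp add: power2_eq_square sum_product)
  show "integrable P (\<lambda>\<omega>. (\<Sum>l=1..m. a l * (\<Sum>k=1..n l. f l (X l k \<omega>)))\<^sup>2)"
    unfolding eq sq by (intro Bochner_Integration.integrable_sum ZZ(1))
  have "expectation (\<lambda>\<omega>. (\<Sum>k\<in>?I. Z k \<omega>)\<^sup>2) = (\<Sum>k\<in>?I. \<Sum>k'\<in>?I. expectation (\<lambda>\<omega>. Z k \<omega> * Z k' \<omega>))"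
    unfolding sq using ZZ(1) by (simp add: Bochner_Integration.integral_sum Bochner_Integration.integrable_sum)
  also have "\<dots> = (\<Sum>k\<in>?I. (a (fst k))\<^sup>2 * (LINT x|Q (fst k). (f (fst k) x)\<^sup>2))"
  proof (rule sum.cong[OF refl])
    fix k assume k: "k \<in> ?I"
    have "(\<Sum>k'\<in>?I. expectation (\<lambda>\<omega>. Z k \<omega> * Z k' \<omega>)) =
        (\<Sum>k'\<in>?I. if k = k' then (a (fst k))\<^sup>2 * (LINT x|Q (fst k). (f (fst k) x)\<^sup>2) else 0)"
      using ZZ(2)[OF k] by (intro sum.cong) auto
    also have "\<dots> = (a (fst k))\<^sup>2 * (LINT x|Q (fst k). (f (fst k) x)\<^sup>2)"
      using k by (subst sum.delta') auto
    finally show "(\<Sum>k'\<in>?I. expectation (\<lambda>\<omega>. Z k \<omega> * Z k' \<omega>)) = (a (fst k))\<^sup>2 * (LINT x|Q (fst k). (f (fst k) x)\<^sup>2)" .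
  qed
  also have "\<dots> = (\<Sum>l=1..m. \<Sum>k=1..n l. (a l)\<^sup>2 * (LINT x|Q l. (f l x)\<^sup>2))"
    by (subst sum.Sigma) (auto simp: case_prod_beta)
  also have "\<dots> = (\<Sum>l=1..m. (a l)\<^sup>2 * real (n l) * (LINT x|Q l. (f l x)\<^sup>2))"
    by (simp add: mult_ac)
  finally show "expectation (\<lambda>\<omega>. (\<Sum>l=1..m. a l * (\<Sum>k=1..n l. f l (X l k \<omega>)))\<^sup>2) =
      (\<Sum>l=1..m. (a l)\<^sup>2 * real (n l) * (LINT x|Q l. (f l x)\<^sup>2))"
    unfolding eq .
qed

end

text \<open>Only finite combinations of basis vectors are used. General points are reached by
  density, so no series expansion has to converge.\<close>

definition finite_support :: "('i \<Rightarrow> real) \<Rightarrow> bool" where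
  "finite_support c \<longleftrightarrow> finite {i. c i \<noteq> 0}"

definition lincomb :: "('i \<Rightarrow> 'q :: real_vector) \<Rightarrow> ('i \<Rightarrow> real) \<Rightarrow> 'q" where
  "lincomb b c = (\<Sum>i | c i \<noteq> 0. c i *\<^sub>R b i)"

lemma sum_support_eq:
  assumes "finite F" "{i. c i \<noteq> (0::real)} \<subseteq> F" "\<And>i. c i = 0 \<Longrightarrow> f i = (0 :: 'a :: comm_monoid_add)"
  shows "(\<Sum>i | c i \<noteq> 0. f i) = (\<Sum>i\<in>F. f i)"
  using assms by (intro sum.mono_neutral_left) auto

lemma lincomb_eq:
  assumes "finite F" "{i. c i \<noteq> 0} \<subseteq> F"
  shows "lincomb b c = (\<Sum>i\<in>F. c i *\<^sub>R b i)"
  unfolding lincomb_def by (rule sum_support_eq[OF assms]) simp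

lemma finite_support_diff:
  assumes "finite_support c" "finite_support c'"
  shows "finite_support (\<lambda>i. c i - c' i)"
  unfolding finite_support_def
  by (rule finite_subset[of _ "{i. c i \<noteq> 0} \<union> {i. c' i \<noteq> 0}"]) (use assms in \<open>auto simp: finite_support_def\<close>)

lemma lincomb_diff:
  assumes "finite_support c" "finite_support c'"
  shows "lincomb b (\<lambda>i. c i - c' i) = lincomb b c - lincomb b c'"
proof -
  define F where "F = {i. c i \<noteq> 0} \<union> {i. c' i \<noteq> 0}"
  have F: "finite F" using assms by (simp add: F_def finite_support_def)
  show ?thesis
    by (subst (1 2 3) lincomb_eq[OF F]) (auto simp: F_def scaleR_left_diff_distrib sum_subtractf)
qed

text \<open>The basis will join coordinate directions of the parameter with eigenfunctions, and
  \<open>W\<close> couples the two. It is therefore not orthonormal for \<open>W\<close>;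
  \<open>W_coef\<close> is the substitute.\<close>

locale spectral_model = log_concave_model P m Q X g A N D W B C1 C2
  for P :: "'w measure" and m :: nat and Q :: "nat \<Rightarrow> 'x measure" and X :: "nat \<Rightarrow> nat \<Rightarrow> 'w \<Rightarrow> 'x"
    and g :: "nat \<Rightarrow> 'q :: real_normed_vector \<Rightarrow> 'x \<Rightarrow> real" and A N D W B C1 C2 +
  fixes b :: "'i :: countable \<Rightarrow> 'q" and \<rho> :: "'i \<Rightarrow> real" and cw Cw :: real
  assumes cw: "0 < cw" "0 < Cw"
    and W_coef: "finite F \<Longrightarrow> cw * (\<Sum>i\<in>F. (c i)\<^sup>2) \<le> W (\<Sum>i\<in>F. c i *\<^sub>R b i)"
      "finite F \<Longrightarrow> W (\<Sum>i\<in>F. c i *\<^sub>R b i) \<le> Cw * (\<Sum>i\<in>F. (c i)\<^sup>2)"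
    and \<rho>_nonneg: "0 \<le> \<rho> i"
begin

text \<open>\<open>W + lam * J\<close> in coordinates, up to the constants of
  \<open>W_coef\<close>.\<close>

definition energy :: "real \<Rightarrow> ('i \<Rightarrow> real) \<Rightarrow> real" where
  "energy lam c = (\<Sum>i | c i \<noteq> 0. (1 + lam * \<rho> i) * (c i)\<^sup>2)"

text \<open>Upper bound for the trace of the inverse of \<open>1 + lam * \<rho>\<close>, stated
  through finite partial sums.\<close>

definition effective_dim_le :: "real \<Rightarrow> real \<Rightarrow> bool" where
  "effective_dim_le lam d \<longleftrightarrow> (\<forall>F. finite F \<longrightarrow> (\<Sum>i\<in>F. 1 / (1 + lam * \<rho> i)) \<le> d)"

definition F_upto :: "nat \<Rightarrow> 'i set" where
  "F_upto j = {i. to_nat i < j}"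

lemma finite_F_upto: "finite (F_upto j)"
  using finite_vimageI[of "{..<j}" "to_nat :: 'i \<Rightarrow> nat"] by (simp add: F_upto_def vimage_def)

lemma F_upto_mono: "j \<le> k \<Longrightarrow> F_upto j \<subseteq> F_upto k"
  by (auto simp: F_upto_def)

lemma F_upto_covers:
  assumes "finite S"
  obtains j where "S \<subseteq> F_upto j"
proof
  show "S \<subseteq> F_upto (Suc (Max (to_nat ` S)))"
    using assms by (auto simp: F_upto_def less_Suc_eq_le)
qed

lemma energy_eq:
  assumes "finite F" "{i. c i \<noteq> 0} \<subseteq> F"
  shows "energy lam c = (\<Sum>i\<in>F. (1 + lam * \<rho> i) * (c i)\<^sup>2)"
  unfolding energy_def by (rule sum_support_eq[OF assms]) simp

lemma D_zero:
  assumes "l \<in> {1..m}" "p \<in> N"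
  shows "AE x in Q l. D l p 0 x = 0"
  using D_scale[OF assms, of 0 0] by simp

lemma D_sum:
  assumes "l \<in> {1..m}" "p \<in> N" "finite F"
  shows "AE x in Q l. D l p (\<Sum>i\<in>F. c i *\<^sub>R b i) x = (\<Sum>i\<in>F. c i * D l p (b i) x)"
  using assms(3)
proof (induction F rule: finite_induct)
  case empty
  then show ?case using D_zero[OF assms(1,2)] by simp
next
  case (insert i F)
  show ?case
    using insert.IH D_scale[OF assms(1,2), of "c i" "b i"] D_add[OF assms(1,2), of "c i *\<^sub>R b i" "\<Sum>i\<in>F. c i *\<^sub>R b i"]
    by eventually_elim (use insert.hyps in auto)
qed

lemma D_lincomb:
  assumes "l \<in> {1..m}" "p \<in> N" "finite_support c"
  shows "AE x in Q l. D l p (lincomb b c) x = (\<Sum>i | c i \<noteq> 0. c i * D l p (b i) x)"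
  unfolding lincomb_def using D_sum[OF assms(1,2)] assms(3) by (auto simp: finite_support_def)

lemma D_sum_second_moment:
  assumes "p \<in> N" "finite F"
  shows "(\<Sum>l=1..m. LINT x|Q l. (\<Sum>i\<in>F. c i * D l p (b i) x)\<^sup>2) \<le> C2 * Cw * (\<Sum>i\<in>F. (c i)\<^sup>2)"
proof -
  have "(\<Sum>l=1..m. LINT x|Q l. (\<Sum>i\<in>F. c i * D l p (b i) x)\<^sup>2) = (\<Sum>l=1..m. LINT x|Q l. (D l p (\<Sum>i\<in>F. c i *\<^sub>R b i) x)\<^sup>2)"
  proof (rule sum.cong[OF refl])
    fix l assume l: "l \<in> {1..m}"
    have m: "(\<lambda>x. (\<Sum>i\<in>F. c i * D l p (b i) x)\<^sup>2) \<in> borel_measurable (Q l)"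
      using D_measurable[OF l assms(1)] by measurable
    show "(LINT x|Q l. (\<Sum>i\<in>F. c i * D l p (b i) x)\<^sup>2) = (LINT x|Q l. (D l p (\<Sum>i\<in>F. c i *\<^sub>R b i) x)\<^sup>2)"
    proof (rule integral_cong_AE)
      show "AE x in Q l. (\<Sum>i\<in>F. c i * D l p (b i) x)\<^sup>2 = (D l p (\<Sum>i\<in>F. c i *\<^sub>R b i) x)\<^sup>2"
        using D_sum[OF l assms, where c = c] by eventually_elim simp
      show "(\<lambda>x. (D l p (\<Sum>i\<in>F. c i *\<^sub>R b i) x)\<^sup>2) \<in> borel_measurable (Q l)"
        using D_measurable[OF l assms(1)] by measurable
    qed (rule m)
  qed
  also have "\<dots> \<le> C2 * W (\<Sum>i\<in>F. c i *\<^sub>R b i)" by (rule D_upper[OF assms(1)])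
  also have "\<dots> \<le> C2 * (Cw * (\<Sum>i\<in>F. (c i)\<^sup>2))" using W_coef(2)[OF assms(2)] const_pos by (intro mult_left_mono) auto
  finally show ?thesis by (simp add: mult.assoc)
qed

text \<open>Cauchy-Schwarz with the weights \<open>1 + lam * \<rho> i\<close> splits the score of a
  combination into its energy and a dual norm that does not depend on the combination. Over finitely
  many coordinates the dual norm has expectation at most a constant times \<open>d / nn\<close>, and
  Markov's inequality finishes.\<close>

lemma linear_noise_bound:
  assumes C: "countable \<C>" "\<And>c. c \<in> \<C> \<Longrightarrow> finite_support c"
    and \<epsilon>: "0 < \<epsilon>" and nn: "0 < nn" "\<And>l. l \<in> {1..m} \<Longrightarrow> nn \<le> real (n l)"
    and lam: "0 < lam" and d: "effective_dim_le lam d"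
  obtains E where "E \<in> events" "1 - \<epsilon> \<le> prob E"
    "\<And>\<omega> c. \<omega> \<in> E \<Longrightarrow> c \<in> \<C> \<Longrightarrow> (\<Sum>l=1..m. 1 / real (n l) * (\<Sum>k=1..n l. D l 0 (lincomb b c) (X l k \<omega>)))\<^sup>2
        \<le> C2 * Cw * d / (nn * \<epsilon>) * energy lam c"
proof -
  define T where "T = (\<lambda>i \<omega>. \<Sum>l=1..m. 1 / real (n l) * (\<Sum>k=1..n l. D l 0 (b i) (X l k \<omega>)))"
  define w where "w = (\<lambda>i. 1 / (1 + lam * \<rho> i))"
  have w: "0 < w i" "1 / w i = 1 + lam * \<rho> i" for i
    using lam \<rho>_nonneg[of i] by (auto simp: w_def add_pos_nonneg)
  define Z where "Z = (\<lambda>j \<omega>. \<Sum>i\<in>F_upto j. w i * (T i \<omega>)\<^sup>2)"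
  define M where "M = C2 * Cw * d / nn"
  have T: "integrable P (\<lambda>\<omega>. (T i \<omega>)\<^sup>2)" "expectation (\<lambda>\<omega>. (T i \<omega>)\<^sup>2) \<le> C2 * Cw / nn" for i
  proof -
    note s = second_moment_samples[where f = "\<lambda>l. D l 0 (b i)" and a = "\<lambda>l. 1 / real (n l)" and n = n,
        OF D_measurable[OF _ N_zero] D_square_integrable[OF _ N_zero] D_mean[OF _ N_zero]]
    show "integrable P (\<lambda>\<omega>. (T i \<omega>)\<^sup>2)" unfolding T_def by (rule s(1)) auto
    have "expectation (\<lambda>\<omega>. (T i \<omega>)\<^sup>2) = (\<Sum>l=1..m. (1 / real (n l))\<^sup>2 * real (n l) * (LINT x|Q l. (D l 0 (b i) x)\<^sup>2))"
      unfolding T_def by (rule s(2)) auto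
    also have "\<dots> \<le> (\<Sum>l=1..m. 1 / nn * (LINT x|Q l. (D l 0 (b i) x)\<^sup>2))"
    proof (intro sum_mono mult_right_mono)
      fix l assume "l \<in> {1..m}"
      then have "nn \<le> real (n l)" by (rule nn(2))
      then show "(1 / real (n l))\<^sup>2 * real (n l) \<le> 1 / nn"
        using nn(1) by (simp add: power2_eq_square field_simps)
    qed (auto intro!: integral_nonneg_AE)
    also have "\<dots> = 1 / nn * (\<Sum>l=1..m. LINT x|Q l. (D l 0 (b i) x)\<^sup>2)" by (simp add: sum_distrib_left)
    also have "\<dots> \<le> 1 / nn * (C2 * Cw)"
      using D_sum_second_moment[OF N_zero, of "{i}" "\<lambda>_. 1"] nn(1) by (intro mult_left_mono) auto
    finally show "expectation (\<lambda>\<omega>. (T i \<omega>)\<^sup>2) \<le> C2 * Cw / nn" by simp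
  qed
  define A' where "A' = (\<lambda>j. {\<omega>\<in>space P. Z j \<omega> \<le> M / \<epsilon>})"
  have Zint: "integrable P (Z j)" for j unfolding Z_def using T(1) by auto
  have Z0: "0 \<le> Z j \<omega>" for j \<omega> unfolding Z_def using w(1) by (intro sum_nonneg mult_nonneg_nonneg) (auto intro: less_imp_le)
  have d0: "0 < d"
  proof -
    \<comment> \<open>An arbitrary index, which exists because types are nonempty; its one term
      already makes \<open>d\<close> positive.\<close>
    obtain i :: 'i where True by simp
    have "w i \<le> d" using d[unfolded effective_dim_le_def, rule_format, of "{i}"] by (simp add: w_def)
    then show ?thesis using w(1)[of i] by linarith
  qed
  have M0: "0 < M" unfolding M_def using const_pos cw d0 nn(1) by auto
  have A': "A' j \<in> events" "1 - \<epsilon> \<le> prob (A' j)" for j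
  proof -
    have [measurable]: "Z j \<in> borel_measurable P" using Zint by auto
    show "A' j \<in> events" unfolding A'_def by measurable
    have "expectation (Z j) = (\<Sum>i\<in>F_upto j. w i * expectation (\<lambda>\<omega>. (T i \<omega>)\<^sup>2))"
      unfolding Z_def using T(1) by (simp add: Bochner_Integration.integral_sum)
    also have "\<dots> \<le> (\<Sum>i\<in>F_upto j. w i * (C2 * Cw / nn))"
      using T(2) w(1) by (intro sum_mono mult_left_mono) (auto intro: less_imp_le)
    also have "\<dots> = (\<Sum>i\<in>F_upto j. w i) * (C2 * Cw / nn)" by (rule sum_distrib_right[symmetric])
    also have "\<dots> \<le> d * (C2 * Cw / nn)"
      using d[unfolded effective_dim_le_def] finite_F_upto const_pos cw nn(1)
      by (intro mult_right_mono) (auto simp: w_def)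
    finally have "(\<integral>\<^sup>+\<omega>. ennreal (Z j \<omega>) \<partial>P) \<le> ennreal M"
      using Zint Z0 by (subst nn_integral_eq_integral) (auto simp: M_def mult_ac intro!: ennreal_leI)
    then have "1 - M / (M / \<epsilon>) \<le> prob (A' j)"
      unfolding A'_def using Z0 M0 \<epsilon> by (intro prob_le_of_nn_integral) auto
    then show "1 - \<epsilon> \<le> prob (A' j)" using M0 by simp
  qed
  \<comment> \<open>Linearity of \<open>D\<close> in the direction holds almost everywhere for each
    combination separately; countability of the family gives one exceptional set for all of them and
    all observations.\<close>
  have "AE \<omega> in P. \<forall>l\<in>{1..m}. \<forall>k\<ge>1. \<forall>c\<in>\<C>. D l 0 (lincomb b c) (X l k \<omega>) = (\<Sum>i | c i \<noteq> 0. c i * D l 0 (b i) (X l k \<omega>))"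
    using C D_lincomb[OF _ N_zero] by (intro AE_samples) (auto simp: AE_ball_countable)
  then obtain G where G: "G \<in> events" "prob G = 1"
    "\<And>\<omega>. \<omega> \<in> G \<Longrightarrow> \<forall>l\<in>{1..m}. \<forall>k\<ge>1. \<forall>c\<in>\<C>. D l 0 (lincomb b c) (X l k \<omega>) = (\<Sum>i | c i \<noteq> 0. c i * D l 0 (b i) (X l k \<omega>))"
    by (rule AE_event) (rule that)
  let ?E = "(\<Inter>i. \<Union>j\<in>{i..}. A' j) \<inter> G"
  note lim = prob_frequently_ge[where A = A' and c = "1 - \<epsilon>", OF A']
  show thesis
  proof (rule that[of ?E])
    show "?E \<in> events" using lim(1) G(1) by auto
    show "1 - \<epsilon> \<le> prob ?E" using prob_Int_ge[OF lim(1) G(1)] lim(2) G(2) by linarith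
    fix \<omega> c assume \<omega>: "\<omega> \<in> ?E" and c: "c \<in> \<C>"
    have fc: "finite {i. c i \<noteq> 0}" using C(2)[OF c] by (simp add: finite_support_def)
    then obtain j0 where j0: "{i. c i \<noteq> 0} \<subseteq> F_upto j0" by (rule F_upto_covers)
    obtain j where j: "j0 \<le> j" "\<omega> \<in> A' j" using \<omega> by auto
    have supp: "{i. c i \<noteq> 0} \<subseteq> F_upto j" using j0 F_upto_mono[OF j(1)] by auto
    have "(\<Sum>l=1..m. 1 / real (n l) * (\<Sum>k=1..n l. D l 0 (lincomb b c) (X l k \<omega>))) =
        (\<Sum>l=1..m. 1 / real (n l) * (\<Sum>k=1..n l. \<Sum>i\<in>F_upto j. c i * D l 0 (b i) (X l k \<omega>)))"
    proof (intro sum.cong refl arg_cong2[of _ _ _ _ "(*)"])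
      fix l k assume "l \<in> {1..m}" "k \<in> {1..n l}"
      then have "D l 0 (lincomb b c) (X l k \<omega>) = (\<Sum>i | c i \<noteq> 0. c i * D l 0 (b i) (X l k \<omega>))"
        using G(3) \<omega> c by auto
      also have "\<dots> = (\<Sum>i\<in>F_upto j. c i * D l 0 (b i) (X l k \<omega>))"
        by (rule sum_support_eq[OF finite_F_upto supp]) simp
      finally show "D l 0 (lincomb b c) (X l k \<omega>) = (\<Sum>i\<in>F_upto j. c i * D l 0 (b i) (X l k \<omega>))" .
    qed
    also have "\<dots> = (\<Sum>l=1..m. \<Sum>i\<in>F_upto j. c i * (1 / real (n l) * (\<Sum>k=1..n l. D l 0 (b i) (X l k \<omega>))))"
    proof (rule sum.cong[OF refl])
      fix l
      have "(\<Sum>k=1..n l. \<Sum>i\<in>F_upto j. c i * D l 0 (b i) (X l k \<omega>)) = (\<Sum>i\<in>F_upto j. c i * (\<Sum>k=1..n l. D l 0 (b i) (X l k \<omega>)))"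
        by (subst sum.swap) (simp add: sum_distrib_left)
      then show "1 / real (n l) * (\<Sum>k=1..n l. \<Sum>i\<in>F_upto j. c i * D l 0 (b i) (X l k \<omega>)) =
          (\<Sum>i\<in>F_upto j. c i * (1 / real (n l) * (\<Sum>k=1..n l. D l 0 (b i) (X l k \<omega>))))"
        by (simp add: sum_distrib_left mult_ac)
    qed
    also have "\<dots> = (\<Sum>i\<in>F_upto j. c i * T i \<omega>)"
      unfolding T_def by (subst sum.swap) (simp add: sum_distrib_left)
    also have "\<dots> = (\<Sum>i\<in>F_upto j. (c i / sqrt (w i)) * (sqrt (w i) * T i \<omega>))"
      using w(1) by (intro sum.cong) (auto simp: less_imp_neq[symmetric])
    also have "\<dots>\<^sup>2 \<le> (\<Sum>i\<in>F_upto j. (c i / sqrt (w i))\<^sup>2) * (\<Sum>i\<in>F_upto j. (sqrt (w i) * T i \<omega>)\<^sup>2)"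
      by (rule Cauchy_Schwarz_ineq_sum)
    also have "(\<Sum>i\<in>F_upto j. (c i / sqrt (w i))\<^sup>2) = energy lam c"
      unfolding energy_eq[OF finite_F_upto supp]
    proof (rule sum.cong[OF refl])
      fix i
      have "(c i / sqrt (w i))\<^sup>2 = (1 / w i) * (c i)\<^sup>2" using w(1)[of i] by (simp add: power_divide)
      then show "(c i / sqrt (w i))\<^sup>2 = (1 + lam * \<rho> i) * (c i)\<^sup>2" by (simp only: w(2))
    qed
    also have "(\<Sum>i\<in>F_upto j. (sqrt (w i) * T i \<omega>)\<^sup>2) = Z j \<omega>"
      unfolding Z_def using w(1) by (intro sum.cong) (auto simp: power_mult_distrib less_imp_le)
    also have "energy lam c * Z j \<omega> \<le> energy lam c * (M / \<epsilon>)"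
    proof (rule mult_left_mono)
      show "Z j \<omega> \<le> M / \<epsilon>" using j(2) by (simp add: A'_def)
      show "0 \<le> energy lam c" unfolding energy_def using lam \<rho>_nonneg by (intro sum_nonneg mult_nonneg_nonneg) auto
    qed
    finally show "(\<Sum>l=1..m. 1 / real (n l) * (\<Sum>k=1..n l. D l 0 (lincomb b c) (X l k \<omega>)))\<^sup>2
        \<le> C2 * Cw * d / (nn * \<epsilon>) * energy lam c"
      by (simp add: M_def mult_ac)
  qed
qed

end

section \<open>Net over the ellipsoid and the union bound\<close>

section \<open>Uniform likelihood bound on a shell\<close>

context spectral_model
begin

text \<open>Every index with \<open>lam * \<rho> i < \<beta>\<close> contributes at least
  \<open>1 / (1 + \<beta>)\<close> to a sum bounded by \<open>d\<close>.\<close>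

lemma low_frequencies_finite:
  assumes "effective_dim_le lam d" "0 < lam" "0 < \<beta>"
  shows "finite {i. lam * \<rho> i < \<beta>}" "real (card {i. lam * \<rho> i < \<beta>}) \<le> (1 + \<beta>) * d"
proof -
  let ?I = "{i. lam * \<rho> i < \<beta>}"
  have le: "real (card G) \<le> (1 + \<beta>) * d" if G: "G \<subseteq> ?I" "finite G" for G
  proof -
    have "real (card G) * (1 / (1 + \<beta>)) = (\<Sum>i\<in>G. 1 / (1 + \<beta>))" by simp
    also have "\<dots> \<le> (\<Sum>i\<in>G. 1 / (1 + lam * \<rho> i))"
    proof (intro sum_mono divide_left_mono mult_pos_pos)
      fix i assume "i \<in> G"
      then show "1 + lam * \<rho> i \<le> 1 + \<beta>" using G(1) by auto
      show "0 < 1 + lam * \<rho> i" using assms(2) \<rho>_nonneg[of i] by (simp add: add_pos_nonneg)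
    qed (use assms(3) in auto)
    also have "\<dots> \<le> d" using assms(1) G(2) by (simp add: effective_dim_le_def)
    finally show ?thesis using assms(3) by (simp add: field_simps)
  qed
  have "card G \<le> nat \<lfloor>(1 + \<beta>) * d\<rfloor>" if "G \<subseteq> ?I" "finite G" for G
    using le[OF that] by (simp add: le_nat_floor)
  then show "finite ?I" using finite_if_finite_subsets_card_bdd[of ?I] by blast
  then show "real (card ?I) \<le> (1 + \<beta>) * d" by (intro le) auto
qed

text \<open>Logarithm, per unit of \<open>d\<close>, of the cell count
  \<open>2 ^ R * 3 ^ card I\<close> from \<open>card_int_functions_le\<close>, with frequency
  threshold \<open>8 * Cs / \<delta>\<close>.\<close>

definition net_rate :: "real \<Rightarrow> real \<Rightarrow> real" where
  "net_rate Cs \<delta> = ln 2 * (8 * Cs * (1 + 8 * Cs / \<delta>) / \<delta> + 1) + ln 3 * (1 + 8 * Cs / \<delta>)"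

text \<open>Coordinates above a frequency threshold are small by the energy bound and need no
  resolution; the remaining ones, at most a multiple of \<open>d\<close> in number, are rounded to a
  grid. Centres are picked inside \<open>T\<close>, so that they inherit membership in the
  neighbourhood and in the shell.\<close>

lemma energy_ball_net:
  assumes lam: "0 < lam" and d: "effective_dim_le lam d" "1 \<le> d"
    and pos: "0 < \<delta>" "0 < Cs" "0 < r"
    and T: "\<And>c. c \<in> T \<Longrightarrow> finite_support c \<and> energy lam c \<le> Cs * r"
  obtains rep where "\<And>c. c \<in> T \<Longrightarrow> rep c \<in> T" "finite (rep ` T)"
    "real (card (rep ` T)) \<le> exp (net_rate Cs \<delta> * d)"
    "\<And>c F. c \<in> T \<Longrightarrow> finite F \<Longrightarrow> {i. c i \<noteq> 0} \<subseteq> F \<Longrightarrow> {i. rep c i \<noteq> 0} \<subseteq> F \<Longrightarrow>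
      (\<Sum>i\<in>F. (c i - rep c i)\<^sup>2) \<le> \<delta> * r"
proof -
  \<comment> \<open>Threshold at which the high coordinates of two points of energy
    \<open>Cs * r\<close> differ by \<open>2 / \<beta> * (2 * Cs * r)\<close>, half of
    \<open>\<delta> * r\<close>.\<close>
  define \<beta> where "\<beta> = 8 * Cs / \<delta>"
  have \<beta>: "0 < \<beta>" unfolding \<beta>_def using pos by simp
  define I where "I = {i. lam * \<rho> i < \<beta>}"
  note I = low_frequencies_finite[OF d(1) lam \<beta>, folded I_def]
  \<comment> \<open>Grid width for which \<open>(1 + \<beta>) * d\<close> coordinates, each with
    error \<open>\<eta>\<close>, use up the other half of \<open>\<delta> * r\<close>.\<close>
  define \<eta> where "\<eta> = sqrt (\<delta> * r / (2 * (1 + \<beta>) * d))"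
  have \<eta>2: "\<eta>\<^sup>2 = \<delta> * r / (2 * (1 + \<beta>) * d)" unfolding \<eta>_def using pos \<beta> d by simp
  have \<eta>: "0 < \<eta>" unfolding \<eta>_def using pos \<beta> d by (intro real_sqrt_gt_zero divide_pos_pos mult_pos_pos) auto
  define cell where "cell = (\<lambda>c. restrict (\<lambda>i. round (c i / \<eta>)) I)"
  define h where "h = (\<lambda>k. SOME c. c \<in> T \<and> cell c = k)"
  define rep where "rep = (\<lambda>c. h (cell c))"
  have rep: "rep c \<in> T \<and> cell (rep c) = cell c" if "c \<in> T" for c
    unfolding rep_def h_def by (rule someI[of _ c]) (use that in simp)
  \<comment> \<open>Bound for the l1 norm of a rounded vector: the modulus of an integer is at most
    its square, and \<open>round_square_le\<close> gives
    \<open>4 / \<eta>\<^sup>2 * (Cs * r)\<close>.\<close>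
  define R where "R = nat \<lceil>8 * Cs * (1 + \<beta>) * d / \<delta>\<rceil>"
  have en: "(\<Sum>i\<in>F. (1 + lam * \<rho> i) * (c i)\<^sup>2) \<le> Cs * r" if c: "c \<in> T" and F: "finite F" for c F
  proof -
    have fs: "finite {i. c i \<noteq> 0}" using T[OF c] by (simp add: finite_support_def)
    have "(\<Sum>i\<in>F. (1 + lam * \<rho> i) * (c i)\<^sup>2) \<le> (\<Sum>i\<in>F \<union> {i. c i \<noteq> 0}. (1 + lam * \<rho> i) * (c i)\<^sup>2)"
      using F fs lam \<rho>_nonneg by (intro sum_mono2) (auto intro!: mult_nonneg_nonneg)
    also have "\<dots> = energy lam c" using F fs by (subst energy_eq) auto
    finally show ?thesis using T[OF c] by linarith
  qed
  have S: "k \<in> extensional I \<and> (\<Sum>i\<in>I. \<bar>k i\<bar>) \<le> int R" if k: "k \<in> cell ` T" for k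
  proof -
    obtain c where c: "c \<in> T" "k = cell c" using k by auto
    have "real_of_int (\<Sum>i\<in>I. \<bar>k i\<bar>) \<le> (\<Sum>i\<in>I. real_of_int ((k i)\<^sup>2))"
      unfolding of_int_sum by (intro sum_mono) (simp only: of_int_le_iff abs_int_le_square)
    also have "\<dots> \<le> (\<Sum>i\<in>I. 4 * (c i / \<eta>)\<^sup>2)"
      using round_square_le c by (intro sum_mono) (auto simp: cell_def)
    also have "\<dots> = 4 / \<eta>\<^sup>2 * (\<Sum>i\<in>I. (c i)\<^sup>2)" by (simp add: sum_distrib_left power_divide)
    also have "\<dots> \<le> 4 / \<eta>\<^sup>2 * (Cs * r)"
    proof (rule mult_left_mono)
      have "(\<Sum>i\<in>I. (c i)\<^sup>2) \<le> (\<Sum>i\<in>I. (1 + lam * \<rho> i) * (c i)\<^sup>2)"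
        using lam \<rho>_nonneg by (intro sum_mono) (simp add: distrib_right)
      then show "(\<Sum>i\<in>I. (c i)\<^sup>2) \<le> Cs * r" using en[OF c(1) I(1)] by linarith
    qed simp
    also have "\<dots> = 8 * Cs * (1 + \<beta>) * d / \<delta>"
      unfolding \<eta>2 using pos d \<beta> by (simp add: field_simps)
    finally have "(\<Sum>i\<in>I. \<bar>k i\<bar>) \<le> int R" unfolding R_def by linarith
    then show ?thesis using c by (auto simp: cell_def)
  qed
  note cnt = card_int_functions_le[OF I(1) S]
  have img: "rep ` T = h ` (cell ` T)" by (auto simp: rep_def)
  show thesis
  proof (rule that[of rep])
    show "finite (rep ` T)" unfolding img using cnt(1) by simp
    have "real (card (rep ` T)) \<le> real (card (cell ` T))" unfolding img using cnt(1) by (simp add: card_image_le)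
    also have "\<dots> \<le> 2 ^ R * 3 ^ card I" by (rule cnt(2))
    also have "\<dots> = exp (ln 2 * real R + ln 3 * real (card I))"
      by (simp add: exp_add exp_of_nat2_mult mult.commute[of "ln _"] exp_of_nat_mult)
    also have "\<dots> \<le> exp (net_rate Cs \<delta> * d)"
    proof -
      have "0 \<le> 8 * Cs * (1 + \<beta>) * d / \<delta>" using pos \<beta> d by auto
      then have "real R \<le> 8 * Cs * (1 + \<beta>) * d / \<delta> + 1" unfolding R_def by linarith
      also have "\<dots> \<le> (8 * Cs * (1 + \<beta>) / \<delta> + 1) * d" using d by (simp add: distrib_right)
      finally have "ln 2 * real R + ln 3 * real (card I) \<le>
          ln 2 * ((8 * Cs * (1 + \<beta>) / \<delta> + 1) * d) + ln 3 * ((1 + \<beta>) * d)"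
        using I(2) by (intro add_mono mult_left_mono) auto
      also have "\<dots> = net_rate Cs \<delta> * d" by (simp add: net_rate_def \<beta>_def algebra_simps)
      finally show ?thesis by simp
    qed
    finally show "real (card (rep ` T)) \<le> exp (net_rate Cs \<delta> * d)" .
    show "rep c \<in> T" if "c \<in> T" for c using rep[OF that] by simp
    fix c and F :: "'i set" assume c: "c \<in> T" and F: "finite F"
    let ?c = "rep c"
    have c': "?c \<in> T" "cell ?c = cell c" using rep[OF c] by auto
    have lo: "(c i - ?c i)\<^sup>2 \<le> \<eta>\<^sup>2" if "i \<in> I" for i
    proof -
      have "round (c i / \<eta>) = round (?c i / \<eta>)"
        using c'(2) that by (auto simp: cell_def restrict_def fun_eq_iff split: if_splits)
      then have "\<bar>c i / \<eta> - ?c i / \<eta>\<bar> \<le> 1"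
        using of_int_round_abs_le[of "c i / \<eta>"] of_int_round_abs_le[of "?c i / \<eta>"] by linarith
      then have "\<bar>c i - ?c i\<bar> \<le> \<eta>" using \<eta> by (simp add: abs_divide divide_le_eq flip: diff_divide_distrib)
      then show ?thesis by (rule abs_le_power2_le)
    qed
    have hi: "(c i - ?c i)\<^sup>2 \<le> 2 / \<beta> * ((1 + lam * \<rho> i) * (c i)\<^sup>2 + (1 + lam * \<rho> i) * (?c i)\<^sup>2)" if "i \<notin> I" for i
    proof -
      have "\<beta> \<le> 1 + lam * \<rho> i" using that by (auto simp: I_def)
      have "(c i - ?c i)\<^sup>2 \<le> 2 * ((c i)\<^sup>2 + (?c i)\<^sup>2)"
        using zero_le_power2[of "c i + ?c i"] by (simp add: power2_eq_square algebra_simps)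
      also have "\<dots> = 2 / \<beta> * (\<beta> * ((c i)\<^sup>2 + (?c i)\<^sup>2))" using \<beta> by simp
      also have "\<dots> \<le> 2 / \<beta> * ((1 + lam * \<rho> i) * ((c i)\<^sup>2 + (?c i)\<^sup>2))"
        using \<beta> \<open>\<beta> \<le> 1 + lam * \<rho> i\<close> by (intro mult_left_mono mult_right_mono) auto
      finally show ?thesis by (simp add: distrib_left)
    qed
    have "(\<Sum>i\<in>F. (c i - ?c i)\<^sup>2) \<le> (\<Sum>i\<in>F. (if i \<in> I then \<eta>\<^sup>2 else 0) +
        2 / \<beta> * ((1 + lam * \<rho> i) * (c i)\<^sup>2 + (1 + lam * \<rho> i) * (?c i)\<^sup>2))"
    proof (rule sum_mono)
      fix i
      have "0 \<le> 2 / \<beta> * ((1 + lam * \<rho> i) * (c i)\<^sup>2 + (1 + lam * \<rho> i) * (?c i)\<^sup>2)"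
        using \<beta> lam \<rho>_nonneg[of i] by (intro mult_nonneg_nonneg add_nonneg_nonneg) auto
      then show "(c i - ?c i)\<^sup>2 \<le> (if i \<in> I then \<eta>\<^sup>2 else 0) +
          2 / \<beta> * ((1 + lam * \<rho> i) * (c i)\<^sup>2 + (1 + lam * \<rho> i) * (?c i)\<^sup>2)"
        using lo[of i] hi[of i] by auto
    qed
    also have "\<dots> = real (card (F \<inter> I)) * \<eta>\<^sup>2 +
        2 / \<beta> * ((\<Sum>i\<in>F. (1 + lam * \<rho> i) * (c i)\<^sup>2) + (\<Sum>i\<in>F. (1 + lam * \<rho> i) * (?c i)\<^sup>2))"
    proof -
      have "(\<Sum>i\<in>F. if i \<in> I then \<eta>\<^sup>2 else 0) = real (card (F \<inter> I)) * \<eta>\<^sup>2"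
        using F by (simp add: sum.If_cases Int_def)
      then show ?thesis by (simp only: sum.distrib sum_distrib_left[symmetric])
    qed
    also have "\<dots> \<le> ((1 + \<beta>) * d) * \<eta>\<^sup>2 + 2 / \<beta> * (Cs * r + Cs * r)"
    proof (intro add_mono mult_right_mono mult_left_mono en c c'(1) F)
      have "real (card (F \<inter> I)) \<le> real (card I)" using I(1) by (simp add: card_mono)
      then show "real (card (F \<inter> I)) \<le> (1 + \<beta>) * d" using I(2) by linarith
    qed (use \<beta> in auto)
    also have "((1 + \<beta>) * d) * \<eta>\<^sup>2 = \<delta> * r / 2" 
    proof -
      have "(1 + \<beta>) * d \<noteq> 0" using \<beta> d by simp
      moreover have half: "x * (\<delta> * r / (2 * x)) = \<delta> * r / 2" if "x \<noteq> 0" for x using that by simp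
      ultimately have "((1 + \<beta>) * d) * (\<delta> * r / (2 * ((1 + \<beta>) * d))) = \<delta> * r / 2" by (intro half)
      then show ?thesis unfolding \<eta>2 by (simp only: mult.assoc)
    qed
    also have "2 / \<beta> * (Cs * r + Cs * r) = \<delta> * r / 2" unfolding \<beta>_def using pos by (simp add: field_simps)
    finally show "(\<Sum>i\<in>F. (c i - ?c i)\<^sup>2) \<le> \<delta> * r" by simp
  qed
qed

text \<open>One event for one centre and one finite coordinate set. The Chernoff bound concerns half
  the log ratio, so drift and level \<open>t\<close> are doubled. The factor \<open>\<theta>\<close>
  scales the derivative into the range where clipping is harmless.\<close>

lemma center_event:
  fixes F :: "'i set" and \<sigma> :: "'i \<Rightarrow> real"
  assumes p: "p \<in> N" and F: "finite F" and \<sigma>: "\<And>i. i \<in> F \<Longrightarrow> 0 < \<sigma> i"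
    and nn: "0 \<le> nn" "\<And>l. l \<in> {1..m} \<Longrightarrow> nn \<le> real (n l) \<and> 1 \<le> n l"
    and cB: "cB * W p \<le> (\<Sum>l=1..m. exp (- B) / 8 * (LINT x|Q l. (g l p x)\<^sup>2))"
    and R: "0 \<le> R"
  obtains E where "E \<in> events" "1 - 3 * exp (- t) \<le> prob E"
    "\<And>\<omega>. \<omega> \<in> E \<Longrightarrow> (\<Sum>l=1..m. nn / real (n l) * (\<Sum>k=1..n l. g l p (X l k \<omega>) - A l p)) \<le> - (2 * nn * cB * W p) + 2 * t"
    "\<And>\<omega> c. \<omega> \<in> E \<Longrightarrow> (\<Sum>i\<in>F. (c i / \<sigma> i)\<^sup>2) \<le> R \<Longrightarrow>
       (\<And>l k. l \<in> {1..m} \<Longrightarrow> k \<in> {1..n l} \<Longrightarrow> -1/2 \<le> (\<Sum>i\<in>F. c i * (\<theta> * D l p (b i) (X l k \<omega>)))) \<Longrightarrow>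
       (\<Sum>l=1..m. nn / real (n l) * (\<Sum>k=1..n l. min (\<Sum>i\<in>F. c i * (\<theta> * D l p (b i) (X l k \<omega>))) (1/2)))
        \<le> R + nn * (\<theta>\<^sup>2 * C2 * Cw) * (\<Sum>i\<in>F. (c i)\<^sup>2) + 5 * nn * (\<theta>\<^sup>2 * C2 * Cw) * (\<Sum>i\<in>F. (\<sigma> i)\<^sup>2) + 3 * t"
proof -
  define s where "s = (\<lambda>l. nn / real (n l))"
  have s: "0 \<le> s l" "s l \<le> 1" "real (n l) * s l = nn" if "l \<in> {1..m}" for l
    using nn(1) nn(2)[OF that] by (auto simp: s_def field_simps)
  let ?V = "\<lambda>l. exp (- B) / 8 * (LINT x|Q l. (g l p x)\<^sup>2)"
  obtain E1 where E1: "E1 \<in> events" "1 - exp (- t) \<le> prob E1"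
    "\<And>\<omega>. \<omega> \<in> E1 \<Longrightarrow> (\<Sum>l=1..m. \<Sum>k=1..n l. s l * ((g l p (X l k \<omega>) - A l p) / 2)) \<le>
      (\<Sum>l=1..m. real (n l) * (- (s l * ?V l))) + t"
  proof (rule chernoff_samples[where f = "\<lambda>l x. s l * ((g l p x - A l p) / 2)" and c = "\<lambda>l. - (s l * ?V l)" and n = n and t = t])
    fix l assume l: "l \<in> {1..m}"
    show "(\<lambda>x. s l * ((g l p x - A l p) / 2)) \<in> borel_measurable (Q l)"
      using g_measurable[OF l] by measurable
    show "(\<integral>\<^sup>+x. ennreal (exp (s l * ((g l p x - A l p) / 2))) \<partial>Q l) \<le> ennreal (exp (- (s l * ?V l)))"
      by (rule exp_half_ratio_le[OF l p s(1,2)[OF l]])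
  qed (rule that)
  have E1': "(\<Sum>l=1..m. nn / real (n l) * (\<Sum>k=1..n l. g l p (X l k \<omega>) - A l p)) \<le> - (2 * nn * cB * W p) + 2 * t" if "\<omega> \<in> E1" for \<omega>
  proof -
    have "(\<Sum>l=1..m. nn / real (n l) * (\<Sum>k=1..n l. g l p (X l k \<omega>) - A l p)) =
        2 * (\<Sum>l=1..m. \<Sum>k=1..n l. s l * ((g l p (X l k \<omega>) - A l p) / 2))"
      unfolding s_def by (simp add: sum_distrib_left)
    also have "\<dots> \<le> 2 * ((\<Sum>l=1..m. real (n l) * (- (s l * ?V l))) + t)"
      using E1(3)[OF that] by simp
    also have "(\<Sum>l=1..m. real (n l) * (- (s l * ?V l))) = (\<Sum>l=1..m. - (nn * ?V l))"
    proof (rule sum.cong[OF refl])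
      fix l assume "l \<in> {1..m}"
      have "real (n l) * (- (s l * ?V l)) = - ((real (n l) * s l) * ?V l)" by simp
      then show "real (n l) * (- (s l * ?V l)) = - (nn * ?V l)" using s(3)[OF \<open>l \<in> {1..m}\<close>] by simp
    qed
    also have "\<dots> = - (nn * (\<Sum>l=1..m. ?V l))" by (simp add: sum_negf sum_distrib_left)
    also have "\<dots> \<le> - (nn * (cB * W p))" using mult_left_mono[OF cB nn(1)] by linarith
    finally show ?thesis by (simp add: algebra_simps)
  qed
  have var: "(\<Sum>l=1..m. LINT x|Q l. (\<Sum>i\<in>F. c i * (\<theta> * D l p (b i) x))\<^sup>2) \<le> \<theta>\<^sup>2 * C2 * Cw * (\<Sum>i\<in>F. (c i)\<^sup>2)" for c
  proof -
    have eq: "(\<Sum>i\<in>F. c i * (\<theta> * D l p (b i) x)) = \<theta> * (\<Sum>i\<in>F. c i * D l p (b i) x)" for l x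
      by (simp add: sum_distrib_left mult_ac)
    have "(\<Sum>l=1..m. LINT x|Q l. (\<Sum>i\<in>F. c i * (\<theta> * D l p (b i) x))\<^sup>2) =
        \<theta>\<^sup>2 * (\<Sum>l=1..m. LINT x|Q l. (\<Sum>i\<in>F. c i * D l p (b i) x)\<^sup>2)"
      unfolding eq power_mult_distrib integral_mult_right_zero sum_distrib_left[symmetric] ..
    also have "\<dots> \<le> \<theta>\<^sup>2 * (C2 * Cw * (\<Sum>i\<in>F. (c i)\<^sup>2))"
      using D_sum_second_moment[OF p F] by (intro mult_left_mono) auto
    finally show ?thesis by (simp add: mult.assoc)
  qed
  obtain E2 where E2: "E2 \<in> events" "1 - 2 * exp (- t) \<le> prob E2"
    "\<And>\<omega> c. \<omega> \<in> E2 \<Longrightarrow> (\<Sum>i\<in>F. (c i / \<sigma> i)\<^sup>2) \<le> R \<Longrightarrow>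
       (\<And>l k. l \<in> {1..m} \<Longrightarrow> k \<in> {1..n l} \<Longrightarrow> -1/2 \<le> (\<Sum>i\<in>F. c i * (\<theta> * D l p (b i) (X l k \<omega>)))) \<Longrightarrow>
       (\<Sum>l=1..m. nn / real (n l) * (\<Sum>k=1..n l. min (\<Sum>i\<in>F. c i * (\<theta> * D l p (b i) (X l k \<omega>))) (1/2)))
        \<le> R + nn * (\<theta>\<^sup>2 * C2 * Cw) * (\<Sum>i\<in>F. (c i)\<^sup>2) + 5 * nn * (\<theta>\<^sup>2 * C2 * Cw) * (\<Sum>i\<in>F. (\<sigma> i)\<^sup>2) + 3 * t"
  proof (rule clipped_linear_process_bound[where F = F and \<sigma> = \<sigma> and N = nn and n = n and R = R and t = t
        and y = "\<lambda>l i x. \<theta> * D l p (b i) x" and \<kappa> = "\<theta>\<^sup>2 * C2 * Cw"])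
    fix l i assume l: "l \<in> {1..m}"
    show "(\<lambda>x. \<theta> * D l p (b i) x) \<in> borel_measurable (Q l)" using D_measurable[OF l p] by measurable
    show "integrable (Q l) (\<lambda>x. (\<theta> * D l p (b i) x)\<^sup>2)"
      using D_square_integrable[OF l p] by (simp add: power_mult_distrib)
    show "(LINT x|Q l. \<theta> * D l p (b i) x) = 0" using D_mean[OF l p] by simp
  next
    show "(\<Sum>l=1..m. LINT x|Q l. (\<Sum>i\<in>F. c i * (\<theta> * D l p (b i) x))\<^sup>2) \<le> \<theta>\<^sup>2 * C2 * Cw * (\<Sum>i\<in>F. (c i)\<^sup>2)" for c
      by (rule var)
  qed (use F \<sigma> nn R that in auto)
  show thesis
  proof (rule that[of "E1 \<inter> E2"])
    show "E1 \<inter> E2 \<in> events" using E1(1) E2(1) by (rule sets.Int)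
    show "1 - 3 * exp (- t) \<le> prob (E1 \<inter> E2)"
      using E1(2) E2(2) prob_Int_ge[OF E1(1) E2(1)] by linarith
  qed (use E1' E2(3) in \<open>blast intro: E1' E2(3)\<close>)+
qed

text \<open>The neighbourhood may be unbounded in norm, yet \<open>W\<close> is bounded on it, since
  \<open>W\<close> is dominated by divergences and these are at most \<open>B\<close>. The constant
  \<open>cB\<close> turns the Hellinger exponent of \<open>exp_half_ratio_le\<close> into a multiple
  of \<open>W\<close>.\<close>

lemma W_bounds_on_N:
  obtains WB cB where "0 \<le> WB" "0 < cB" "\<And>v. v \<in> N \<Longrightarrow> W v \<le> WB"
    "\<And>v. v \<in> N \<Longrightarrow> cB * W v \<le> (\<Sum>l=1..m. exp (- B) / 8 * (LINT x|Q l. (g l v x)\<^sup>2))"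
proof -
  obtain K where K: "0 < K" "\<And>v. v \<in> N \<Longrightarrow> W v \<le> K * total_A v" using W_le_total_A by blast
  show thesis
  proof (rule that[of "K * (real m * B)" "exp (- (3 * B)) / (8 * K)"])
    show "0 \<le> K * (real m * B)" using K const_pos by auto
    show "0 < exp (- (3 * B)) / (8 * K)" using K by auto
    fix v assume v: "v \<in> N"
    have "W v \<le> K * total_A v" by (rule K(2)[OF v])
    also have "\<dots> \<le> K * (real m * B)" using total_A_bounds(2)[OF v] K(1) by (intro mult_left_mono) auto
    finally show "W v \<le> K * (real m * B)" .
    have "exp (- (3 * B)) / (8 * K) * W v \<le> exp (- (3 * B)) / (8 * K) * (K * total_A v)"
      using K v by (intro mult_left_mono) auto
    also have "\<dots> = (\<Sum>l=1..m. exp (- (3 * B)) / 8 * A l v)" using K(1) by (simp add: sum_distrib_left)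
    also have "\<dots> \<le> (\<Sum>l=1..m. exp (- B) / 8 * (LINT x|Q l. (g l v x)\<^sup>2))"
    proof (rule sum_mono)
      fix l assume l: "l \<in> {1..m}"
      have "exp (- (3 * B)) / 8 * A l v \<le> exp (- (3 * B)) / 8 * (exp (2 * B) * (LINT x|Q l. (g l v x)\<^sup>2))"
        using A_le_variance[OF l v] by (intro mult_left_mono) auto
      also have "\<dots> = (exp (- (3 * B)) * exp (2 * B)) / 8 * (LINT x|Q l. (g l v x)\<^sup>2)" by simp
      also have "exp (- (3 * B)) * exp (2 * B) = exp (- B)" by (simp flip: exp_add)
      finally show "exp (- (3 * B)) / 8 * A l v \<le> exp (- B) / 8 * (LINT x|Q l. (g l v x)\<^sup>2)" .
    qed
    finally show "exp (- (3 * B)) / (8 * K) * W v \<le> (\<Sum>l=1..m. exp (- B) / 8 * (LINT x|Q l. (g l v x)\<^sup>2))" .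
  qed
qed

text \<open>Each inequality is almost sure for one pair of points; the countable family lets them
  hold at all observations and for all pairs on one event of probability one.\<close>

lemma sample_linearization:
  assumes C: "countable \<C>" "\<And>c. c \<in> \<C> \<Longrightarrow> finite_support c"
  obtains G where "G \<in> events" "prob G = 1"
    "\<And>\<omega> l k c c'. \<omega> \<in> G \<Longrightarrow> l \<in> {1..m} \<Longrightarrow> 1 \<le> k \<Longrightarrow> c \<in> \<C> \<Longrightarrow> c' \<in> \<C> \<Longrightarrow>
      lincomb b c \<in> N \<Longrightarrow> lincomb b c' \<in> N \<Longrightarrow>
      \<bar>g l (lincomb b c) (X l k \<omega>) - g l (lincomb b c') (X l k \<omega>)\<bar> \<le> 4 * B \<and>
      g l (lincomb b c) (X l k \<omega>) - g l (lincomb b c') (X l k \<omega>) \<le>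
        (\<Sum>i | c i - c' i \<noteq> 0. (c i - c' i) * D l (lincomb b c') (b i) (X l k \<omega>)) +
        lin_const * (sqrt (W (lincomb b c')) * sqrt (W (lincomb b c - lincomb b c')) + W (lincomb b c - lincomb b c'))"
proof -
  let ?R = "\<lambda>l x c c'. lincomb b c \<in> N \<longrightarrow> lincomb b c' \<in> N \<longrightarrow>
      \<bar>g l (lincomb b c) x - g l (lincomb b c') x\<bar> \<le> 4 * B \<and>
      g l (lincomb b c) x - g l (lincomb b c') x \<le>
        (\<Sum>i | c i - c' i \<noteq> 0. (c i - c' i) * D l (lincomb b c') (b i) x) +
        lin_const * (sqrt (W (lincomb b c')) * sqrt (W (lincomb b c - lincomb b c')) + W (lincomb b c - lincomb b c'))"
  have "AE x in Q l. \<forall>c\<in>\<C>. \<forall>c'\<in>\<C>. ?R l x c c'" if l: "l \<in> {1..m}" for l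
  proof -
    have "AE x in Q l. ?R l x c c'" if c: "c \<in> \<C>" "c' \<in> \<C>" for c c'
    proof (cases "lincomb b c \<in> N \<and> lincomb b c' \<in> N")
      case True
      then have N: "lincomb b c \<in> N" "lincomb b c' \<in> N" by auto
      show ?thesis
        using increment_facts(1)[OF l N] linearization[OF l N(2,1)]
          D_lincomb[OF l N(2) finite_support_diff[OF C(2)[OF c(1)] C(2)[OF c(2)]]]
        unfolding lincomb_diff[OF C(2)[OF c(1)] C(2)[OF c(2)]]
        by eventually_elim auto
    qed auto
    then show ?thesis by (simp add: AE_ball_countable[OF C(1)])
  qed
  then have "AE \<omega> in P. \<forall>l\<in>{1..m}. \<forall>k\<ge>1. \<forall>c\<in>\<C>. \<forall>c'\<in>\<C>. ?R l (X l k \<omega>) c c'"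
    by (intro AE_samples)
  then obtain G where "G \<in> events" "prob G = 1"
    "\<And>\<omega>. \<omega> \<in> G \<Longrightarrow> \<forall>l\<in>{1..m}. \<forall>k\<ge>1. \<forall>c\<in>\<C>. \<forall>c'\<in>\<C>. ?R l (X l k \<omega>) c c'"
    by (rule AE_event) (rule that)
  then show thesis by (intro that[of G]) blast+
qed

end

context spectral_model
begin

text \<open>At the centre the divergence gives \<open>- c0 * nn * r\<close>. The four costs on the
  way to the point itself (deviation level, smoothing by signs, variance of the increment,
  linearization) are each made at most an eighth of that. The rate \<open>c1\<close> is fixed before
  \<open>\<epsilon>\<close> and \<open>K\<close>, which the localization argument relies on.\<close>

theorem uniform_likelihood_bound:
  assumes C: "countable \<C>" "\<And>c. c \<in> \<C> \<Longrightarrow> finite_support c" and Cs: "0 < Cs"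
  shows "\<exists>c1>0. \<forall>\<epsilon>>0. \<exists>K0\<ge>1. \<forall>K\<ge>K0. \<forall>n nn lam d. 0 < nn \<longrightarrow> 1 \<le> d \<longrightarrow> 0 < lam \<longrightarrow>
    (\<forall>l\<in>{1..m}. 1 \<le> n l \<and> nn \<le> real (n l)) \<longrightarrow> effective_dim_le lam d \<longrightarrow>
    (\<exists>E\<in>events. 1 - \<epsilon> \<le> prob E \<and> (\<forall>\<omega>\<in>E. \<forall>c\<in>\<C>. lincomb b c \<in> N \<longrightarrow>
      K * (d / nn + lam) / 4 \<le> W (lincomb b c) \<longrightarrow> energy lam c \<le> Cs * (K * (d / nn + lam)) \<longrightarrow>
      (\<Sum>l=1..m. 1 / real (n l) * (\<Sum>k=1..n l. g l (lincomb b c) (X l k \<omega>) - A l (lincomb b c)))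
        \<le> - c1 * (K * (d / nn + lam))))"
proof -
  obtain WB cB where WB0: "0 \<le> WB" and cB0: "0 < cB" and WBN: "\<And>v. v \<in> N \<Longrightarrow> W v \<le> WB"
    and cBN: "\<And>v. v \<in> N \<Longrightarrow> cB * W v \<le> (\<Sum>l=1..m. exp (- B) / 8 * (LINT x|Q l. (g l v x)\<^sup>2))"
    by (rule W_bounds_on_N) (rule that)
  note WB = WB0 WBN and cB = cB0 cBN
  \<comment> \<open>At a centre \<open>W p \<ge> r / 4\<close>, which turns the drift
    \<open>2 * nn * cB * W p\<close> into at least \<open>nn * c0 * r\<close>.\<close>
  define c0 where "c0 = cB / 2"
  have c0: "0 < c0" using cB by (simp add: c0_def)
  \<comment> \<open>The half at which the process is clipped corresponds, after division by
    \<open>\<theta>\<close>, to \<open>4 * B + 4 * WB + 1\<close>. That exceeds every increment of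
    the log ratio together with the linearization error.\<close>
  define \<theta> where "\<theta> = 1 / (2 * (4 * B + 4 * WB + 1))"
  have \<theta>: "0 < \<theta>" unfolding \<theta>_def using const_pos WB by (intro divide_pos_pos) auto
  have \<theta>': "1 / \<theta> = 2 * (4 * B + 4 * WB + 1)" by (simp add: \<theta>_def)
  define \<kappa> where "\<kappa> = \<theta>\<^sup>2 * C2 * Cw"
  have \<kappa>: "0 \<le> \<kappa>" unfolding \<kappa>_def using const_pos cw by auto
  define U where "U = Cw * (sqrt Cs + 1)"
  have U: "0 \<le> U" unfolding U_def using cw Cs by auto
  \<comment> \<open>Collects the constants in front of the mesh: the errors will be at most
    \<open>L * s\<close> times \<open>nn * r\<close>. The summand 1 makes \<open>L\<close>
    positive.\<close>
  define L where "L = real m * (lin_const + tilt_const) * U + lin_const * U + \<kappa> / \<theta> + 1"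
  have L: "real m * (lin_const + tilt_const) * U \<le> L" "lin_const * U \<le> L" "\<kappa> / \<theta> \<le> L" "0 < L"
    unfolding L_def using lin_const_nonneg tilt_const_nonneg U \<kappa> \<theta>
    by (auto intro!: add_nonneg_nonneg mult_nonneg_nonneg add_nonneg_pos)
  define s where "s = min 1 (min (1 / L) (c0 / (8 * L)))"
  have s: "0 < s" "s \<le> 1" "s * L \<le> 1" "s * L \<le> c0 / 8"
  proof -
    show "0 < s" "s \<le> 1" unfolding s_def using L(4) c0 by auto
    have "s \<le> 1 / L" "s \<le> c0 / (8 * L)" unfolding s_def by auto
    then show "s * L \<le> 1" "s * L \<le> c0 / 8" using L(4) by (auto simp: field_simps)
  qed
  \<comment> \<open>Distances in the net are squared, so \<open>s\<close> is the mesh relative to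
    the radius.\<close>
  define \<delta> where "\<delta> = s\<^sup>2"
  have \<delta>: "0 < \<delta>" "\<delta> \<le> s" "sqrt \<delta> = s"
    using s by (auto simp: \<delta>_def power2_eq_square mult_left_le)
  \<comment> \<open>The deviation level is \<open>t = c2 * (nn * r)\<close>; it enters twice at the
    centre and \<open>3 / \<theta>\<close> times through the process, and this total is to be an
    eighth of the drift.\<close>
  define c2 where "c2 = c0 / 8 / (2 + 3 / \<theta>)"
  have c2: "0 < c2" "c2 * (2 + 3 / \<theta>) = c0 / 8"
  proof -
    have "0 < 2 + 3 / \<theta>" using \<theta> by (simp add: add_pos_pos)
    moreover have "c0 / 8 / x * x = c0 / 8" if "0 < x" for x using that by simp
    ultimately show "0 < c2" "c2 * (2 + 3 / \<theta>) = c0 / 8" unfolding c2_def using c0 by (auto simp del: times_divide_eq_left divide_divide_eq_left)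
  qed
  define H where "H = net_rate Cs \<delta>"
  show ?thesis
  proof (rule exI[of _ "c0 / 2"], intro conjI allI impI)
    show "0 < c0 / 2" using c0 by simp
    fix \<epsilon> :: real assume \<epsilon>: "0 < \<epsilon>"
    define Y where "Y = 8 * (4 * Cs + 5 * \<kappa>) / (\<theta> * c0)"
    have Y: "0 \<le> Y" unfolding Y_def using Cs \<kappa> \<theta> c0 by auto
    \<comment> \<open>The quotient lets \<open>t\<close> beat both the entropy \<open>H * d\<close>
      of the net and \<open>ln (3 / \<epsilon>)\<close>. The square of \<open>Y\<close> makes the
      cost of smoothing, of order \<open>1 / sqrt K\<close>, an eighth of \<open>c0\<close>.\<close>
    define K0 where "K0 = max 1 (max ((\<bar>H\<bar> + \<bar>ln (3 / \<epsilon>)\<bar>) / c2) (Y\<^sup>2))"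
    show "\<exists>K0\<ge>1. \<forall>K\<ge>K0. \<forall>n nn lam d. 0 < nn \<longrightarrow> 1 \<le> d \<longrightarrow> 0 < lam \<longrightarrow>
      (\<forall>l\<in>{1..m}. 1 \<le> n l \<and> nn \<le> real (n l)) \<longrightarrow> effective_dim_le lam d \<longrightarrow>
      (\<exists>E\<in>events. 1 - \<epsilon> \<le> prob E \<and> (\<forall>\<omega>\<in>E. \<forall>c\<in>\<C>. lincomb b c \<in> N \<longrightarrow>
        K * (d / nn + lam) / 4 \<le> W (lincomb b c) \<longrightarrow> energy lam c \<le> Cs * (K * (d / nn + lam)) \<longrightarrow>
        (\<Sum>l=1..m. 1 / real (n l) * (\<Sum>k=1..n l. g l (lincomb b c) (X l k \<omega>) - A l (lincomb b c)))
          \<le> - (c0 / 2) * (K * (d / nn + lam))))"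
    proof (rule exI[of _ K0], intro conjI allI impI)
      show "1 \<le> K0" by (simp add: K0_def)
      fix K nn lam d :: real and n :: "nat \<Rightarrow> nat"
      assume K: "K0 \<le> K" and nn: "0 < nn" and d: "1 \<le> d" and lam: "0 < lam"
        and n: "\<forall>l\<in>{1..m}. 1 \<le> n l \<and> nn \<le> real (n l)" and dim: "effective_dim_le lam d"
      define r where "r = K * (d / nn + lam)"
      have K': "1 \<le> K" "\<bar>H\<bar> + \<bar>ln (3 / \<epsilon>)\<bar> \<le> c2 * K" "Y \<le> sqrt K"
      proof -
        show "1 \<le> K" using K by (simp add: K0_def)
        have "(\<bar>H\<bar> + \<bar>ln (3 / \<epsilon>)\<bar>) / c2 \<le> K" using K by (simp add: K0_def)
        then show "\<bar>H\<bar> + \<bar>ln (3 / \<epsilon>)\<bar> \<le> c2 * K" using c2(1) by (simp add: divide_le_eq mult.commute)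
        have "Y\<^sup>2 \<le> K" using K by (simp add: K0_def)
        then show "Y \<le> sqrt K" by (rule real_le_rsqrt)
      qed
      have r: "0 < r" unfolding r_def using K' d nn lam by (auto intro!: mult_pos_pos add_pos_pos)
      have nr: "K * d \<le> nn * r" unfolding r_def using K' nn lam by (simp add: distrib_left)
      define t where "t = c2 * (nn * r)"
      define T where "T = {c \<in> \<C>. lincomb b c \<in> N \<and> r / 4 \<le> W (lincomb b c) \<and> energy lam c \<le> Cs * r}"
      obtain rep where rep: "\<And>c. c \<in> T \<Longrightarrow> rep c \<in> T" "finite (rep ` T)"
        "real (card (rep ` T)) \<le> exp (H * d)"
        "\<And>c F. c \<in> T \<Longrightarrow> finite F \<Longrightarrow> {i. c i \<noteq> 0} \<subseteq> F \<Longrightarrow> {i. rep c i \<noteq> 0} \<subseteq> F \<Longrightarrow>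
          (\<Sum>i\<in>F. (c i - rep c i)\<^sup>2) \<le> \<delta> * r"
        unfolding H_def
        by (rule energy_ball_net[OF lam dim d \<delta>(1) Cs r, of T]) (use C(2) in \<open>auto simp: T_def\<close>)
      \<comment> \<open>Smoothing scale that balances two costs. The variance of the signs gives
        \<open>nn * (\<Sum>i\<in>F. (\<sigma> i)\<^sup>2) \<le> a * d = nn * r / sqrt K\<close>, and
        the entropy gives at most \<open>4 * Cs * d * sqrt K\<close>, which
        \<open>K * d \<le> nn * r\<close> turns into the same order.\<close>
      define a where "a = nn * r / (sqrt K * d)"
      have a: "0 < a" unfolding a_def using nn r K' d by (intro divide_pos_pos mult_pos_pos) auto
      define \<sigma> where "\<sigma> = (\<lambda>i. sqrt (a / (nn * (1 + lam * \<rho> i))))"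
      have wpos: "0 < 1 + lam * \<rho> i" for i using lam \<rho>_nonneg[of i] by (simp add: add_pos_nonneg)
      have \<sigma>: "0 < \<sigma> i" "(\<sigma> i)\<^sup>2 = a / nn * (1 / (1 + lam * \<rho> i))" for i
        unfolding \<sigma>_def using a nn wpos[of i] by (auto simp: less_imp_le)
      have \<sigma>sum: "nn * (\<Sum>i\<in>F. (\<sigma> i)\<^sup>2) \<le> nn * r / sqrt K" if "finite F" for F
      proof -
        have "nn * (\<Sum>i\<in>F. (\<sigma> i)\<^sup>2) = a * (\<Sum>i\<in>F. 1 / (1 + lam * \<rho> i))"
          using nn by (simp add: \<sigma>(2) sum_distrib_left)
        also have "\<dots> \<le> a * d" using dim that a by (intro mult_left_mono) (auto simp: effective_dim_le_def)
        also have "\<dots> = nn * r / sqrt K" using d K' by (simp add: a_def)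
        finally show ?thesis .
      qed
      define R where "R = 4 * Cs * (nn * r) / sqrt K"
      have R: "0 \<le> R" unfolding R_def using Cs nn r K' by auto
      define F where "F = (\<lambda>j. F_upto j :: 'i set)"
      have F: "finite (F j)" for j by (simp add: F_def finite_F_upto)
      let ?L1 = "\<lambda>p \<omega>. (\<Sum>l=1..m. nn / real (n l) * (\<Sum>k=1..n l. g l p (X l k \<omega>) - A l p))"
      let ?L2 = "\<lambda>p F w \<omega>. (\<Sum>l=1..m. nn / real (n l) * (\<Sum>k=1..n l. min (\<Sum>i\<in>F. w i * (\<theta> * D l p (b i) (X l k \<omega>))) (1/2)))"
      define good where "good = (\<lambda>c' j \<omega>. ?L1 (lincomb b c') \<omega> \<le> - (2 * nn * cB * W (lincomb b c')) + 2 * t \<and>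
          (\<forall>w. (\<Sum>i\<in>F j. (w i / \<sigma> i)\<^sup>2) \<le> R \<longrightarrow>
            (\<forall>l\<in>{1..m}. \<forall>k\<in>{1..n l}. -1/2 \<le> (\<Sum>i\<in>F j. w i * (\<theta> * D l (lincomb b c') (b i) (X l k \<omega>)))) \<longrightarrow>
            ?L2 (lincomb b c') (F j) w \<omega> \<le> R + nn * \<kappa> * (\<Sum>i\<in>F j. (w i)\<^sup>2) + 5 * nn * \<kappa> * (\<Sum>i\<in>F j. (\<sigma> i)\<^sup>2) + 3 * t))"
      have "\<exists>E. E \<in> events \<and> 1 - 3 * exp (- t) \<le> prob E \<and> (\<forall>\<omega>\<in>E. good c' j \<omega>)" if "c' \<in> T" for c' j
      proof -
        have p: "lincomb b c' \<in> N" using that by (simp add: T_def)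
        have n': "\<And>l. l \<in> {1..m} \<Longrightarrow> nn \<le> real (n l) \<and> 1 \<le> n l" using n by auto
        show ?thesis
        proof (rule center_event[where p = "lincomb b c'" and F = "F j" and \<sigma> = \<sigma> and nn = nn and n = n and cB = cB and R = R
              and \<theta> = \<theta> and t = t])
          show "lincomb b c' \<in> N" "finite (F j)" "0 \<le> nn" "0 \<le> R" by (fact p F less_imp_le[OF nn] R)+
          show "0 < \<sigma> i" for i by (rule \<sigma>(1))
          show "nn \<le> real (n l) \<and> 1 \<le> n l" if "l \<in> {1..m}" for l by (rule n'[OF that])
          show "cB * W (lincomb b c') \<le> (\<Sum>l=1..m. exp (- B) / 8 * (LINT x|Q l. (g l (lincomb b c') x)\<^sup>2))"
            by (rule cB(2)[OF p])
        next
          fix E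
          assume E: "E \<in> events" "1 - 3 * exp (- t) \<le> prob E"
            and E1: "\<And>\<omega>. \<omega> \<in> E \<Longrightarrow> ?L1 (lincomb b c') \<omega> \<le> - (2 * nn * cB * W (lincomb b c')) + 2 * t"
            and E2: "\<And>\<omega> c. \<omega> \<in> E \<Longrightarrow> (\<Sum>i\<in>F j. (c i / \<sigma> i)\<^sup>2) \<le> R \<Longrightarrow>
              (\<And>l k. l \<in> {1..m} \<Longrightarrow> k \<in> {1..n l} \<Longrightarrow> -1/2 \<le> (\<Sum>i\<in>F j. c i * (\<theta> * D l (lincomb b c') (b i) (X l k \<omega>)))) \<Longrightarrow>
              ?L2 (lincomb b c') (F j) c \<omega> \<le> R + nn * (\<theta>\<^sup>2 * C2 * Cw) * (\<Sum>i\<in>F j. (c i)\<^sup>2) + 5 * nn * (\<theta>\<^sup>2 * C2 * Cw) * (\<Sum>i\<in>F j. (\<sigma> i)\<^sup>2) + 3 * t"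
          have "good c' j \<omega>" if "\<omega> \<in> E" for \<omega>
            unfolding good_def \<kappa>_def using E1[OF that] E2[OF that] by blast
          with E show "\<exists>E. E \<in> events \<and> 1 - 3 * exp (- t) \<le> prob E \<and> (\<forall>\<omega>\<in>E. good c' j \<omega>)" by blast
        qed
      qed
      then obtain EV where EV: "\<And>c' j. c' \<in> T \<Longrightarrow> EV c' j \<in> events" "\<And>c' j. c' \<in> T \<Longrightarrow> 1 - 3 * exp (- t) \<le> prob (EV c' j)"
        "\<And>c' j \<omega>. c' \<in> T \<Longrightarrow> \<omega> \<in> EV c' j \<Longrightarrow> good c' j \<omega>"
        by metis
      \<comment> \<open>Union bound over the finitely many centres, for each finite coordinate set
        separately; the limit superior over these sets comes afterwards.\<close>
      define AA where "AA = (\<lambda>j. (\<Inter>c'\<in>rep ` T. EV c' j) \<inter> space P)"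
      have repT: "c' \<in> T" if "c' \<in> rep ` T" for c' using that rep(1) by auto
      have AA: "AA j \<in> events" "1 - \<epsilon> \<le> prob (AA j)" for j
      proof -
        note I = prob_finite_Int_ge[OF rep(2), where A = "\<lambda>c'. EV c' j" and \<epsilon> = "3 * exp (- t)", OF EV(1)[OF repT] EV(2)[OF repT]]
        show "AA j \<in> events" unfolding AA_def by (rule I(1))
        have "real (card (rep ` T)) * (3 * exp (- t)) \<le> exp (H * d) * (3 * exp (- t))"
          using rep(3) by (intro mult_right_mono) auto
        also have "\<dots> = 3 * exp (H * d - t)" by (simp add: exp_diff exp_minus field_simps)
        also have "\<dots> \<le> 3 * exp (- ln (3 / \<epsilon>))"
        proof -
          have "c2 * (K * d) \<le> t" unfolding t_def using nr c2(1) by (intro mult_left_mono) auto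
          moreover have "(\<bar>H\<bar> + \<bar>ln (3 / \<epsilon>)\<bar>) * d \<le> (c2 * K) * d" using K'(2) d by (intro mult_right_mono) auto
          moreover have "H * d \<le> \<bar>H\<bar> * d" using d by (intro mult_right_mono) auto
          moreover have "\<bar>ln (3 / \<epsilon>)\<bar> * 1 \<le> \<bar>ln (3 / \<epsilon>)\<bar> * d" using d by (intro mult_left_mono) auto
          ultimately have "H * d - t \<le> - \<bar>ln (3 / \<epsilon>)\<bar>" unfolding distrib_right mult.assoc by linarith
          then have "H * d - t \<le> - ln (3 / \<epsilon>)" by linarith
          then show ?thesis by simp
        qed
        also have "\<dots> = \<epsilon>" using \<epsilon> by (simp add: exp_minus)
        finally show "1 - \<epsilon> \<le> prob (AA j)" using I(2) unfolding AA_def by linarith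
      qed
      note lim = prob_frequently_ge[where A = AA and c = "1 - \<epsilon>", OF AA]
      obtain G where G: "G \<in> events" "prob G = 1"
        "\<And>\<omega> l k c c'. \<omega> \<in> G \<Longrightarrow> l \<in> {1..m} \<Longrightarrow> 1 \<le> k \<Longrightarrow> c \<in> \<C> \<Longrightarrow> c' \<in> \<C> \<Longrightarrow>
          lincomb b c \<in> N \<Longrightarrow> lincomb b c' \<in> N \<Longrightarrow>
          \<bar>g l (lincomb b c) (X l k \<omega>) - g l (lincomb b c') (X l k \<omega>)\<bar> \<le> 4 * B \<and>
          g l (lincomb b c) (X l k \<omega>) - g l (lincomb b c') (X l k \<omega>) \<le>
            (\<Sum>i | c i - c' i \<noteq> 0. (c i - c' i) * D l (lincomb b c') (b i) (X l k \<omega>)) +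
            lin_const * (sqrt (W (lincomb b c')) * sqrt (W (lincomb b c - lincomb b c')) + W (lincomb b c - lincomb b c'))"
        by (rule sample_linearization[OF C]) (assumption | rule that)+
      let ?E = "(\<Inter>i. \<Union>j\<in>{i..}. AA j) \<inter> G"
      show "\<exists>E\<in>events. 1 - \<epsilon> \<le> prob E \<and> (\<forall>\<omega>\<in>E. \<forall>c\<in>\<C>. lincomb b c \<in> N \<longrightarrow>
        K * (d / nn + lam) / 4 \<le> W (lincomb b c) \<longrightarrow> energy lam c \<le> Cs * (K * (d / nn + lam)) \<longrightarrow>
        (\<Sum>l=1..m. 1 / real (n l) * (\<Sum>k=1..n l. g l (lincomb b c) (X l k \<omega>) - A l (lincomb b c)))
          \<le> - (c0 / 2) * (K * (d / nn + lam)))"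
        unfolding r_def[symmetric]
      proof (intro bexI[of _ ?E] conjI ballI impI)
        show "?E \<in> events" using lim(1) G(1) by (rule sets.Int)
        show "1 - \<epsilon> \<le> prob ?E" using prob_Int_ge[OF lim(1) G(1)] lim(2) G(2) by linarith
        fix \<omega> c
        assume \<omega>: "\<omega> \<in> ?E" and c: "c \<in> \<C>" and v: "lincomb b c \<in> N" "r / 4 \<le> W (lincomb b c)" "energy lam c \<le> Cs * r"
        have cT: "c \<in> T" using c v by (simp add: T_def)
        define c' where "c' = rep c"
        define p where "p = lincomb b c'"
        define u where "u = lincomb b c"
        define w where "w = (\<lambda>i. c i - c' i)"
        have c'T: "c' \<in> T" using rep(1)[OF cT] by (simp add: c'_def)
        have c'C: "c' \<in> \<C>" "energy lam c' \<le> Cs * r" and p: "p \<in> N" "r / 4 \<le> W p" using c'T by (auto simp: T_def p_def)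
        have u: "u \<in> N" "r / 4 \<le> W u" using v by (auto simp: u_def)
        have fs: "finite {i. c i \<noteq> 0}" "finite {i. c' i \<noteq> 0}" using C(2)[OF c] C(2)[OF c'C(1)] by (auto simp: finite_support_def)
        obtain j0 where j0: "{i. c i \<noteq> 0} \<union> {i. c' i \<noteq> 0} \<subseteq> F_upto j0"
          using F_upto_covers[of "{i. c i \<noteq> 0} \<union> {i. c' i \<noteq> 0}"] fs by auto
        obtain j where j: "j0 \<le> j" "\<omega> \<in> AA j" using \<omega> by auto
        have sup: "{i. c i \<noteq> 0} \<subseteq> F j" "{i. c' i \<noteq> 0} \<subseteq> F j" "{i. w i \<noteq> 0} \<subseteq> F j"
        proof -
          show 1: "{i. c i \<noteq> 0} \<subseteq> F j" "{i. c' i \<noteq> 0} \<subseteq> F j"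
            using j0 F_upto_mono[OF j(1)] by (auto simp: F_def)
          have "{i. w i \<noteq> 0} \<subseteq> {i. c i \<noteq> 0} \<union> {i. c' i \<noteq> 0}" by (auto simp: w_def)
          then show "{i. w i \<noteq> 0} \<subseteq> F j" using 1 by blast
        qed
        have gd: "good c' j \<omega>" using j(2) cT by (intro EV(3)[OF c'T]) (auto simp: AA_def c'_def)
        have w2: "(\<Sum>i\<in>F j. (w i)\<^sup>2) \<le> \<delta> * r"
          unfolding w_def c'_def by (rule rep(4)[OF cT F sup(1) sup(2)[unfolded c'_def]])
        have upw: "u - p = (\<Sum>i\<in>F j. w i *\<^sub>R b i)"
          unfolding u_def p_def lincomb_eq[OF F sup(1)] lincomb_eq[OF F sup(2)] w_def
          by (simp add: scaleR_left_diff_distrib sum_subtractf)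
        have Wd: "W (u - p) \<le> Cw * (\<delta> * r)"
          unfolding upw using W_coef(2)[OF F[of j], of w] mult_left_mono[OF w2 less_imp_le[OF cw(2)]] by (rule order_trans)
        have Wp: "W p \<le> Cw * (Cs * r)"
        proof -
          have "(\<Sum>i\<in>F j. (c' i)\<^sup>2) \<le> (\<Sum>i\<in>F j. (1 + lam * \<rho> i) * (c' i)\<^sup>2)"
            using lam \<rho>_nonneg by (intro sum_mono) (simp add: distrib_right)
          then have "(\<Sum>i\<in>F j. (c' i)\<^sup>2) \<le> Cs * r" using c'C(2) energy_eq[OF F sup(2), of lam] by simp
          then show ?thesis
            unfolding p_def lincomb_eq[OF F sup(2)]
            using W_coef(2)[OF F[of j], of c'] mult_left_mono[OF _ less_imp_le[OF cw(2)]] by (blast intro: order_trans)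
        qed
        have sqrts: "sqrt (W p) * sqrt (W (u - p)) \<le> Cw * sqrt Cs * s * r"
        proof -
          have "sqrt (W p) * sqrt (W (u - p)) \<le> sqrt (Cw * (Cs * r)) * sqrt (Cw * (\<delta> * r))"
            using W_nonneg cw Cs r by (intro mult_mono real_sqrt_le_mono Wp Wd) auto
          also have "\<dots> = Cw * sqrt Cs * s * r"
            using cw r by (simp add: real_sqrt_mult \<delta>(3) mult_ac)
          finally show ?thesis .
        qed
        have Wd': "W (u - p) \<le> Cw * s * r"
        proof -
          have "Cw * (\<delta> * r) \<le> Cw * (s * r)" using \<delta>(2) cw r by (intro mult_left_mono mult_right_mono) auto
          then show ?thesis using Wd by (simp add: mult.assoc)
        qed
        have tot: "sqrt (W p) * sqrt (W (u - p)) + W (u - p) \<le> U * s * r"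
          using sqrts Wd' by (simp add: U_def algebra_simps)
        define err where "err = lin_const * (sqrt (W p) * sqrt (W (u - p)) + W (u - p))"
        have err0: "0 \<le> err" unfolding err_def using lin_const_nonneg W_nonneg by (intro mult_nonneg_nonneg add_nonneg_nonneg) auto
        have err1: "err \<le> lin_const * U * s * r"
          unfolding err_def using mult_left_mono[OF tot lin_const_nonneg] by (simp add: mult.assoc)
        have r4: "r \<le> 4 * WB" using u WB(2)[OF u(1)] by linarith
        have err2: "err \<le> 4 * WB"
        proof -
          have "lin_const * U * s \<le> L * s" using s(1) by (intro mult_right_mono L(2)) auto
          then have "lin_const * U * s \<le> 1" using s(3) by (simp only: mult.commute[of L])
          then have "(lin_const * U * s) * r \<le> 1 * r" using r by (intro mult_right_mono) auto
          then show ?thesis using err1 r4 by linarith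
        qed
        define Dw where "Dw = (\<lambda>l k. \<Sum>i\<in>F j. w i * D l p (b i) (X l k \<omega>))"
        have lin: "\<bar>g l u (X l k \<omega>) - g l p (X l k \<omega>)\<bar> \<le> 4 * B" "g l u (X l k \<omega>) - g l p (X l k \<omega>) \<le> Dw l k + err"
          if l: "l \<in> {1..m}" and k: "k \<in> {1..n l}" for l k
        proof -
          have "Dw l k = (\<Sum>i | c i - c' i \<noteq> 0. (c i - c' i) * D l p (b i) (X l k \<omega>))"
            unfolding Dw_def w_def by (rule sum_support_eq[symmetric, OF F]) (use sup(3) in \<open>auto simp: w_def\<close>)
          then show "\<bar>g l u (X l k \<omega>) - g l p (X l k \<omega>)\<bar> \<le> 4 * B" "g l u (X l k \<omega>) - g l p (X l k \<omega>) \<le> Dw l k + err"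
            using G(3)[of \<omega> l k c c'] \<omega> l k c c'C(1) v(1) p(1) unfolding err_def u_def p_def by auto
        qed
        have wD: "(\<Sum>i\<in>F j. w i * (\<theta> * D l p (b i) (X l k \<omega>))) = \<theta> * Dw l k" for l k
          unfolding Dw_def by (simp add: sum_distrib_left mult_ac)
        \<comment> \<open>The linearization read backwards: a bounded increment keeps
          \<open>Dw\<close> from being too negative, which is the side condition of the clipped
          process bound.\<close>
        have low: "-1/2 \<le> \<theta> * Dw l k" if "l \<in> {1..m}" "k \<in> {1..n l}" for l k
        proof -
          have "- (4 * B + 4 * WB + 1) \<le> Dw l k" using lin[OF that] err2 by linarith
          then have "\<theta> * (- (4 * B + 4 * WB + 1)) \<le> \<theta> * Dw l k" using \<theta> by (intro mult_left_mono) auto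
          moreover have "\<theta> * (- (4 * B + 4 * WB + 1)) = -1/2"
            unfolding \<theta>_def using const_pos WB(1) by (simp add: field_simps)
          ultimately show ?thesis by linarith
        qed
        \<comment> \<open>Where the clipping acts, \<open>1 / \<theta>\<close> times one half is
          already larger than any possible increment, so nothing is lost.\<close>
        have up: "g l u (X l k \<omega>) - g l p (X l k \<omega>) \<le> 1 / \<theta> * min (\<theta> * Dw l k) (1/2) + err"
          if "l \<in> {1..m}" "k \<in> {1..n l}" for l k
        proof (cases "\<theta> * Dw l k \<le> 1/2")
          case True
          then show ?thesis using lin(2)[OF that] \<theta> by simp
        next
          case False
          then have "1 / \<theta> * min (\<theta> * Dw l k) (1/2) = 4 * B + 4 * WB + 1" unfolding \<theta>' by simp
          then show ?thesis using lin(1)[OF that] err0 WB(1) by linarith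
        qed
        have wR: "(\<Sum>i\<in>F j. (w i / \<sigma> i)\<^sup>2) \<le> R"
        proof -
          have "(\<Sum>i\<in>F j. (w i / \<sigma> i)\<^sup>2) \<le> (\<Sum>i\<in>F j. 2 * nn / a * ((1 + lam * \<rho> i) * (c i)\<^sup>2 + (1 + lam * \<rho> i) * (c' i)\<^sup>2))"
          proof (rule sum_mono)
            fix i
            have "(w i / \<sigma> i)\<^sup>2 = nn / a * ((1 + lam * \<rho> i) * (w i)\<^sup>2)"
              using a nn wpos[of i] by (simp add: power_divide \<sigma>(2))
            also have "\<dots> \<le> nn / a * ((1 + lam * \<rho> i) * (2 * ((c i)\<^sup>2 + (c' i)\<^sup>2)))"
            proof (intro mult_left_mono)
              show "(w i)\<^sup>2 \<le> 2 * ((c i)\<^sup>2 + (c' i)\<^sup>2)"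
                using zero_le_power2[of "c i + c' i"] by (simp add: w_def power2_eq_square algebra_simps)
            qed (use a nn wpos[of i] in auto)
            finally show "(w i / \<sigma> i)\<^sup>2 \<le> 2 * nn / a * ((1 + lam * \<rho> i) * (c i)\<^sup>2 + (1 + lam * \<rho> i) * (c' i)\<^sup>2)"
              by (simp add: distrib_left mult_ac)
          qed
          also have "\<dots> = 2 * nn / a * (energy lam c + energy lam c')"
            unfolding energy_eq[OF F sup(1)] energy_eq[OF F sup(2)] by (simp only: sum.distrib sum_distrib_left[symmetric])
          also have "\<dots> \<le> 2 * nn / a * (Cs * r + Cs * r)"
            using a nn v(3) c'C(2) by (intro mult_left_mono add_mono) auto
          also have "\<dots> = 4 * Cs * d * sqrt K"
            unfolding a_def using nn r K' d by (simp add: field_simps)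
          also have "\<dots> \<le> R"
          proof -
            have "4 * Cs * (K * d) \<le> 4 * Cs * (nn * r)" using nr Cs by (intro mult_left_mono) auto
            then have "4 * Cs * (K * d) / sqrt K \<le> R" unfolding R_def using K' by (intro divide_right_mono) auto
            moreover have "4 * Cs * (K * d) / sqrt K = 4 * Cs * d * sqrt K"
            proof -
              have "K / sqrt K = sqrt K" using K'(1) by (simp add: real_div_sqrt)
              moreover have "4 * Cs * (K * d) / sqrt K = 4 * Cs * d * (K / sqrt K)" by simp
              ultimately show ?thesis by simp
            qed
            ultimately show ?thesis by simp
          qed
          finally show ?thesis .
        qed
        have g1: "?L1 p \<omega> \<le> - (2 * nn * cB * W p) + 2 * t" using gd by (simp add: good_def p_def)
        have g2: "(\<Sum>l=1..m. nn / real (n l) * (\<Sum>k=1..n l. min (\<theta> * Dw l k) (1/2))) \<le>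
            R + nn * \<kappa> * (\<Sum>i\<in>F j. (w i)\<^sup>2) + 5 * nn * \<kappa> * (\<Sum>i\<in>F j. (\<sigma> i)\<^sup>2) + 3 * t"
          using gd[unfolded good_def, folded p_def, THEN conjunct2, rule_format, of w] wR low unfolding wD by blast
        have "?L1 u \<omega> \<le> (\<Sum>l=1..m. nn / real (n l) * (\<Sum>k=1..n l. (g l p (X l k \<omega>) - A l p) +
            (1 / \<theta> * min (\<theta> * Dw l k) (1/2) + err + (A l p - A l u))))"
        proof (intro sum_mono mult_left_mono)
          fix l k assume "l \<in> {1..m}" "k \<in> {1..n l}"
          from up[OF this] show "g l u (X l k \<omega>) - A l u \<le> (g l p (X l k \<omega>) - A l p) +
            (1 / \<theta> * min (\<theta> * Dw l k) (1/2) + err + (A l p - A l u))" by linarith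
        qed (use nn in auto)
        also have "\<dots> = ?L1 p \<omega> + 1 / \<theta> * (\<Sum>l=1..m. nn / real (n l) * (\<Sum>k=1..n l. min (\<theta> * Dw l k) (1/2))) +
            (\<Sum>l=1..m. nn * (err + (A l p - A l u)))"
        proof -
          have "nn / real (n l) * (\<Sum>k=1..n l. (g l p (X l k \<omega>) - A l p) + (1 / \<theta> * min (\<theta> * Dw l k) (1/2) + err + (A l p - A l u))) =
            nn / real (n l) * (\<Sum>k=1..n l. g l p (X l k \<omega>) - A l p) +
            1 / \<theta> * (nn / real (n l) * (\<Sum>k=1..n l. min (\<theta> * Dw l k) (1/2))) + nn * (err + (A l p - A l u))" if "l \<in> {1..m}" for l
          proof -
            have nl: "real (n l) \<noteq> 0" using n that by fastforce
            have "(\<Sum>k=1..n l. (g l p (X l k \<omega>) - A l p) + (1 / \<theta> * min (\<theta> * Dw l k) (1/2) + err + (A l p - A l u))) =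
              (\<Sum>k=1..n l. g l p (X l k \<omega>) - A l p) + (1 / \<theta> * (\<Sum>k=1..n l. min (\<theta> * Dw l k) (1/2)) + real (n l) * (err + (A l p - A l u)))"
            proof -
              have "(\<Sum>k=1..n l. x k + (q * y k + e1 + e2)) = (\<Sum>k=1..n l. x k) + (q * (\<Sum>k=1..n l. y k) + real (n l) * (e1 + e2))"
                for x y :: "nat \<Rightarrow> real" and q e1 e2
                by (simp add: sum.distrib sum_distrib_left distrib_left)
              then show ?thesis .
            qed
            then show ?thesis using nl by (simp add: distrib_left)
          qed
          then show ?thesis by (simp only: sum.distrib sum_distrib_left[symmetric] cong: sum.cong)
        qed
        also have "(\<Sum>l=1..m. nn * (err + (A l p - A l u))) \<le> nn * (real m * (lin_const + tilt_const) * U * s * r)"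
        proof -
          have "err + (A l p - A l u) \<le> (lin_const + tilt_const) * U * s * r" if "l \<in> {1..m}" for l
          proof -
            have "A l p - A l u \<le> tilt_const * (sqrt (W p) * sqrt (W (u - p)))" by (rule A_decrement_bound[OF that p(1) u(1)])
            also have "\<dots> \<le> tilt_const * (U * s * r)"
              using tot W_nonneg[of "u - p"] by (intro mult_left_mono tilt_const_nonneg) linarith
            finally show ?thesis using err1 by (simp add: algebra_simps)
          qed
          then have "(\<Sum>l=1..m. nn * (err + (A l p - A l u))) \<le> (\<Sum>l=1..m. nn * ((lin_const + tilt_const) * U * s * r))"
            using nn by (intro sum_mono mult_left_mono) auto
          then show ?thesis by (simp add: mult_ac)
        qed
        also have "\<dots> \<le> nn * (c0 / 8 * r)"
        proof -
          have "real m * (lin_const + tilt_const) * U * s \<le> L * s" using s(1) by (intro mult_right_mono L(1)) auto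
          then have "real m * (lin_const + tilt_const) * U * s \<le> c0 / 8" using s(4) by (simp only: mult.commute[of L])
          then show ?thesis using nn r by (intro mult_left_mono mult_right_mono) auto
        qed
        also have "1 / \<theta> * (\<Sum>l=1..m. nn / real (n l) * (\<Sum>k=1..n l. min (\<theta> * Dw l k) (1/2))) \<le> 1 / \<theta> * (R + nn * \<kappa> * (\<delta> * r) + 5 * \<kappa> * (nn * r / sqrt K) + 3 * t)"
        proof (rule mult_left_mono)
          have "nn * \<kappa> * (\<Sum>i\<in>F j. (w i)\<^sup>2) \<le> nn * \<kappa> * (\<delta> * r)" using w2 nn \<kappa> by (intro mult_left_mono) auto
          moreover have "5 * nn * \<kappa> * (\<Sum>i\<in>F j. (\<sigma> i)\<^sup>2) \<le> 5 * \<kappa> * (nn * r / sqrt K)"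
            using mult_left_mono[OF \<sigma>sum[OF F[of j]], of "5 * \<kappa>"] \<kappa> by (simp add: mult_ac)
          ultimately show "(\<Sum>l=1..m. nn / real (n l) * (\<Sum>k=1..n l. min (\<theta> * Dw l k) (1/2))) \<le> R + nn * \<kappa> * (\<delta> * r) + 5 * \<kappa> * (nn * r / sqrt K) + 3 * t"
            using g2 by linarith
        qed (use \<theta> in auto)
        also have "?L1 p \<omega> \<le> - (nn * (c0 * r)) + 2 * t"
        proof -
          have "2 * nn * cB * (r / 4) \<le> 2 * nn * cB * W p" using p(2) nn cB(1) by (intro mult_left_mono) auto
          moreover have "2 * nn * cB * (r / 4) = nn * (c0 * r)" by (simp add: c0_def)
          ultimately show ?thesis using g1 by linarith
        qed
        finally have "?L1 u \<omega> \<le> - (nn * (c0 * r)) + 2 * t +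
            1 / \<theta> * (R + nn * \<kappa> * (\<delta> * r) + 5 * \<kappa> * (nn * r / sqrt K) + 3 * t) + nn * (c0 / 8 * r)" by linarith
        also have "\<dots> = nn * r * (- c0 + c2 * (2 + 3 / \<theta>) + (4 * Cs + 5 * \<kappa>) / \<theta> / sqrt K + \<kappa> / \<theta> * \<delta> + c0 / 8)"
          unfolding t_def R_def by (simp add: algebra_simps add_divide_distrib)
        \<comment> \<open>Four eighths of \<open>c0\<close> are spent and half of it is
          left.\<close>
        also have "\<dots> \<le> nn * r * (- c0 + c0 / 8 + c0 / 8 + c0 / 8 + c0 / 8)"
        proof (intro mult_left_mono add_mono order_refl)
          show "c2 * (2 + 3 / \<theta>) \<le> c0 / 8" using c2(2) by simp
          have sK: "0 < sqrt K" using K' by simp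
          have "(4 * Cs + 5 * \<kappa>) / \<theta> = Y * c0 / 8" 
          proof -
            have "8 * x / (\<theta> * c0) * c0 / 8 = x / \<theta>" for x using \<theta> c0 by (simp add: field_simps)
            from this[of "4 * Cs + 5 * \<kappa>"] show ?thesis unfolding Y_def by (rule sym)
          qed
          also have "\<dots> \<le> sqrt K * c0 / 8" using K'(3) c0 by (intro divide_right_mono mult_right_mono) auto
          finally have "(4 * Cs + 5 * \<kappa>) / \<theta> \<le> c0 / 8 * sqrt K" by (simp add: mult.commute)
          then show "(4 * Cs + 5 * \<kappa>) / \<theta> / sqrt K \<le> c0 / 8" by (simp only: pos_divide_le_eq[OF sK])
          have "\<kappa> / \<theta> * \<delta> \<le> L * s" using L(3,4) \<delta> \<kappa> \<theta> by (intro mult_mono) auto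
          then show "\<kappa> / \<theta> * \<delta> \<le> c0 / 8" using s(4) by (simp only: mult.commute[of L])
        qed (use nn r in auto)
        also have "\<dots> = nn * (- (c0 / 2) * r)" by simp
        finally have fin: "?L1 u \<omega> \<le> nn * (- (c0 / 2) * r)" .
        have "?L1 u \<omega> = nn * (\<Sum>l=1..m. 1 / real (n l) * (\<Sum>k=1..n l. g l u (X l k \<omega>) - A l u))"
          by (simp add: sum_distrib_left)
        then show "(\<Sum>l=1..m. 1 / real (n l) * (\<Sum>k=1..n l. g l (lincomb b c) (X l k \<omega>) - A l (lincomb b c))) \<le> - (c0 / 2) * r"
          using fin unfolding u_def[symmetric] by (simp only: mult_le_cancel_left_pos[OF nn])
      qed
    qed
  qed
qed

end

section \<open>Bounded density ratios from comparable variances; partial derivatives at a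
  point\<close>

section \<open>Density ratios and point derivatives\<close>

lemma L2_0D:
  assumes "f \<in> L2_0 P"
  shows "f \<in> borel_measurable P" "integrable P (\<lambda>x. (f x)\<^sup>2)" "(LINT x|P. f x) = 0"
  using assms by (auto simp: L2_0_def L2_def)

lemma L2_bounded_linearD:
  assumes "L2_bounded_linear P T"
  shows "T v \<in> L2_0 P" "AE x in P. T (u + v) x = T u x + T v x" "AE x in P. T (c *\<^sub>R v) x = c * T v x"
  using assms by (auto simp: L2_bounded_linear_def)

lemma cov_L2_0: "f \<in> L2_0 P \<Longrightarrow> cov P f h = (LINT x|P. f x * h x)"
  by (simp add: cov_def L2_0_def)

lemma (in prob_space) L2_0_add:
  assumes "f \<in> L2_0 M" "h \<in> L2_0 M"
  shows "(\<lambda>x. f x + h x) \<in> L2_0 M"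
proof -
  note f = L2_0D[OF assms(1)] and h = L2_0D[OF assms(2)]
  note fh = mean_zero_cauchy_schwarz(1)[OF f(1) h(1) f(2) h(2)]
  have "integrable M f" "integrable M h"
    using square_integrable_imp_integrable f h by auto
  moreover have "(f x + h x)\<^sup>2 = (f x)\<^sup>2 + 2 * (f x * h x) + (h x)\<^sup>2" for x by (simp add: power2_eq_square algebra_simps)
  ultimately show ?thesis using f h fh by (auto simp: L2_0_def L2_def)
qed

lemma (in prob_space) indicator_centered_L2_0:
  assumes "E \<in> events"
  shows "(\<lambda>x. indicator E x - prob E) \<in> L2_0 M"
proof -
  have i: "integrable M (indicator E :: 'a \<Rightarrow> real)" using assms by (simp add: integrable_real_indicator emeasure_eq_measure)
  have "(indicator E x - prob E)\<^sup>2 = indicator E x - 2 * prob E * indicator E x + (prob E)\<^sup>2" for x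
    by (simp add: power2_eq_square algebra_simps indicator_def)
  then show ?thesis using i assms by (auto simp: L2_0_def L2_def prob_space Int_absorb2 sets.sets_into_space)
qed

lemma (in prob_space) cov_indicator:
  assumes "E \<in> events"
  shows "cov M (\<lambda>x. indicator E x - c) (\<lambda>x. indicator E x - c) = prob E * (1 - prob E)"
proof -
  have i: "integrable M (indicator E :: 'a \<Rightarrow> real)" using assms by (simp add: integrable_real_indicator emeasure_eq_measure)
  have m: "(\<integral>x. indicator E x \<partial>M) = prob E" using assms by (simp add: Int_absorb2 sets.sets_into_space)
  have sq: "(indicator E x - c) * (indicator E x - c) = indicator E x - 2 * c * indicator E x + c\<^sup>2" for x :: 'a
    by (simp add: power2_eq_square algebra_simps indicator_def)
  have e1: "(\<integral>x. (indicator E x - c) * (indicator E x - c) \<partial>M) = prob E - 2 * c * prob E + c\<^sup>2"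
    unfolding sq using i m by (simp add: prob_space)
  have e2: "(\<integral>x. indicator E x - c \<partial>M) = prob E - c" using i m by (simp add: prob_space)
  show ?thesis unfolding cov_def e1 e2 by (simp add: power2_eq_square algebra_simps)
qed

text \<open>Two-sided comparison of the variances of indicators under a change of measure bounds the density:
  a set on which the density is large is small under the old measure, hence nearly everything under the
  new one, which leaves no variance for a fixed nontrivial set.\<close>

lemma (in prob_space) density_ratio_bounded:
  fixes w :: "'a \<Rightarrow> real"
  assumes w: "w \<in> borel_measurable M" "\<And>x. 0 \<le> w x" "integrable M w" "(\<integral>x. w x \<partial>M) = 1"
    and cmp: "\<And>E. E \<in> events \<Longrightarrow> C3 * (prob E * (1 - prob E)) \<le>
        (\<integral>x. w x * indicator E x \<partial>M) * (1 - (\<integral>x. w x * indicator E x \<partial>M))"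
      "\<And>E. E \<in> events \<Longrightarrow> (\<integral>x. w x * indicator E x \<partial>M) * (1 - (\<integral>x. w x * indicator E x \<partial>M)) \<le>
        C4 * (prob E * (1 - prob E))"
    and G: "G \<in> events" "0 < prob G" "prob G < 1" and pos: "0 < C3" "0 < C4"
    and b2: "b2 = (C3 + C4) / (C3 * (prob G * (1 - prob G))) + 1" and b1: "b1 = 1 / (2 * (1 + b2 / C3))"
  shows "AE x in M. w x \<le> b2" "AE x in M. b1 \<le> w x"
proof -
  define q where "q = (\<lambda>E. \<integral>x. w x * indicator E x \<partial>M)"
  have wi: "integrable M (\<lambda>x. w x * indicator E x)" if "E \<in> events" for E
    using integrable_real_mult_indicator[OF that w(3)] by simp
  have ii: "integrable M (\<lambda>x. c * indicator E x :: real)" if "E \<in> events" for E c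
    using that by (intro integrable_mult_right integrable_real_indicator) (auto simp: emeasure_eq_measure)
  have q0: "0 \<le> q E" for E unfolding q_def using w(2) by (intro integral_nonneg_AE) auto
  have q_mono: "q E \<le> q F" if "E \<in> events" "F \<in> events" "E \<subseteq> F" for E F
    unfolding q_def using wi that w(2) by (intro integral_mono) (auto simp: indicator_def)
  have q_compl: "q (space M - E) = 1 - q E" if E: "E \<in> events" for E
  proof -
    have "q E + q (space M - E) = (\<integral>x. w x * indicator E x + w x * indicator (space M - E) x \<partial>M)"
      unfolding q_def using wi E by (intro Bochner_Integration.integral_add[symmetric]) auto
    also have "\<dots> = (\<integral>x. w x \<partial>M)"
      by (intro Bochner_Integration.integral_cong) (auto simp: indicator_def)
    finally show ?thesis using w(4) by simp
  qed
  have q1: "q E \<le> 1" if "E \<in> events" for E using q_compl[OF that] q0[of "space M - E"] by simp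
  have p1: "prob E \<le> 1" for E by simp
  define \<gamma> where "\<gamma> = prob G * (1 - prob G)"
  have \<gamma>: "0 < \<gamma>" using G by (simp add: \<gamma>_def)
  \<comment> \<open>\<open>b2\<close> is chosen to contradict
    \<open>C3 * \<gamma> * b2 \<le> C3 + C4\<close>, which a nonnull set with
    \<open>w x > b2\<close> would imply.\<close>
  have b2': "0 < b2" "C3 * \<gamma> * b2 > C3 + C4"
    unfolding b2 \<gamma>_def[symmetric] using pos \<gamma> by (auto simp: field_simps add_pos_pos intro!: add_pos_pos)
  let ?E = "{x\<in>space M. b2 < w x}"
  have E: "?E \<in> events" using w(1) by measurable
  have "prob ?E = 0"
  proof (rule ccontr)
    assume ne: "prob ?E \<noteq> 0"
    then have p: "0 < prob ?E" by (simp add: zero_less_measure_iff)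
    have bp: "b2 * prob ?E \<le> q ?E"
    proof -
      have "(\<integral>x. b2 * indicator ?E x \<partial>M) \<le> q ?E"
        unfolding q_def by (intro integral_mono wi[OF E] ii[OF E]) (auto simp: indicator_def)
      then show ?thesis using E by (simp add: Int_absorb2 sets.sets_into_space)
    qed
    have qp: "0 < q ?E" using bp mult_pos_pos[OF b2'(1) p] by linarith
    have pb: "prob ?E \<le> q ?E / b2" using bp b2'(1) by (simp add: le_divide_eq mult.commute)
    have "q ?E * (1 - q ?E) \<le> C4 * (prob ?E * (1 - prob ?E))" unfolding q_def by (rule cmp(2)[OF E])
    also have "\<dots> \<le> C4 * (prob ?E * 1)" using pos by (intro mult_left_mono) auto
    also have "\<dots> \<le> C4 * (q ?E / b2)" using pb pos by (intro mult_left_mono) auto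
    finally have "q ?E * (1 - q ?E) \<le> q ?E * (C4 / b2)" by (simp add: mult.commute)
    then have small: "1 - q ?E \<le> C4 / b2" using qp by (simp only: mult_le_cancel_left_pos)
    let ?F = "space M - ?E" and ?G = "G \<inter> (space M - ?E)"
    have F: "?F \<in> events" "?G \<in> events" using E G by auto
    have "q ?G \<le> C4 / b2" using q_mono[OF F(2,1)] q_compl[OF E] small by auto
    moreover have "C3 * (prob ?G * (1 - prob ?G)) \<le> q ?G * (1 - q ?G)" unfolding q_def by (rule cmp(1)[OF F(2)])
    moreover have "q ?G * (1 - q ?G) \<le> q ?G" using q0[of ?G] by (simp add: mult_left_le)
    ultimately have up: "C3 * (prob ?G * (1 - prob ?G)) \<le> C4 / b2" by linarith
    have pE: "prob ?E \<le> 1 / b2"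
    proof -
      have "q ?E / b2 \<le> 1 / b2" using q1[OF E] b2'(1) by (intro divide_right_mono) auto
      then show ?thesis using pb by linarith
    qed
    \<comment> \<open>Cutting the set of large density out of \<open>G\<close> lowers
      \<open>prob G * (1 - prob G)\<close> by at most the probability of that set, which is at most
      \<open>1 / b2\<close>.\<close>
    have "\<gamma> - 1 / b2 \<le> prob ?G * (1 - prob ?G)"
    proof -
      have le: "prob ?G \<le> prob G" using F G by (intro finite_measure_mono) auto
      have "prob G \<le> prob ?G + prob ?E"
        using finite_measure_mono[of G "?G \<union> ?E"] measure_Un_le[of ?G M ?E] G F E sets.sets_into_space[OF G(1)] by fastforce
      then have ge: "prob G - prob ?G \<le> 1 / b2" using pE by linarith
      have "\<gamma> - prob ?G * (1 - prob ?G) = (prob G - prob ?G) * (1 - prob G - prob ?G)"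
        unfolding \<gamma>_def by (simp add: algebra_simps)
      also have "\<dots> \<le> (prob G - prob ?G) * 1"
        using le measure_nonneg[of M G] measure_nonneg[of M ?G] by (intro mult_left_mono) linarith+
      finally have "\<gamma> - prob ?G * (1 - prob ?G) \<le> prob G - prob ?G" by (simp only: mult_1_right)
      from order_trans[OF this ge] show ?thesis by (simp only: diff_le_eq add.commute)
    qed
    then have "C3 * (\<gamma> - 1 / b2) \<le> C4 / b2" 
      using up pos by (intro order_trans[OF mult_left_mono up]) auto
    then have "(C3 * (\<gamma> - 1 / b2)) * b2 \<le> (C4 / b2) * b2" using b2'(1) by (intro mult_right_mono) auto
    then have "C3 * \<gamma> * b2 \<le> C3 + C4" using b2'(1) by (simp add: algebra_simps)
    then show False using b2'(2) by linarith
  qed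
  then have "AE x in M. x \<notin> ?E" using E by (intro AE_not_in) (simp add: null_sets_def emeasure_eq_measure)
  then show up: "AE x in M. w x \<le> b2" by (rule AE_mp) (auto intro!: AE_I2)
  have b1': "0 < b1" "b1 + b2 * (b1 / C3) = 1/2"
  proof -
    have "0 < 1 + b2 / C3" using b2'(1) pos by (simp add: add_pos_pos)
    moreover have "0 < 1 / (2 * x)" "1 / (2 * x) * x = 1/2" if "0 < x" for x :: real using that by auto
    ultimately have "0 < b1" "b1 * (1 + b2 / C3) = 1/2" unfolding b1 by blast+
    then show "0 < b1" "b1 + b2 * (b1 / C3) = 1/2" by (simp_all add: distrib_left mult.commute)
  qed
  \<comment> \<open>A nonnull set with \<open>w x < b1\<close> would, by the lower comparison, have
    complement of probability at most \<open>b1 / C3\<close>. With \<open>w x \<le> b2\<close> on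
    the complement the total mass of \<open>w\<close> is then at most
    \<open>b1 + b2 * (b1 / C3) = 1/2\<close> instead of 1.\<close>
  let ?E = "{x\<in>space M. w x < b1}"
  have E: "?E \<in> events" using w(1) by measurable
  have "prob ?E = 0"
  proof (rule ccontr)
    assume ne: "prob ?E \<noteq> 0"
    then have p: "0 < prob ?E" by (simp add: zero_less_measure_iff)
    have qb: "q ?E \<le> b1 * prob ?E"
    proof -
      have "q ?E \<le> (\<integral>x. b1 * indicator ?E x \<partial>M)"
        unfolding q_def by (intro integral_mono wi[OF E] ii[OF E]) (auto simp: indicator_def)
      then show ?thesis using E by (simp add: Int_absorb2 sets.sets_into_space)
    qed
    have "C3 * (prob ?E * (1 - prob ?E)) \<le> q ?E * (1 - q ?E)" unfolding q_def by (rule cmp(1)[OF E])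
    also have "\<dots> \<le> q ?E" using q0[of ?E] by (simp add: mult_left_le)
    finally have "prob ?E * (C3 * (1 - prob ?E)) \<le> prob ?E * b1" using qb by (simp add: mult_ac)
    then have "C3 * (1 - prob ?E) \<le> b1" using p by (simp only: mult_le_cancel_left_pos)
    then have pc: "1 - prob ?E \<le> b1 / C3" using pos by (simp add: le_divide_eq mult.commute)
    have "q (space M - ?E) \<le> (\<integral>x. b2 * indicator (space M - ?E) x \<partial>M)"
      unfolding q_def
    proof (rule integral_mono_AE)
      show "AE x in M. w x * indicator (space M - ?E) x \<le> b2 * indicator (space M - ?E) x"
        using up by eventually_elim (auto simp: indicator_def)
    qed (use wi ii E in auto)
    also have "\<dots> = b2 * (1 - prob ?E)" using prob_compl[OF E] E by (simp add: Int_absorb2 sets.sets_into_space)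
    also have "\<dots> \<le> b2 * (b1 / C3)" using pc b2'(1) by (intro mult_left_mono) auto
    finally have "1 - q ?E \<le> b2 * (b1 / C3)" using q_compl[OF E] by simp
    moreover have "q ?E \<le> b1" using qb mult_left_le[OF p1 less_imp_le[OF b1'(1)], of ?E] by linarith
    ultimately show False using b1'(2) by linarith
  qed
  then have "AE x in M. x \<notin> ?E" using E by (intro AE_not_in) (simp add: null_sets_def emeasure_eq_measure)
  then show "AE x in M. b1 \<le> w x" by (rule AE_mp) (auto intro!: AE_I2)
qed

text \<open>A mean-zero function of constant sign vanishes almost everywhere. This supplies the
  fixed nontrivial set that \<open>density_ratio_bounded\<close> needs.\<close>

lemma (in prob_space) mean_zero_sets:
  assumes f: "f \<in> L2_0 M" and ne: "\<not> (AE x in M. f x = 0)"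
  shows "{x\<in>space M. 0 < f x} \<in> events" "0 < prob {x\<in>space M. 0 < f x}" "prob {x\<in>space M. 0 < f x} < 1"
proof -
  note f' = L2_0D[OF f]
  have i: "integrable M f" using square_integrable_imp_integrable f' by auto
  have [measurable]: "f \<in> borel_measurable M" by (rule f')
  have z: "AE x in M. f x = 0" if "AE x in M. 0 \<le> f x"
    using integral_nonneg_eq_0_iff_AE[OF i that] f'(3) by simp
  have z': "AE x in M. f x = 0" if "AE x in M. f x \<le> 0"
    using integral_nonneg_eq_0_iff_AE[of M "\<lambda>x. - f x"] i that f'(3) by simp
  let ?G = "{x\<in>space M. 0 < f x}"
  show G: "?G \<in> events" by measurable
  have "prob ?G \<noteq> 0"
  proof
    assume "prob ?G = 0"
    then have "AE x in M. x \<notin> ?G" using G by (intro AE_not_in) (simp add: null_sets_def emeasure_eq_measure)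
    then have "AE x in M. f x \<le> 0" by (rule AE_mp) (auto intro!: AE_I2)
    then show False using z' ne by blast
  qed
  then show "0 < prob ?G" by (simp add: zero_less_measure_iff)
  have "prob ?G \<noteq> 1"
  proof
    assume "prob ?G = 1"
    then have "AE x in M. x \<in> ?G" using G by (simp add: prob_eq_1)
    then have "AE x in M. 0 \<le> f x" by (rule AE_mp) (auto intro!: AE_I2)
    then show False using z ne by blast
  qed
  then show "prob ?G < 1" using prob_le_1[of ?G] by linarith
qed

lemma D_fst_D_snd_eq:
  assumes "F differentiable (at \<tau>)"
  shows "D_fst F \<tau> \<zeta> + D_snd F \<tau> g = frechet_derivative F (at \<tau>) (\<zeta>, g)"
proof -
  let ?F = "frechet_derivative F (at \<tau>)"
  have F: "(F has_derivative ?F) (at \<tau>)" using assms by (simp add: frechet_derivative_works)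
  then interpret F: bounded_linear ?F by (rule has_derivative_bounded_linear)
  have F': "(F has_derivative ?F) (at (fst \<tau>, snd \<tau>))" using F by simp
  have 1: "((\<lambda>t. F (t, snd \<tau>)) has_derivative (\<lambda>h. ?F (h, 0))) (at (fst \<tau>))"
    by (rule has_derivative_compose[where f = "\<lambda>t. (t, snd \<tau>)" and g = F and g' = ?F, OF _ F'[unfolded]])
      (auto intro!: derivative_eq_intros)
  have 2: "((\<lambda>u. F (fst \<tau>, u)) has_derivative (\<lambda>h. ?F (0, h))) (at (snd \<tau>))"
    by (rule has_derivative_compose[where f = "\<lambda>u. (fst \<tau>, u)" and g = F and g' = ?F, OF _ F'])
      (auto intro!: derivative_eq_intros)
  have "D_fst F \<tau> \<zeta> + D_snd F \<tau> g = ?F (\<zeta>, 0) + ?F (0, g)"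
    unfolding D_fst_def D_snd_def frechet_derivative_at[OF 1, symmetric] frechet_derivative_at[OF 2, symmetric] ..
  also have "\<dots> = ?F (\<zeta>, g)" by (simp flip: F.add)
  finally show ?thesis .
qed

lemma difference_quotient_LIMSEQ:
  fixes F :: "'v :: real_normed_vector \<Rightarrow> real"
  assumes "F differentiable (at \<tau>)"
  shows "(\<lambda>j. (F (\<tau> + inverse (real (Suc j)) *\<^sub>R w) - F \<tau>) * real (Suc j)) \<longlonglongrightarrow> frechet_derivative F (at \<tau>) w"
proof -
  let ?F = "frechet_derivative F (at \<tau>)"
  have F: "(F has_derivative ?F) (at \<tau>)" using assms by (simp add: frechet_derivative_works)
  then interpret F: bounded_linear ?F by (rule has_derivative_bounded_linear)
  have F': "(F has_derivative ?F) (at (\<tau> + (0::real) *\<^sub>R w))" using F by simp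
  have "((\<lambda>h::real. F (\<tau> + h *\<^sub>R w)) has_derivative (\<lambda>h. ?F (h *\<^sub>R w))) (at 0)"
    by (rule has_derivative_compose[where f = "\<lambda>h::real. \<tau> + h *\<^sub>R w" and g = F and g' = ?F, OF _ F'])
      (auto intro!: derivative_eq_intros)
  then have "((\<lambda>h::real. F (\<tau> + h *\<^sub>R w)) has_field_derivative ?F w) (at 0)"
    by (simp add: has_field_derivative_def F.scaleR mult.commute[of _ "?F w"] mult_commute_abs)
  then have lim: "((\<lambda>h. (F (\<tau> + h *\<^sub>R w) - F \<tau>) / h) \<longlongrightarrow> ?F w) (at 0)"
    by (simp add: DERIV_def)
  have "filterlim (\<lambda>j. inverse (real (Suc j))) (at 0) sequentially"
    unfolding filterlim_at using LIMSEQ_inverse_real_of_nat by auto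
  from filterlim_compose[OF lim this] show ?thesis by (simp add: divide_inverse)
qed

section \<open>From the stated assumptions to bounded ratios and almost concave log
  densities\<close>

section \<open>The density model\<close>

text \<open>\<open>n0\<close> is one tuple of sample sizes with an almost surely convex criterion.
  Concavity of the \<open>\<eta> l\<close> is a property of the model and not of the sample, so it
  is extracted once and then serves all sample sizes.\<close>

locale density_model =
  fixes m :: nat
    and M :: "nat \<Rightarrow> 'x measure"
    and \<eta> :: "nat \<Rightarrow> (real ^ 'p) \<times> ('h :: {real_inner, complete_space}) \<Rightarrow> 'x \<Rightarrow> real"
    and \<tau>0 :: "(real ^ 'p) \<times> 'h"
    and P :: "'w measure" and X :: "nat \<Rightarrow> nat \<Rightarrow> 'w \<Rightarrow> 'x"
    and Lth :: "nat \<Rightarrow> real ^ 'p \<Rightarrow> 'x \<Rightarrow> real" and Lh :: "nat \<Rightarrow> 'h \<Rightarrow> 'x \<Rightarrow> real"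
    and S :: "((real ^ 'p) \<times> 'h) set"
    and C1 C2 C3 C4 :: real
    and n0 :: "nat \<Rightarrow> nat"
    and P0 :: "nat \<Rightarrow> 'x measure"
  assumes m_ge_1: "1 \<le> m"
    and P0_def: "P0 = (\<lambda>l. model_law (M l) (\<eta> l) \<tau>0)"
    and norm_const: "l \<in> {1..m} \<Longrightarrow> integrable (M l) (\<lambda>x. exp (\<eta> l \<tau> x))"
    and eta_L2_0: "l \<in> {1..m} \<Longrightarrow> \<eta> l \<tau> \<in> L2_0 (P0 l)"
    and prob_P: "prob_space P"
    and X_indep_M: "prob_space.indep_vars P (\<lambda>(l, i). M l) (\<lambda>(l, i). X l i) ({1..m} \<times> {1..})"
    and law_X: "l \<in> {1..m} \<Longrightarrow> 1 \<le> i \<Longrightarrow> distr P (M l) (X l i) = P0 l"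
    and Lth: "l \<in> {1..m} \<Longrightarrow> L2_bounded_linear (P0 l) (Lth l)" "l \<in> {1..m} \<Longrightarrow> L2_zero_null_space (P0 l) (Lth l)"
    and Lh: "l \<in> {1..m} \<Longrightarrow> L2_bounded_linear (P0 l) (Lh l)"
    and S: "open S" "\<tau>0 \<in> S" "convex S"
    and eta_C3: "l \<in> {1..m} \<Longrightarrow> L2_Ck_on (P0 l) 3 S (\<eta> l)"
    and eta_diff: "l \<in> {1..m} \<Longrightarrow> AE x in P0 l. \<forall>\<tau>\<in>S. (\<lambda>\<sigma>. \<eta> l \<sigma> x) differentiable (at \<tau>)"
    and D_bounded_linear: "l \<in> {1..m} \<Longrightarrow> \<tau> \<in> S \<Longrightarrow>
        L2_bounded_linear (P0 l) (D_theta (\<eta> l) \<tau>) \<and> L2_bounded_linear (P0 l) (D_h (\<eta> l) \<tau>)"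
    and C_pos: "0 < C1" "0 < C2" "0 < C3" "0 < C4"
    and D_compare: "\<tau> \<in> S \<Longrightarrow>
        C1 * sum_var m P0 (\<lambda>l x. Lth l \<zeta> x + Lh l g x)
          \<le> sum_var m P0 (\<lambda>l x. D_theta (\<eta> l) \<tau> \<zeta> x + D_h (\<eta> l) \<tau> g x)"
        "\<tau> \<in> S \<Longrightarrow> sum_var m P0 (\<lambda>l x. D_theta (\<eta> l) \<tau> \<zeta> x + D_h (\<eta> l) \<tau> g x)
          \<le> C2 * sum_var m P0 (\<lambda>l x. Lth l \<zeta> x + Lh l g x)"
    and law_compare: "\<tau> \<in> S \<Longrightarrow> (\<And>l. l \<in> {1..m} \<Longrightarrow> f l \<in> L2_0 (P0 l)) \<Longrightarrow>
        C3 * sum_var m P0 f \<le> sum_var m (\<lambda>l. model_law (M l) (\<eta> l) \<tau>) f"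
        "\<tau> \<in> S \<Longrightarrow> (\<And>l. l \<in> {1..m} \<Longrightarrow> f l \<in> L2_0 (P0 l)) \<Longrightarrow>
        sum_var m (\<lambda>l. model_law (M l) (\<eta> l) \<tau>) f \<le> C4 * sum_var m P0 f"
    and n0: "l \<in> {1..m} \<Longrightarrow> 1 \<le> n0 l"
    and convex_n0: "AE \<omega> in P. convex_on UNIV (sum_loglik m M \<eta> n0 (\<lambda>l i. X l i \<omega>))"
begin

sublocale P: prob_space P by (rule prob_P)

lemma sets_P0 [measurable_cong]: "sets (P0 l) = sets (M l)"
  by (simp add: P0_def model_law_def)

lemma X_measurable_M: "l \<in> {1..m} \<Longrightarrow> 1 \<le> i \<Longrightarrow> X l i \<in> measurable P (M l)"
  using X_indep_M unfolding P.indep_vars_def by force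

sublocale indep_samples P m P0 X
proof
  fix l i assume l: "l \<in> {1..m}" and i: "1 \<le> (i::nat)"
  show "X l i \<in> measurable P (P0 l)"
    using X_measurable_M[OF l i] by (simp add: measurable_cong_sets[OF refl sets_P0])
  have "distr P (P0 l) (X l i) = distr P (M l) (X l i)" by (intro distr_cong) (simp_all add: sets_P0)
  then show "distr P (P0 l) (X l i) = P0 l" using law_X[OF l i] by simp
next
  show "P.indep_vars (\<lambda>(l, i). P0 l) (\<lambda>(l, i). X l i) ({1..m} \<times> {1..})"
    using X_indep_M unfolding P.indep_vars_def2 by (simp add: sets_P0 case_prod_beta measurable_cong_sets[OF refl sets_P0])
qed

definition Z :: "nat \<Rightarrow> (real ^ 'p) \<times> 'h \<Rightarrow> real" where
  "Z l \<tau> = (LINT x|M l. exp (\<eta> l \<tau> x))"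

lemma eta_measurable: "l \<in> {1..m} \<Longrightarrow> \<eta> l \<tau> \<in> borel_measurable (M l)"
  using L2_0D(1)[OF eta_L2_0[of l \<tau>]] by (simp add: measurable_cong_sets[OF sets_P0 refl])

text \<open>The reference measure could a priori be zero. It is not, because \<open>P0 l\<close> is
  the law of an observation, hence a probability measure, and has a density with respect to
  it.\<close>

lemma Z_pos:
  assumes l: "l \<in> {1..m}"
  shows "0 < Z l \<tau>"
proof -
  interpret Q: prob_space "P0 l" by (rule prob_space_Q[OF l])
  have "Z l \<tau> \<noteq> 0"
  proof
    assume "Z l \<tau> = 0"
    then have "AE x in M l. exp (\<eta> l \<tau> x) = 0"
      using integral_nonneg_eq_0_iff_AE[OF norm_const[OF l]] by (simp add: Z_def)
    then have "AE x in M l. False" by simp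
    then have "AE x in P0 l. False"
      unfolding P0_def model_law_def using eta_measurable[OF l]
      by (subst AE_density) (auto simp: model_density_def)
    then show False by simp
  qed
  moreover have "0 \<le> Z l \<tau>" unfolding Z_def by (intro integral_nonneg_AE) auto
  ultimately show ?thesis by simp
qed

definition g :: "nat \<Rightarrow> (real ^ 'p) \<times> 'h \<Rightarrow> 'x \<Rightarrow> real" where
  "g l v x = \<eta> l (\<tau>0 + v) x - \<eta> l \<tau>0 x"

definition A :: "nat \<Rightarrow> (real ^ 'p) \<times> 'h \<Rightarrow> real" where
  "A l v = ln (Z l (\<tau>0 + v)) - ln (Z l \<tau>0)"

definition N :: "((real ^ 'p) \<times> 'h) set" where
  "N = {v. \<tau>0 + v \<in> S}"

definition D :: "nat \<Rightarrow> (real ^ 'p) \<times> 'h \<Rightarrow> (real ^ 'p) \<times> 'h \<Rightarrow> 'x \<Rightarrow> real" where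
  "D l v w x = D_theta (\<eta> l) (\<tau>0 + v) (fst w) x + D_h (\<eta> l) (\<tau>0 + v) (snd w) x"

definition L :: "nat \<Rightarrow> (real ^ 'p) \<times> 'h \<Rightarrow> 'x \<Rightarrow> real" where
  "L l w x = Lth l (fst w) x + Lh l (snd w) x"

definition W :: "(real ^ 'p) \<times> 'h \<Rightarrow> real" where
  "W w = sum_var m P0 (\<lambda>l. L l w)"

lemma model_density_ratio:
  assumes l: "l \<in> {1..m}"
  shows "model_density (M l) (\<eta> l) (\<tau>0 + v) x = model_density (M l) (\<eta> l) \<tau>0 x * exp (g l v x - A l v)"
proof -
  have "exp (g l v x - A l v) = exp (\<eta> l (\<tau>0 + v) x) / exp (\<eta> l \<tau>0 x) * (Z l \<tau>0 / Z l (\<tau>0 + v))"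
    using Z_pos[OF l] by (simp add: g_def A_def exp_diff)
  then show ?thesis
    using Z_pos[OF l, of \<tau>0] Z_pos[OF l, of "\<tau>0 + v"] by (simp add: model_density_def Z_def[symmetric])
qed

lemma model_density_nonneg: "l \<in> {1..m} \<Longrightarrow> 0 \<le> model_density (M l) (\<eta> l) \<tau> x"
  using Z_pos[of l \<tau>] by (simp add: model_density_def Z_def[symmetric])

lemma model_density_measurable: "l \<in> {1..m} \<Longrightarrow> model_density (M l) (\<eta> l) \<tau> \<in> borel_measurable (M l)"
  using eta_measurable[of l \<tau>] unfolding model_density_def by measurable

lemma g_meas: "l \<in> {1..m} \<Longrightarrow> g l v \<in> borel_measurable (P0 l)"
  unfolding g_def using L2_0D(1)[OF eta_L2_0] by auto

lemma integral_model_law: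
  fixes f :: "'x \<Rightarrow> real"
  assumes l: "l \<in> {1..m}" and f: "f \<in> borel_measurable (P0 l)"
  shows "(LINT x|model_law (M l) (\<eta> l) (\<tau>0 + v). f x) = (LINT x|P0 l. exp (g l v x - A l v) * f x)"
proof -
  have f': "f \<in> borel_measurable (M l)" using f by (simp add: measurable_cong_sets[OF sets_P0 refl])
  have g': "g l v \<in> borel_measurable (M l)" using g_meas[OF l] by (simp add: measurable_cong_sets[OF sets_P0 refl])
  have "(LINT x|model_law (M l) (\<eta> l) (\<tau>0 + v). f x) = (LINT x|M l. model_density (M l) (\<eta> l) (\<tau>0 + v) x * f x)"
    unfolding model_law_def using model_density_nonneg[OF l] model_density_measurable[OF l] f'
    by (subst integral_density) auto
  also have "\<dots> = (LINT x|M l. model_density (M l) (\<eta> l) \<tau>0 x * (exp (g l v x - A l v) * f x))"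
    by (simp add: model_density_ratio[OF l] mult.assoc)
  also have "\<dots> = (LINT x|P0 l. exp (g l v x - A l v) * f x)"
    unfolding P0_def model_law_def using model_density_nonneg[OF l] model_density_measurable[OF l] f' g'
    by (subst integral_density) auto
  finally show ?thesis .
qed

lemma ratio_normalized:
  assumes l: "l \<in> {1..m}"
  shows "(LINT x|P0 l. exp (g l v x - A l v)) = 1" "integrable (P0 l) (\<lambda>x. exp (g l v x - A l v))"
proof -
  have *: "(LINT x|M l. model_density (M l) (\<eta> l) \<tau> x) = 1" for \<tau>
    using Z_pos[OF l, of \<tau>] by (simp add: model_density_def Z_def[symmetric])
  have "(LINT x|model_law (M l) (\<eta> l) (\<tau>0 + v). 1) = (LINT x|M l. model_density (M l) (\<eta> l) (\<tau>0 + v) x * 1)"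
    unfolding model_law_def using model_density_nonneg[OF l] model_density_measurable[OF l]
    by (subst integral_density) auto
  then show 1: "(LINT x|P0 l. exp (g l v x - A l v)) = 1"
    using integral_model_law[OF l, of "\<lambda>_. 1" v] * by simp
  \<comment> \<open>The Bochner integral of a nonintegrable function is 0, so the value 1 proves
    integrability.\<close>
  show "integrable (P0 l) (\<lambda>x. exp (g l v x - A l v))"
    using 1 not_integrable_integral_eq by fastforce
qed

text \<open>Putting zero in all other components lets a comparison of summed variances be read for a
  single sample.\<close>

lemma cov_single_component:
  assumes l: "l \<in> {1..m}"
  shows "sum_var m Pr (\<lambda>l'. if l' = l then f else (\<lambda>_. 0)) = cov (Pr l) f f"
proof -
  have "sum_var m Pr (\<lambda>l'. if l' = l then f else (\<lambda>_. 0)) = (\<Sum>l'=1..m. if l' = l then cov (Pr l) f f else 0)"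
    by (intro sum.cong) (auto simp: cov_def)
  then show ?thesis using l by simp
qed

lemma zero_L2_0: "(\<lambda>_. 0) \<in> L2_0 Pr"
  by (simp add: L2_0_def L2_def)

lemma ratio_bounds:
  "\<exists>B\<ge>0. \<forall>l\<in>{1..m}. \<forall>v\<in>N. AE x in P0 l. \<bar>g l v x - A l v\<bar> \<le> B"
proof -
  have "\<exists>B. \<forall>v\<in>N. AE x in P0 l. \<bar>g l v x - A l v\<bar> \<le> B" if l: "l \<in> {1..m}" for l
  proof -
    interpret Q: prob_space "P0 l" by (rule prob_space_Q[OF l])
    \<comment> \<open>\<open>undefined\<close> just names some coordinate; what matters is that
      \<open>e\<close> is nonzero, so that \<open>Lth l e\<close> is not almost everywhere
      zero.\<close>
    define e :: "real ^ 'p" where "e = axis undefined 1"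
    have "e \<noteq> 0" by (simp add: e_def)
    then have ne: "\<not> (AE x in P0 l. Lth l e x = 0)" using Lth(2)[OF l] by (auto simp: L2_zero_null_space_def)
    have Le: "Lth l e \<in> L2_0 (P0 l)" using Lth(1)[OF l] by (simp add: L2_bounded_linear_def)
    define G where "G = {x\<in>space (P0 l). 0 < Lth l e x}"
    note G = Q.mean_zero_sets[OF Le ne, folded G_def]
    \<comment> \<open>Both bounds depend on \<open>G\<close> and the constants but not on
      \<open>v\<close>, which makes the conclusion uniform over the neighbourhood.\<close>
    define b2 where "b2 = (C3 + C4) / (C3 * (Q.prob G * (1 - Q.prob G))) + 1"
    define b1 where "b1 = 1 / (2 * (1 + b2 / C3))"
    have b2: "0 < b2" unfolding b2_def using C_pos G by (auto intro!: add_pos_pos divide_pos_pos mult_pos_pos)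
    have b1: "0 < b1" unfolding b1_def using C_pos b2 by (auto intro!: add_pos_pos divide_pos_pos mult_pos_pos)
    have "AE x in P0 l. \<bar>g l v x - A l v\<bar> \<le> \<bar>ln b1\<bar> + \<bar>ln b2\<bar>" if v: "v \<in> N" for v
    proof -
      let ?w = "\<lambda>x. exp (g l v x - A l v)"
      let ?q = "\<lambda>E. LINT x|P0 l. ?w x * indicator E x"
      let ?Pv = "model_law (M l) (\<eta> l) (\<tau>0 + v)"
      have v': "\<tau>0 + v \<in> S" using v by (simp add: N_def)
      have q: "cov ?Pv (\<lambda>x. indicator E x - Q.prob E) (\<lambda>x. indicator E x - Q.prob E) = ?q E * (1 - ?q E)"
        if E: "E \<in> sets (P0 l)" for E
      proof -
        let ?c = "Q.prob E"
        have sq: "(indicator E x - ?c) * (indicator E x - ?c) = indicator E x - 2 * ?c * indicator E x + ?c\<^sup>2" for x :: 'x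
          by (simp add: power2_eq_square algebra_simps indicator_def)
        have i: "integrable (P0 l) (\<lambda>x. ?w x * indicator E x)"
          using integrable_real_mult_indicator[OF E ratio_normalized(2)[OF l]] by simp
        have m1: "(LINT x|?Pv. indicator E x - ?c) = ?q E - ?c"
        proof -
          have "(LINT x|?Pv. indicator E x - ?c) = (LINT x|P0 l. ?w x * (indicator E x - ?c))"
            by (rule integral_model_law[OF l]) (use E in measurable)
          also have "\<dots> = ?q E - ?c"
            using i ratio_normalized[OF l, of v] by (simp add: right_diff_distrib)
          finally show ?thesis .
        qed
        have m2: "(LINT x|?Pv. (indicator E x - ?c) * (indicator E x - ?c)) = ?q E - 2 * ?c * ?q E + ?c\<^sup>2"
        proof -
          have "(LINT x|?Pv. (indicator E x - ?c) * (indicator E x - ?c)) = (LINT x|P0 l. ?w x * ((indicator E x - ?c) * (indicator E x - ?c)))"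
            by (rule integral_model_law[OF l]) (use E in measurable)
          also have "\<dots> = (LINT x|P0 l. ?w x * indicator E x - 2 * ?c * (?w x * indicator E x) + ?c\<^sup>2 * ?w x)"
            unfolding sq by (intro Bochner_Integration.integral_cong) (auto simp: algebra_simps)
          also have "\<dots> = ?q E - 2 * ?c * ?q E + ?c\<^sup>2"
            using i ratio_normalized[OF l, of v] by simp
          finally show ?thesis .
        qed
        show ?thesis unfolding cov_def m1 m2 by (simp add: power2_eq_square algebra_simps)
      qed
      have cmp: "C3 * (Q.prob E * (1 - Q.prob E)) \<le> ?q E * (1 - ?q E) \<and> ?q E * (1 - ?q E) \<le> C4 * (Q.prob E * (1 - Q.prob E))"
        if E: "E \<in> sets (P0 l)" for E
      proof -
        let ?f = "\<lambda>l'. if l' = l then (\<lambda>x. indicator E x - Q.prob E) else (\<lambda>_. 0 :: real)"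
        have f: "?f l' \<in> L2_0 (P0 l')" for l' using Q.indicator_centered_L2_0[OF E] zero_L2_0 by auto
        show ?thesis
          using law_compare(1)[OF v', of ?f] law_compare(2)[OF v', of ?f] f
          unfolding cov_single_component[OF l] q[OF E] Q.cov_indicator[OF E] by blast
      qed
      note r = Q.density_ratio_bounded[of ?w C3 C4 G b2 b1, OF _ _ ratio_normalized(2)[OF l] ratio_normalized(1)[OF l] _ _ G C_pos(3,4) b2_def b1_def]
      have m: "?w \<in> borel_measurable (P0 l)" using g_meas[OF l] by measurable
      have "AE x in P0 l. ?w x \<le> b2" "AE x in P0 l. b1 \<le> ?w x"
        by (rule r; use m cmp in auto)+
      then show ?thesis
      proof eventually_elim
        fix x assume "?w x \<le> b2" "b1 \<le> ?w x"
        then have "g l v x - A l v \<le> ln b2" "exp (ln b1) \<le> ?w x" using b1 b2 by (simp_all add: ln_ge_iff)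
        then show "\<bar>g l v x - A l v\<bar> \<le> \<bar>ln b1\<bar> + \<bar>ln b2\<bar>" by simp
      qed
    qed
    then show ?thesis by blast
  qed
  then obtain Bl where Bl: "\<And>l v. l \<in> {1..m} \<Longrightarrow> v \<in> N \<Longrightarrow> AE x in P0 l. \<bar>g l v x - A l v\<bar> \<le> Bl l" by metis
  show ?thesis
  proof (intro exI[of _ "\<Sum>l=1..m. \<bar>Bl l\<bar>"] conjI ballI)
    show "0 \<le> (\<Sum>l=1..m. \<bar>Bl l\<bar>)" by (intro sum_nonneg) auto
    fix l v assume l: "l \<in> {1..m}" and v: "v \<in> N"
    have "\<bar>Bl l\<bar> \<le> (\<Sum>l=1..m. \<bar>Bl l\<bar>)" using l by (intro member_le_sum) auto
    then show "AE x in P0 l. \<bar>g l v x - A l v\<bar> \<le> (\<Sum>l=1..m. \<bar>Bl l\<bar>)"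
      using Bl[OF l v] by (auto elim!: eventually_mono)
  qed
qed

text \<open>Convexity of the criterion for almost every sample forces, for each sample space separately, an almost
  sure lower bound on the concavity defect of \<open>\<eta> l\<close>: otherwise, with positive probability, all observations
  from the \<open>l\<close>-th law violate it while the other defects, having mean zero, are nonpositive.\<close>

lemma eta_almost_concave:
  assumes l0: "l0 \<in> {1..m}" and t: "0 \<le> t" "t \<le> 1"
  shows "AE x in P0 l0. t * \<eta> l0 \<tau> x + (1 - t) * \<eta> l0 \<sigma> x -
     (\<Sum>l=1..m. t * ln (Z l \<tau>) + (1 - t) * ln (Z l \<sigma>) - ln (Z l (t *\<^sub>R \<tau> + (1 - t) *\<^sub>R \<sigma>)))
     \<le> \<eta> l0 (t *\<^sub>R \<tau> + (1 - t) *\<^sub>R \<sigma>) x"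
proof -
  let ?\<pi> = "t *\<^sub>R \<tau> + (1 - t) *\<^sub>R \<sigma>"
  define gap where "gap = (\<Sum>l=1..m. t * ln (Z l \<tau>) + (1 - t) * ln (Z l \<sigma>) - ln (Z l ?\<pi>))"
  define c where "c = (\<lambda>l x. \<eta> l ?\<pi> x - t * \<eta> l \<tau> x - (1 - t) * \<eta> l \<sigma> x)"
  have c_meas: "c l \<in> borel_measurable (P0 l)" if "l \<in> {1..m}" for l
    unfolding c_def using L2_0D(1)[OF eta_L2_0[OF that]] by measurable
  \<comment> \<open>The sets to be met simultaneously: the observations of sample \<open>l0\<close>
    violate the claim, those of every other sample have nonpositive defect.\<close>
  define R where "R = (\<lambda>l. if l = l0 then {x\<in>space (P0 l). c l x < - gap} else {x\<in>space (P0 l). c l x \<le> 0})"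
  have R: "R l \<in> sets (P0 l)" if "l \<in> {1..m}" for l
    unfolding R_def using c_meas[OF that] by (cases "l = l0") simp_all
  \<comment> \<open>\<open>c l\<close> has mean zero, so it cannot be positive almost
    everywhere.\<close>
  have nonneg_pos: "emeasure (P0 l) (R l) \<noteq> 0" if l: "l \<in> {1..m}" "l \<noteq> l0" for l
  proof
    assume z: "emeasure (P0 l) (R l) = 0"
    interpret Q: prob_space "P0 l" by (rule prob_space_Q[OF l(1)])
    have i: "integrable (P0 l) (\<eta> l \<tau>)" for \<tau>
      using Q.square_integrable_imp_integrable L2_0D[OF eta_L2_0[OF l(1)]] by blast
    have ci: "integrable (P0 l) (c l)" unfolding c_def using i by auto
    have c0: "(LINT x|P0 l. c l x) = 0"
      unfolding c_def using i L2_0D(3)[OF eta_L2_0[OF l(1)]] by simp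
    have "AE x in P0 l. x \<notin> R l" using z R[OF l(1)] by (intro AE_not_in) (simp add: null_sets_def)
    then have pos: "AE x in P0 l. 0 < c l x" by (rule AE_mp) (use l(2) in \<open>auto simp: R_def intro!: AE_I2\<close>)
    then have "AE x in P0 l. 0 \<le> c l x" by eventually_elim simp
    then have "AE x in P0 l. c l x = 0"
      using integral_nonneg_eq_0_iff_AE[OF ci] c0 by simp
    with pos have "AE x in P0 l. False" by eventually_elim simp
    then show False by simp
  qed
  have "emeasure (P0 l0) (R l0) = 0"
  proof (rule ccontr)
    \<comment> \<open>Independence makes the probability that all observations lie in these sets a
      product of positive numbers, while convexity makes the same probability zero.\<close>
    assume ne: "emeasure (P0 l0) (R l0) \<noteq> 0"
    have "(\<integral>\<^sup>+\<omega>. (\<Prod>l=1..m. \<Prod>i=1..n0 l. ennreal (indicator (R l) (X l i \<omega>))) \<partial>P) =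
        (\<Prod>l=1..m. (\<integral>\<^sup>+x. ennreal (indicator (R l) x) \<partial>P0 l) ^ n0 l)"
      using R by (intro nn_integral_prod_samples) auto
    also have "\<dots> = (\<Prod>l=1..m. emeasure (P0 l) (R l) ^ n0 l)"
      using R by (intro prod.cong refl) (simp add: ennreal_indicator)
    also have "\<dots> \<noteq> 0" using ne nonneg_pos by (auto simp: prod_zero_iff) metis
    finally have *: "(\<integral>\<^sup>+\<omega>. (\<Prod>l=1..m. \<Prod>i=1..n0 l. ennreal (indicator (R l) (X l i \<omega>))) \<partial>P) \<noteq> 0" .
    have "AE \<omega> in P. (\<Prod>l=1..m. \<Prod>i=1..n0 l. ennreal (indicator (R l) (X l i \<omega>))) = 0"
      using convex_n0
    proof eventually_elim
      fix \<omega>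
      assume conv: "convex_on UNIV (sum_loglik m M \<eta> n0 (\<lambda>l i. X l i \<omega>))"
      show "(\<Prod>l=1..m. \<Prod>i=1..n0 l. ennreal (indicator (R l) (X l i \<omega>))) = 0"
      proof (rule ccontr)
        assume nz: "(\<Prod>l=1..m. \<Prod>i=1..n0 l. ennreal (indicator (R l) (X l i \<omega>))) \<noteq> 0"
        have inR: "X l i \<omega> \<in> R l" if "l \<in> {1..m}" "i \<in> {1..n0 l}" for l i
        proof (rule ccontr)
          assume "X l i \<omega> \<notin> R l"
          then have "(\<Prod>i=1..n0 l. ennreal (indicator (R l) (X l i \<omega>))) = 0"
            using that(2) by (intro prod_zero bexI[of _ i]) auto
          from this that(1) have "(\<Prod>l=1..m. \<Prod>i=1..n0 l. ennreal (indicator (R l) (X l i \<omega>))) = 0"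
            by (rule prod_zero[OF finite_atLeastAtMost bexI])
          then show False using nz by simp
        qed
        let ?F = "\<lambda>\<tau>. sum_loglik m M \<eta> n0 (\<lambda>l i. X l i \<omega>) \<tau>"
        let ?avg = "\<lambda>l. (1 / real (n0 l)) * (\<Sum>i=1..n0 l. c l (X l i \<omega>))"
        have "?F ?\<pi> \<le> t * ?F \<tau> + (1 - t) * ?F \<sigma>"
          using convex_onD[OF conv, of "1 - t" \<tau> \<sigma>] t by simp
        moreover have "t * ?F \<tau> + (1 - t) * ?F \<sigma> - ?F ?\<pi> = (\<Sum>l=1..m. ?avg l) + gap"
        proof -
          have "t * ?F \<tau> + (1 - t) * ?F \<sigma> - ?F ?\<pi> =
            (\<Sum>l=1..m. t * neg_loglik (M l) (\<eta> l) (n0 l) (\<lambda>i. X l i \<omega>) \<tau> +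
              (1 - t) * neg_loglik (M l) (\<eta> l) (n0 l) (\<lambda>i. X l i \<omega>) \<sigma> - neg_loglik (M l) (\<eta> l) (n0 l) (\<lambda>i. X l i \<omega>) ?\<pi>)"
            by (simp add: sum_loglik_def sum_distrib_left sum.distrib sum_subtractf)
          also have "\<dots> = (\<Sum>l=1..m. ?avg l + (t * ln (Z l \<tau>) + (1 - t) * ln (Z l \<sigma>) - ln (Z l ?\<pi>)))"
          proof (rule sum.cong[OF refl])
            fix l
            have "(\<Sum>i=1..n0 l. c l (X l i \<omega>)) = (\<Sum>i=1..n0 l. \<eta> l ?\<pi> (X l i \<omega>)) -
              t * (\<Sum>i=1..n0 l. \<eta> l \<tau> (X l i \<omega>)) - (1 - t) * (\<Sum>i=1..n0 l. \<eta> l \<sigma> (X l i \<omega>))"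
              by (simp add: c_def sum_subtractf sum_distrib_left)
            moreover have "t * (- k * a1 + b1) + (1 - t) * (- k * a2 + b2) - (- k * a3 + b3) =
                k * (a3 - t * a1 - (1 - t) * a2) + (t * b1 + (1 - t) * b2 - b3)" for k a1 a2 a3 b1 b2 b3 :: real
              by (simp add: algebra_simps)
            ultimately show "t * neg_loglik (M l) (\<eta> l) (n0 l) (\<lambda>i. X l i \<omega>) \<tau> +
              (1 - t) * neg_loglik (M l) (\<eta> l) (n0 l) (\<lambda>i. X l i \<omega>) \<sigma> - neg_loglik (M l) (\<eta> l) (n0 l) (\<lambda>i. X l i \<omega>) ?\<pi> =
              ?avg l + (t * ln (Z l \<tau>) + (1 - t) * ln (Z l \<sigma>) - ln (Z l ?\<pi>))"
              by (simp only: neg_loglik_def Z_def)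
          qed
          finally show ?thesis by (simp add: gap_def sum.distrib)
        qed
        ultimately have ge: "- gap \<le> (\<Sum>l=1..m. ?avg l)" by linarith
        have av0: "?avg l \<le> 0" if l: "l \<in> {1..m} - {l0}" for l
        proof -
          have "(\<Sum>i=1..n0 l. c l (X l i \<omega>)) \<le> 0" 
          proof (rule sum_nonpos)
            fix i assume "i \<in> {1..n0 l}"
            then have "X l i \<omega> \<in> R l" using l by (intro inR) auto
            then show "c l (X l i \<omega>) \<le> 0" using l by (simp add: R_def)
          qed
          then show ?thesis by (intro mult_nonneg_nonpos) auto
        qed
        have "(\<Sum>i=1..n0 l0. c l0 (X l0 i \<omega>)) < (\<Sum>i=1..n0 l0. - gap)"
        proof (rule sum_strict_mono)
          show "c l0 (X l0 i \<omega>) < - gap" if "i \<in> {1..n0 l0}" for i using inR[OF l0 that] by (simp add: R_def)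
        qed (use n0[OF l0] in auto)
        then have "?avg l0 < (1 / real (n0 l0)) * (real (n0 l0) * - gap)"
          using n0[OF l0] by (intro mult_strict_left_mono) auto
        then have "?avg l0 < - gap" using n0[OF l0] by simp
        moreover have "(\<Sum>l=1..m. ?avg l) = ?avg l0 + (\<Sum>l\<in>{1..m} - {l0}. ?avg l)"
          using l0 by (intro sum.remove) auto
        moreover have "(\<Sum>l\<in>{1..m} - {l0}. ?avg l) \<le> 0" using av0 by (intro sum_nonpos)
        ultimately show False using ge by linarith
      qed
    qed
    then have "(\<integral>\<^sup>+\<omega>. (\<Prod>l=1..m. \<Prod>i=1..n0 l. ennreal (indicator (R l) (X l i \<omega>))) \<partial>P) = (\<integral>\<^sup>+\<omega>. 0 \<partial>P)"
      by (intro nn_integral_cong_AE)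
    then show False using * by simp
  qed
  then have "AE x in P0 l0. x \<notin> R l0" using R[OF l0] by (intro AE_not_in) (simp add: null_sets_def)
  then show ?thesis
    unfolding gap_def[symmetric] by (rule AE_mp) (auto intro!: AE_I2 simp: R_def c_def)
qed

end

section \<open>Pointwise and mean-square derivatives agree; Lipschitz bound for the log
  densities\<close>

section \<open>Semi-inner products and derivatives in the mean\<close>

lemma semi_inner_productD:
  assumes "semi_inner_product B"
  shows "bilinear B" "B u v = B v u" "0 \<le> B u u"
  using assms by (auto simp: semi_inner_product_def)

lemma semi_inner_product_add_scale:
  assumes "semi_inner_product B"
  shows "B (u + v) w = B u w + B v w" "B (c *\<^sub>R u) w = c * B u w"
    "B w (u + v) = B w u + B w v" "B w (c *\<^sub>R u) = c * B w u" "B (u - v) w = B u w - B v w" "B w (u - v) = B w u - B w v"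
  using semi_inner_productD(1)[OF assms]
  by (simp_all add: bilinear_ladd bilinear_radd bilinear_lmul bilinear_rmul bilinear_lsub bilinear_rsub)

lemma semi_inner_product_cauchy_schwarz:
  assumes B: "semi_inner_product B"
  shows "\<bar>B u v\<bar> \<le> sqrt (B u u) * sqrt (B v v)"
proof -
  note r = semi_inner_product_add_scale[OF B] and nn = semi_inner_productD(3)[OF B]
  have quad: "0 \<le> s\<^sup>2 * B u u - 2 * s * t * B u v + t\<^sup>2 * B v v" for s t
  proof -
    have "0 \<le> B (s *\<^sub>R u - t *\<^sub>R v) (s *\<^sub>R u - t *\<^sub>R v)" by (rule nn)
    also have "\<dots> = s\<^sup>2 * B u u - 2 * s * t * B u v + t\<^sup>2 * B v v"
      using semi_inner_productD(2)[OF B, of v u] by (simp add: r power2_eq_square algebra_simps)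
    finally show ?thesis .
  qed
  have "(B u v)\<^sup>2 \<le> B u u * B v v"
  proof (cases "B v v = 0")
    case True
    have "B u v = 0"
    proof (rule ccontr)
      assume "B u v \<noteq> 0"
      then show False using quad[of 1 "(B u u + 1) / B u v"] True nn[of u] by simp
    qed
    then show ?thesis using True by simp
  next
    case False
    then have "0 < B v v" using nn[of v] by linarith
    have "0 \<le> B v v * (B u u * B v v - (B u v)\<^sup>2)"
      using quad[of "B v v" "B u v"] by (simp add: power2_eq_square algebra_simps)
    then show ?thesis using \<open>0 < B v v\<close> by (simp add: zero_le_mult_iff)
  qed
  then have "sqrt ((B u v)\<^sup>2) \<le> sqrt (B u u * B v v)" by (rule real_sqrt_le_mono)
  then show ?thesis by (simp add: real_sqrt_mult)
qed

lemma semi_inner_product_bounded_bilinear: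
  fixes B :: "'v :: real_normed_vector \<Rightarrow> 'v \<Rightarrow> real"
  assumes B: "semi_inner_product B" and K: "\<And>u. B u u \<le> K * (norm u)\<^sup>2"
  shows "bounded_bilinear B"
proof (rule bounded_bilinear.intro)
  show "\<exists>K. \<forall>u v. norm (B u v) \<le> norm u * norm v * K"
  proof (intro exI[of _ "\<bar>K\<bar>"] allI)
    fix u v
    have s: "sqrt (B u u) \<le> sqrt \<bar>K\<bar> * norm u" for u
    proof -
      have "B u u \<le> \<bar>K\<bar> * (norm u)\<^sup>2"
        by (rule order_trans[OF K mult_right_mono]) auto
      then have "sqrt (B u u) \<le> sqrt (\<bar>K\<bar> * (norm u)\<^sup>2)" by (rule real_sqrt_le_mono)
      then show ?thesis by (simp add: real_sqrt_mult)
    qed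
    have "\<bar>B u v\<bar> \<le> sqrt (B u u) * sqrt (B v v)" by (rule semi_inner_product_cauchy_schwarz[OF B])
    also have "\<dots> \<le> (sqrt \<bar>K\<bar> * norm u) * (sqrt \<bar>K\<bar> * norm v)"
      using s semi_inner_productD(3)[OF B] by (intro mult_mono) auto
    also have "\<dots> = norm u * norm v * (sqrt \<bar>K\<bar> * sqrt \<bar>K\<bar>)" by (simp only: mult_ac)
    finally show "norm (B u v) \<le> norm u * norm v * \<bar>K\<bar>" by simp
  qed
qed (simp_all add: semi_inner_product_add_scale[OF B])

lemma semi_inner_product_orthogonal_expansion:
  assumes B: "semi_inner_product B" and F: "finite F"
    and orth: "\<And>i j. i \<in> F \<Longrightarrow> j \<in> F \<Longrightarrow> B (e i) (e j) = (if i = j then d i else 0)"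
  shows "B (\<Sum>i\<in>F. c i *\<^sub>R e i) (\<Sum>i\<in>F. c i *\<^sub>R e i) = (\<Sum>i\<in>F. d i * (c i)\<^sup>2)"
proof -
  have "B (\<Sum>i\<in>F. c i *\<^sub>R e i) (\<Sum>i\<in>F. c i *\<^sub>R e i) = (\<Sum>i\<in>F. \<Sum>j\<in>F. B (c i *\<^sub>R e i) (c j *\<^sub>R e j))"
    using bilinear_sum[OF semi_inner_productD(1)[OF B], of "\<lambda>i. c i *\<^sub>R e i" F "\<lambda>i. c i *\<^sub>R e i" F]
    by (simp add: sum.cartesian_product)
  also have "\<dots> = (\<Sum>i\<in>F. \<Sum>j\<in>F. if i = j then d i * (c i)\<^sup>2 else 0)"
    using orth by (intro sum.cong) (auto simp: semi_inner_product_add_scale[OF B] power2_eq_square)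
  also have "\<dots> = (\<Sum>i\<in>F. d i * (c i)\<^sup>2)" using F by (simp add: sum.delta')
  finally show ?thesis .
qed

lemma semi_inner_product_parallelogram:
  assumes B: "semi_inner_product B"
  shows "B (u + v) (u + v) \<le> 2 * B u u + 2 * B v v"
proof -
  have "0 \<le> B (u - v) (u - v)" by (rule semi_inner_productD(3)[OF B])
  then show ?thesis by (simp add: semi_inner_product_add_scale[OF B])
qed

text \<open>Linearity of \<open>T\<close> holds only almost everywhere, with an exceptional set
  depending on the arguments; covariances do not see null sets.\<close>

lemma (in prob_space) L2_linear_semi_inner_product:
  fixes T :: "'v :: real_vector \<Rightarrow> 'a \<Rightarrow> real"
  assumes T: "\<And>v. T v \<in> L2_0 M" "\<And>u v. AE x in M. T (u + v) x = T u x + T v x"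
    "\<And>c v. AE x in M. T (c *\<^sub>R v) x = c * T v x"
  shows "semi_inner_product (\<lambda>u v. cov M (T u) (T v))"
proof -
  have c: "cov M (T u) (T v) = (\<integral>x. T u x * T v x \<partial>M)" for u v by (rule cov_L2_0[OF T(1)])
  have i: "integrable M (\<lambda>x. T u x * T v x)" for u v
    by (rule mean_zero_cauchy_schwarz(1)) (use L2_0D[OF T(1)] in auto)
  have m [measurable]: "T u \<in> borel_measurable M" for u by (rule L2_0D(1)[OF T(1)])
  have sym: "cov M (T u) (T v) = cov M (T v) (T u)" for u v unfolding c by (simp add: mult.commute)
  have add: "cov M (T (u + v)) (T w) = cov M (T u) (T w) + cov M (T v) (T w)" for u v w
  proof -
    have "(\<integral>x. T (u + v) x * T w x \<partial>M) = (\<integral>x. T u x * T w x + T v x * T w x \<partial>M)"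
      by (rule integral_cong_AE, measurable) (use T(2)[of u v] in \<open>eventually_elim, simp add: distrib_right\<close>)
    then show ?thesis unfolding c using i by simp
  qed
  have scale: "cov M (T (a *\<^sub>R u)) (T w) = a * cov M (T u) (T w)" for a u w
  proof -
    have "(\<integral>x. T (a *\<^sub>R u) x * T w x \<partial>M) = (\<integral>x. a * (T u x * T w x) \<partial>M)"
      by (rule integral_cong_AE, measurable) (use T(3)[of a u] in \<open>eventually_elim, simp\<close>)
    then show ?thesis unfolding c by simp
  qed
  have "0 \<le> cov M (T u) (T u)" for u unfolding c by (intro integral_nonneg_AE) auto
  moreover have "bilinear (\<lambda>u v. cov M (T u) (T v))"
    unfolding bilinear_def
  proof (intro conjI allI)
    show "linear (\<lambda>y. cov M (T x) (T y))" for x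
    proof (rule linearI)
      show "cov M (T x) (T (u + v)) = cov M (T x) (T u) + cov M (T x) (T v)" for u v
        unfolding sym[of x] by (rule add)
      show "cov M (T x) (T (a *\<^sub>R u)) = a *\<^sub>R cov M (T x) (T u)" for a u
        unfolding sym[of x] by (simp add: scale)
    qed
    show "linear (\<lambda>x. cov M (T x) (T y))" for y
      by (rule linearI) (simp_all add: add scale)
  qed
  ultimately show ?thesis using sym by (auto simp: semi_inner_product_def)
qed

lemma semi_inner_product_sum:
  assumes "\<And>l. l \<in> I \<Longrightarrow> semi_inner_product (B l)"
  shows "semi_inner_product (\<lambda>u v. \<Sum>l\<in>I. B l u v)"
proof -
  have "bilinear (\<lambda>u v. \<Sum>l\<in>I. B l u v)"
    unfolding bilinear_def
  proof (intro conjI allI)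
    show "linear (\<lambda>y. \<Sum>l\<in>I. B l x y)" for x
      using semi_inner_product_add_scale(3,4)[OF assms] by (intro linearI) (simp_all add: sum.distrib sum_distrib_left)
    show "linear (\<lambda>x. \<Sum>l\<in>I. B l x y)" for y
      using semi_inner_product_add_scale(1,2)[OF assms] by (intro linearI) (simp_all add: sum.distrib sum_distrib_left)
  qed
  moreover have "(\<Sum>l\<in>I. B l u v) = (\<Sum>l\<in>I. B l v u)" for u v
    by (intro sum.cong refl semi_inner_productD(2) assms)
  moreover have "0 \<le> (\<Sum>l\<in>I. B l u u)" for u by (intro sum_nonneg semi_inner_productD(3) assms)
  ultimately show ?thesis by (simp add: semi_inner_product_def)
qed

text \<open>By Fatou's lemma the mean square of \<open>f - h\<close> is at most the limit inferior
  of the mean squares of \<open>q j - h\<close>, which is zero.\<close>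

lemma (in prob_space) AE_limit_eq_L2_limit:
  fixes q :: "nat \<Rightarrow> 'a \<Rightarrow> real"
  assumes meas: "\<And>j. q j \<in> borel_measurable M" "f \<in> borel_measurable M" "h \<in> borel_measurable M"
    and int: "\<And>j. integrable M (\<lambda>x. (q j x - h x)\<^sup>2)"
    and lim: "AE x in M. (\<lambda>j. q j x) \<longlonglongrightarrow> f x" and L2: "(\<lambda>j. \<integral>x. (q j x - h x)\<^sup>2 \<partial>M) \<longlonglongrightarrow> 0"
  shows "AE x in M. f x = h x"
proof -
  note [measurable] = meas
  have "(\<integral>\<^sup>+x. ennreal ((f x - h x)\<^sup>2) \<partial>M) = (\<integral>\<^sup>+x. liminf (\<lambda>j. ennreal ((q j x - h x)\<^sup>2)) \<partial>M)"
  proof (rule nn_integral_cong_AE, use lim in eventually_elim)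
    fix x assume "(\<lambda>j. q j x) \<longlonglongrightarrow> f x"
    then have "(\<lambda>j. ennreal ((q j x - h x)\<^sup>2)) \<longlonglongrightarrow> ennreal ((f x - h x)\<^sup>2)"
      by (intro tendsto_ennrealI tendsto_power tendsto_diff tendsto_const)
    then show "ennreal ((f x - h x)\<^sup>2) = liminf (\<lambda>j. ennreal ((q j x - h x)\<^sup>2))"
      by (intro lim_imp_Liminf[symmetric]) auto
  qed
  also have "\<dots> \<le> liminf (\<lambda>j. \<integral>\<^sup>+x. ennreal ((q j x - h x)\<^sup>2) \<partial>M)"
    by (rule nn_integral_liminf) measurable
  also have "(\<lambda>j. \<integral>\<^sup>+x. ennreal ((q j x - h x)\<^sup>2) \<partial>M) = (\<lambda>j. ennreal (\<integral>x. (q j x - h x)\<^sup>2 \<partial>M))"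
    using int by (intro ext nn_integral_eq_integral) auto
  also have "liminf (\<lambda>j. ennreal (\<integral>x. (q j x - h x)\<^sup>2 \<partial>M)) = 0"
    using tendsto_ennrealI[OF L2] by (intro lim_imp_Liminf) auto
  finally have "(\<integral>\<^sup>+x. ennreal ((f x - h x)\<^sup>2) \<partial>M) = 0" by simp
  then have "AE x in M. ennreal ((f x - h x)\<^sup>2) = 0" by (subst (asm) nn_integral_0_iff_AE) auto
  then show ?thesis by eventually_elim simp
qed

context density_model
begin

lemma N_facts: "open N" "convex N" "0 \<in> N"
proof -
  have "N = (\<lambda>v. \<tau>0 + v) -` S" by (auto simp: N_def)
  moreover have "open ((\<lambda>v. \<tau>0 + v) -` S)" by (intro open_vimage S(1) continuous_intros)
  ultimately show "open N" by simp
  have "N = (\<lambda>s. - \<tau>0 + s) ` S"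
  proof (intro set_eqI iffI)
    fix v assume "v \<in> N"
    then show "v \<in> (\<lambda>s. - \<tau>0 + s) ` S" by (intro image_eqI[of _ _ "\<tau>0 + v"]) (auto simp: N_def)
  qed (auto simp: N_def)
  then show "convex N" using convex_translation[OF S(3), of "- \<tau>0"] by simp
  show "0 \<in> N" using S(2) by (simp add: N_def)
qed

lemma D_eq_frechet:
  assumes "l \<in> {1..m}"
  shows "AE x in P0 l. \<forall>v\<in>N. (\<lambda>\<sigma>. \<eta> l \<sigma> x) differentiable (at (\<tau>0 + v)) \<and>
    (\<forall>w. D l v w x = frechet_derivative (\<lambda>\<sigma>. \<eta> l \<sigma> x) (at (\<tau>0 + v)) w)"
  using eta_diff[OF assms]
proof eventually_elim
  fix x assume d: "\<forall>\<tau>\<in>S. (\<lambda>\<sigma>. \<eta> l \<sigma> x) differentiable (at \<tau>)"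
  show "\<forall>v\<in>N. (\<lambda>\<sigma>. \<eta> l \<sigma> x) differentiable (at (\<tau>0 + v)) \<and>
    (\<forall>w. D l v w x = frechet_derivative (\<lambda>\<sigma>. \<eta> l \<sigma> x) (at (\<tau>0 + v)) w)"
  proof (intro ballI conjI allI)
    fix v w assume "v \<in> N"
    then show d': "(\<lambda>\<sigma>. \<eta> l \<sigma> x) differentiable (at (\<tau>0 + v))" using d by (simp add: N_def)
    show "D l v w x = frechet_derivative (\<lambda>\<sigma>. \<eta> l \<sigma> x) (at (\<tau>0 + v)) w"
      unfolding D_def using D_fst_D_snd_eq[OF d', of "fst w" "snd w"] by simp
  qed
qed

lemma D_quotient_lim:
  assumes "l \<in> {1..m}" "v \<in> N"
  shows "AE x in P0 l. (\<lambda>j. (g l (v + inverse (real (Suc j)) *\<^sub>R w) x - g l v x) * real (Suc j)) \<longlonglongrightarrow> D l v w x"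
  using D_eq_frechet[OF assms(1)]
proof eventually_elim
  fix x
  assume "\<forall>v\<in>N. (\<lambda>\<sigma>. \<eta> l \<sigma> x) differentiable (at (\<tau>0 + v)) \<and>
    (\<forall>w. D l v w x = frechet_derivative (\<lambda>\<sigma>. \<eta> l \<sigma> x) (at (\<tau>0 + v)) w)"
  then have "(\<lambda>\<sigma>. \<eta> l \<sigma> x) differentiable (at (\<tau>0 + v))"
    "D l v w x = frechet_derivative (\<lambda>\<sigma>. \<eta> l \<sigma> x) (at (\<tau>0 + v)) w" using assms(2) by blast+
  then show "(\<lambda>j. (g l (v + inverse (real (Suc j)) *\<^sub>R w) x - g l v x) * real (Suc j)) \<longlonglongrightarrow> D l v w x"
    using difference_quotient_LIMSEQ[of "\<lambda>\<sigma>. \<eta> l \<sigma> x" "\<tau>0 + v" w] by (simp add: g_def add.assoc)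
qed

lemma D_L2_0:
  assumes "l \<in> {1..m}" "v \<in> N"
  shows "D l v w \<in> L2_0 (P0 l)"
proof -
  interpret Q: prob_space "P0 l" by (rule prob_space_Q[OF assms(1)])
  have "\<tau>0 + v \<in> S" using assms(2) by (simp add: N_def)
  then show ?thesis
    unfolding D_def using D_bounded_linear[OF assms(1)] by (intro Q.L2_0_add) (auto simp: L2_bounded_linear_def)
qed

lemma D_linear:
  assumes "l \<in> {1..m}" "v \<in> N"
  shows "AE x in P0 l. D l v (u + w) x = D l v u x + D l v w x" "AE x in P0 l. D l v (c *\<^sub>R w) x = c * D l v w x"
proof -
  have S: "\<tau>0 + v \<in> S" using assms(2) by (simp add: N_def)
  note t = L2_bounded_linearD[OF conjunct1[OF D_bounded_linear[OF assms(1) S]]]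
    and h = L2_bounded_linearD[OF conjunct2[OF D_bounded_linear[OF assms(1) S]]]
  show "AE x in P0 l. D l v (u + w) x = D l v u x + D l v w x"
    unfolding D_def fst_add snd_add using t(2)[of "fst u" "fst w"] h(2)[of "snd u" "snd w"] by eventually_elim simp
  show "AE x in P0 l. D l v (c *\<^sub>R w) x = c * D l v w x"
    unfolding D_def fst_scaleR snd_scaleR using t(3)[of c "fst w"] h(3)[of c "snd w"]
    by eventually_elim (simp add: distrib_left)
qed

lemma L_L2:
  assumes l: "l \<in> {1..m}"
  shows "L l w \<in> L2_0 (P0 l)" "AE x in P0 l. L l (u + w) x = L l u x + L l w x" "AE x in P0 l. L l (c *\<^sub>R w) x = c * L l w x"
proof -
  interpret Q: prob_space "P0 l" by (rule prob_space_Q[OF l])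
  note t = L2_bounded_linearD[OF Lth(1)[OF l]] and h = L2_bounded_linearD[OF Lh[OF l]]
  show "L l w \<in> L2_0 (P0 l)" unfolding L_def by (intro Q.L2_0_add t(1) h(1))
  show "AE x in P0 l. L l (u + w) x = L l u x + L l w x"
    unfolding L_def fst_add snd_add using t(2)[of "fst u" "fst w"] h(2)[of "snd u" "snd w"] by eventually_elim simp
  show "AE x in P0 l. L l (c *\<^sub>R w) x = c * L l w x"
    unfolding L_def fst_scaleR snd_scaleR using t(3)[of c "fst w"] h(3)[of c "snd w"]
    by eventually_elim (simp add: distrib_left)
qed

definition ipW :: "(real ^ 'p) \<times> 'h \<Rightarrow> (real ^ 'p) \<times> 'h \<Rightarrow> real" where
  "ipW u v = sum_cov m P0 (\<lambda>l. L l u) (\<lambda>l. L l v)"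

lemma W_ipW: "W w = ipW w w"
  by (simp add: W_def ipW_def)

lemma ipW_semi_inner_product: "semi_inner_product ipW"
proof -
  have "semi_inner_product (\<lambda>u v. \<Sum>l=1..m. cov (P0 l) (L l u) (L l v))"
  proof (rule semi_inner_product_sum)
    fix l assume l: "l \<in> {1..m}"
    interpret Q: prob_space "P0 l" by (rule prob_space_Q[OF l])
    show "semi_inner_product (\<lambda>u v. cov (P0 l) (L l u) (L l v))"
      by (rule Q.L2_linear_semi_inner_product[OF L_L2[OF l]])
  qed
  then show ?thesis unfolding ipW_def .
qed

lemma W_scale: "W (t *\<^sub>R v) = t\<^sup>2 * W v"
  unfolding W_ipW by (simp add: semi_inner_product_add_scale[OF ipW_semi_inner_product] power2_eq_square)

lemma W_nonneg: "0 \<le> W v"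
  unfolding W_ipW by (rule semi_inner_productD(3)[OF ipW_semi_inner_product])

lemma L2_bounded_linear_square:
  assumes "prob_space Pr" "L2_bounded_linear Pr T"
  shows "\<exists>K\<ge>0. \<forall>v. cov Pr (T v) (T v) \<le> K * (norm v)\<^sup>2"
proof -
  obtain K where K: "\<And>v. L2_norm Pr (T v) \<le> K * norm v" using assms(2) by (auto simp: L2_bounded_linear_def)
  have "cov Pr (T v) (T v) \<le> K\<^sup>2 * (norm v)\<^sup>2" for v
  proof -
    have T: "T v \<in> L2_0 Pr" by (rule L2_bounded_linearD(1)[OF assms(2)])
    have "cov Pr (T v) (T v) = (L2_norm Pr (T v))\<^sup>2"
      unfolding cov_L2_0[OF T] L2_norm_def by (simp add: power2_eq_square integral_nonneg_AE)
    also have "\<dots> \<le> (K * norm v)\<^sup>2"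
      using K[of v] by (intro power_mono) (auto simp: L2_norm_def)
    finally show ?thesis by (simp add: power_mult_distrib)
  qed
  then show ?thesis by (intro exI[of _ "K\<^sup>2"]) auto
qed

lemma D_compare':
  assumes "v \<in> N"
  shows "C1 * W w \<le> (\<Sum>l=1..m. LINT x|P0 l. (D l v w x)\<^sup>2)" "(\<Sum>l=1..m. LINT x|P0 l. (D l v w x)\<^sup>2) \<le> C2 * W w"
proof -
  have S: "\<tau>0 + v \<in> S" using assms by (simp add: N_def)
  have eq: "sum_var m P0 (\<lambda>l x. D_theta (\<eta> l) (\<tau>0 + v) (fst w) x + D_h (\<eta> l) (\<tau>0 + v) (snd w) x) =
      (\<Sum>l=1..m. LINT x|P0 l. (D l v w x)\<^sup>2)"
  proof (rule sum.cong[OF refl])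
    fix l assume l: "l \<in> {1..m}"
    show "cov (P0 l) (\<lambda>x. D_theta (\<eta> l) (\<tau>0 + v) (fst w) x + D_h (\<eta> l) (\<tau>0 + v) (snd w) x)
       (\<lambda>x. D_theta (\<eta> l) (\<tau>0 + v) (fst w) x + D_h (\<eta> l) (\<tau>0 + v) (snd w) x) = (LINT x|P0 l. (D l v w x)\<^sup>2)"
      using cov_L2_0[OF D_L2_0[OF l assms, of w], of "D l v w"] unfolding D_def power2_eq_square .
  qed
  show "C1 * W w \<le> (\<Sum>l=1..m. LINT x|P0 l. (D l v w x)\<^sup>2)" "(\<Sum>l=1..m. LINT x|P0 l. (D l v w x)\<^sup>2) \<le> C2 * W w"
    using D_compare[OF S, of "fst w" "snd w"] unfolding eq W_def L_def by auto
qed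

text \<open>The \<open>L\<^sup>2\<close> derivative of \<open>\<eta> l\<close> is identified with the pointwise derivative \<open>D\<close> along difference quotients.\<close>

lemma L2_derivative:
  assumes l: "l \<in> {1..m}"
  obtains E where
    "\<And>v w. v \<in> N \<Longrightarrow> AE x in P0 l. E v w x = D l v w x"
    "\<And>v \<epsilon>. v \<in> N \<Longrightarrow> 0 < \<epsilon> \<Longrightarrow> \<exists>\<delta>>0. \<forall>u. u \<in> N \<longrightarrow> norm (u - v) < \<delta> \<longrightarrow>
       L2_norm (P0 l) (\<lambda>x. g l u x - g l v x - E v (u - v) x) \<le> \<epsilon> * norm (u - v)"
    "\<And>v w. v \<in> N \<Longrightarrow> E v w \<in> L2_0 (P0 l)"
proof -
  interpret Q: prob_space "P0 l" by (rule prob_space_Q[OF l])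
  from eta_C3[OF l, unfolded L2_Ck_on_def] obtain Dm where Dm:
    "(\<forall>\<tau>\<in>S. Dm 0 \<tau> [] = \<eta> l \<tau>) \<and>
     (\<forall>j\<le>3. \<forall>\<tau>\<in>S. L2_bounded_multilinear (P0 l) j (Dm j \<tau>)) \<and>
     (\<forall>j<3. \<forall>\<tau>\<in>S. \<forall>\<epsilon>>0. \<exists>\<delta>>0. \<forall>\<sigma>\<in>S. norm (\<sigma> - \<tau>) < \<delta> \<longrightarrow>
        (\<forall>vs. length vs = j \<longrightarrow>
           L2_norm (P0 l) (\<lambda>x. Dm j \<sigma> vs x - Dm j \<tau> vs x - Dm (Suc j) \<tau> ((\<sigma> - \<tau>) # vs) x)
             \<le> \<epsilon> * norm (\<sigma> - \<tau>) * prod_list (map norm vs))) \<and>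
     (\<forall>\<tau>\<in>S. \<forall>\<epsilon>>0. \<exists>\<delta>>0. \<forall>\<sigma>\<in>S. norm (\<sigma> - \<tau>) < \<delta> \<longrightarrow>
        (\<forall>vs. length vs = 3 \<longrightarrow>
           L2_norm (P0 l) (\<lambda>x. Dm 3 \<sigma> vs x - Dm 3 \<tau> vs x) \<le> \<epsilon> * prod_list (map norm vs)))"
    by (rule exE)
  note D0 = conjunct1[OF Dm, rule_format]
    and Dlin = conjunct1[OF conjunct2[OF Dm], rule_format]
    and Ddiff = conjunct1[OF conjunct2[OF conjunct2[OF Dm]], rule_format]
  define E where "E = (\<lambda>v w. Dm 1 (\<tau>0 + v) [w])"
  have EL: "E v w \<in> L2_0 (P0 l)" if "v \<in> N" for v w
    using Dlin[of 1 "\<tau>0 + v"] that unfolding L2_bounded_multilinear_def E_def N_def by simp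
  have Escale: "AE x in P0 l. E v (c *\<^sub>R w) x = c * E v w x" if "v \<in> N" for v c w
  proof -
    have "\<forall>vs. length vs = 1 \<longrightarrow> (\<forall>i<1. \<forall>c u. AE x in P0 l. Dm 1 (\<tau>0 + v) (vs[i := c *\<^sub>R u]) x = c * Dm 1 (\<tau>0 + v) (vs[i := u]) x)"
      using Dlin[of 1 "\<tau>0 + v"] that unfolding L2_bounded_multilinear_def N_def by simp
    from this[rule_format, of "[w]" 0 c w] show ?thesis by (simp add: E_def)
  qed
  have diff: "\<exists>\<delta>>0. \<forall>u. u \<in> N \<longrightarrow> norm (u - v) < \<delta> \<longrightarrow>
       L2_norm (P0 l) (\<lambda>x. g l u x - g l v x - E v (u - v) x) \<le> \<epsilon> * norm (u - v)" if v: "v \<in> N" and \<epsilon>: "0 < \<epsilon>" for v \<epsilon>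
  proof -
    have vS: "\<tau>0 + v \<in> S" using v by (simp add: N_def)
    have three: "0 < (3::nat)" by simp
    obtain \<delta> where \<delta>0: "\<delta> > 0" and \<delta>1: "\<forall>\<sigma>\<in>S. norm (\<sigma> - (\<tau>0 + v)) < \<delta> \<longrightarrow>
        (\<forall>vs. length vs = 0 \<longrightarrow>
        L2_norm (P0 l) (\<lambda>x. Dm 0 \<sigma> vs x - Dm 0 (\<tau>0 + v) vs x - Dm (Suc 0) (\<tau>0 + v) ((\<sigma> - (\<tau>0 + v)) # vs) x)
             \<le> \<epsilon> * norm (\<sigma> - (\<tau>0 + v)) * prod_list (map norm vs))"
      using Ddiff[OF three vS \<epsilon>] by (elim exE conjE)
    have \<delta>: "\<delta> > 0" "\<And>\<sigma>. \<sigma> \<in> S \<Longrightarrow> norm (\<sigma> - (\<tau>0 + v)) < \<delta> \<Longrightarrow>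
        L2_norm (P0 l) (\<lambda>x. Dm 0 \<sigma> [] x - Dm 0 (\<tau>0 + v) [] x - Dm (Suc 0) (\<tau>0 + v) [\<sigma> - (\<tau>0 + v)] x)
             \<le> \<epsilon> * norm (\<sigma> - (\<tau>0 + v))"
      using \<delta>0 \<delta>1[rule_format, of _ "[]"] by simp_all
    show ?thesis
    proof (intro exI[of _ \<delta>] conjI allI impI)
      fix u assume u: "u \<in> N" "norm (u - v) < \<delta>"
      have uS: "\<tau>0 + u \<in> S" using u by (simp add: N_def)
      show "L2_norm (P0 l) (\<lambda>x. g l u x - g l v x - E v (u - v) x) \<le> \<epsilon> * norm (u - v)"
        using \<delta>(2)[OF uS] u(2) by (simp add: D0 uS vS g_def E_def)
    qed (rule \<delta>(1))
  qed
  have ED: "AE x in P0 l. E v w x = D l v w x" if v: "v \<in> N" for v w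
  proof -
    define h where "h = (\<lambda>j. inverse (real (Suc j)))"
    have h: "0 < h j" "h j * real (Suc j) = 1" for j by (auto simp: h_def)
    have hl: "h \<longlonglongrightarrow> 0" unfolding h_def by (rule LIMSEQ_inverse_real_of_nat)
    define q where "q = (\<lambda>j x. (g l (v + h j *\<^sub>R w) x - g l v x) * real (Suc j))"
    have gL: "g l u \<in> L2_0 (P0 l)" for u
    proof -
      have "(\<lambda>x. \<eta> l (\<tau>0 + u) x + (-1) * \<eta> l \<tau>0 x) \<in> L2_0 (P0 l)"
      proof (rule Q.L2_0_add[OF eta_L2_0[OF l]])
        show "(\<lambda>x. (-1) * \<eta> l \<tau>0 x) \<in> L2_0 (P0 l)"
          using L2_0D[OF eta_L2_0[OF l, of \<tau>0]] by (auto simp: L2_0_def L2_def)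
      qed
      then show ?thesis unfolding g_def[abs_def] by simp
    qed
    have scaleL: "(\<lambda>x. c * f x) \<in> L2_0 (P0 l)" if "f \<in> L2_0 (P0 l)" for f c
      using L2_0D[OF that] by (auto simp: L2_0_def L2_def power_mult_distrib)
    have rL: "(\<lambda>x. q j x - E v w x) \<in> L2_0 (P0 l)" for j
    proof -
      have "(\<lambda>x. (real (Suc j) * g l (v + h j *\<^sub>R w) x + (- real (Suc j)) * g l v x) + (-1) * E v w x) \<in> L2_0 (P0 l)"
        by (intro Q.L2_0_add scaleL gL EL v)
      then show ?thesis by (simp add: q_def algebra_simps)
    qed
    have lim0: "(\<lambda>j. L2_norm (P0 l) (\<lambda>x. q j x - E v w x)) \<longlonglongrightarrow> 0"
    proof (rule LIMSEQ_I)
      fix e :: real assume e: "0 < e"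
      define \<epsilon> where "\<epsilon> = e / (2 * (norm w + 1))"
      have \<epsilon>: "0 < \<epsilon>" "\<epsilon> * norm w < e"
      proof -
        have p: "0 < norm w + 1" by (simp add: add_nonneg_pos)
        then show "0 < \<epsilon>" using e by (simp add: \<epsilon>_def)
        have "\<epsilon> * norm w \<le> \<epsilon> * (norm w + 1)" using \<open>0 < \<epsilon>\<close> by (intro mult_left_mono) auto
        also have "\<dots> = e / 2"
        proof -
          have half: "e / (2 * y) * y = e / 2" if "0 < y" for y using that by simp
          show ?thesis unfolding \<epsilon>_def by (rule half[OF p])
        qed
        finally show "\<epsilon> * norm w < e" using e by linarith
      qed
      obtain \<delta> where \<delta>: "\<delta> > 0" "\<And>u. u \<in> N \<Longrightarrow> norm (u - v) < \<delta> \<Longrightarrow>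
          L2_norm (P0 l) (\<lambda>x. g l u x - g l v x - E v (u - v) x) \<le> \<epsilon> * norm (u - v)"
        using diff[OF v \<epsilon>(1)] by blast
      have lim: "(\<lambda>j. v + h j *\<^sub>R w) \<longlonglongrightarrow> v" using tendsto_add[OF tendsto_const tendsto_scaleR[OF hl tendsto_const]] by simp
      have "\<forall>\<^sub>F j in sequentially. v + h j *\<^sub>R w \<in> N" using topological_tendstoD[OF lim N_facts(1) v] .
      moreover have "\<forall>\<^sub>F j in sequentially. norm (v + h j *\<^sub>R w - v) < \<delta>"
        using tendstoD[OF lim \<delta>(1)] by (simp add: dist_norm)
      ultimately have "\<forall>\<^sub>F j in sequentially. norm (L2_norm (P0 l) (\<lambda>x. q j x - E v w x) - 0) < e"
      proof eventually_elim
        fix j assume N: "v + h j *\<^sub>R w \<in> N" and s: "norm (v + h j *\<^sub>R w - v) < \<delta>"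
        let ?r = "\<lambda>x. g l (v + h j *\<^sub>R w) x - g l v x - E v (h j *\<^sub>R w) x"
        have b: "L2_norm (P0 l) ?r \<le> \<epsilon> * (h j * norm w)" using \<delta>(2)[OF N s] h(1)[of j] by simp
        have "L2_norm (P0 l) (\<lambda>x. q j x - E v w x) = sqrt (LINT x|P0 l. (real (Suc j))\<^sup>2 * (?r x)\<^sup>2)"
          unfolding L2_norm_def
        proof (intro arg_cong[of _ _ sqrt] integral_cong_AE)
          show "(\<lambda>x. (q j x - E v w x)\<^sup>2) \<in> borel_measurable (P0 l)" using L2_0D(1)[OF rL[of j]] by measurable
          show "(\<lambda>x. (real (Suc j))\<^sup>2 * (?r x)\<^sup>2) \<in> borel_measurable (P0 l)"
            using g_meas[OF l] L2_0D(1)[OF EL[OF v]] by measurable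
          show "AE x in P0 l. (q j x - E v w x)\<^sup>2 = (real (Suc j))\<^sup>2 * (?r x)\<^sup>2"
            using Escale[OF v, of "h j" w]
          proof eventually_elim
            fix x assume sc: "E v (h j *\<^sub>R w) x = h j * E v w x"
            have "real (Suc j) * ?r x = q j x - (h j * real (Suc j)) * E v w x"
              unfolding sc q_def by (simp add: algebra_simps)
            then have "real (Suc j) * ?r x = q j x - E v w x" using h(2)[of j] by simp
            then show "(q j x - E v w x)\<^sup>2 = (real (Suc j))\<^sup>2 * (?r x)\<^sup>2" unfolding power_mult_distrib[symmetric] by simp
          qed
        qed
        also have "\<dots> = real (Suc j) * L2_norm (P0 l) ?r" by (simp add: L2_norm_def real_sqrt_mult)
        also have "\<dots> \<le> real (Suc j) * (\<epsilon> * (h j * norm w))" using b by (intro mult_left_mono) auto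
        also have "\<dots> = (h j * real (Suc j)) * (\<epsilon> * norm w)" by simp
        also have "\<dots> < e" using h(2)[of j] \<epsilon>(2) by simp
        finally show "norm (L2_norm (P0 l) (\<lambda>x. q j x - E v w x) - 0) < e"
          by (simp add: L2_norm_def)
      qed
      then show "\<exists>no. \<forall>j\<ge>no. norm (L2_norm (P0 l) (\<lambda>x. q j x - E v w x) - 0) < e"
        by (simp add: eventually_sequentially)
    qed
    have L2lim: "(\<lambda>j. LINT x|P0 l. (q j x - E v w x)\<^sup>2) \<longlonglongrightarrow> 0"
    proof -
      have "(\<lambda>j. (L2_norm (P0 l) (\<lambda>x. q j x - E v w x))\<^sup>2) \<longlonglongrightarrow> 0\<^sup>2" by (intro tendsto_power lim0)
      then show ?thesis by (simp add: L2_norm_def integral_nonneg_AE)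
    qed
    have "AE x in P0 l. D l v w x = E v w x"
    proof (rule Q.AE_limit_eq_L2_limit[where q = q])
      show "q j \<in> borel_measurable (P0 l)" for j unfolding q_def using g_meas[OF l] by measurable
      show "D l v w \<in> borel_measurable (P0 l)" by (rule L2_0D(1)[OF D_L2_0[OF l v]])
      show "E v w \<in> borel_measurable (P0 l)" by (rule L2_0D(1)[OF EL[OF v]])
      show "integrable (P0 l) (\<lambda>x. (q j x - E v w x)\<^sup>2)" for j by (rule L2_0D(2)[OF rL])
      show "AE x in P0 l. (\<lambda>j. q j x) \<longlonglongrightarrow> D l v w x" unfolding q_def h_def by (rule D_quotient_lim[OF l v])
    qed (rule L2lim)
    then show ?thesis by eventually_elim simp
  qed
  show thesis by (rule that[OF ED diff EL])
qed

end

context density_model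
begin

lemma g_L2_0:
  assumes l: "l \<in> {1..m}"
  shows "g l u \<in> L2_0 (P0 l)" "(\<lambda>x. g l u x - g l v x) \<in> L2_0 (P0 l)"
proof -
  interpret Q: prob_space "P0 l" by (rule prob_space_Q[OF l])
  have neg: "(\<lambda>x. (-1) * \<eta> l \<tau> x) \<in> L2_0 (P0 l)" for \<tau>
    using L2_0D[OF eta_L2_0[OF l, of \<tau>]] by (auto simp: L2_0_def L2_def)
  show "g l u \<in> L2_0 (P0 l)"
    using Q.L2_0_add[OF eta_L2_0[OF l] neg] unfolding g_def[abs_def] by simp
  show "(\<lambda>x. g l u x - g l v x) \<in> L2_0 (P0 l)"
    using Q.L2_0_add[OF eta_L2_0[OF l, of "\<tau>0 + u"] neg[of "\<tau>0 + v"]] unfolding g_def[abs_def] by simp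
qed

text \<open>Pairing with a fixed \<open>f\<close> reduces the derivative in mean square to that of a
  real function of \<open>s\<close>, to which the mean value theorem applies. Cauchy-Schwarz carries
  the remainder over.\<close>

lemma weak_derivative:
  assumes l: "l \<in> {1..m}" and f: "f \<in> L2_0 (P0 l)" and p: "v + s *\<^sub>R w \<in> N"
  shows "((\<lambda>s. LINT x|P0 l. f x * g l (v + s *\<^sub>R w) x) has_real_derivative (LINT x|P0 l. f x * D l (v + s *\<^sub>R w) w x)) (at s)"
proof -
  interpret Q: prob_space "P0 l" by (rule prob_space_Q[OF l])
  obtain E where ED: "\<And>v w. v \<in> N \<Longrightarrow> AE x in P0 l. E v w x = D l v w x"
    and E: "\<And>v \<epsilon>. v \<in> N \<Longrightarrow> 0 < \<epsilon> \<Longrightarrow> \<exists>\<delta>>0. \<forall>u. u \<in> N \<longrightarrow> norm (u - v) < \<delta> \<longrightarrow>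
       L2_norm (P0 l) (\<lambda>x. g l u x - g l v x - E v (u - v) x) \<le> \<epsilon> * norm (u - v)"
    and EL: "\<And>v w. v \<in> N \<Longrightarrow> E v w \<in> L2_0 (P0 l)"
    by (rule L2_derivative[OF l]) (rule that)
  let ?p = "v + s *\<^sub>R w"
  let ?c = "LINT x|P0 l. f x * D l ?p w x"
  let ?\<psi> = "\<lambda>s. LINT x|P0 l. f x * g l (v + s *\<^sub>R w) x"
  note fL = L2_0D[OF f]
  have prod: "integrable (P0 l) (\<lambda>x. f x * h x)" if "h \<in> L2_0 (P0 l)" for h
    using Q.mean_zero_cauchy_schwarz(1)[OF fL(1) L2_0D(1)[OF that] fL(2) L2_0D(2)[OF that]] .
  define F where "F = L2_norm (P0 l) f"
  have F0: "0 \<le> F" by (simp add: F_def L2_norm_def)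
  have "(?\<psi> has_derivative (\<lambda>h. ?c * h)) (at s)"
    unfolding has_derivative_at_alt
  proof (intro conjI allI impI)
    show "bounded_linear (\<lambda>h. ?c * h)" by (rule bounded_linear_mult_right)
    fix e :: real assume e: "0 < e"
    define \<epsilon> where "\<epsilon> = e / ((F + 1) * (norm w + 1))"
    have pos: "0 < F + 1" "0 < norm w + 1" using F0 by (auto simp: add_nonneg_pos)
    have \<epsilon>: "0 < \<epsilon>" unfolding \<epsilon>_def using e pos by simp
    have \<epsilon>e: "F * (\<epsilon> * norm w) \<le> e"
    proof -
      have "F * (\<epsilon> * norm w) \<le> (F + 1) * (\<epsilon> * (norm w + 1))"
        using F0 \<epsilon> by (intro mult_mono) auto
      also have "\<dots> = e"
      proof -
        have "a * (e / (a * b) * b) = e" if "0 < a" "0 < b" for a b :: real using that by simp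
        from this[OF pos] show ?thesis unfolding \<epsilon>_def .
      qed
      finally show ?thesis .
    qed
    obtain \<delta> where \<delta>: "\<delta> > 0" "\<And>u. u \<in> N \<Longrightarrow> norm (u - ?p) < \<delta> \<Longrightarrow>
       L2_norm (P0 l) (\<lambda>x. g l u x - g l ?p x - E ?p (u - ?p) x) \<le> \<epsilon> * norm (u - ?p)"
      using E[OF p \<epsilon>] by blast
    obtain d0 where d0: "d0 > 0" "\<And>u. dist u ?p < d0 \<Longrightarrow> u \<in> N"
      using N_facts(1) p unfolding open_dist by blast
    show "\<exists>d>0. \<forall>y. norm (y - s) < d \<longrightarrow> norm (?\<psi> y - ?\<psi> s - ?c * (y - s)) \<le> e * norm (y - s)"
    proof (intro exI[of _ "min \<delta> d0 / (norm w + 1)"] conjI allI impI)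
      show "0 < min \<delta> d0 / (norm w + 1)" using \<delta> d0 pos by simp
      fix y assume y: "norm (y - s) < min \<delta> d0 / (norm w + 1)"
      let ?u = "v + y *\<^sub>R w"
      have diff: "?u - ?p = (y - s) *\<^sub>R w" by (simp add: scaleR_left_diff_distrib)
      have "norm (?u - ?p) = \<bar>y - s\<bar> * norm w" unfolding diff by simp
      also have "\<dots> \<le> \<bar>y - s\<bar> * (norm w + 1)" by (intro mult_left_mono) auto
      also have "\<dots> < min \<delta> d0" using y pos by (simp add: less_divide_eq)
      finally have small: "norm (?u - ?p) < \<delta>" "norm (?u - ?p) < d0" by auto
      have uN: "?u \<in> N" using d0(2)[of ?u] small(2) by (simp add: dist_norm)
      let ?r = "\<lambda>x. g l ?u x - g l ?p x - (y - s) * D l ?p w x"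
      have rL: "?r \<in> L2_0 (P0 l)"
      proof -
        have "(\<lambda>x. (- (y - s)) * D l ?p w x) \<in> L2_0 (P0 l)"
          using L2_0D[OF D_L2_0[OF l p, of w]] by (auto simp: L2_0_def L2_def power_mult_distrib)
        from Q.L2_0_add[OF g_L2_0(2)[OF l, of ?u ?p] this]
        have "(\<lambda>x. g l ?u x - g l ?p x + (- (y - s)) * D l ?p w x) \<in> L2_0 (P0 l)" .
        moreover have "(\<lambda>x. g l ?u x - g l ?p x + (- (y - s)) * D l ?p w x) = ?r"
          by (rule ext) (simp add: algebra_simps)
        ultimately show ?thesis by (simp only:)
      qed
      have eq1: "?\<psi> y - ?\<psi> s - ?c * (y - s) = (LINT x|P0 l. f x * ?r x)"
      proof -
        have "(LINT x|P0 l. f x * ?r x) = (LINT x|P0 l. f x * g l ?u x - f x * g l ?p x - (y - s) * (f x * D l ?p w x))"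
          by (intro Bochner_Integration.integral_cong) (auto simp: algebra_simps)
        also have "\<dots> = ?\<psi> y - ?\<psi> s - (y - s) * ?c"
          using prod[OF g_L2_0(1)[OF l]] prod[OF D_L2_0[OF l p]] by simp
        finally show ?thesis by simp
      qed
      have le1: "\<bar>LINT x|P0 l. f x * ?r x\<bar> \<le> sqrt (LINT x|P0 l. (f x)\<^sup>2) * sqrt (LINT x|P0 l. (?r x)\<^sup>2)"
        by (rule Q.mean_zero_cauchy_schwarz(2)[OF fL(1) L2_0D(1)[OF rL] fL(2) L2_0D(2)[OF rL]])
      have eq2: "sqrt (LINT x|P0 l. (?r x)\<^sup>2) = L2_norm (P0 l) (\<lambda>x. g l ?u x - g l ?p x - E ?p (?u - ?p) x)"
        unfolding L2_norm_def
      proof (rule arg_cong[where f = sqrt], rule integral_cong_AE)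
        show "(\<lambda>x. (?r x)\<^sup>2) \<in> borel_measurable (P0 l)" by (rule borel_measurable_power[OF L2_0D(1)[OF rL]])
        show "(\<lambda>x. (g l ?u x - g l ?p x - E ?p (?u - ?p) x)\<^sup>2) \<in> borel_measurable (P0 l)"
          by (intro borel_measurable_power borel_measurable_diff g_meas[OF l] L2_0D(1)[OF EL[OF p]])
        show "AE x in P0 l. (?r x)\<^sup>2 = (g l ?u x - g l ?p x - E ?p (?u - ?p) x)\<^sup>2"
          using ED[OF p, of "?u - ?p"] D_linear(2)[OF l p, of "y - s" w] unfolding diff
          by eventually_elim (simp only:)
      qed
      have le2: "L2_norm (P0 l) (\<lambda>x. g l ?u x - g l ?p x - E ?p (?u - ?p) x) \<le> \<epsilon> * norm (?u - ?p)"
        by (rule \<delta>(2)[OF uN small(1)])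
      have "norm (?\<psi> y - ?\<psi> s - ?c * (y - s)) \<le> F * sqrt (LINT x|P0 l. (?r x)\<^sup>2)"
        unfolding eq1 real_norm_def using le1 unfolding F_def L2_norm_def .
      also have "\<dots> \<le> F * (\<epsilon> * norm (?u - ?p))"
        using le2 F0 unfolding eq2 by (rule mult_left_mono)
      also have "\<dots> = (F * (\<epsilon> * norm w)) * \<bar>y - s\<bar>" unfolding diff by simp
      also have "\<dots> \<le> e * \<bar>y - s\<bar>" using \<epsilon>e by (intro mult_right_mono) auto
      finally show "norm (?\<psi> y - ?\<psi> s - ?c * (y - s)) \<le> e * norm (y - s)" unfolding real_norm_def[of "y - s"] .
    qed
  qed
  then show ?thesis by (simp add: has_field_derivative_def)
qed

text \<open>Mean value theorem for the pairing with the increment itself: its squared norm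
  \<open>T\<close> equals its pairing with the derivative at an intermediate point. Cauchy-Schwarz
  and the upper comparison give \<open>T * T \<le> T * (C2 * W w)\<close>, and \<open>T\<close> is
  cancelled.\<close>

lemma g_lipschitz:
  assumes u: "u \<in> N" and v: "v \<in> N"
  shows "(\<Sum>l=1..m. LINT x|P0 l. (g l u x - g l v x)\<^sup>2) \<le> C2 * W (u - v)"
proof -
  define w where "w = u - v"
  define f where "f = (\<lambda>l x. g l u x - g l v x)"
  have fL: "f l \<in> L2_0 (P0 l)" if "l \<in> {1..m}" for l unfolding f_def by (rule g_L2_0(2)[OF that])
  define T where "T = (\<Sum>l=1..m. LINT x|P0 l. (f l x)\<^sup>2)"
  have T0: "0 \<le> T" unfolding T_def by (intro sum_nonneg integral_nonneg_AE) auto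
  let ?\<phi> = "\<lambda>s. \<Sum>l=1..m. LINT x|P0 l. f l x * g l (v + s *\<^sub>R w) x"
  let ?\<phi>' = "\<lambda>s. \<Sum>l=1..m. LINT x|P0 l. f l x * D l (v + s *\<^sub>R w) w x"
  have N: "v + s *\<^sub>R w \<in> N" if "0 \<le> s" "s \<le> 1" for s
  proof -
    have "v + s *\<^sub>R w = (1 - s) *\<^sub>R v + s *\<^sub>R u" by (simp add: w_def algebra_simps)
    then show ?thesis using convexD_alt[OF N_facts(2) v u that] by simp
  qed
  have "(?\<phi> has_real_derivative ?\<phi>' s) (at s)" if "0 \<le> s" "s \<le> 1" for s
    by (intro DERIV_sum weak_derivative fL N that)
  then obtain z where z: "0 < z" "z < 1" "?\<phi> 1 - ?\<phi> 0 = (1 - 0) * ?\<phi>' z"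
    using MVT2[of 0 1 ?\<phi> ?\<phi>'] by auto
  have "?\<phi> 1 - ?\<phi> 0 = T"
    unfolding T_def sum_subtractf[symmetric]
  proof (rule sum.cong[OF refl])
    fix l assume l: "l \<in> {1..m}"
    interpret Q: prob_space "P0 l" by (rule prob_space_Q[OF l])
    have i: "integrable (P0 l) (\<lambda>x. f l x * g l q x)" for q
      using Q.mean_zero_cauchy_schwarz(1)[OF L2_0D(1)[OF fL[OF l]] L2_0D(1)[OF g_L2_0(1)[OF l]] L2_0D(2)[OF fL[OF l]] L2_0D(2)[OF g_L2_0(1)[OF l]]] .
    have "(LINT x|P0 l. f l x * g l (v + 1 *\<^sub>R w) x) - (LINT x|P0 l. f l x * g l (v + 0 *\<^sub>R w) x) =
        (LINT x|P0 l. f l x * g l u x - f l x * g l v x)" using i by (simp add: w_def)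
    also have "\<dots> = (LINT x|P0 l. (f l x)\<^sup>2)"
      by (intro Bochner_Integration.integral_cong) (auto simp: f_def power2_eq_square algebra_simps)
    finally show "(LINT x|P0 l. f l x * g l (v + 1 *\<^sub>R w) x) - (LINT x|P0 l. f l x * g l (v + 0 *\<^sub>R w) x) =
        (LINT x|P0 l. (f l x)\<^sup>2)" .
  qed
  then have "T = ?\<phi>' z" using z(3) by simp
  have zN: "v + z *\<^sub>R w \<in> N" using z by (intro N) auto
  let ?a = "\<lambda>l. sqrt (LINT x|P0 l. (f l x)\<^sup>2)" and ?b = "\<lambda>l. sqrt (LINT x|P0 l. (D l (v + z *\<^sub>R w) w x)\<^sup>2)"
  have "T \<le> (\<Sum>l=1..m. ?a l * ?b l)"
    unfolding \<open>T = ?\<phi>' z\<close>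
  proof (rule sum_mono)
    fix l assume l: "l \<in> {1..m}"
    interpret Q: prob_space "P0 l" by (rule prob_space_Q[OF l])
    note DL = L2_0D[OF D_L2_0[OF l zN, of w]] and fl = L2_0D[OF fL[OF l]]
    show "(LINT x|P0 l. f l x * D l (v + z *\<^sub>R w) w x) \<le> ?a l * ?b l"
      using Q.mean_zero_cauchy_schwarz(2)[OF fl(1) DL(1) fl(2) DL(2)] by linarith
  qed
  then have "T\<^sup>2 \<le> (\<Sum>l=1..m. ?a l * ?b l)\<^sup>2" using T0 by (intro power_mono)
  also have "\<dots> \<le> (\<Sum>l=1..m. (?a l)\<^sup>2) * (\<Sum>l=1..m. (?b l)\<^sup>2)" by (rule Cauchy_Schwarz_ineq_sum)
  also have "(\<Sum>l=1..m. (?a l)\<^sup>2) = T" unfolding T_def by (simp add: integral_nonneg_AE)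
  also have "T * (\<Sum>l=1..m. (?b l)\<^sup>2) \<le> T * (C2 * W w)"
    using D_compare'(2)[OF zN, of w] T0 by (intro mult_left_mono) (simp_all add: integral_nonneg_AE)
  finally have "T * T \<le> T * (C2 * W w)" by (simp add: power2_eq_square)
  then have "T \<le> C2 * W w"
  proof (cases "T = 0")
    case True
    then show ?thesis using W_nonneg[of w] C_pos by simp
  next
    case False
    then show ?thesis using \<open>T * T \<le> T * (C2 * W w)\<close> T0 by (simp add: mult_le_cancel_left)
  qed
  then show ?thesis unfolding T_def f_def w_def .
qed

lemma g_concave:
  assumes l: "l \<in> {1..m}" and t: "0 \<le> t" "t \<le> 1"
  shows "AE x in P0 l. t * g l u x + (1 - t) * g l v x -
        (t * (\<Sum>l=1..m. A l u) + (1 - t) * (\<Sum>l=1..m. A l v) - (\<Sum>l=1..m. A l (t *\<^sub>R u + (1 - t) *\<^sub>R v)))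
        \<le> g l (t *\<^sub>R u + (1 - t) *\<^sub>R v) x"
  using eta_almost_concave[OF l t, of "\<tau>0 + u" "\<tau>0 + v"]
proof eventually_elim
  fix x
  have \<pi>: "t *\<^sub>R (\<tau>0 + u) + (1 - t) *\<^sub>R (\<tau>0 + v) = \<tau>0 + (t *\<^sub>R u + (1 - t) *\<^sub>R v)"
    by (simp add: algebra_simps)
  assume *: "t * \<eta> l (\<tau>0 + u) x + (1 - t) * \<eta> l (\<tau>0 + v) x -
     (\<Sum>l=1..m. t * ln (Z l (\<tau>0 + u)) + (1 - t) * ln (Z l (\<tau>0 + v)) - ln (Z l (t *\<^sub>R (\<tau>0 + u) + (1 - t) *\<^sub>R (\<tau>0 + v))))
     \<le> \<eta> l (t *\<^sub>R (\<tau>0 + u) + (1 - t) *\<^sub>R (\<tau>0 + v)) x"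
  have "t * (\<Sum>l=1..m. A l u) + (1 - t) * (\<Sum>l=1..m. A l v) - (\<Sum>l=1..m. A l (t *\<^sub>R u + (1 - t) *\<^sub>R v)) =
    (\<Sum>l=1..m. t * A l u + (1 - t) * A l v - A l (t *\<^sub>R u + (1 - t) *\<^sub>R v))"
    by (simp add: sum.distrib sum_subtractf sum_distrib_left)
  also have "\<dots> = (\<Sum>l=1..m. t * ln (Z l (\<tau>0 + u)) + (1 - t) * ln (Z l (\<tau>0 + v)) - ln (Z l (\<tau>0 + (t *\<^sub>R u + (1 - t) *\<^sub>R v))))"
    by (intro sum.cong refl) (simp add: A_def algebra_simps)
  finally show "t * g l u x + (1 - t) * g l v x -
        (t * (\<Sum>l=1..m. A l u) + (1 - t) * (\<Sum>l=1..m. A l v) - (\<Sum>l=1..m. A l (t *\<^sub>R u + (1 - t) *\<^sub>R v)))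
        \<le> g l (t *\<^sub>R u + (1 - t) *\<^sub>R v) x"
    using * unfolding \<pi> by (simp add: g_def algebra_simps)
qed

lemma log_concave:
  assumes B: "0 \<le> B" "\<And>l v. l \<in> {1..m} \<Longrightarrow> v \<in> N \<Longrightarrow> AE x in P0 l. \<bar>g l v x - A l v\<bar> \<le> B"
  shows "log_concave_model P m P0 X g A N D W B C1 C2"
proof
  show "1 \<le> m" by (rule m_ge_1)
  show "convex N" "0 \<in> N" by (fact N_facts)+
  show "0 \<le> B" "0 < C1" "0 < C2" by (fact B C_pos)+
  show "W (t *\<^sub>R v) = t\<^sup>2 * W v" "0 \<le> W v" for t v by (rule W_scale, rule W_nonneg)
  fix l assume l: "l \<in> {1..m}"
  show "g l v \<in> borel_measurable (P0 l)" for v by (rule g_meas[OF l])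
  show "(LINT x|P0 l. g l v x) = 0" for v by (rule L2_0D(3)[OF g_L2_0(1)[OF l]])
  show "(LINT x|P0 l. exp (g l v x - A l v)) = 1" for v by (rule ratio_normalized(1)[OF l])
  show "AE x in P0 l. \<bar>g l v x - A l v\<bar> \<le> B" if "v \<in> N" for v by (rule B(2)[OF l that])
  show "AE x in P0 l. t * g l u x + (1 - t) * g l v x -
        (t * (\<Sum>l=1..m. A l u) + (1 - t) * (\<Sum>l=1..m. A l v) - (\<Sum>l=1..m. A l (t *\<^sub>R u + (1 - t) *\<^sub>R v)))
        \<le> g l (t *\<^sub>R u + (1 - t) *\<^sub>R v) x" if "0 \<le> t" "t \<le> 1" for u v t by (rule g_concave[OF l that])
  fix p w u c assume p: "p \<in> N"
  show "AE x in P0 l. (\<lambda>j. (g l (p + inverse (real (Suc j)) *\<^sub>R w) x - g l p x) * real (Suc j)) \<longlonglongrightarrow> D l p w x"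
    by (rule D_quotient_lim[OF l p])
  note DL = L2_0D[OF D_L2_0[OF l p, of w]]
  show "D l p w \<in> borel_measurable (P0 l)" "integrable (P0 l) (\<lambda>x. (D l p w x)\<^sup>2)" "(LINT x|P0 l. D l p w x) = 0"
    by (fact DL)+
  show "AE x in P0 l. D l p (u + w) x = D l p u x + D l p w x" "AE x in P0 l. D l p (c *\<^sub>R w) x = c * D l p w x"
    by (fact D_linear[OF l p])+
next
  show "g l 0 x = 0" for l x by (simp add: g_def)
  show "C1 * W w \<le> (\<Sum>l=1..m. LINT x|P0 l. (D l p w x)\<^sup>2)" "(\<Sum>l=1..m. LINT x|P0 l. (D l p w x)\<^sup>2) \<le> C2 * W w"
    if "p \<in> N" for p w by (fact D_compare'[OF that])+
  show "(\<Sum>l=1..m. LINT x|P0 l. (g l u x - g l v x)\<^sup>2) \<le> C2 * W (u - v)" if "u \<in> N" "v \<in> N" for u v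
    by (rule g_lipschitz[OF that])
qed

end

section \<open>Trace bound from polynomial eigenvalue growth; a countable dense family\<close>

section \<open>Effective dimension and rational coefficients\<close>

text \<open>Comparison of the eigenvalue sum with a sum that is constant on blocks of length \<open>N \<approx> \<lambda> powr (- 1 / r)\<close>.\<close>

lemma effective_dimension_powr:
  fixes r \<beta> :: real and \<rho> :: "nat \<Rightarrow> real"
  assumes r: "1 < r" and \<beta>: "0 < \<beta>" and \<rho>: "\<And>\<nu>. \<beta> * real (Suc \<nu>) powr r \<le> \<rho> \<nu>"
  shows "\<exists>C\<ge>1. \<forall>lam F. 0 < lam \<longrightarrow> lam \<le> 1 \<longrightarrow> finite F \<longrightarrow>
    (\<Sum>\<nu>\<in>F. 1 / (1 + lam * \<rho> \<nu>)) \<le> C * lam powr (- 1 / r)"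
proof -
  \<comment> \<open>Bound for the summands on block \<open>q\<close>. Block 0 has only the trivial
    bound 1; on the others the eigenvalue growth gives decay of order \<open>r\<close>, summable
    because \<open>r > 1\<close>.\<close>
  define a where "a = (\<lambda>q::nat. if q = 0 then 1 else (1 / \<beta>) * real q powr (- r))"
  have a0: "0 \<le> a q" for q using \<beta> by (simp add: a_def)
  have sa: "summable a"
  proof -
    have "summable (\<lambda>q. (1 / \<beta>) * real q powr (- r))"
      using r by (intro summable_mult) (simp add: summable_real_powr_iff)
    moreover have "\<forall>\<^sub>F q in sequentially. a q = (1 / \<beta>) * real q powr (- r)"
      using eventually_gt_at_top[of 0] by eventually_elim (simp add: a_def)
    ultimately show ?thesis by (simp add: summable_cong)
  qed
  have a1: "1 \<le> suminf a" 
  proof -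
    have "sum a {0} \<le> suminf a" by (rule sum_le_suminf[OF sa]) (auto intro: a0)
    moreover have "a 0 = 1" by (simp add: a_def)
    ultimately show ?thesis by simp
  qed
  show ?thesis
  proof (intro exI[of _ "2 * suminf a"] conjI allI impI)
    show "1 \<le> 2 * suminf a" using a1 by simp
    fix lam :: real and F :: "nat set"
    assume lam: "0 < lam" "lam \<le> 1" and F: "finite F"
    define x where "x = lam powr (1 / r)"
    have x: "0 < x" "x \<le> 1" unfolding x_def using lam r by (auto intro: powr_le1)
    have xr: "x powr r = lam" unfolding x_def using lam r by (simp add: powr_powr)
    have xi: "lam powr (- 1 / r) = 1 / x" unfolding x_def using lam by (simp add: powr_minus_divide)
    \<comment> \<open>Block length \<open>lam powr (- 1 / r)\<close> rounded up. At least
      \<open>1 / x\<close> is needed for the decay inside a block, and at most \<open>2 / x\<close>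
      for the final count.\<close>
    define N where "N = nat \<lceil>1 / x\<rceil>"
    have N: "1 / x \<le> real N" "real N \<le> 2 / x"
    proof -
      have o: "1 \<le> 1 / x" using x by simp
      show "1 / x \<le> real N" unfolding N_def by (rule real_nat_ceiling_ge)
      have "real N \<le> 1 / x + 1" unfolding N_def using o by linarith
      then show "real N \<le> 2 / x" using o by (simp add: add_divide_distrib[symmetric])
    qed
    have xN: "1 \<le> x * real N" using N(1) x by (simp add: divide_le_eq mult.commute)
    have N0: "0 < N" using xN by (cases N) auto
    have block_le: "1 / (1 + lam * \<rho> \<nu>) \<le> a (\<nu> div N)" for \<nu>
    proof -
      have \<rho>0: "0 \<le> \<rho> \<nu>" using order_trans[OF _ \<rho>[of \<nu>]] \<beta> by simp
      show ?thesis
      proof (cases "\<nu> div N = 0")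
        case True
        then show ?thesis using \<rho>0 lam by (simp add: a_def divide_le_eq)
      next
        case False
        define q where "q = \<nu> div N"
        have q: "0 < q" using False by (simp add: q_def)
        have "real (N * q) \<le> real (Suc \<nu>)"
          unfolding q_def of_nat_le_iff using times_div_less_eq_dividend[of N \<nu>] by linarith
        then have "x * real N * real q \<le> x * real (Suc \<nu>)" using x by simp
        moreover have "real q \<le> x * real N * real q" using xN q by simp
        ultimately have "real q \<le> x * real (Suc \<nu>)" by linarith
        then have "real q powr r \<le> (x * real (Suc \<nu>)) powr r" using q r by (intro powr_mono2) auto
        also have "\<dots> = lam * real (Suc \<nu>) powr r" using x by (simp add: powr_mult xr)
        finally have "\<beta> * real q powr r \<le> \<beta> * (lam * real (Suc \<nu>) powr r)" using \<beta> by simp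
        also have "\<dots> = lam * (\<beta> * real (Suc \<nu>) powr r)" by simp
        also have "\<dots> \<le> lam * \<rho> \<nu>" using \<rho>[of \<nu>] lam by (intro mult_left_mono) auto
        finally have le: "\<beta> * real q powr r \<le> 1 + lam * \<rho> \<nu>" by simp
        have p: "0 < \<beta> * real q powr r" using \<beta> q by simp
        have "1 / (1 + lam * \<rho> \<nu>) \<le> 1 / (\<beta> * real q powr r)" using le p by (intro divide_left_mono) auto
        also have "\<dots> = a q" using q by (simp add: a_def powr_minus_divide)
        finally show ?thesis by (simp add: q_def)
      qed
    qed
    obtain Q where Q: "F \<subseteq> {..<Q}" using F finite_nat_iff_bounded by auto
    have "(\<Sum>\<nu>\<in>F. 1 / (1 + lam * \<rho> \<nu>)) \<le> (\<Sum>\<nu>\<in>F. a (\<nu> div N))" by (intro sum_mono block_le)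
    also have "\<dots> \<le> (\<Sum>\<nu><Q * N. a (\<nu> div N))"
    proof (rule sum_mono2)
      have "{..<Q} \<subseteq> {..<Q * N}" using N0 by (simp add: lessThan_subset_iff)
      with Q show "F \<subseteq> {..<Q * N}" by (rule order_trans)
    qed (auto simp: a0)
    also have "\<dots> = (\<Sum>q<Q. \<Sum>\<nu>=q * N..<q * N + N. a (\<nu> div N))" by (rule sum.nat_group[symmetric])
    also have "\<dots> = (\<Sum>q<Q. real N * a q)"
    proof (rule sum.cong[OF refl])
      fix q
      have "(\<Sum>\<nu>=q * N..<q * N + N. a (\<nu> div N)) = (\<Sum>\<nu>=q * N..<q * N + N. a q)"
      proof (rule sum.cong[OF refl])
        fix \<nu> assume "\<nu> \<in> {q * N..<q * N + N}"
        then have "\<nu> div N = q" by (intro div_nat_eqI) (auto simp: mult.commute)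
        then show "a (\<nu> div N) = a q" by simp
      qed
      then show "(\<Sum>\<nu>=q * N..<q * N + N. a (\<nu> div N)) = real N * a q" by simp
    qed
    also have "\<dots> = real N * (\<Sum>q<Q. a q)" by (simp add: sum_distrib_left)
    also have "\<dots> \<le> 2 / x * suminf a"
      using N(2) sum_le_suminf[OF sa, of "{..<Q}"] a0 x by (intro mult_mono) (auto intro: sum_nonneg)
    finally show "(\<Sum>\<nu>\<in>F. 1 / (1 + lam * \<rho> \<nu>)) \<le> 2 * suminf a * lam powr (- 1 / r)" unfolding xi by simp
  qed
qed

text \<open>Association lists with rational entries parametrize these vectors, so countability is
  that of a type of lists; indices missing from the list get coefficient 0.\<close>

definition rational_coefficients :: "('i \<Rightarrow> real) set" where
  "rational_coefficients = (\<lambda>l i. case map_of l i of None \<Rightarrow> 0 | Some q \<Rightarrow> of_rat q) ` UNIV"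

lemma countable_rational_coefficients: "countable (rational_coefficients :: ('i :: countable \<Rightarrow> real) set)"
  unfolding rational_coefficients_def by (intro countable_image countableI_type)

lemma finite_support_rational_coefficients:
  assumes "c \<in> rational_coefficients"
  shows "finite_support c"
proof -
  obtain l where c: "c = (\<lambda>i. case map_of l i of None \<Rightarrow> 0 | Some q \<Rightarrow> of_rat q)"
    using assms unfolding rational_coefficients_def by (rule imageE)
  have "{i. c i \<noteq> 0} \<subseteq> dom (map_of l)" unfolding c by (auto split: option.splits)
  then show ?thesis unfolding finite_support_def by (rule finite_subset) (rule finite_dom_map_of)
qed

lemma rational_coefficientsI:
  assumes "finite F" "\<And>i. i \<in> F \<Longrightarrow> c i = of_rat (q i)" "\<And>i. i \<notin> F \<Longrightarrow> c i = 0"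
  shows "c \<in> rational_coefficients"
proof -
  obtain xs where xs: "set xs = F" using finite_list[OF assms(1)] by blast
  have "c = (\<lambda>i. case map_of (map (\<lambda>i. (i, q i)) xs) i of None \<Rightarrow> 0 | Some q \<Rightarrow> of_rat q)"
    using assms(2,3) xs by (auto simp: map_of_map_restrict restrict_map_def)
  then show ?thesis unfolding rational_coefficients_def by blast
qed

lemma rational_coefficients_dense:
  fixes b :: "'i \<Rightarrow> 'q :: real_normed_vector"
  assumes b: "closure (span (range b)) = UNIV"
  shows "closure (lincomb b ` rational_coefficients) = UNIV"
proof -
  have sub: "span (range b) \<subseteq> closure (lincomb b ` rational_coefficients)"
  proof
    fix v assume "v \<in> span (range b)"
    then have "\<exists>t u. v = (\<Sum>a\<in>t. u a *\<^sub>R a) \<and> finite t \<and> t \<subseteq> range b"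
      unfolding span_explicit mem_Collect_eq .
    then obtain t u where v: "v = (\<Sum>a\<in>t. u a *\<^sub>R a)" and t: "finite t" "t \<subseteq> range b"
      by (elim exE conjE)
    \<comment> \<open>\<open>b\<close> may take a value repeatedly, so one index is chosen for each
      vector that occurs.\<close>
    obtain F where F: "inj_on b F" "t = b ` F" using t(2) by (auto simp: subset_image_inj)
    have finF: "finite F" using t(1) unfolding F(2) finite_image_iff[OF F(1)] .
    have v': "v = (\<Sum>i\<in>F. u (b i) *\<^sub>R b i)" unfolding v F(2) using F(1) by (simp add: sum.reindex)
    have ex: "\<exists>q::nat \<Rightarrow> rat. (\<lambda>j. real_of_rat (q j)) \<longlonglongrightarrow> x" for x
    proof -
      have "\<exists>q. \<bar>real_of_rat q - x\<bar> < inverse (real (Suc j))" for j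
      proof -
        have "x - inverse (real (Suc j)) < x + inverse (real (Suc j))" by simp
        then obtain q where "x - inverse (real (Suc j)) < real_of_rat q" "real_of_rat q < x + inverse (real (Suc j))"
          using of_rat_dense by blast
        then show ?thesis by (intro exI[of _ q]) (simp only: abs_less_iff, linarith)
      qed
      then obtain q where q: "\<And>j. \<bar>real_of_rat (q j) - x\<bar> < inverse (real (Suc j))" by metis
      have "(\<lambda>j. real_of_rat (q j) - x) \<longlonglongrightarrow> 0"
        by (rule Lim_null_comparison[OF _ LIMSEQ_inverse_real_of_nat])
           (rule always_eventually, rule allI, rule less_imp_le, simp only: real_norm_def q)
      then have "(\<lambda>j. real_of_rat (q j)) \<longlonglongrightarrow> x" by (rule LIM_zero_cancel)
      then show ?thesis by (intro exI[of _ q])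
    qed
    define q where "q = (\<lambda>i. SOME q::nat \<Rightarrow> rat. (\<lambda>j. real_of_rat (q j)) \<longlonglongrightarrow> u (b i))"
    have q: "(\<lambda>j. real_of_rat (q i j)) \<longlonglongrightarrow> u (b i)" for i
      unfolding q_def by (rule someI_ex[OF ex])
    define c where "c = (\<lambda>j i. if i \<in> F then real_of_rat (q i j) else 0)"
    have "lincomb b (c j) \<in> lincomb b ` rational_coefficients" for j
      by (intro imageI rational_coefficientsI[OF finF, where q = "\<lambda>i. q i j"]) (auto simp: c_def)
    moreover have "(\<lambda>j. lincomb b (c j)) \<longlonglongrightarrow> v"
    proof -
      have "lincomb b (c j) = (\<Sum>i\<in>F. real_of_rat (q i j) *\<^sub>R b i)" for j
        unfolding lincomb_def by (rule sum.mono_neutral_cong_left[OF finF]) (auto simp: c_def split: if_splits)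
      then show ?thesis unfolding v' by (simp add: tendsto_sum tendsto_scaleR q)
    qed
    ultimately show "v \<in> closure (lincomb b ` rational_coefficients)"
      unfolding closure_sequential by (intro exI[of _ "\<lambda>j. lincomb b (c j)"] conjI allI)
  qed
  have "closure (span (range b)) \<subseteq> closure (lincomb b ` rational_coefficients)"
    by (rule closure_minimal[OF sub closed_closure])
  then show ?thesis using b by blast
qed

section \<open>Localization of both minimizers inside the ellipsoid\<close>

section \<open>Bounds for the minimizers\<close>

text \<open>\<open>W\<close> and \<open>J\<close> are bounded quadratic forms, hence continuous, and
  the span of \<open>b\<close> is dense: inequalities known for rational combinations pass to all
  points.\<close>

locale penalized_model = spectral_model P m Q X g A N D W B C1 C2 b \<rho> cw Cw
  for P :: "'w measure" and m :: nat and Q :: "nat \<Rightarrow> 'x measure" and X :: "nat \<Rightarrow> nat \<Rightarrow> 'w \<Rightarrow> 'x"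
    and g :: "nat \<Rightarrow> 'q :: real_normed_vector \<Rightarrow> 'x \<Rightarrow> real" and A N D W B C1 C2
    and b :: "'i :: countable \<Rightarrow> 'q" and \<rho> cw Cw +
  fixes V J :: "'q \<Rightarrow> 'q \<Rightarrow> real" and KV KJ :: real
  assumes V: "semi_inner_product V" "W v = V v v" "V v v \<le> KV * (norm v)\<^sup>2"
    and J: "semi_inner_product J" "J v v \<le> KJ * (norm v)\<^sup>2"
    and J_lincomb: "finite_support c \<Longrightarrow> J (lincomb b c) (lincomb b c) = (\<Sum>i | c i \<noteq> 0. \<rho> i * (c i)\<^sup>2)"
    and span_dense: "closure (span (range b)) = UNIV"
    and N_open: "open N"
begin

definition S :: "real \<Rightarrow> 'q \<Rightarrow> real" where
  "S lam v = W v + lam * J v v"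

definition log_ratio :: "(nat \<Rightarrow> nat) \<Rightarrow> 'w \<Rightarrow> 'q \<Rightarrow> real" where
  "log_ratio n \<omega> v = (\<Sum>l=1..m. 1 / real (n l) * (\<Sum>k=1..n l. g l v (X l k \<omega>) - A l v))"

definition score :: "(nat \<Rightarrow> nat) \<Rightarrow> 'w \<Rightarrow> 'q \<Rightarrow> real" where
  "score n \<omega> v = (\<Sum>l=1..m. 1 / real (n l) * (\<Sum>k=1..n l. D l 0 v (X l k \<omega>)))"

text \<open>Pathwise properties that will hold almost surely. On such a sample, and on the events of
  the probabilistic bounds, the localization argument is deterministic.\<close>

definition regular_sample :: "(nat \<Rightarrow> nat) \<Rightarrow> 'w \<Rightarrow> bool" where
  "regular_sample n \<omega> \<longleftrightarrow> convex_on UNIV (\<lambda>v. - log_ratio n \<omega> v) \<and>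
     (\<forall>l\<in>{1..m}. \<forall>k\<in>{1..n l}. continuous_on N (\<lambda>v. g l v (X l k \<omega>)) \<and>
        bounded_linear (\<lambda>v. D l 0 v (X l k \<omega>)) \<and>
        (\<forall>v. (\<lambda>j. (g l (inverse (real (Suc j)) *\<^sub>R v) (X l k \<omega>) - g l 0 (X l k \<omega>)) * real (Suc j))
          \<longlonglongrightarrow> D l 0 v (X l k \<omega>)))"

lemma J_nonneg: "0 \<le> J v v"
  by (rule semi_inner_productD(3)[OF J(1)])

lemma W_le_S: "0 \<le> lam \<Longrightarrow> W v \<le> S lam v" and J_le_S: "lam * J v v \<le> S lam v"
  and S_nonneg: "0 \<le> lam \<Longrightarrow> 0 \<le> S lam v"
  using J_nonneg[of v] W_nonneg[of v] by (auto simp: S_def)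

lemma S_scale: "S lam (t *\<^sub>R v) = t\<^sup>2 * S lam v"
  unfolding S_def W_scale by (simp add: semi_inner_product_add_scale[OF J(1)] power2_eq_square algebra_simps)

lemma S_parallelogram: "0 \<le> lam \<Longrightarrow> S lam (u - v) \<le> 2 * S lam u + 2 * S lam v"
proof -
  assume lam: "0 \<le> lam"
  have q: "B (u - v) (u - v) \<le> 2 * B u u + 2 * B v v" if "semi_inner_product B" for B :: "'q \<Rightarrow> 'q \<Rightarrow> real"
    using semi_inner_productD(3)[OF that, of "u + v"] by (simp add: semi_inner_product_add_scale[OF that])
  have "lam * J (u - v) (u - v) \<le> lam * (2 * J u u + 2 * J v v)" by (rule mult_left_mono[OF q[OF J(1)] lam])
  then show ?thesis using q[OF V(1)] by (simp add: S_def V(2) algebra_simps)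
qed

lemma isCont_W: "isCont W v" and isCont_J: "isCont (\<lambda>v. J v v) v"
proof -
  interpret V: bounded_bilinear V by (rule semi_inner_product_bounded_bilinear[OF V(1,3)])
  interpret J: bounded_bilinear J by (rule semi_inner_product_bounded_bilinear[OF J])
  have "isCont (\<lambda>v. V v v) v" by (intro V.continuous continuous_ident)
  then show "isCont W v" unfolding V(2)[abs_def] .
  show "isCont (\<lambda>v. J v v) v" by (intro J.continuous continuous_ident)
qed

lemma isCont_S: "isCont (S lam) v"
  unfolding S_def[abs_def] by (intro continuous_add isCont_W continuous_mult continuous_const isCont_J)

lemma energy_le_S:
  assumes c: "finite_support c" and lam: "0 \<le> lam"
  shows "energy lam c \<le> (1 / cw + 1) * S lam (lincomb b c)"
proof -
  have F: "finite {i. c i \<noteq> 0}" using c by (simp add: finite_support_def)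
  have "energy lam c = (\<Sum>i | c i \<noteq> 0. (c i)\<^sup>2) + lam * J (lincomb b c) (lincomb b c)"
    unfolding energy_def J_lincomb[OF c] by (simp add: sum.distrib sum_distrib_left algebra_simps)
  moreover have "(\<Sum>i | c i \<noteq> 0. (c i)\<^sup>2) \<le> 1 / cw * W (lincomb b c)"
    using W_coef(1)[OF F, of c] cw unfolding lincomb_def by (simp add: le_divide_eq mult.commute)
  moreover have "1 / cw * W (lincomb b c) \<le> 1 / cw * S lam (lincomb b c)"
    using cw W_le_S[OF lam] by (intro mult_left_mono) auto
  ultimately show ?thesis using J_le_S[of lam "lincomb b c"] by (simp add: distrib_right)
qed

lemma dense_limit:
  obtains c where "\<And>j. c j \<in> rational_coefficients" "(\<lambda>j. lincomb b (c j)) \<longlonglongrightarrow> v"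
proof -
  have "v \<in> closure (lincomb b ` rational_coefficients)" using rational_coefficients_dense[OF span_dense] by simp
  then obtain y where y: "\<forall>j. y j \<in> lincomb b ` rational_coefficients" "y \<longlonglongrightarrow> v"
    unfolding closure_sequential by (elim exE conjE)
  define c where "c = (\<lambda>j. SOME c. c \<in> rational_coefficients \<and> y j = lincomb b c)"
  have c: "c j \<in> rational_coefficients \<and> y j = lincomb b (c j)" for j
  proof -
    have "\<exists>c. c \<in> rational_coefficients \<and> y j = lincomb b c" using y(1) by auto
    then show ?thesis unfolding c_def by (rule someI_ex)
  qed
  have "y = (\<lambda>j. lincomb b (c j))" using c by (intro ext) auto
  then show thesis using y(2) c by (intro that[of c]) auto
qed

lemma score_linear:
  assumes "regular_sample n \<omega>"
  shows "bounded_linear (score n \<omega>)"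
  unfolding score_def[abs_def]
  by (intro bounded_linear_sum bounded_linear_const_mult) (use assms in \<open>auto simp: regular_sample_def\<close>)

text \<open>On a regular sample both sides are continuous in \<open>v\<close>, so the bound for
  rational combinations extends by density. Passing from \<open>energy\<close> to \<open>S\<close>
  costs the factor \<open>1 / cw + 1\<close>.\<close>

lemma score_bound:
  assumes \<epsilon>: "0 < \<epsilon>" and nn: "0 < nn" "\<And>l. l \<in> {1..m} \<Longrightarrow> nn \<le> real (n l)"
    and lam: "0 < lam" and d: "effective_dim_le lam d"
  obtains E where "E \<in> events" "1 - \<epsilon> \<le> prob E"
    "\<And>\<omega> v. \<omega> \<in> E \<Longrightarrow> regular_sample n \<omega> \<Longrightarrow> (score n \<omega> v)\<^sup>2 \<le> C2 * Cw * (1 / cw + 1) / \<epsilon> * (d / nn) * S lam v"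
proof -
  obtain E where E: "E \<in> events" "1 - \<epsilon> \<le> prob E"
    "\<And>\<omega> c. \<omega> \<in> E \<Longrightarrow> c \<in> (rational_coefficients :: ('i \<Rightarrow> real) set) \<Longrightarrow>
       (\<Sum>l=1..m. 1 / real (n l) * (\<Sum>k=1..n l. D l 0 (lincomb b c) (X l k \<omega>)))\<^sup>2 \<le> C2 * Cw * d / (nn * \<epsilon>) * energy lam c"
    by (rule linear_noise_bound[OF countable_rational_coefficients finite_support_rational_coefficients \<epsilon> nn lam d])
       (assumption | rule that)+
  have "0 \<le> d" using d unfolding effective_dim_le_def by (elim allE[of _ "{}"]) simp
  have k: "0 \<le> C2 * Cw * d / (nn * \<epsilon>)" using const_pos cw \<open>0 \<le> d\<close> nn(1) \<epsilon> by auto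
  show thesis
  proof (rule that[OF E(1,2)])
    fix \<omega> v assume \<omega>: "\<omega> \<in> E" and reg: "regular_sample n \<omega>"
    interpret T: bounded_linear "score n \<omega>" by (rule score_linear[OF reg])
    obtain c where c: "\<And>j. c j \<in> rational_coefficients" and lim: "(\<lambda>j. lincomb b (c j)) \<longlonglongrightarrow> v"
      by (rule dense_limit) (assumption | rule that)+
    have "(score n \<omega> (lincomb b (c j)))\<^sup>2 \<le> C2 * Cw * d / (nn * \<epsilon>) * ((1 / cw + 1) * S lam (lincomb b (c j)))" for j
    proof -
      have "(score n \<omega> (lincomb b (c j)))\<^sup>2 \<le> C2 * Cw * d / (nn * \<epsilon>) * energy lam (c j)"
        unfolding score_def by (rule E(3)[OF \<omega> c])
      also have "\<dots> \<le> C2 * Cw * d / (nn * \<epsilon>) * ((1 / cw + 1) * S lam (lincomb b (c j)))"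
        using energy_le_S[OF finite_support_rational_coefficients[OF c]] lam k by (intro mult_left_mono) auto
      finally show ?thesis .
    qed
    moreover have "(\<lambda>j. (score n \<omega> (lincomb b (c j)))\<^sup>2) \<longlonglongrightarrow> (score n \<omega> v)\<^sup>2"
      by (intro tendsto_power T.tendsto lim)
    moreover have "(\<lambda>j. C2 * Cw * d / (nn * \<epsilon>) * ((1 / cw + 1) * S lam (lincomb b (c j))))
        \<longlonglongrightarrow> C2 * Cw * d / (nn * \<epsilon>) * ((1 / cw + 1) * S lam v)"
      by (intro tendsto_mult tendsto_const isCont_tendsto_compose[OF isCont_S] lim)
    ultimately have "(score n \<omega> v)\<^sup>2 \<le> C2 * Cw * d / (nn * \<epsilon>) * ((1 / cw + 1) * S lam v)"
      by (intro LIMSEQ_le) auto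
    also have "\<dots> = C2 * Cw * (1 / cw + 1) / \<epsilon> * (d / nn) * S lam v" by (simp add: divide_simps)
    finally show "(score n \<omega> v)\<^sup>2 \<le> C2 * Cw * (1 / cw + 1) / \<epsilon> * (d / nn) * S lam v" .
  qed
qed

lemma log_ratio_eq:
  assumes "\<And>l. l \<in> {1..m} \<Longrightarrow> 1 \<le> n l"
  shows "log_ratio n \<omega> v = (\<Sum>l=1..m. 1 / real (n l) * (\<Sum>k=1..n l. g l v (X l k \<omega>))) - total_A v"
proof -
  have "1 / real (n l) * (\<Sum>k=1..n l. g l v (X l k \<omega>) - A l v) =
      1 / real (n l) * (\<Sum>k=1..n l. g l v (X l k \<omega>)) - A l v" if "l \<in> {1..m}" for l
    using assms[OF that] by (simp add: sum_subtractf diff_divide_distrib)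
  then show ?thesis unfolding log_ratio_def by (simp add: sum_subtractf)
qed

text \<open>A concave function lies below its tangent at \<open>0\<close>, and \<open>0 \<le> \<Sum>l. A l v\<close>.\<close>

lemma log_ratio_le_score:
  assumes reg: "regular_sample n \<omega>" and n: "\<And>l. l \<in> {1..m} \<Longrightarrow> 1 \<le> n l" and v: "v \<in> N"
  shows "log_ratio n \<omega> v \<le> score n \<omega> v"
proof -
  define s where "s = (\<lambda>j. inverse (real (Suc j)))"
  have s: "0 < s j" "s j \<le> 1" "s j * real (Suc j) = 1" for j by (auto simp: s_def field_simps)
  have l0: "log_ratio n \<omega> 0 = 0" unfolding log_ratio_def by (simp add: g_zero A_zero)
  let ?q = "\<lambda>j. \<Sum>l=1..m. 1 / real (n l) * (\<Sum>k=1..n l. (g l (s j *\<^sub>R v) (X l k \<omega>) - g l 0 (X l k \<omega>)) * real (Suc j))"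
  have "log_ratio n \<omega> v \<le> ?q j" for j
  proof -
    have "- log_ratio n \<omega> ((1 - s j) *\<^sub>R 0 + s j *\<^sub>R v) \<le> (1 - s j) * - log_ratio n \<omega> 0 + s j * - log_ratio n \<omega> v"
      using reg s[of j] unfolding regular_sample_def by (intro convex_onD) auto
    then have "s j * log_ratio n \<omega> v \<le> log_ratio n \<omega> (s j *\<^sub>R v)" by (simp add: l0)
    also have "\<dots> \<le> (\<Sum>l=1..m. 1 / real (n l) * (\<Sum>k=1..n l. g l (s j *\<^sub>R v) (X l k \<omega>)))"
      
    proof -
      have "log_ratio n \<omega> (s j *\<^sub>R v) = (\<Sum>l=1..m. 1 / real (n l) * (\<Sum>k=1..n l. g l (s j *\<^sub>R v) (X l k \<omega>))) - total_A (s j *\<^sub>R v)"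
        by (rule log_ratio_eq) (rule n)
      moreover have "0 \<le> total_A (s j *\<^sub>R v)"
        using s[of j] by (intro total_A_bounds(1) ray_in_N v) auto
      ultimately show ?thesis by linarith
    qed
    finally have "real (Suc j) * (s j * log_ratio n \<omega> v) \<le>
        real (Suc j) * (\<Sum>l=1..m. 1 / real (n l) * (\<Sum>k=1..n l. g l (s j *\<^sub>R v) (X l k \<omega>)))"
      by (rule mult_left_mono) simp
    moreover have "real (Suc j) * (s j * log_ratio n \<omega> v) = log_ratio n \<omega> v"
      using s(3)[of j] by (simp only: mult.assoc[symmetric] mult.commute[of "real (Suc j)"] mult_1)
    moreover have "real (Suc j) * (\<Sum>l=1..m. 1 / real (n l) * (\<Sum>k=1..n l. g l (s j *\<^sub>R v) (X l k \<omega>))) = ?q j"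
      unfolding sum_distrib_left g_zero by (intro sum.cong refl) (simp add: mult_ac)
    ultimately show ?thesis by (simp only:)
  qed
  moreover have "?q \<longlonglongrightarrow> score n \<omega> v"
    unfolding score_def s_def
    by (intro tendsto_sum tendsto_mult tendsto_const) (use reg in \<open>auto simp: regular_sample_def\<close>)
  ultimately show ?thesis by (intro LIMSEQ_le_const) auto
qed

text \<open>\<open>total_A\<close> is convex and bounded on the open set \<open>N\<close>, hence
  continuous there; the point values of \<open>g\<close> are continuous on a regular sample.\<close>

lemma log_ratio_continuous:
  assumes reg: "regular_sample n \<omega>" and n: "\<And>l. l \<in> {1..m} \<Longrightarrow> 1 \<le> n l"
  shows "continuous_on N (log_ratio n \<omega>)"
proof -
  have "convex_on N (\<lambda>v. total_A v)"
  proof (rule convex_onI)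
    show "convex N" by (rule N_convex)
    fix t :: real and u v assume "0 < t" "t < 1" "u \<in> N" "v \<in> N"
    then show "total_A ((1 - t) *\<^sub>R u + t *\<^sub>R v) \<le> (1 - t) * total_A u + t * total_A v"
      using total_A_convex[of u v "1 - t"] by simp
  qed
  moreover have "\<forall>v\<in>N. \<bar>total_A v\<bar> \<le> real m * B"
  proof
    fix v assume "v \<in> N"
    from total_A_bounds[OF this] show "\<bar>total_A v\<bar> \<le> real m * B" by linarith
  qed
  ultimately have A: "continuous_on N (\<lambda>v. total_A v)" by (rule convex_on_bounded_continuous[OF N_open])
  have eq: "log_ratio n \<omega> = (\<lambda>v. (\<Sum>l=1..m. 1 / real (n l) * (\<Sum>k=1..n l. g l v (X l k \<omega>))) - total_A v)"
    by (rule ext, rule log_ratio_eq) (rule n)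
  show ?thesis
    unfolding eq
    by (intro continuous_on_diff A continuous_on_sum continuous_on_mult continuous_on_const)
       (use reg in \<open>auto simp: regular_sample_def\<close>)
qed

text \<open>\<open>lam * J h v\<close> will be the cross term of the penalty expanded at the truth,
  with \<open>h\<close> the true parameter; it represents the bias.\<close>

lemma offset_bound:
  assumes lam: "0 \<le> lam"
  shows "\<bar>lam * J h v\<bar> \<le> sqrt (lam * J h h) * sqrt (S lam v)"
proof -
  have "\<bar>lam * J h v\<bar> = lam * \<bar>J h v\<bar>" using lam by (simp add: abs_mult)
  also have "\<dots> \<le> lam * (sqrt (J h h) * sqrt (J v v))"
    by (rule mult_left_mono[OF semi_inner_product_cauchy_schwarz[OF J(1)] lam])
  also have "\<dots> = sqrt lam * sqrt lam * (sqrt (J h h) * sqrt (J v v))" using lam by simp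
  also have "\<dots> = sqrt (lam * J h h) * sqrt (lam * J v v)" by (simp only: real_sqrt_mult mult_ac)
  also have "\<dots> \<le> sqrt (lam * J h h) * sqrt (S lam v)"
    using J_le_S lam J_nonneg[of h] by (intro mult_left_mono real_sqrt_le_mono) auto
  finally show ?thesis .
qed

text \<open>With \<open>s = sqrt (S lam v)\<close> the comparison with the truth reads
  \<open>c * s\<^sup>2 \<le> 2 * y * s\<close>: quadratic gain against noise and bias that are
  linear in \<open>s\<close>.\<close>

lemma quadratic_minimizer_bound:
  assumes lam: "0 \<le> lam" and a: "0 \<le> a" "(score n \<omega> v)\<^sup>2 \<le> a * S lam v"
    and min: "1 / 2 * (\<Sum>l=1..m. LINT x|Q l. (D l 0 v x)\<^sup>2) + lam / 2 * J v v + lam * J h v \<le> score n \<omega> v"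
  shows "S lam v \<le> 8 / (min C1 1)\<^sup>2 * (a + lam * J h h)"
proof -
  define s where "s = sqrt (S lam v)"
  define c where "c = min C1 1"
  define y where "y = sqrt a + sqrt (lam * J h h)"
  have c: "0 < c" "c \<le> C1" "c \<le> 1" using const_pos by (auto simp: c_def)
  have s: "0 \<le> s" "s\<^sup>2 = S lam v" using S_nonneg[OF lam] by (auto simp: s_def)
  have b0: "0 \<le> lam * J h h" using lam J_nonneg by simp
  have y0: "0 \<le> y" unfolding y_def using a(1) b0 by simp
  have "score n \<omega> v \<le> sqrt ((score n \<omega> v)\<^sup>2)" by simp
  also have "\<dots> \<le> sqrt (a * S lam v)" by (rule real_sqrt_le_mono[OF a(2)])
  finally have sc: "score n \<omega> v \<le> sqrt a * s" by (simp add: real_sqrt_mult s_def)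
  have "c * W v \<le> C1 * W v" by (rule mult_right_mono[OF c(2) W_nonneg])
  moreover have "c * (lam * J v v) \<le> 1 * (lam * J v v)"
    by (rule mult_right_mono[OF c(3)]) (use lam J_nonneg in simp)
  ultimately have "c * S lam v \<le> C1 * W v + lam * J v v" unfolding S_def distrib_left by linarith
  also have "\<dots> \<le> 2 * (score n \<omega> v - lam * J h v)" 
  proof -
    have "w + x \<le> 2 * (z - y)" if "1 / 2 * q + lam / 2 * J v v + y \<le> z" "w \<le> q" "x = lam * J v v" for w x y z q
      using that by (simp add: field_simps)
    from this[OF min D_lower[OF N_zero] refl] show ?thesis .
  qed
  also have "\<dots> \<le> 2 * (sqrt a * s + sqrt (lam * J h h) * s)"
  proof -
    have "2 * (z - y) \<le> 2 * (p + q)" if "z \<le> p" "\<bar>y\<bar> \<le> q" for z y p q :: real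
      using that(1) abs_le_D2[OF that(2)] by (simp add: algebra_simps)
    from this[OF sc offset_bound[OF lam, of h v]] show ?thesis unfolding s_def .
  qed
  finally have cs: "c * s\<^sup>2 \<le> 2 * y * s" unfolding s(2) y_def by (simp add: algebra_simps)
  have "c * s \<le> 2 * y"
  proof (cases "s = 0")
    case False
    then show ?thesis using cs s(1) by (simp add: power2_eq_square mult.assoc[symmetric])
  qed (use y0 in simp)
  then have "(c * s)\<^sup>2 \<le> (2 * y)\<^sup>2" using c s by (intro power_mono) auto
  also have "(2 * y)\<^sup>2 = 4 * y\<^sup>2" by (simp add: power_mult_distrib)
  also have "y\<^sup>2 \<le> 2 * (a + lam * J h h)"
  proof -
    have "0 \<le> (sqrt a - sqrt (lam * J h h))\<^sup>2" by simp
    then show ?thesis unfolding y_def using a(1) b0 by (simp add: power2_sum power2_diff)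
  qed
  finally have "c\<^sup>2 * S lam v \<le> 8 * (a + lam * J h h)" by (simp add: power_mult_distrib s(2))
  then have "S lam v \<le> 8 * (a + lam * J h h) / c\<^sup>2" using c by (simp add: le_divide_eq mult.commute)
  then show ?thesis by (simp add: c_def)
qed

text \<open>Otherwise some point of the segment from \<open>0\<close> to \<open>v\<close> lies on the ellipsoid \<open>S lam u = R\<close>. There the linear
  upper bound makes the penalty negligible, so \<open>W u\<close> is large and the uniform likelihood bound is violated.\<close>

lemma likelihood_minimizer_bound:
  assumes reg: "regular_sample n \<omega>" and n: "\<And>l. l \<in> {1..m} \<Longrightarrow> 1 \<le> n l" and v: "v \<in> N"
    and lam: "0 < lam" and R: "0 < R" and \<kappa>: "0 < \<kappa>" "\<kappa> \<le> 1 / 8" "\<kappa> \<le> c1 / 2"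
    and a: "0 \<le> a" "a \<le> \<kappa>\<^sup>2 * R" "\<And>u. (score n \<omega> u)\<^sup>2 \<le> a * S lam u"
    and h: "lam * J h h \<le> \<kappa>\<^sup>2 * R"
    and min: "\<And>t. 0 \<le> t \<Longrightarrow> t \<le> 1 \<Longrightarrow> lam / 2 * J (t *\<^sub>R v) (t *\<^sub>R v) + lam * J h (t *\<^sub>R v) \<le> log_ratio n \<omega> (t *\<^sub>R v)"
    and unif: "\<And>c. c \<in> rational_coefficients \<Longrightarrow> lincomb b c \<in> N \<Longrightarrow> R / 4 \<le> W (lincomb b c) \<Longrightarrow>
      energy lam c \<le> 2 * (1 / cw + 1) * R \<Longrightarrow> log_ratio n \<omega> (lincomb b c) \<le> - c1 * R"
  shows "S lam v \<le> R"
proof (rule ccontr)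
  assume "\<not> S lam v \<le> R"
  then have Rv: "R < S lam v" by simp
  \<comment> \<open>Scaling that brings the point onto the surface \<open>S lam u = R\<close>; it is
    at most 1 because \<open>S\<close> is quadratic and \<open>R < S lam v\<close>.\<close>
  define t where "t = sqrt (R / S lam v)"
  define u where "u = t *\<^sub>R v"
  have t: "0 \<le> t" "t \<le> 1" "t\<^sup>2 = R / S lam v" using R Rv by (auto simp: t_def real_sqrt_le_1_iff)
  have Su: "S lam u = R" unfolding u_def S_scale t(3) using R Rv by simp
  have uN: "u \<in> N" unfolding u_def by (rule ray_in_N[OF v t(1,2)])
  have sqR: "sqrt R * sqrt R = R" using R by simp
  have \<kappa>R: "sqrt x * sqrt R \<le> \<kappa> * R" if "x \<le> \<kappa>\<^sup>2 * R" for x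
  proof -
    have "sqrt x \<le> sqrt (\<kappa>\<^sup>2 * R)" by (rule real_sqrt_le_mono[OF that])
    then have "sqrt x \<le> \<kappa> * sqrt R" using \<kappa>(1) by (simp add: real_sqrt_mult)
    then have "sqrt x * sqrt R \<le> \<kappa> * sqrt R * sqrt R" using R by (intro mult_right_mono) auto
    then show ?thesis unfolding mult.assoc sqR .
  qed
  have "log_ratio n \<omega> u \<le> score n \<omega> u" by (rule log_ratio_le_score[OF reg n uN])
  also have "\<dots> \<le> sqrt ((score n \<omega> u)\<^sup>2)" by simp
  also have "\<dots> \<le> sqrt (a * S lam u)" by (rule real_sqrt_le_mono[OF a(3)])
  also have "\<dots> = sqrt a * sqrt R" by (simp add: real_sqrt_mult Su)
  also have "\<dots> \<le> \<kappa> * R" by (rule \<kappa>R[OF a(2)])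
  finally have up: "log_ratio n \<omega> u \<le> \<kappa> * R" .
  have off: "\<bar>lam * J h u\<bar> \<le> \<kappa> * R"
    using offset_bound[of lam h u] lam \<kappa>R[OF h] by (simp add: Su)
  have mu: "lam / 2 * J u u + lam * J h u \<le> log_ratio n \<omega> u" unfolding u_def by (rule min[OF t(1,2)])
  \<comment> \<open>Score and bias contribute \<open>\<kappa> * R\<close> each, and removing the
    factor one half of the penalty doubles them. With \<open>\<kappa> \<le> 1 / 8\<close> at least
    \<open>R / 2\<close> is left for \<open>W u\<close>.\<close>
  have "lam * J u u \<le> 4 * (\<kappa> * R)" using mu up off by linarith
  also have "\<dots> \<le> R / 2" using \<kappa>(2) R by simp
  finally have "R / 2 \<le> W u" using Su by (simp add: S_def)
  then have Wu: "R / 4 < W u" using R by linarith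
  have "0 \<le> lam / 2 * J u u" using lam J_nonneg by simp
  moreover have "\<kappa> * R \<le> c1 / 2 * R" using \<kappa>(3) R by (intro mult_right_mono) auto
  ultimately have low: "- (c1 / 2 * R) \<le> log_ratio n \<omega> u" using mu off by linarith
  \<comment> \<open>The uniform bound is available only for rational combinations. The slack between
    \<open>R / 4\<close> and \<open>R / 2\<close> for \<open>W\<close>, and between \<open>R\<close>
    and \<open>2 * R\<close> for \<open>S\<close>, absorbs the approximation of
    \<open>u\<close>.\<close>
  obtain c where c: "\<And>j. c j \<in> rational_coefficients" and lim: "(\<lambda>j. lincomb b (c j)) \<longlonglongrightarrow> u"
    by (rule dense_limit) (assumption | rule that)+
  have "\<forall>\<^sub>F j in sequentially. lincomb b (c j) \<in> N" by (rule topological_tendstoD[OF lim N_open uN])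
  moreover have "\<forall>\<^sub>F j in sequentially. R / 4 < W (lincomb b (c j))"
    by (rule order_tendstoD(1)[OF isCont_tendsto_compose[OF isCont_W lim] Wu])
  moreover have "\<forall>\<^sub>F j in sequentially. S lam (lincomb b (c j)) < 2 * R"
    by (rule order_tendstoD(2)[OF isCont_tendsto_compose[OF isCont_S lim]]) (use Su R in simp)
  ultimately have "\<forall>\<^sub>F j in sequentially. log_ratio n \<omega> (lincomb b (c j)) \<le> - c1 * R"
  proof eventually_elim
    fix j assume j: "lincomb b (c j) \<in> N" "R / 4 < W (lincomb b (c j))" "S lam (lincomb b (c j)) < 2 * R"
    have "energy lam (c j) \<le> (1 / cw + 1) * S lam (lincomb b (c j))"
      using lam by (intro energy_le_S finite_support_rational_coefficients c) simp
    also have "\<dots> \<le> (1 / cw + 1) * (2 * R)" using j(3) cw by (intro mult_left_mono) auto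
    also have "\<dots> = 2 * (1 / cw + 1) * R" by simp
    finally show "log_ratio n \<omega> (lincomb b (c j)) \<le> - c1 * R" using j by (intro unif c) auto
  qed
  moreover have "(\<lambda>j. log_ratio n \<omega> (lincomb b (c j))) \<longlonglongrightarrow> log_ratio n \<omega> u"
    using log_ratio_continuous[OF reg n] N_open uN
    by (intro isCont_tendsto_compose[OF _ lim]) (simp add: continuous_on_eq_continuous_at)
  ultimately have "log_ratio n \<omega> u \<le> - c1 * R"
    by (intro tendsto_upperbound[where F = sequentially]) auto
  moreover have "0 < c1 * R" using \<kappa> R by simp
  ultimately show False using low by linarith
qed

text \<open>\<open>c1\<close> depends neither on \<open>\<epsilon>\<close> nor on \<open>K\<close>.
  Hence \<open>\<kappa>\<close> can be fixed first and \<open>K\<close> then enlarged until noise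
  and bias are both below \<open>\<kappa>\<^sup>2 * K\<close> times the rate.\<close>

theorem minimizer_rates:
  fixes h :: 'q
  assumes \<epsilon>: "0 < \<epsilon>"
  shows "\<exists>C. \<forall>n nn lam d. 0 < nn \<longrightarrow> 1 \<le> d \<longrightarrow> 0 < lam \<longrightarrow>
    (\<forall>l\<in>{1..m}. 1 \<le> n l \<and> nn \<le> real (n l)) \<longrightarrow> effective_dim_le lam d \<longrightarrow>
    (\<exists>E\<in>events. 1 - \<epsilon> \<le> prob E \<and> (\<forall>\<omega>\<in>E. regular_sample n \<omega> \<longrightarrow>
      (\<forall>v\<in>N. (\<forall>t. 0 \<le> t \<longrightarrow> t \<le> 1 \<longrightarrow>
          lam / 2 * J (t *\<^sub>R v) (t *\<^sub>R v) + lam * J h (t *\<^sub>R v) \<le> log_ratio n \<omega> (t *\<^sub>R v)) \<longrightarrow>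
        S lam v \<le> C * (d / nn + lam)) \<and>
      (\<forall>v. 1 / 2 * (\<Sum>l=1..m. LINT x|Q l. (D l 0 v x)\<^sup>2) + lam / 2 * J v v + lam * J h v \<le> score n \<omega> v \<longrightarrow>
        S lam v \<le> C * (d / nn + lam))))"
proof -
  define Cs where "Cs = 2 * (1 / cw + 1)"
  have Cs: "0 < Cs" unfolding Cs_def using cw by (auto intro: add_pos_pos)
  obtain c1 where c1: "0 < c1" and U: "\<forall>\<epsilon>>0. \<exists>K0\<ge>1. \<forall>K\<ge>K0. \<forall>n nn lam d. 0 < nn \<longrightarrow> 1 \<le> d \<longrightarrow> 0 < lam \<longrightarrow>
    (\<forall>l\<in>{1..m}. 1 \<le> n l \<and> nn \<le> real (n l)) \<longrightarrow> effective_dim_le lam d \<longrightarrow>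
    (\<exists>E\<in>events. 1 - \<epsilon> \<le> prob E \<and> (\<forall>\<omega>\<in>E. \<forall>c\<in>rational_coefficients. lincomb b c \<in> N \<longrightarrow>
      K * (d / nn + lam) / 4 \<le> W (lincomb b c) \<longrightarrow> energy lam c \<le> Cs * (K * (d / nn + lam)) \<longrightarrow>
      (\<Sum>l=1..m. 1 / real (n l) * (\<Sum>k=1..n l. g l (lincomb b c) (X l k \<omega>) - A l (lincomb b c)))
        \<le> - c1 * (K * (d / nn + lam))))"
    by (rule exE[OF uniform_likelihood_bound[OF countable_rational_coefficients _ Cs]])
       (rule finite_support_rational_coefficients, assumption, elim conjE, rule that)
  have \<epsilon>2: "0 < \<epsilon> / 2" using \<epsilon> by simp
  from U[THEN spec, THEN mp, OF \<epsilon>2] obtain K0 where K0: "1 \<le> K0" and U': "\<forall>K\<ge>K0. \<forall>n nn lam d. 0 < nn \<longrightarrow> 1 \<le> d \<longrightarrow> 0 < lam \<longrightarrow>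
    (\<forall>l\<in>{1..m}. 1 \<le> n l \<and> nn \<le> real (n l)) \<longrightarrow> effective_dim_le lam d \<longrightarrow>
    (\<exists>E\<in>events. 1 - \<epsilon> / 2 \<le> prob E \<and> (\<forall>\<omega>\<in>E. \<forall>c\<in>rational_coefficients. lincomb b c \<in> N \<longrightarrow>
      K * (d / nn + lam) / 4 \<le> W (lincomb b c) \<longrightarrow> energy lam c \<le> Cs * (K * (d / nn + lam)) \<longrightarrow>
      (\<Sum>l=1..m. 1 / real (n l) * (\<Sum>k=1..n l. g l (lincomb b c) (X l k \<omega>) - A l (lincomb b c)))
        \<le> - c1 * (K * (d / nn + lam))))"
    by (elim exE conjE)
  define a0 where "a0 = C2 * Cw * (1 / cw + 1) / (\<epsilon> / 2)"
  define \<kappa> where "\<kappa> = min (1 / 8) (c1 / 2)"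
  have \<kappa>: "0 < \<kappa>" "\<kappa> \<le> 1 / 8" "\<kappa> \<le> c1 / 2" using c1 by (auto simp: \<kappa>_def)
  have a0: "0 \<le> a0" unfolding a0_def using const_pos cw \<epsilon> by (auto intro!: divide_nonneg_pos mult_nonneg_nonneg add_nonneg_nonneg)
  have h0: "0 \<le> J h h" by (rule J_nonneg)
  define K where "K = max K0 ((a0 + J h h) / \<kappa>\<^sup>2)"
  have K: "K0 \<le> K" "0 < K" using K0 by (auto simp: K_def)
  have "(a0 + J h h) / \<kappa>\<^sup>2 \<le> K" by (simp add: K_def)
  then have K\<kappa>: "a0 + J h h \<le> \<kappa>\<^sup>2 * K" using \<kappa>(1) by (simp add: divide_le_eq mult.commute)
  define C' where "C' = 8 / (min C1 1)\<^sup>2 * (a0 + J h h)"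
  show ?thesis
  proof (rule exI[of _ "max K C'"], intro allI impI)
    fix n nn lam d
    assume nn: "0 < nn" and d: "1 \<le> d" and lam: "0 < lam"
      and n: "\<forall>l\<in>{1..m}. 1 \<le> n l \<and> nn \<le> real (n l)" and dim: "effective_dim_le lam d"
    define R where "R = d / nn + lam"
    have R: "0 < R" unfolding R_def using d nn lam by (auto intro: add_pos_pos)
    have dR: "d / nn \<le> R" "lam \<le> R" "0 \<le> d / nn" unfolding R_def using d nn lam by auto
    from U'[THEN spec, THEN mp, OF K(1), THEN spec[of _ n], THEN spec[of _ nn], THEN spec[of _ lam], THEN spec[of _ d],
        THEN mp, OF nn, THEN mp, OF d, THEN mp, OF lam, THEN mp, OF n, THEN mp, OF dim]
    obtain E1 where E1: "E1 \<in> events" "1 - \<epsilon> / 2 \<le> prob E1"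
      and E1': "\<forall>\<omega>\<in>E1. \<forall>c\<in>rational_coefficients. lincomb b c \<in> N \<longrightarrow>
      K * R / 4 \<le> W (lincomb b c) \<longrightarrow> energy lam c \<le> Cs * (K * R) \<longrightarrow> log_ratio n \<omega> (lincomb b c) \<le> - c1 * (K * R)"
      unfolding log_ratio_def R_def by (elim bexE conjE)
    have nl: "nn \<le> real (n l)" if "l \<in> {1..m}" for l using n that by auto
    obtain E2 where E2: "E2 \<in> events" "1 - \<epsilon> / 2 \<le> prob E2"
      and E2': "\<And>\<omega> v. \<omega> \<in> E2 \<Longrightarrow> regular_sample n \<omega> \<Longrightarrow> (score n \<omega> v)\<^sup>2 \<le> C2 * Cw * (1 / cw + 1) / (\<epsilon> / 2) * (d / nn) * S lam v"
      by (rule score_bound[where n = n, OF \<epsilon>2 nn nl lam dim]) (assumption | rule that)+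
    have "1 - \<epsilon> \<le> prob (E1 \<inter> E2)" using prob_Int_ge[OF E1(1) E2(1)] E1(2) E2(2) by simp
    moreover have "S lam v \<le> max K C' * R" if \<omega>: "\<omega> \<in> E1 \<inter> E2" and reg: "regular_sample n \<omega>" and v: "v \<in> N"
      and min: "\<forall>t. 0 \<le> t \<longrightarrow> t \<le> 1 \<longrightarrow>
          lam / 2 * J (t *\<^sub>R v) (t *\<^sub>R v) + lam * J h (t *\<^sub>R v) \<le> log_ratio n \<omega> (t *\<^sub>R v)" for \<omega> v
    proof -
      have "S lam v \<le> K * R"
      proof (rule likelihood_minimizer_bound[where a = "a0 * (d / nn)" and \<kappa> = \<kappa> and ?c1.0 = c1 and h = h, OF reg _ v lam _ \<kappa>])
        show "1 \<le> n l" if "l \<in> {1..m}" for l using n that by auto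
        show "0 < K * R" using K R by simp
        show "0 \<le> a0 * (d / nn)" by (rule mult_nonneg_nonneg[OF a0 dR(3)])
        have "a0 * (d / nn) \<le> (\<kappa>\<^sup>2 * K) * R" using K\<kappa> a0 h0 dR by (intro mult_mono) auto
        then show "a0 * (d / nn) \<le> \<kappa>\<^sup>2 * (K * R)" by (simp add: mult.assoc)
        have "J h h * lam \<le> (\<kappa>\<^sup>2 * K) * R" using K\<kappa> a0 h0 dR lam by (intro mult_mono) auto
        then show "lam * J h h \<le> \<kappa>\<^sup>2 * (K * R)" by (simp add: mult_ac)
        show "(score n \<omega> u)\<^sup>2 \<le> a0 * (d / nn) * S lam u" for u using \<omega> by (intro E2'[folded a0_def] reg) simp
        show "lam / 2 * J (t *\<^sub>R v) (t *\<^sub>R v) + lam * J h (t *\<^sub>R v) \<le> log_ratio n \<omega> (t *\<^sub>R v)" if "0 \<le> t" "t \<le> 1" for t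
          using min that by simp
        show "log_ratio n \<omega> (lincomb b c) \<le> - c1 * (K * R)" if "c \<in> rational_coefficients" "lincomb b c \<in> N"
          "K * R / 4 \<le> W (lincomb b c)" "energy lam c \<le> 2 * (1 / cw + 1) * (K * R)" for c
          using E1'[rule_format, of \<omega> c] that \<omega> unfolding Cs_def by simp
      qed
      also have "\<dots> \<le> max K C' * R" using R by (intro mult_right_mono) auto
      finally show ?thesis .
    qed
    moreover have "S lam v \<le> max K C' * R" if \<omega>: "\<omega> \<in> E1 \<inter> E2" and reg: "regular_sample n \<omega>"
      and min: "1 / 2 * (\<Sum>l=1..m. LINT x|Q l. (D l 0 v x)\<^sup>2) + lam / 2 * J v v + lam * J h v \<le> score n \<omega> v" for \<omega> v
    proof -
      have "S lam v \<le> 8 / (min C1 1)\<^sup>2 * (a0 * (d / nn) + lam * J h h)"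
        by (intro quadratic_minimizer_bound[OF _ _ _ min] E2'[folded a0_def] reg mult_nonneg_nonneg a0 dR(3))
           (use lam \<omega> in auto)
      also have "\<dots> \<le> 8 / (min C1 1)\<^sup>2 * ((a0 + J h h) * R)"
      proof (rule mult_left_mono)
        have "a0 * (d / nn) \<le> a0 * R" by (rule mult_left_mono[OF dR(1) a0])
        moreover have "lam * J h h \<le> R * J h h" by (rule mult_right_mono[OF dR(2) h0])
        ultimately show "a0 * (d / nn) + lam * J h h \<le> (a0 + J h h) * R"
          unfolding distrib_right mult.commute[of R] by (rule add_mono)
      qed simp
      also have "\<dots> = C' * R" by (simp add: C'_def)
      also have "\<dots> \<le> max K C' * R" using R by (intro mult_right_mono) auto
      finally show ?thesis .
    qed
    ultimately show "\<exists>E\<in>events. 1 - \<epsilon> \<le> prob E \<and> (\<forall>\<omega>\<in>E. regular_sample n \<omega> \<longrightarrow>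
      (\<forall>v\<in>N. (\<forall>t. 0 \<le> t \<longrightarrow> t \<le> 1 \<longrightarrow>
          lam / 2 * J (t *\<^sub>R v) (t *\<^sub>R v) + lam * J h (t *\<^sub>R v) \<le> log_ratio n \<omega> (t *\<^sub>R v)) \<longrightarrow>
        S lam v \<le> max K C' * (d / nn + lam)) \<and>
      (\<forall>v. 1 / 2 * (\<Sum>l=1..m. LINT x|Q l. (D l 0 v x)\<^sup>2) + lam / 2 * J v v + lam * J h v \<le> score n \<omega> v \<longrightarrow>
        S lam v \<le> max K C' * (d / nn + lam)))"
      unfolding R_def[symmetric]
      by (intro bexI[of _ "E1 \<inter> E2"] conjI ballI allI impI) (use E1(1) E2(1) in auto)
  qed
qed

end

section \<open>Two-sided coefficient bounds for the joint basis of parameter and function\<close>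

section \<open>Eigenbasis of the penalized model\<close>

lemma cov_cong_AE:
  assumes "f \<in> borel_measurable P" "f' \<in> borel_measurable P" "AE x in P. f x = f' x"
  shows "cov P f f = cov P f' f'"
proof -
  have "(LINT x|P. f x * f x) = (LINT x|P. f' x * f' x)" "(LINT x|P. f x) = (LINT x|P. f' x)"
    by (rule integral_cong_AE; use assms in \<open>auto elim: eventually_mono\<close>)+
  then show ?thesis by (simp add: cov_def)
qed

locale penalized_density_model = density_model m M \<eta> \<tau>0 P X Lth Lh S C1 C2 C3 C4 n0 P0
  for m :: nat and M :: "nat \<Rightarrow> 'x measure"
    and \<eta> :: "nat \<Rightarrow> (real ^ 'p) \<times> ('h :: {real_inner, complete_space}) \<Rightarrow> 'x \<Rightarrow> real"
    and \<tau>0 :: "(real ^ 'p) \<times> 'h" and P :: "'w measure" and X :: "nat \<Rightarrow> nat \<Rightarrow> 'w \<Rightarrow> 'x"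
    and Lth :: "nat \<Rightarrow> real ^ 'p \<Rightarrow> 'x \<Rightarrow> real" and Lh :: "nat \<Rightarrow> 'h \<Rightarrow> 'x \<Rightarrow> real"
    and S :: "((real ^ 'p) \<times> 'h) set" and C1 C2 C3 C4 :: real and n0 :: "nat \<Rightarrow> nat" and P0 :: "nat \<Rightarrow> 'x measure" +
  fixes J :: "'h \<Rightarrow> 'h \<Rightarrow> real" and \<phi> :: "nat \<Rightarrow> 'h" and \<rho> :: "nat \<Rightarrow> real" and c\<delta> M2 :: real
  assumes J: "semi_inner_product J"
    and J_bound: "sum_var m P0 (\<lambda>l. Lh l h) + J h h \<le> M2 * (norm h)\<^sup>2"
    and identifiable: "0 < c\<delta>" "norm \<zeta> = 1 \<Longrightarrow> c\<delta> < sum_var m P0 (\<lambda>l x. Lth l \<zeta> x - Lh l h x)"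
    and V_orthonormal: "1 \<le> \<nu> \<Longrightarrow> 1 \<le> \<mu> \<Longrightarrow>
        sum_cov m P0 (\<lambda>l. Lh l (\<phi> \<nu>)) (\<lambda>l. Lh l (\<phi> \<mu>)) = (if \<nu> = \<mu> then 1 else 0)"
    and J_orthogonal: "1 \<le> \<nu> \<Longrightarrow> 1 \<le> \<mu> \<Longrightarrow> J (\<phi> \<nu>) (\<phi> \<mu>) = (if \<nu> = \<mu> then \<rho> \<nu> else 0)"
    and complete: "closure (span (\<phi> ` {1..})) = UNIV"
begin

text \<open>Natural numbers start at 0 and the eigenfunctions at 1, hence \<open>Suc\<close>.
  Correspondingly \<open>\<rho>'\<close> vanishes on the parameter coordinates, which carry no
  penalty.\<close>

definition b :: "'p + nat \<Rightarrow> (real ^ 'p) \<times> 'h" where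
  "b i = (case i of Inl j \<Rightarrow> (axis j 1, 0) | Inr \<nu> \<Rightarrow> (0, \<phi> (Suc \<nu>)))"

definition \<rho>' :: "'p + nat \<Rightarrow> real" where
  "\<rho>' i = (case i of Inl j \<Rightarrow> 0 | Inr \<nu> \<Rightarrow> \<rho> (Suc \<nu>))"

definition J' :: "(real ^ 'p) \<times> 'h \<Rightarrow> (real ^ 'p) \<times> 'h \<Rightarrow> real" where
  "J' u v = J (snd u) (snd v)"

lemma semi_inner_product_linear_image:
  assumes B: "semi_inner_product B" and f: "linear f"
  shows "semi_inner_product (\<lambda>u v. B (f u) (f v))"
proof -
  have "bilinear (\<lambda>u v. B (f u) (f v))"
    unfolding bilinear_def
    by (intro conjI allI linearI)
       (simp_all add: linear_add[OF f] linear_scale[OF f] semi_inner_product_add_scale[OF B])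
  then show ?thesis
    using semi_inner_productD(2,3)[OF B] unfolding semi_inner_product_def by blast
qed

lemma J'_semi_inner_product: "semi_inner_product J'"
  unfolding J'_def[abs_def] by (rule semi_inner_product_linear_image[OF J linear_snd])

lemma \<rho>_pos: "1 \<le> \<nu> \<Longrightarrow> 0 \<le> \<rho> \<nu>"
  using J_orthogonal[of \<nu> \<nu>] semi_inner_productD(3)[OF J, of "\<phi> \<nu>"] by simp

lemma operator_zero:
  assumes l: "l \<in> {1..m}"
  shows "AE x in P0 l. Lth l 0 x = 0" "AE x in P0 l. Lh l 0 x = 0"
  using L2_bounded_linearD(3)[OF Lth(1)[OF l], of 0 0] L2_bounded_linearD(3)[OF Lh[OF l], of 0 0] by simp_all

lemma operator_meas:
  assumes l: "l \<in> {1..m}"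
  shows "Lth l \<zeta> \<in> borel_measurable (P0 l)" "Lh l h \<in> borel_measurable (P0 l)"
  using L2_0D(1)[OF L2_bounded_linearD(1)[OF Lth(1)[OF l], of \<zeta>]]
    L2_0D(1)[OF L2_bounded_linearD(1)[OF Lh[OF l], of h]] by simp_all

lemma W_components:
  "W (\<zeta>, 0) = sum_var m P0 (\<lambda>l. Lth l \<zeta>)" "W (0, h) = sum_var m P0 (\<lambda>l. Lh l h)"
  "W (\<zeta>, - h) = sum_var m P0 (\<lambda>l x. Lth l \<zeta> x - Lh l h x)"
proof -
  have 1: "cov (P0 l) (L l (\<zeta>, 0)) (L l (\<zeta>, 0)) = cov (P0 l) (Lth l \<zeta>) (Lth l \<zeta>)" if l: "l \<in> {1..m}" for l
    by (rule cov_cong_AE[OF L2_0D(1)[OF L_L2(1)[OF l]] operator_meas(1)[OF l]])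
       (use operator_zero(2)[OF l] in \<open>eventually_elim, simp add: L_def\<close>)
  have 2: "cov (P0 l) (L l (0, h)) (L l (0, h)) = cov (P0 l) (Lh l h) (Lh l h)" if l: "l \<in> {1..m}" for l
    by (rule cov_cong_AE[OF L2_0D(1)[OF L_L2(1)[OF l]] operator_meas(2)[OF l]])
       (use operator_zero(1)[OF l] in \<open>eventually_elim, simp add: L_def\<close>)
  have 3: "cov (P0 l) (L l (\<zeta>, - h)) (L l (\<zeta>, - h)) = cov (P0 l) (\<lambda>x. Lth l \<zeta> x - Lh l h x) (\<lambda>x. Lth l \<zeta> x - Lh l h x)"
    if l: "l \<in> {1..m}" for l
    by (rule cov_cong_AE[OF L2_0D(1)[OF L_L2(1)[OF l]] borel_measurable_diff[OF operator_meas[OF l]]])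
       (use L2_bounded_linearD(3)[OF Lh[OF l], of "-1" h] in \<open>eventually_elim, simp add: L_def\<close>)
  show "W (\<zeta>, 0) = sum_var m P0 (\<lambda>l. Lth l \<zeta>)" unfolding W_def by (intro sum.cong refl 1)
  show "W (0, h) = sum_var m P0 (\<lambda>l. Lh l h)" unfolding W_def by (intro sum.cong refl 2)
  show "W (\<zeta>, - h) = sum_var m P0 (\<lambda>l x. Lth l \<zeta> x - Lh l h x)" unfolding W_def by (intro sum.cong refl 3)
qed

text \<open>Identifiability is stated for unit vectors and arbitrary \<open>h\<close>; both sides
  are quadratic, so dividing by the norm of \<open>\<zeta>\<close> reduces to that case. The minus
  sign in front of \<open>h\<close> is absorbed since \<open>h\<close> is arbitrary.\<close>

lemma W_lower: "c\<delta> * (norm \<zeta>)\<^sup>2 \<le> W (\<zeta>, h)"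
proof (cases "\<zeta> = 0")
  case True
  then show ?thesis using W_nonneg by simp
next
  case False
  define t where "t = norm \<zeta>"
  have t: "0 < t" using False by (simp add: t_def)
  have eq: "W (\<zeta>, h) = t\<^sup>2 * W ((1 / t) *\<^sub>R \<zeta>, - ((- 1 / t) *\<^sub>R h))"
    using t unfolding W_scale[symmetric] by simp
  have n: "norm ((1 / t) *\<^sub>R \<zeta>) = 1" using t by (simp add: t_def)
  have "c\<delta> \<le> W ((1 / t) *\<^sub>R \<zeta>, - ((- 1 / t) *\<^sub>R h))"
    unfolding W_components(3) using identifiable(2)[OF n] by (rule less_imp_le)
  then have "t\<^sup>2 * c\<delta> \<le> W (\<zeta>, h)" unfolding eq by (rule mult_left_mono) simp
  then show ?thesis by (simp add: t_def mult.commute)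
qed

lemma W_fst_bound: "\<exists>K\<ge>0. \<forall>\<zeta>. W (\<zeta>, 0) \<le> K * (norm \<zeta>)\<^sup>2"
proof -
  have "\<exists>K\<ge>0. \<forall>\<zeta>. cov (P0 l) (Lth l \<zeta>) (Lth l \<zeta>) \<le> K * (norm \<zeta>)\<^sup>2" if l: "l \<in> {1..m}" for l
    by (rule L2_bounded_linear_square[OF prob_space_Q[OF l] Lth(1)[OF l]])
  then obtain K where K: "\<And>l. l \<in> {1..m} \<Longrightarrow> 0 \<le> K l" "\<And>l \<zeta>. l \<in> {1..m} \<Longrightarrow> cov (P0 l) (Lth l \<zeta>) (Lth l \<zeta>) \<le> K l * (norm \<zeta>)\<^sup>2"
    by metis
  show ?thesis
    unfolding W_components(1)
    by (intro exI[of _ "\<Sum>l=1..m. K l"] conjI allI)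
       (auto simp: sum_distrib_right intro!: sum_nonneg sum_mono K)
qed

lemma W_parallelogram: "W (u + v) \<le> 2 * W u + 2 * W v"
  unfolding W_ipW by (rule semi_inner_product_parallelogram[OF ipW_semi_inner_product])

lemma V_bound: "W (0, h) \<le> M2 * (norm h)\<^sup>2" and J_norm_bound: "J h h \<le> M2 * (norm h)\<^sup>2"
  using J_bound[of h] semi_inner_productD(3)[OF J, of h] W_nonneg[of "(0, h)"] unfolding W_components(2) by linarith+

lemma M2_nonneg: "0 \<le> M2"
proof -
  have "W (0, \<phi> 1) = 1" using V_orthonormal[of 1 1] unfolding W_components(2) by simp
  then have "0 \<le> M2 * (norm (\<phi> 1))\<^sup>2" using V_bound[of "\<phi> 1"] by simp
  moreover have "0 < (norm (\<phi> 1))\<^sup>2" using V_bound[of "\<phi> 1"] \<open>W (0, \<phi> 1) = 1\<close> by (cases "\<phi> 1 = 0") auto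
  ultimately show ?thesis by (simp add: zero_le_mult_iff)
qed

lemma W_norm_bound: "\<exists>K. \<forall>v. W v \<le> K * (norm v)\<^sup>2"
proof -
  obtain K where K: "0 \<le> K" "\<And>\<zeta>. W (\<zeta>, 0) \<le> K * (norm \<zeta>)\<^sup>2" using W_fst_bound by blast
  have "W v \<le> (2 * K + 2 * M2) * (norm v)\<^sup>2" for v
  proof -
    have "W v \<le> 2 * W (fst v, 0) + 2 * W (0, snd v)" using W_parallelogram[of "(fst v, 0)" "(0, snd v)"] by simp
    also have "\<dots> \<le> 2 * (K * (norm (fst v))\<^sup>2) + 2 * (M2 * (norm (snd v))\<^sup>2)"
      using K(2)[of "fst v"] V_bound[of "snd v"] by linarith
    also have "\<dots> \<le> 2 * (K * (norm v)\<^sup>2) + 2 * (M2 * (norm v)\<^sup>2)"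
      using K(1) M2_nonneg norm_fst_le[of "fst v" "snd v"] norm_snd_le[of "snd v" "fst v"]
      by (intro add_mono mult_left_mono power_mono) auto
    finally show ?thesis by (simp add: algebra_simps)
  qed
  then show ?thesis by blast
qed

text \<open>The decoupled form \<open>(norm (fst v))\<^sup>2 + W (0, snd v)\<close>, unlike
  \<open>W\<close>, has \<open>b\<close> as an orthonormal system, and \<open>J\<close> is diagonal
  in it as well.\<close>

lemma expansion:
  fixes c :: "'p + nat \<Rightarrow> real"
  assumes F: "finite F"
  defines "v \<equiv> \<Sum>i\<in>F. c i *\<^sub>R b i"
  shows "(norm (fst v))\<^sup>2 + W (0, snd v) = (\<Sum>i\<in>F. (c i)\<^sup>2)" "J (snd v) (snd v) = (\<Sum>i\<in>F. \<rho>' i * (c i)\<^sup>2)"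
proof -
  have "semi_inner_product (\<lambda>u v :: (real ^ 'p) \<times> 'h. fst u \<bullet> fst v)"
    by (rule semi_inner_product_linear_image[OF _ linear_fst])
       (auto simp: semi_inner_product_def inner_commute bilinear_def inner_add_left inner_add_right intro!: linearI)
  note e1 = semi_inner_product_orthogonal_expansion[OF this F, of b "\<lambda>i. case i of Inl j \<Rightarrow> 1 | Inr \<nu> \<Rightarrow> 0" c]
  have lin: "linear (\<lambda>v :: (real ^ 'p) \<times> 'h. (0 :: real ^ 'p, snd v))" by (intro linearI) auto
  note e2 = semi_inner_product_orthogonal_expansion[OF semi_inner_product_linear_image[OF ipW_semi_inner_product lin] F,
      of b "\<lambda>i. case i of Inl j \<Rightarrow> 0 | Inr \<nu> \<Rightarrow> 1" c]
  note e3 = semi_inner_product_orthogonal_expansion[OF J'_semi_inner_product F, of b \<rho>' c]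
  have i1: "fst v \<bullet> fst v = (\<Sum>i\<in>F. (case i of Inl j \<Rightarrow> 1 | Inr \<nu> \<Rightarrow> 0) * (c i)\<^sup>2)"
    unfolding v_def by (rule e1) (auto simp: b_def inner_axis_axis split: sum.splits)
  have ip: "ipW (0, h) (0, h') = sum_cov m P0 (\<lambda>l. Lh l h) (\<lambda>l. Lh l h')" for h h'
    unfolding ipW_def
  proof (rule sum.cong[OF refl])
    fix l assume l: "l \<in> {1..m}"
    note L0 = L2_0D[OF L_L2(1)[OF l]] and h0 = L2_bounded_linearD(1)[OF Lh[OF l]]
    have ae: "AE x in P0 l. L l (0, k) x = Lh l k x" for k
      using operator_zero(1)[OF l] by eventually_elim (simp add: L_def)
    have "(LINT x|P0 l. L l (0, h) x * L l (0, h') x) = (LINT x|P0 l. Lh l h x * Lh l h' x)"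
      by (rule integral_cong_AE)
         (use ae[of h] ae[of h'] in \<open>auto intro!: borel_measurable_times L0(1) operator_meas(2)[OF l] elim: eventually_elim2\<close>)
    then show "cov (P0 l) (L l (0, h)) (L l (0, h')) = cov (P0 l) (Lh l h) (Lh l h')"
      unfolding cov_L2_0[OF L_L2(1)[OF l]] cov_L2_0[OF h0] .
  qed
  have Vip: "ipW (0, \<phi> (Suc \<nu>)) (0, \<phi> (Suc \<mu>)) = (if \<nu> = \<mu> then 1 else 0)" for \<nu> \<mu>
    unfolding ip by (subst V_orthonormal) auto
  have ipzero: "ipW (0, 0) u = 0" "ipW u (0, 0) = 0" for u
    using semi_inner_product_add_scale(2)[OF ipW_semi_inner_product, of 0 0 u]
      semi_inner_product_add_scale(4)[OF ipW_semi_inner_product, of u 0 0] by (simp_all add: zero_prod_def)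
  have J0: "J 0 u = 0" "J u 0 = 0" for u
    using semi_inner_product_add_scale(2)[OF J, of 0 0 u] semi_inner_product_add_scale(4)[OF J, of u 0 0] by simp_all
  have i2: "ipW (0, snd v) (0, snd v) = (\<Sum>i\<in>F. (case i of Inl j \<Rightarrow> 0 | Inr \<nu> \<Rightarrow> 1) * (c i)\<^sup>2)"
    unfolding v_def by (rule e2) (auto simp: b_def ipzero Vip split: sum.splits)
  show "J (snd v) (snd v) = (\<Sum>i\<in>F. \<rho>' i * (c i)\<^sup>2)"
    unfolding v_def J'_def[symmetric]
    by (rule e3) (auto simp: b_def J'_def J0 \<rho>'_def J_orthogonal split: sum.splits)
  have "(norm (fst v))\<^sup>2 + W (0, snd v) = (\<Sum>i\<in>F. (case i of Inl j \<Rightarrow> 1 | Inr \<nu> \<Rightarrow> 0) * (c i)\<^sup>2 + (case i of Inl j \<Rightarrow> 0 | Inr \<nu> \<Rightarrow> 1) * (c i)\<^sup>2)"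
    unfolding power2_norm_eq_inner W_ipW i1 i2 by (simp add: sum.distrib)
  also have "\<dots> = (\<Sum>i\<in>F. (c i)\<^sup>2)" by (intro sum.cong refl) (auto split: sum.splits)
  finally show "(norm (fst v))\<^sup>2 + W (0, snd v) = (\<Sum>i\<in>F. (c i)\<^sup>2)" .
qed

text \<open>It suffices to compare \<open>W\<close> with the decoupled form of
  \<open>expansion\<close>. Identifiability bounds the parameter part by \<open>W\<close>, and the
  parallelogram inequality then recovers the function part.\<close>

lemma W_coefficients:
  "\<exists>cw>0. \<exists>Cw>0. \<forall>F c. finite F \<longrightarrow> cw * (\<Sum>i\<in>F. (c i)\<^sup>2) \<le> W (\<Sum>i\<in>F. c i *\<^sub>R b i) \<and>
      W (\<Sum>i\<in>F. c i *\<^sub>R b i) \<le> Cw * (\<Sum>i\<in>F. (c i)\<^sup>2)"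
proof -
  obtain K where K: "0 \<le> K" "\<And>\<zeta>. W (\<zeta>, 0) \<le> K * (norm \<zeta>)\<^sup>2" using W_fst_bound by blast
  \<comment> \<open>The parallelogram inequality bounds the decoupled form by
    \<open>2 * W v + (1 + 2 * K) * (norm (fst v))\<^sup>2\<close>, and \<open>W_lower\<close>
    replaces the norm by \<open>W v / c\<delta>\<close>.\<close>
  define y where "y = (1 + 2 * K) / c\<delta> + 2"
  have y: "0 < y" unfolding y_def using K(1) identifiable(1) by (auto intro: add_nonneg_pos)
  have bounds: "1 / y * (\<Sum>i\<in>F. (c i)\<^sup>2) \<le> W (\<Sum>i\<in>F. c i *\<^sub>R b i) \<and>
      W (\<Sum>i\<in>F. c i *\<^sub>R b i) \<le> (2 * K + 2) * (\<Sum>i\<in>F. (c i)\<^sup>2)" if F: "finite F" for F c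
  proof
    define v where "v = (\<Sum>i\<in>F. c i *\<^sub>R b i)"
    note e = expansion(1)[OF F, of c, folded v_def]
    let ?z = "(norm (fst v))\<^sup>2"
    have z: "?z \<le> W v / c\<delta>" using W_lower[of "fst v" "snd v"] identifiable(1) by (simp add: le_divide_eq mult.commute)
    have "W (0, snd v) \<le> 2 * W v + 2 * W (- fst v, 0)" using W_parallelogram[of v "(- fst v, 0)"] by (cases v) simp
    also have "W (- fst v, 0) \<le> K * ?z" using K(2)[of "- fst v"] by simp
    finally have "?z + W (0, snd v) \<le> 2 * W v + (1 + 2 * K) * ?z" by (simp add: distrib_right)
    also have "\<dots> \<le> 2 * W v + (1 + 2 * K) * (W v / c\<delta>)" using z K(1) by (intro add_left_mono mult_left_mono) auto
    also have "\<dots> = y * W v" by (simp add: y_def distrib_right)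
    finally show "1 / y * (\<Sum>i\<in>F. (c i)\<^sup>2) \<le> W (\<Sum>i\<in>F. c i *\<^sub>R b i)"
      unfolding e v_def[symmetric] using y by (simp add: divide_le_eq mult.commute)
    have "W v \<le> 2 * W (fst v, 0) + 2 * W (0, snd v)" using W_parallelogram[of "(fst v, 0)" "(0, snd v)"] by simp
    also have "\<dots> \<le> 2 * (K * ?z) + 2 * W (0, snd v)" using K(2)[of "fst v"] by simp
    also have "\<dots> \<le> (2 * K + 2) * (?z + W (0, snd v))"
      using K(1) W_nonneg[of "(0, snd v)"] by (simp add: algebra_simps)
    finally show "W (\<Sum>i\<in>F. c i *\<^sub>R b i) \<le> (2 * K + 2) * (\<Sum>i\<in>F. (c i)\<^sup>2)" unfolding e v_def[symmetric] .
  qed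
  have pos: "0 < 1 / y" "0 < 2 * K + 2" using K(1) y by auto
  show ?thesis
    by (rule exI[of _ "1 / y"], rule conjI[OF pos(1)], rule exI[of _ "2 * K + 2"], rule conjI[OF pos(2)])
       (intro allI impI bounds)
qed

lemma span_b_dense: "closure (span (range b)) = UNIV"
proof -
  have fst_in: "(\<zeta>, 0) \<in> span (range b)" for \<zeta>
  proof -
    have "(\<zeta>, 0) = (\<Sum>j\<in>UNIV. (\<zeta> $ j) *\<^sub>R b (Inl j))"
    proof (rule prod_eqI)
      have "fst (\<Sum>j\<in>UNIV. (\<zeta> $ j) *\<^sub>R b (Inl j)) = (\<Sum>j\<in>UNIV. (\<zeta> $ j) *\<^sub>R axis j 1)"
        by (simp add: fst_sum b_def)
      also have "\<dots> = \<zeta>" using basis_expansion[of \<zeta>] by (simp add: scalar_mult_eq_scaleR)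
      finally show "fst (\<zeta>, 0) = fst (\<Sum>j\<in>UNIV. (\<zeta> $ j) *\<^sub>R b (Inl j))" by simp
      show "snd (\<zeta>, 0) = snd (\<Sum>j\<in>UNIV. (\<zeta> $ j) *\<^sub>R b (Inl j))" by (simp add: snd_sum b_def)
    qed
    then show ?thesis by (simp add: span_sum span_scale span_base)
  qed
  have snd_in: "(0, h) \<in> span (range b)" if "h \<in> span (\<phi> ` {1..})" for h
  proof -
    have lin: "linear (\<lambda>h. (0 :: real ^ 'p, h :: 'h))" by (intro linearI) auto
    have "(0 :: real ^ 'p, h) \<in> span ((\<lambda>h. (0, h)) ` \<phi> ` {1..})"
      unfolding linear_span_image[OF lin] using that by (rule imageI)
    moreover have "(\<lambda>h. (0 :: real ^ 'p, h)) ` \<phi> ` {1..} \<subseteq> range b"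
    proof
      fix w assume "w \<in> (\<lambda>h. (0 :: real ^ 'p, h)) ` \<phi> ` {1..}"
      then obtain \<nu> where \<nu>: "1 \<le> \<nu>" "w = (0, \<phi> \<nu>)" by auto
      then have "w = b (Inr (\<nu> - 1))" by (simp add: b_def)
      then show "w \<in> range b" by simp
    qed
    ultimately show ?thesis using span_mono by blast
  qed
  show ?thesis
  proof (rule equalityI[OF subset_UNIV], rule subsetI)
    fix w :: "(real ^ 'p) \<times> 'h"
    have "snd w \<in> closure (span (\<phi> ` {1..}))" using complete by simp
    then obtain y where y: "\<forall>j. y j \<in> span (\<phi> ` {1..})" "y \<longlonglongrightarrow> snd w"
      unfolding closure_sequential by (elim exE conjE)
    have "(fst w, y j) \<in> span (range b)" for j
      using span_add[OF fst_in[of "fst w"] snd_in[of "y j"]] y(1) by simp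
    moreover have "(\<lambda>j. (fst w, y j)) \<longlonglongrightarrow> (fst w, snd w)" by (intro tendsto_Pair tendsto_const y(2))
    ultimately show "w \<in> closure (span (range b))"
      unfolding closure_sequential by (intro exI[of _ "\<lambda>j. (fst w, y j)"]) simp
  qed
qed

lemma penalized_model:
  "\<exists>B cw Cw KV. penalized_model P m P0 X g A N D W B C1 C2 b \<rho>' cw Cw ipW J' KV M2"
proof -
  obtain B where B: "0 \<le> B" "\<forall>l\<in>{1..m}. \<forall>v\<in>N. AE x in P0 l. \<bar>g l v x - A l v\<bar> \<le> B"
    using ratio_bounds by (elim exE conjE)
  obtain cw Cw where cw: "0 < cw" "0 < Cw" and Wc: "\<forall>F c. finite F \<longrightarrow> cw * (\<Sum>i\<in>F. (c i)\<^sup>2) \<le> W (\<Sum>i\<in>F. c i *\<^sub>R b i) \<and>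
      W (\<Sum>i\<in>F. c i *\<^sub>R b i) \<le> Cw * (\<Sum>i\<in>F. (c i)\<^sup>2)"
    using W_coefficients by (elim exE conjE)
  obtain KV where KV: "\<forall>v. W v \<le> KV * (norm v)\<^sup>2" using W_norm_bound by (elim exE)
  interpret log_concave_model P m P0 X g A N D W B C1 C2
    by (rule log_concave[OF B(1) B(2)[rule_format]])
  have "penalized_model P m P0 X g A N D W B C1 C2 b \<rho>' cw Cw ipW J' KV M2"
  proof
    show "0 < cw" "0 < Cw" by (fact cw)+
    show "cw * (\<Sum>i\<in>F. (c i)\<^sup>2) \<le> W (\<Sum>i\<in>F. c i *\<^sub>R b i)" "W (\<Sum>i\<in>F. c i *\<^sub>R b i) \<le> Cw * (\<Sum>i\<in>F. (c i)\<^sup>2)"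
      if "finite F" for F c using Wc that by auto
    show "0 \<le> \<rho>' i" for i using \<rho>_pos by (simp add: \<rho>'_def split: sum.splits)
    show "semi_inner_product ipW" by (rule ipW_semi_inner_product)
    show "W v = ipW v v" for v by (rule W_ipW)
    show "ipW v v \<le> KV * (norm v)\<^sup>2" for v using KV[rule_format, of v] by (simp only: W_ipW)
    show "semi_inner_product J'" by (rule J'_semi_inner_product)
    show "J' v v \<le> M2 * (norm v)\<^sup>2" for v
    proof -
      have "J' v v \<le> M2 * (norm (snd v))\<^sup>2" unfolding J'_def by (rule J_norm_bound)
      also have "\<dots> \<le> M2 * (norm v)\<^sup>2"
        using M2_nonneg norm_snd_le[of "snd v" "fst v"] by (intro mult_left_mono power_mono) auto
      finally show ?thesis .
    qed
    show "J' (lincomb b c) (lincomb b c) = (\<Sum>i | c i \<noteq> 0. \<rho>' i * (c i)\<^sup>2)" if "finite_support c" for c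
      unfolding J'_def lincomb_def by (rule expansion(2)) (use that in \<open>simp add: finite_support_def\<close>)
    show "closure (span (range b)) = UNIV" by (rule span_b_dense)
    show "open N" by (rule N_facts(1))
  qed
  then show ?thesis by (intro exI)
qed

end

section \<open>Both criteria as functions of the deviation from the truth\<close>

section \<open>The criteria\<close>

context penalized_density_model
begin

lemma pointwise_smooth:
  assumes x: "\<forall>v\<in>N. (\<lambda>\<sigma>. \<eta> l \<sigma> x) differentiable (at (\<tau>0 + v)) \<and>
    (\<forall>w. D l v w x = frechet_derivative (\<lambda>\<sigma>. \<eta> l \<sigma> x) (at (\<tau>0 + v)) w)"
  shows "continuous_on N (\<lambda>v. g l v x)" "bounded_linear (\<lambda>v. D l 0 v x)"
    "(\<lambda>j. (g l (inverse (real (Suc j)) *\<^sub>R v) x - g l 0 x) * real (Suc j)) \<longlonglongrightarrow> D l 0 v x"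
proof -
  show "continuous_on N (\<lambda>v. g l v x)"
  proof (rule continuous_at_imp_continuous_on, rule ballI)
    fix v assume "v \<in> N"
    then have *: "isCont (\<lambda>\<sigma>. \<eta> l \<sigma> x) (\<tau>0 + v)"
      using bspec[OF x] by (intro differentiable_imp_continuous_within) simp
    have "isCont (\<lambda>v. \<tau>0 + v) v" by (intro continuous_intros)
    from isCont_o2[OF this *] have "isCont (\<lambda>v. \<eta> l (\<tau>0 + v) x) v" .
    then show "isCont (\<lambda>v. g l v x) v" unfolding g_def by (intro continuous_intros)
  qed
  have d: "(\<lambda>\<sigma>. \<eta> l \<sigma> x) differentiable (at \<tau>0)" and e: "D l 0 w x = frechet_derivative (\<lambda>\<sigma>. \<eta> l \<sigma> x) (at \<tau>0) w" for w
    using bspec[OF x N_facts(3), THEN conjunct1] bspec[OF x N_facts(3), THEN conjunct2, THEN spec[of _ w]] by simp_all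
  have "bounded_linear (frechet_derivative (\<lambda>\<sigma>. \<eta> l \<sigma> x) (at \<tau>0))"
    using d unfolding frechet_derivative_works by (rule has_derivative_bounded_linear)
  then show "bounded_linear (\<lambda>v. D l 0 v x)" unfolding e by simp
  show "(\<lambda>j. (g l (inverse (real (Suc j)) *\<^sub>R v) x - g l 0 x) * real (Suc j)) \<longlonglongrightarrow> D l 0 v x"
    using difference_quotient_LIMSEQ[OF d, of v] unfolding e g_def by simp
qed

lemma penalty_expand: "J (snd (\<tau>0 + v)) (snd (\<tau>0 + v)) = J (snd \<tau>0) (snd \<tau>0) + J' v v + 2 * J' \<tau>0 v"
  using semi_inner_productD(2)[OF J, of "snd v" "snd \<tau>0"]
  by (simp add: J'_def semi_inner_product_add_scale[OF J])

lemma sum_loglik_eq: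
  assumes n: "\<And>l. l \<in> {1..m} \<Longrightarrow> 1 \<le> n l"
  shows "sum_loglik m M \<eta> n xs (\<tau>0 + v) - sum_loglik m M \<eta> n xs \<tau>0 =
    - (\<Sum>l=1..m. 1 / real (n l) * (\<Sum>k=1..n l. g l v (xs l k) - A l v))"
  unfolding sum_loglik_def sum_subtractf[symmetric] sum_negf[symmetric]
proof (rule sum.cong[OF refl])
  fix l assume "l \<in> {1..m}"
  then have "0 < real (n l)" using n by force
  moreover have "- (1 / x) * a + p - (- (1 / x) * a' + q) = - (1 / x * (a - a' - x * (p - q)))" if "0 < x" for x a a' p q :: real
    using that by (simp add: field_simps)
  moreover have "(\<Sum>k=1..n l. g l v (xs l k) - A l v) =
      (\<Sum>k=1..n l. \<eta> l (\<tau>0 + v) (xs l k)) - (\<Sum>k=1..n l. \<eta> l \<tau>0 (xs l k)) - real (n l) * (ln (Z l (\<tau>0 + v)) - ln (Z l \<tau>0))"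
    unfolding g_def A_def by (simp add: sum_subtractf)
  ultimately show "neg_loglik (M l) (\<eta> l) (n l) (xs l) (\<tau>0 + v) - neg_loglik (M l) (\<eta> l) (n l) (xs l) \<tau>0 =
      - (1 / real (n l) * (\<Sum>k=1..n l. g l v (xs l k) - A l v))"
    unfolding neg_loglik_def Z_def[symmetric] by (simp only:)
qed

lemma pen_crit_convex:
  assumes "convex_on UNIV (sum_loglik m M \<eta> n xs)" and lam: "0 \<le> lam"
  shows "convex_on UNIV (pen_crit m M \<eta> J lam n xs)"
proof -
  have "convex_on UNIV (\<lambda>\<tau>. J' \<tau> \<tau>)"
  proof (rule convex_onI)
    fix t :: real and u v :: "(real ^ 'p) \<times> 'h"
    assume t: "0 < t" "t < 1"
    note r = semi_inner_product_add_scale[OF J'_semi_inner_product]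
    have "0 \<le> t * (1 - t) * J' (u - v) (u - v)"
      using t semi_inner_productD(3)[OF J'_semi_inner_product] by simp
    also have "t * (1 - t) * J' (u - v) (u - v) =
        (1 - t) * J' u u + t * J' v v - J' ((1 - t) *\<^sub>R u + t *\<^sub>R v) ((1 - t) *\<^sub>R u + t *\<^sub>R v)"
      unfolding r using semi_inner_productD(2)[OF J'_semi_inner_product, of v u] by (simp add: algebra_simps)
    finally show "J' ((1 - t) *\<^sub>R u + t *\<^sub>R v) ((1 - t) *\<^sub>R u + t *\<^sub>R v) \<le> (1 - t) * J' u u + t * J' v v" by simp
  qed simp
  then have "convex_on UNIV (\<lambda>\<tau>. lam / 2 * J' \<tau> \<tau>)" using lam by (intro convex_on_cmul) auto
  then show ?thesis
    unfolding pen_crit_def[abs_def] J'_def[symmetric] by (rule convex_on_add[OF assms(1)])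
qed

text \<open>By convexity a local minimum is global, so the far end of the segment has value at most
  that at \<open>\<tau>0\<close>; convexity bounds the points in between.\<close>

lemma local_minimum_segment:
  assumes F: "convex_on UNIV F" and loc: "local_minimum F (\<tau>0 + v)" and t: "0 \<le> t" "t \<le> 1"
  shows "F (\<tau>0 + t *\<^sub>R v) \<le> F \<tau>0"
proof -
  obtain e where e: "0 < e" "\<forall>\<sigma>. dist \<sigma> (\<tau>0 + v) < e \<longrightarrow> F (\<tau>0 + v) \<le> F \<sigma>"
    using loc unfolding local_minimum_def eventually_nhds_metric by (elim exE conjE)
  have "\<forall>\<sigma>\<in>UNIV. F (\<tau>0 + v) \<le> F \<sigma>"
    by (rule convex_local_global_minimum[OF e(1) F]) (use e(2) in \<open>auto simp: dist_commute\<close>)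
  then have "F (\<tau>0 + v) \<le> F \<tau>0" by (rule bspec) (rule UNIV_I)
  moreover have "F ((1 - t) *\<^sub>R \<tau>0 + t *\<^sub>R (\<tau>0 + v)) \<le> (1 - t) * F \<tau>0 + t * F (\<tau>0 + v)"
    by (rule convex_onD[OF F t]) auto
  moreover have "(1 - t) *\<^sub>R \<tau>0 + t *\<^sub>R (\<tau>0 + v) = \<tau>0 + t *\<^sub>R v" by (simp add: algebra_simps)
  ultimately have "F (\<tau>0 + t *\<^sub>R v) \<le> (1 - t) * F \<tau>0 + t * F \<tau>0"
    using mult_left_mono[of "F (\<tau>0 + v)" "F \<tau>0" t] t by simp
  then show ?thesis by (simp add: algebra_simps)
qed

lemma quad_crit_eq:
  assumes lin: "\<And>l k. l \<in> {1..m} \<Longrightarrow> k \<in> {1..n l} \<Longrightarrow> bounded_linear (\<lambda>w. D l 0 w (xs l k))"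
  shows "quad_crit m M \<eta> J \<tau>0 lam n xs (\<tau>0 + v) - quad_crit m M \<eta> J \<tau>0 lam n xs \<tau>0 =
    1 / 2 * (\<Sum>l=1..m. LINT x|P0 l. (D l 0 v x)\<^sup>2) + lam / 2 * J' v v + lam * J' \<tau>0 v
    - (\<Sum>l=1..m. 1 / real (n l) * (\<Sum>k=1..n l. D l 0 v (xs l k)))"
proof -
  have D0: "D_theta (\<eta> l) \<tau>0 (fst w) x + D_h (\<eta> l) \<tau>0 (snd w) x = D l 0 w x" for l w x by (simp add: D_def)
  have cov: "cov (P0 l) (D l 0 w) (D l 0 w) = (LINT x|P0 l. (D l 0 w x)\<^sup>2)" if "l \<in> {1..m}" for l w
    unfolding cov_L2_0[OF D_L2_0[OF that N_facts(3)]] power2_eq_square ..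
  \<comment> \<open>At the truth the quadratic term is evaluated in direction 0.
    \<open>D l 0 0\<close> is zero only almost everywhere, so its mean square is removed through the
    bound by \<open>W 0\<close>.\<close>
  have "W 0 = 0" using W_scale[of 0 0] by simp
  then have "(\<Sum>l=1..m. LINT x|P0 l. (D l 0 0 x)\<^sup>2) \<le> 0" using D_compare'(2)[OF N_facts(3), of 0] by simp
  then have z: "(\<Sum>l=1..m. LINT x|P0 l. (D l 0 0 x)\<^sup>2) = 0"
    by (intro antisym sum_nonneg integral_nonneg_AE) auto
  have ql: "quad_loglik (M l) (\<eta> l) \<tau>0 (n l) (xs l) (\<tau>0 + w) =
     - (1 / real (n l) * (\<Sum>k=1..n l. D l 0 (\<tau>0 + w) (xs l k))) + 1 / 2 * (LINT x|P0 l. (D l 0 w x)\<^sup>2)"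
    if l: "l \<in> {1..m}" for l w
  proof -
    have P0l: "model_law (M l) (\<eta> l) \<tau>0 = P0 l" by (simp add: P0_def)
    have i0: "(LINT x|P0 l. D l 0 u x) = 0" for u by (rule L2_0D(3)[OF D_L2_0[OF l N_facts(3)]])
    show ?thesis
      unfolding quad_loglik_def Let_def P0l D0 i0 add_diff_cancel_left' cov[OF l] by simp
  qed
  have lin': "(\<Sum>k=1..n l. D l 0 (\<tau>0 + v) (xs l k)) = (\<Sum>k=1..n l. D l 0 \<tau>0 (xs l k)) + (\<Sum>k=1..n l. D l 0 v (xs l k))"
    if l: "l \<in> {1..m}" for l
    unfolding sum.distrib[symmetric]
    by (intro sum.cong refl linear_add[OF bounded_linear.linear[OF lin[OF l]]])
  have "(\<Sum>l=1..m. quad_loglik (M l) (\<eta> l) \<tau>0 (n l) (xs l) (\<tau>0 + v)) - (\<Sum>l=1..m. quad_loglik (M l) (\<eta> l) \<tau>0 (n l) (xs l) (\<tau>0 + 0)) =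
      (\<Sum>l=1..m. 1 / 2 * (LINT x|P0 l. (D l 0 v x)\<^sup>2) - 1 / 2 * (LINT x|P0 l. (D l 0 0 x)\<^sup>2)
        - 1 / real (n l) * (\<Sum>k=1..n l. D l 0 v (xs l k)))"
    unfolding sum_subtractf[symmetric]
  proof (rule sum.cong[OF refl])
    fix l assume l: "l \<in> {1..m}"
    show "quad_loglik (M l) (\<eta> l) \<tau>0 (n l) (xs l) (\<tau>0 + v) - quad_loglik (M l) (\<eta> l) \<tau>0 (n l) (xs l) (\<tau>0 + 0) =
      1 / 2 * (LINT x|P0 l. (D l 0 v x)\<^sup>2) - 1 / 2 * (LINT x|P0 l. (D l 0 0 x)\<^sup>2) - 1 / real (n l) * (\<Sum>k=1..n l. D l 0 v (xs l k))"
      unfolding ql[OF l] lin'[OF l] by (simp add: distrib_left)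
  qed
  also have "\<dots> = 1 / 2 * (\<Sum>l=1..m. LINT x|P0 l. (D l 0 v x)\<^sup>2) - (\<Sum>l=1..m. 1 / real (n l) * (\<Sum>k=1..n l. D l 0 v (xs l k)))"
    unfolding sum_subtractf sum_distrib_left[symmetric] z by simp
  finally show ?thesis unfolding quad_crit_def penalty_expand by (simp add: algebra_simps)
qed

text \<open>The unpenalized parameter directions add \<open>CARD('p)\<close>, a constant absorbed
  because \<open>lam powr (- 1 / r) \<ge> 1\<close> for \<open>lam \<le> 1\<close>.\<close>

lemma effective_dimension:
  assumes r: "1 < r" and \<beta>: "0 < \<beta>" and \<rho>: "\<And>\<nu>. 1 \<le> \<nu> \<Longrightarrow> \<beta> * real \<nu> powr r \<le> \<rho> \<nu>"
  shows "\<exists>C\<ge>1. \<forall>lam F. 0 < lam \<longrightarrow> lam \<le> 1 \<longrightarrow> finite F \<longrightarrow>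
    (\<Sum>i\<in>F. 1 / (1 + lam * \<rho>' i)) \<le> C * lam powr (- 1 / r) \<and> 1 \<le> C * lam powr (- 1 / r)"
proof -
  have "\<beta> * real (Suc \<nu>) powr r \<le> \<rho> (Suc \<nu>)" for \<nu> by (rule \<rho>) simp
  note ed = effective_dimension_powr[where \<rho> = "\<lambda>\<nu>. \<rho> (Suc \<nu>)", OF r \<beta> this]
  obtain C where C: "1 \<le> C" "\<forall>lam F. 0 < lam \<longrightarrow> lam \<le> 1 \<longrightarrow> finite F \<longrightarrow>
      (\<Sum>\<nu>\<in>F. 1 / (1 + lam * \<rho> (Suc \<nu>))) \<le> C * lam powr (- 1 / r)"
    using ed by (elim exE conjE)
  show ?thesis
  proof (rule exI[of _ "real CARD('p) + C"], intro conjI allI impI)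
    show "1 \<le> real CARD('p) + C" using C(1) by simp
    fix lam :: real and F :: "('p + nat) set" assume lam: "0 < lam" "lam \<le> 1" and F: "finite F"
    have p: "1 \<le> lam powr (- 1 / r)"
    proof -
      have "lam powr (1 / r) \<le> 1" "0 < lam powr (1 / r)" using lam r by (auto intro: powr_le1)
      then show ?thesis by (simp add: powr_minus_divide)
    qed
    have eq: "F = Inl ` (Inl -` F) \<union> Inr ` (Inr -` F)"
    proof (rule set_eqI)
      fix i show "i \<in> F \<longleftrightarrow> i \<in> Inl ` (Inl -` F) \<union> Inr ` (Inr -` F)" by (cases i) auto
    qed
    have fin: "finite (Inl -` F)" "finite (Inr -` F)" using F by (auto intro!: finite_vimageI)
    have "(\<Sum>i\<in>F. 1 / (1 + lam * \<rho>' i)) =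
        (\<Sum>i\<in>Inl ` (Inl -` F). 1 / (1 + lam * \<rho>' i)) + (\<Sum>i\<in>Inr ` (Inr -` F). 1 / (1 + lam * \<rho>' i))"
      by (subst eq, rule sum.union_disjoint[OF finite_imageI[OF fin(1)] finite_imageI[OF fin(2)]]) auto
    also have "(\<Sum>i\<in>Inl ` (Inl -` F). 1 / (1 + lam * \<rho>' i)) = real (card (Inl -` F))"
      by (subst sum.reindex) (auto simp: \<rho>'_def)
    also have "\<dots> \<le> real CARD('p)" by (simp add: card_mono)
    also have "(\<Sum>i\<in>Inr ` (Inr -` F). 1 / (1 + lam * \<rho>' i)) = (\<Sum>\<nu>\<in>Inr -` F. 1 / (1 + lam * \<rho> (Suc \<nu>)))"
      by (subst sum.reindex) (auto simp: \<rho>'_def)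
    also have "\<dots> \<le> C * lam powr (- 1 / r)" using C(2) lam fin(2) by blast
    also have "real CARD('p) + C * lam powr (- 1 / r) \<le> (real CARD('p) + C) * lam powr (- 1 / r)"
      unfolding distrib_right using mult_left_mono[OF p, of "real CARD('p)"] by simp
    finally show "(\<Sum>i\<in>F. 1 / (1 + lam * \<rho>' i)) \<le> (real CARD('p) + C) * lam powr (- 1 / r)" by simp
    show "1 \<le> (real CARD('p) + C) * lam powr (- 1 / r)"
      using mult_mono[of 1 "real CARD('p) + C" 1 "lam powr (- 1 / r)"] C(1) p by simp
  qed
qed

text \<open>The estimator enters as a local minimum in \<open>S\<close>, the quadratic minimizer
  through not exceeding its criterion at the truth. The bounds hold for every such pair on one
  event, so measurability of the minimizers is not at issue.\<close>

theorem estimator_rates: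
  assumes r: "1 < r" and \<beta>: "0 < \<beta>" and \<rho>: "\<And>\<nu>. 1 \<le> \<nu> \<Longrightarrow> \<beta> * real \<nu> powr r \<le> \<rho> \<nu>" and \<epsilon>: "0 < \<epsilon>"
  shows "\<exists>C. \<forall>n nn lam. 0 < nn \<longrightarrow> 0 < lam \<longrightarrow> lam \<le> 1 \<longrightarrow> (\<forall>l\<in>{1..m}. 1 \<le> n l \<and> nn \<le> real (n l)) \<longrightarrow>
    (AE \<omega> in P. convex_on UNIV (sum_loglik m M \<eta> n (\<lambda>l i. X l i \<omega>))) \<longrightarrow>
    (\<exists>E\<in>sets P. 1 - \<epsilon> \<le> P.prob E \<and> (\<forall>\<omega>\<in>E. \<forall>\<tau> \<tau>'. \<tau> \<in> S \<longrightarrow>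
      local_minimum (pen_crit m M \<eta> J lam n (\<lambda>l i. X l i \<omega>)) \<tau> \<longrightarrow>
      quad_crit m M \<eta> J \<tau>0 lam n (\<lambda>l i. X l i \<omega>) \<tau>' \<le> quad_crit m M \<eta> J \<tau>0 lam n (\<lambda>l i. X l i \<omega>) \<tau>0 \<longrightarrow>
      \<bar>W (\<tau> - \<tau>') + lam * J' (\<tau> - \<tau>') (\<tau> - \<tau>')\<bar> \<le> C * (1 / nn * lam powr (- 1 / r) + lam) \<and>
      \<bar>W (\<tau> - \<tau>0) + lam * J' (\<tau> - \<tau>0) (\<tau> - \<tau>0)\<bar> \<le> C * (1 / nn * lam powr (- 1 / r) + lam)))"
proof -
  obtain B cw Cw KV where "penalized_model P m P0 X g A N D W B C1 C2 b \<rho>' cw Cw ipW J' KV M2"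
    using penalized_model by (elim exE)
  then interpret pm: penalized_model P m P0 X g A N D W B C1 C2 b \<rho>' cw Cw ipW J' KV M2 .
  obtain Cd where Cd: "1 \<le> Cd" "\<forall>lam F. 0 < lam \<longrightarrow> lam \<le> 1 \<longrightarrow> finite F \<longrightarrow>
      (\<Sum>i\<in>F. 1 / (1 + lam * \<rho>' i)) \<le> Cd * lam powr (- 1 / r) \<and> 1 \<le> Cd * lam powr (- 1 / r)"
    by (rule exE[OF effective_dimension[OF r \<beta>]]) (rule \<rho>, assumption, elim conjE, rule that)
  obtain C0 where C0: "\<forall>n nn lam d. 0 < nn \<longrightarrow> 1 \<le> d \<longrightarrow> 0 < lam \<longrightarrow>
    (\<forall>l\<in>{1..m}. 1 \<le> n l \<and> nn \<le> real (n l)) \<longrightarrow> pm.effective_dim_le lam d \<longrightarrow>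
    (\<exists>E\<in>P.events. 1 - \<epsilon> \<le> P.prob E \<and> (\<forall>\<omega>\<in>E. pm.regular_sample n \<omega> \<longrightarrow>
      (\<forall>v\<in>N. (\<forall>t. 0 \<le> t \<longrightarrow> t \<le> 1 \<longrightarrow>
          lam / 2 * J' (t *\<^sub>R v) (t *\<^sub>R v) + lam * J' \<tau>0 (t *\<^sub>R v) \<le> pm.log_ratio n \<omega> (t *\<^sub>R v)) \<longrightarrow>
        pm.S lam v \<le> C0 * (d / nn + lam)) \<and>
      (\<forall>v. 1 / 2 * (\<Sum>l=1..m. LINT x|P0 l. (D l 0 v x)\<^sup>2) + lam / 2 * J' v v + lam * J' \<tau>0 v \<le> pm.score n \<omega> v \<longrightarrow>
        pm.S lam v \<le> C0 * (d / nn + lam))))"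
    using pm.minimizer_rates[OF \<epsilon>, of \<tau>0] by (elim exE)
  define C where "C = \<bar>C0\<bar> * Cd"
  have C: "0 \<le> C" unfolding C_def using Cd(1) by simp
  show ?thesis
  \<comment> \<open>Both deviations from the truth have \<open>S\<close> at most \<open>C\<close>
    times the rate; the parallelogram inequality doubles each of them for the difference.\<close>
  proof (rule exI[of _ "4 * C"], intro allI impI)
    fix n :: "nat \<Rightarrow> nat" and nn lam :: real
    assume nn: "0 < nn" and lam: "0 < lam" "lam \<le> 1" and n: "\<forall>l\<in>{1..m}. 1 \<le> n l \<and> nn \<le> real (n l)"
      and conv: "AE \<omega> in P. convex_on UNIV (sum_loglik m M \<eta> n (\<lambda>l i. X l i \<omega>))"
    define d where "d = Cd * lam powr (- 1 / r)"
    define R where "R = 1 / nn * lam powr (- 1 / r) + lam"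
    have n1: "1 \<le> n l" if "l \<in> {1..m}" for l using n that by auto
    have Cd': "(\<Sum>i\<in>F. 1 / (1 + lam * \<rho>' i)) \<le> d \<and> 1 \<le> d" if "finite F" for F
      unfolding d_def using Cd(2)[THEN spec[of _ lam], THEN spec[of _ F], THEN mp, OF lam(1), THEN mp, OF lam(2), THEN mp, OF that] .
    have d1: "1 \<le> d" by (rule conjunct2[OF Cd'[OF finite.emptyI]])
    have dim: "pm.effective_dim_le lam d"
      unfolding pm.effective_dim_le_def by (intro allI impI conjunct1[OF Cd'])
    have R: "0 \<le> R" unfolding R_def using nn lam by simp
    have le: "C0 * (d / nn + lam) \<le> C * R"
    proof -
      have "d / nn + lam \<le> Cd * R"
        unfolding R_def d_def distrib_left using Cd(1) lam mult_right_mono[of 1 Cd lam] by simp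
      then have "\<bar>C0\<bar> * (d / nn + lam) \<le> \<bar>C0\<bar> * (Cd * R)" by (rule mult_left_mono) simp
      moreover have "C0 * (d / nn + lam) \<le> \<bar>C0\<bar> * (d / nn + lam)" using d1 nn lam by (intro mult_right_mono) auto
      ultimately show ?thesis by (simp add: C_def mult.assoc)
    qed
    obtain E where E: "E \<in> P.events" "1 - \<epsilon> \<le> P.prob E" and E':
      "\<forall>\<omega>\<in>E. pm.regular_sample n \<omega> \<longrightarrow>
      (\<forall>v\<in>N. (\<forall>t. 0 \<le> t \<longrightarrow> t \<le> 1 \<longrightarrow>
          lam / 2 * J' (t *\<^sub>R v) (t *\<^sub>R v) + lam * J' \<tau>0 (t *\<^sub>R v) \<le> pm.log_ratio n \<omega> (t *\<^sub>R v)) \<longrightarrow>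
        pm.S lam v \<le> C0 * (d / nn + lam)) \<and>
      (\<forall>v. 1 / 2 * (\<Sum>l=1..m. LINT x|P0 l. (D l 0 v x)\<^sup>2) + lam / 2 * J' v v + lam * J' \<tau>0 v \<le> pm.score n \<omega> v \<longrightarrow>
        pm.S lam v \<le> C0 * (d / nn + lam))"
      using C0[THEN spec[of _ n], THEN spec[of _ nn], THEN spec[of _ lam], THEN spec[of _ d],
        THEN mp, OF nn, THEN mp, OF d1, THEN mp, OF lam(1), THEN mp, OF n, THEN mp, OF dim]
      by (elim bexE conjE)
    have "AE \<omega> in P. \<forall>l\<in>{1..m}. \<forall>i\<ge>1. \<forall>v\<in>N. (\<lambda>\<sigma>. \<eta> l \<sigma> (X l i \<omega>)) differentiable (at (\<tau>0 + v)) \<and>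
        (\<forall>w. D l v w (X l i \<omega>) = frechet_derivative (\<lambda>\<sigma>. \<eta> l \<sigma> (X l i \<omega>)) (at (\<tau>0 + v)) w)"
      by (rule AE_samples[OF D_eq_frechet])
    then have "AE \<omega> in P. convex_on UNIV (sum_loglik m M \<eta> n (\<lambda>l i. X l i \<omega>)) \<and> pm.regular_sample n \<omega>"
      using conv
    proof eventually_elim
      fix \<omega>
      assume sm: "\<forall>l\<in>{1..m}. \<forall>i\<ge>1. \<forall>v\<in>N. (\<lambda>\<sigma>. \<eta> l \<sigma> (X l i \<omega>)) differentiable (at (\<tau>0 + v)) \<and>
          (\<forall>w. D l v w (X l i \<omega>) = frechet_derivative (\<lambda>\<sigma>. \<eta> l \<sigma> (X l i \<omega>)) (at (\<tau>0 + v)) w)"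
        and cv: "convex_on UNIV (sum_loglik m M \<eta> n (\<lambda>l i. X l i \<omega>))"
      have "convex_on UNIV (\<lambda>v. - pm.log_ratio n \<omega> v)"
      proof (rule convex_onI)
        fix t :: real and u v assume t: "0 < t" "t < 1"
        have eq: "- pm.log_ratio n \<omega> v = sum_loglik m M \<eta> n (\<lambda>l i. X l i \<omega>) (\<tau>0 + v) - sum_loglik m M \<eta> n (\<lambda>l i. X l i \<omega>) \<tau>0" for v
          unfolding pm.log_ratio_def by (rule sum_loglik_eq[symmetric]) (rule n1)
        have "sum_loglik m M \<eta> n (\<lambda>l i. X l i \<omega>) ((1 - t) *\<^sub>R (\<tau>0 + u) + t *\<^sub>R (\<tau>0 + v)) \<le>
            (1 - t) * sum_loglik m M \<eta> n (\<lambda>l i. X l i \<omega>) (\<tau>0 + u) + t * sum_loglik m M \<eta> n (\<lambda>l i. X l i \<omega>) (\<tau>0 + v)"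
          using t by (intro convex_onD[OF cv]) auto
        moreover have "(1 - t) *\<^sub>R (\<tau>0 + u) + t *\<^sub>R (\<tau>0 + v) = \<tau>0 + ((1 - t) *\<^sub>R u + t *\<^sub>R v)" by (simp add: algebra_simps)
        ultimately show "- pm.log_ratio n \<omega> ((1 - t) *\<^sub>R u + t *\<^sub>R v) \<le> (1 - t) * - pm.log_ratio n \<omega> u + t * - pm.log_ratio n \<omega> v"
          unfolding eq by (simp add: algebra_simps)
      qed simp
      note cv' = this
      have sm': "continuous_on N (\<lambda>v. g l v (X l k \<omega>))" "bounded_linear (\<lambda>v. D l 0 v (X l k \<omega>))"
        "(\<lambda>j. (g l (inverse (real (Suc j)) *\<^sub>R v) (X l k \<omega>) - g l 0 (X l k \<omega>)) * real (Suc j))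
          \<longlonglongrightarrow> D l 0 v (X l k \<omega>)" if l: "l \<in> {1..m}" and k: "k \<in> {1..n l}" for l k v
      proof -
        have "1 \<le> k" using k by simp
        note s = pointwise_smooth[OF sm[THEN bspec, OF l, THEN spec, THEN mp, OF this]]
        show "continuous_on N (\<lambda>v. g l v (X l k \<omega>))" "bounded_linear (\<lambda>v. D l 0 v (X l k \<omega>))"
          "(\<lambda>j. (g l (inverse (real (Suc j)) *\<^sub>R v) (X l k \<omega>) - g l 0 (X l k \<omega>)) * real (Suc j))
            \<longlonglongrightarrow> D l 0 v (X l k \<omega>)" by (fact s)+
      qed
      show "convex_on UNIV (sum_loglik m M \<eta> n (\<lambda>l i. X l i \<omega>)) \<and> pm.regular_sample n \<omega>"
        unfolding pm.regular_sample_def by (intro conjI cv cv' ballI allI sm')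
    qed
    then obtain E0 where E0: "E0 \<in> P.events" "P.prob E0 = 1"
      and E0': "\<And>\<omega>. \<omega> \<in> E0 \<Longrightarrow> convex_on UNIV (sum_loglik m M \<eta> n (\<lambda>l i. X l i \<omega>)) \<and> pm.regular_sample n \<omega>"
      by (rule P.AE_event) (assumption | rule that)+
    have pE: "1 - \<epsilon> \<le> P.prob (E \<inter> E0)" using P.prob_Int_ge[OF E(1) E0(1)] E(2) E0(2) by simp
    have main: "\<bar>W (\<tau> - \<tau>') + lam * J' (\<tau> - \<tau>') (\<tau> - \<tau>')\<bar> \<le> 4 * C * R \<and> \<bar>W (\<tau> - \<tau>0) + lam * J' (\<tau> - \<tau>0) (\<tau> - \<tau>0)\<bar> \<le> 4 * C * R"
      if \<omega>: "\<omega> \<in> E \<inter> E0" and \<tau>: "\<tau> \<in> S" and loc: "local_minimum (pen_crit m M \<eta> J lam n (\<lambda>l i. X l i \<omega>)) \<tau>"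
        and quad: "quad_crit m M \<eta> J \<tau>0 lam n (\<lambda>l i. X l i \<omega>) \<tau>' \<le> quad_crit m M \<eta> J \<tau>0 lam n (\<lambda>l i. X l i \<omega>) \<tau>0" for \<omega> \<tau> \<tau>'
    proof -
      have cv: "convex_on UNIV (sum_loglik m M \<eta> n (\<lambda>l i. X l i \<omega>))" and reg: "pm.regular_sample n \<omega>"
        by (fact conjunct1[OF E0'[OF IntD2[OF \<omega>]]] conjunct2[OF E0'[OF IntD2[OF \<omega>]]])+
      have bounds: "\<forall>v\<in>N. (\<forall>t. 0 \<le> t \<longrightarrow> t \<le> 1 \<longrightarrow>
          lam / 2 * J' (t *\<^sub>R v) (t *\<^sub>R v) + lam * J' \<tau>0 (t *\<^sub>R v) \<le> pm.log_ratio n \<omega> (t *\<^sub>R v)) \<longrightarrow>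
          pm.S lam v \<le> C0 * (d / nn + lam)"
        "\<forall>v. 1 / 2 * (\<Sum>l=1..m. LINT x|P0 l. (D l 0 v x)\<^sup>2) + lam / 2 * J' v v + lam * J' \<tau>0 v \<le> pm.score n \<omega> v \<longrightarrow>
          pm.S lam v \<le> C0 * (d / nn + lam)"
        by (fact conjunct1[OF E'[THEN bspec, OF IntD1[OF \<omega>], THEN mp, OF reg]]
          conjunct2[OF E'[THEN bspec, OF IntD1[OF \<omega>], THEN mp, OF reg]])+
      define v where "v = \<tau> - \<tau>0"
      define v' where "v' = \<tau>' - \<tau>0"
      have v: "\<tau> = \<tau>0 + v" "\<tau>' = \<tau>0 + v'" by (simp_all add: v_def v'_def)
      have vN: "v \<in> N" using \<tau> by (simp add: N_def v(1)[symmetric])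
      have "pm.S lam v \<le> C0 * (d / nn + lam)"
      proof (rule bounds(1)[THEN bspec, OF vN, THEN mp], intro allI impI)
        fix t :: real assume t: "0 \<le> t" "t \<le> 1"
        have p1: "pen_crit m M \<eta> J lam n (\<lambda>l i. X l i \<omega>) (\<tau>0 + t *\<^sub>R v) \<le> pen_crit m M \<eta> J lam n (\<lambda>l i. X l i \<omega>) \<tau>0"
          using lam loc unfolding v by (intro local_minimum_segment pen_crit_convex cv t) auto
        have p2: "sum_loglik m M \<eta> n (\<lambda>l i. X l i \<omega>) (\<tau>0 + t *\<^sub>R v) - sum_loglik m M \<eta> n (\<lambda>l i. X l i \<omega>) \<tau>0 = - pm.log_ratio n \<omega> (t *\<^sub>R v)"
          unfolding pm.log_ratio_def by (rule sum_loglik_eq) (rule n1)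
        have shift_bound: "lam / 2 * x + lam * y \<le> z" if "a + lam / 2 * (c + x + 2 * y) \<le> a' + lam / 2 * c" "a - a' = - z" for a a' c x y z :: real
        proof -
          have "lam / 2 * (c + x + 2 * y) = lam / 2 * c + (lam / 2 * x + lam * y)" by (simp add: algebra_simps)
          with that(1) have "a + (lam / 2 * c + (lam / 2 * x + lam * y)) \<le> a' + lam / 2 * c" by (simp only:)
          moreover have shift: "q \<le> a' - a" if "a + (p + q) \<le> a' + p" for p q :: real using that by linarith
          ultimately have "lam / 2 * x + lam * y \<le> a' - a" by (intro shift)
          then show ?thesis using that(2) by linarith
        qed
        show "lam / 2 * J' (t *\<^sub>R v) (t *\<^sub>R v) + lam * J' \<tau>0 (t *\<^sub>R v) \<le> pm.log_ratio n \<omega> (t *\<^sub>R v)"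
          by (rule shift_bound[OF p1[unfolded pen_crit_def penalty_expand] p2])
      qed
      then have Sv: "pm.S lam v \<le> C * R" using le by linarith
      have "pm.S lam v' \<le> C0 * (d / nn + lam)"
      proof (rule bounds(2)[THEN spec, THEN mp])
        have "bounded_linear (\<lambda>w. D l 0 w (X l k \<omega>))" if "l \<in> {1..m}" "k \<in> {1..n l}" for l k
          using conjunct2[OF reg[unfolded pm.regular_sample_def], THEN bspec, OF that(1), THEN bspec, OF that(2)] by (elim conjE)
        note lin = this
        from quad_crit_eq[of n "\<lambda>l i. X l i \<omega>", OF lin]
        have "quad_crit m M \<eta> J \<tau>0 lam n (\<lambda>l i. X l i \<omega>) (\<tau>0 + v') - quad_crit m M \<eta> J \<tau>0 lam n (\<lambda>l i. X l i \<omega>) \<tau>0 =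
          1 / 2 * (\<Sum>l=1..m. LINT x|P0 l. (D l 0 v' x)\<^sup>2) + lam / 2 * J' v' v' + lam * J' \<tau>0 v' - pm.score n \<omega> v'"
          unfolding pm.score_def by simp
        then show "1 / 2 * (\<Sum>l=1..m. LINT x|P0 l. (D l 0 v' x)\<^sup>2) + lam / 2 * J' v' v' + lam * J' \<tau>0 v' \<le> pm.score n \<omega> v'"
          using quad unfolding v by linarith
      qed
      then have Sv': "pm.S lam v' \<le> C * R" using le by linarith
      have "\<tau> - \<tau>' = v - v'" by (simp add: v_def v'_def)
      moreover have "pm.S lam (v - v') \<le> 4 * C * R"
        using pm.S_parallelogram[of lam v v'] Sv Sv' lam by simp
      moreover have "pm.S lam v \<le> 4 * C * R" using Sv mult_nonneg_nonneg[OF C R] by linarith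
      ultimately show ?thesis
        using pm.S_nonneg[of lam v] pm.S_nonneg[of lam "v - v'"] lam unfolding pm.S_def v_def[symmetric] by simp
    qed
    show "\<exists>E\<in>sets P. 1 - \<epsilon> \<le> P.prob E \<and> (\<forall>\<omega>\<in>E. \<forall>\<tau> \<tau>'. \<tau> \<in> S \<longrightarrow>
      local_minimum (pen_crit m M \<eta> J lam n (\<lambda>l i. X l i \<omega>)) \<tau> \<longrightarrow>
      quad_crit m M \<eta> J \<tau>0 lam n (\<lambda>l i. X l i \<omega>) \<tau>' \<le> quad_crit m M \<eta> J \<tau>0 lam n (\<lambda>l i. X l i \<omega>) \<tau>0 \<longrightarrow>
      \<bar>W (\<tau> - \<tau>') + lam * J' (\<tau> - \<tau>') (\<tau> - \<tau>')\<bar> \<le> 4 * C * (1 / nn * lam powr (- 1 / r) + lam) \<and>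
      \<bar>W (\<tau> - \<tau>0) + lam * J' (\<tau> - \<tau>0) (\<tau> - \<tau>0)\<bar> \<le> 4 * C * (1 / nn * lam powr (- 1 / r) + lam))"
      unfolding R_def[symmetric]
      by (intro bexI[of _ "E \<inter> E0"] conjI[OF pE] ballI allI impI main sets.Int E(1) E0(1))
  qed
qed

end

section \<open>Passage to stochastic order along a sequence\<close>

section \<open>Rates of convergence\<close>

theorem theorem5:
  fixes m :: nat
    and M :: "nat \<Rightarrow> 'x measure"
    and \<eta> :: "nat \<Rightarrow> (real ^ 'p) \<times> ('h :: {real_inner, complete_space}) \<Rightarrow> 'x \<Rightarrow> real"
    and \<theta>0 :: "real ^ 'p" and h0 :: 'h
    and P :: "'w measure" and X :: "nat \<Rightarrow> nat \<Rightarrow> 'w \<Rightarrow> 'x"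
    and J :: "'h \<Rightarrow> 'h \<Rightarrow> real"
    and Lth :: "nat \<Rightarrow> real ^ 'p \<Rightarrow> 'x \<Rightarrow> real" and Lh :: "nat \<Rightarrow> 'h \<Rightarrow> 'x \<Rightarrow> real"
    and Nth :: "(real ^ 'p) set" and Nh :: "'h set"
    and C1 C2 C3 C4 Cd :: real
    and \<phi> :: "nat \<Rightarrow> 'h" and \<rho> \<kappa> :: "nat \<Rightarrow> real" and r \<beta>1 \<beta>2 :: real
    and n :: "nat \<Rightarrow> nat \<Rightarrow> nat" and nmin :: "nat \<Rightarrow> nat" and lam :: "nat \<Rightarrow> real"
    and \<tau>hat \<tau>til :: "nat \<Rightarrow> 'w \<Rightarrow> (real ^ 'p) \<times> 'h"
    and P0 :: "nat \<Rightarrow> 'x measure"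
  assumes "m \<ge> 1"
    \<comment> \<open>model and samples\<close>
    and P0_def: "P0 = (\<lambda>l. model_law (M l) (\<eta> l) (\<theta>0, h0))"
    and norm_const: "\<forall>l\<in>{1..m}. \<forall>\<tau>. integrable (M l) (\<lambda>x. exp (\<eta> l \<tau> x))"
    and eta_L2_0: "\<forall>l\<in>{1..m}. \<forall>\<tau>. \<eta> l \<tau> \<in> L2_0 (P0 l)"
    and prob_P: "prob_space P"
    and indep: "prob_space.indep_vars P (\<lambda>(l, i). M l) (\<lambda>(l, i). X l i) ({1..m} \<times> {1..})"
    and law_X: "\<forall>l\<in>{1..m}. \<forall>i\<ge>1. distr P (M l) (X l i) = P0 l"
    \<comment> \<open>Assumption 1\<close>
    and A1_J: "semi_inner_product J"
    and A1_null: "\<exists>B. finite B \<and> {g. J g g = 0} = span B"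
    \<comment> \<open>Assumption 2\<close>
    and A2_L: "\<forall>l\<in>{1..m}. L2_bounded_linear (P0 l) (Lth l) \<and> L2_zero_null_space (P0 l) (Lth l) \<and>
                 L2_bounded_linear (P0 l) (Lh l) \<and> L2_zero_null_space (P0 l) (Lh l)"
    and A2_i: "\<forall>s>0. \<exists>M1>0. \<exists>M2>0. \<forall>g.
                 M1 * (norm g)\<^sup>2 \<le> sum_var m P0 (\<lambda>l. Lh l g) + s * J g g \<and>
                 sum_var m P0 (\<lambda>l. Lh l g) + s * J g g \<le> M2 * (norm g)\<^sup>2"
    and A2_ii: "\<exists>c\<delta>>0. \<forall>\<zeta> g. norm \<zeta> = 1 \<longrightarrow>
                 sum_var m P0 (\<lambda>l x. Lth l \<zeta> x - Lh l g x) > c\<delta>"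
    \<comment> \<open>neighborhoods\<close>
    and Nth: "open Nth" "\<theta>0 \<in> Nth" and Nh: "open Nh" "h0 \<in> Nh"
    \<comment> \<open>Assumption 3\<close>
    and A3_inj: "\<forall>l\<in>{1..m}. \<forall>\<tau>\<in>Nth \<times> Nh. \<forall>\<sigma>\<in>Nth \<times> Nh.
                   (AE x in P0 l. \<eta> l \<tau> x = \<eta> l \<sigma> x) \<longrightarrow> \<tau> = \<sigma>"
    and A3_C3: "\<forall>l\<in>{1..m}. L2_Ck_on (P0 l) 3 (Nth \<times> Nh) (\<eta> l)"
    and A3_point: "\<forall>l\<in>{1..m}. AE x in P0 l. \<forall>\<tau>\<in>Nth \<times> Nh. (\<lambda>\<sigma>. \<eta> l \<sigma> x) differentiable (at \<tau>)"
    and A3_root: "\<forall>ns. (\<forall>l\<in>{1..m}. ns l \<ge> 1) \<longrightarrow> (\<forall>\<tau>\<in>Nth \<times> Nh.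
        (\<forall>\<zeta>. (LINT \<omega>|P. D_fst (sum_loglik m M \<eta> ns (\<lambda>l i. X l i \<omega>)) \<tau> \<zeta>) = 0) \<and>
        (\<forall>g. (LINT \<omega>|P. D_snd (sum_loglik m M \<eta> ns (\<lambda>l i. X l i \<omega>)) \<tau> g) = 0)
        \<longleftrightarrow> \<tau> = (\<theta>0, h0))"
    \<comment> \<open>Assumption 4\<close>
    and A4_lin: "\<forall>l\<in>{1..m}. \<forall>\<tau>\<in>Nth \<times> Nh.
                   L2_bounded_linear (P0 l) (D_theta (\<eta> l) \<tau>) \<and> L2_bounded_linear (P0 l) (D_h (\<eta> l) \<tau>)"
    and A4_const: "C1 > 0" "C2 > 0"
    and A4: "\<forall>\<tau>\<in>Nth \<times> Nh. \<forall>\<zeta> g.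
        C1 * sum_var m P0 (\<lambda>l x. Lth l \<zeta> x + Lh l g x)
          \<le> sum_var m P0 (\<lambda>l x. D_theta (\<eta> l) \<tau> \<zeta> x + D_h (\<eta> l) \<tau> g x) \<and>
        sum_var m P0 (\<lambda>l x. D_theta (\<eta> l) \<tau> \<zeta> x + D_h (\<eta> l) \<tau> g x)
          \<le> C2 * sum_var m P0 (\<lambda>l x. Lth l \<zeta> x + Lh l g x)"
    \<comment> \<open>Assumption 5\<close>
    and A5_const: "Cd > 0" "Cd < 2 * C1"
    and A5: "\<forall>\<tau>1\<in>Nth \<times> Nh. \<forall>\<tau>2\<in>Nth \<times> Nh. \<forall>(\<zeta>, g)\<in>Nth \<times> Nh.
        sum_var m P0 (\<lambda>l x. (D_theta (\<eta> l) \<tau>1 \<zeta> x - D_theta (\<eta> l) \<tau>2 \<zeta> x)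
                             + (D_h (\<eta> l) \<tau>1 g x - D_h (\<eta> l) \<tau>2 g x))
          \<le> Cd * sum_var m P0 (\<lambda>l x. Lth l \<zeta> x + Lh l g x)"
    \<comment> \<open>Assumption 6; membership of the estimator in the neighborhood is part of \<open>estimators\<close>\<close>
    and A6_convex: "convex (Nth \<times> Nh)"
    and A6_const: "C3 > 0" "C4 > 0"
    and A6: "\<forall>\<tau>\<in>Nth \<times> Nh. \<forall>f. (\<forall>l\<in>{1..m}. f l \<in> L2_0 (P0 l)) \<longrightarrow>
        C3 * sum_var m P0 f \<le> sum_var m (\<lambda>l. model_law (M l) (\<eta> l) \<tau>) f \<and>
        sum_var m (\<lambda>l. model_law (M l) (\<eta> l) \<tau>) f \<le> C4 * sum_var m P0 f"
    \<comment> \<open>Assumption 7 with the complete system of eigenfunctions\<close>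
    and A7: "completely_continuous_wrt (\<lambda>g. sum_var m P0 (\<lambda>l. Lh l g)) (\<lambda>g. J g g)"
    and A7_V: "\<forall>\<nu>\<ge>1. \<forall>\<mu>\<ge>1. sum_cov m P0 (\<lambda>l. Lh l (\<phi> \<nu>)) (\<lambda>l. Lh l (\<phi> \<mu>)) = (if \<nu> = \<mu> then 1 else 0)"
    and A7_J: "\<forall>\<nu>\<ge>1. \<forall>\<mu>\<ge>1. J (\<phi> \<nu>) (\<phi> \<mu>) = (if \<nu> = \<mu> then \<rho> \<nu> else 0)"
    and A7_complete: "closure (span (\<phi> ` {1..})) = UNIV"
    and A7_rho: "\<forall>\<nu>\<ge>1. \<rho> \<nu> \<ge> 0" "filterlim \<rho> at_top sequentially"
    \<comment> \<open>Assumption 8\<close>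
    and A8_const: "r > 1" "0 < \<beta>1" "\<beta>1 < \<beta>2"
    and A8: "\<forall>\<nu>\<ge>1. \<rho> \<nu> = \<kappa> \<nu> * real \<nu> powr r \<and> \<kappa> \<nu> \<in> {\<beta>1<..<\<beta>2}"
    \<comment> \<open>sample sizes and smoothing parameter\<close>
    and n_pos: "\<forall>k. \<forall>l\<in>{1..m}. n k l \<ge> 1"
    and nmin_def: "nmin = (\<lambda>k. Min (n k ` {1..m}))"
    and lam_pos: "\<forall>k. lam k > 0"
    and n_lim: "filterlim nmin at_top sequentially"
    and lam_lim: "lam \<longlonglongrightarrow> 0"
    and n_lam_lim: "filterlim (\<lambda>k. real (nmin k) * lam k powr (1 / r)) at_top sequentially"
    \<comment> \<open>criteria and estimators\<close>
    and convex_loglik: "\<forall>k. AE \<omega> in P. convex_on UNIV (sum_loglik m M \<eta> (n k) (\<lambda>l i. X l i \<omega>))"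
    and estimators: "with_prob_tendsto_1 P (\<lambda>k \<omega>.
        let F = pen_crit m M \<eta> J (lam k) (n k) (\<lambda>l i. X l i \<omega>);
            G = quad_crit m M \<eta> J (\<theta>0, h0) (lam k) (n k) (\<lambda>l i. X l i \<omega>)
        in \<tau>hat k \<omega> \<in> Nth \<times> Nh \<and>
           (\<forall>\<tau>\<in>Nth \<times> Nh. local_minimum F \<tau> \<longleftrightarrow> \<tau> = \<tau>hat k \<omega>) \<and>
           (\<forall>\<tau>\<in>Nth \<times> Nh. critical_point F \<tau> \<longleftrightarrow> \<tau> = \<tau>hat k \<omega>) \<and>
           \<tau>til k \<omega> \<in> Nth \<times> Nh \<and>
           (\<forall>\<tau>. G (\<tau>til k \<omega>) \<le> G \<tau>))"
  shows "bigO_prob P (\<lambda>k \<omega>.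
            sum_var m P0 (\<lambda>l x. Lth l (fst (\<tau>hat k \<omega>) - fst (\<tau>til k \<omega>)) x
                                 + Lh l (snd (\<tau>hat k \<omega>) - snd (\<tau>til k \<omega>)) x)
            + lam k * J (snd (\<tau>hat k \<omega>) - snd (\<tau>til k \<omega>)) (snd (\<tau>hat k \<omega>) - snd (\<tau>til k \<omega>)))
          (\<lambda>k. 1 / real (nmin k) * lam k powr (- 1 / r) + lam k)
       \<and> bigO_prob P (\<lambda>k \<omega>.
            sum_var m P0 (\<lambda>l x. Lth l (fst (\<tau>hat k \<omega>) - \<theta>0) x
                                 + Lh l (snd (\<tau>hat k \<omega>) - h0) x)
            + lam k * J (snd (\<tau>hat k \<omega>) - h0) (snd (\<tau>hat k \<omega>) - h0))
          (\<lambda>k. 1 / real (nmin k) * lam k powr (- 1 / r) + lam k)"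
proof -
  interpret P: prob_space P by (rule prob_P)
  \<comment> \<open>Taking \<open>s = 1\<close> gives continuity constants for \<open>W\<close> and
    \<open>J\<close> that do not vary with the smoothing parameter.\<close>
  obtain M1 M2 where "\<forall>g. M1 * (norm g)\<^sup>2 \<le> sum_var m P0 (\<lambda>l. Lh l g) + 1 * J g g \<and>
      sum_var m P0 (\<lambda>l. Lh l g) + 1 * J g g \<le> M2 * (norm g)\<^sup>2"
    using A2_i[THEN spec[of _ 1], THEN mp, OF zero_less_one] by (elim exE conjE)
  then have M2: "sum_var m P0 (\<lambda>l. Lh l g) + J g g \<le> M2 * (norm g)\<^sup>2" for g by simp
  obtain c\<delta> where c\<delta>: "0 < c\<delta>" "\<forall>\<zeta> g. norm \<zeta> = 1 \<longrightarrow> c\<delta> < sum_var m P0 (\<lambda>l x. Lth l \<zeta> x - Lh l g x)"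
    using A2_ii by (elim exE conjE)
  \<comment> \<open>The model-level facts come from convexity for the first tuple of sample sizes,
    \<open>n 0\<close>; convexity at index \<open>k\<close> is used again when the rates are
    applied.\<close>
  interpret model: penalized_density_model m M \<eta> "(\<theta>0, h0)" P X Lth Lh "Nth \<times> Nh" C1 C2 C3 C4 "n 0" P0 J \<phi> \<rho> c\<delta> M2
  proof
    show "1 \<le> m" by fact
    show "P0 = (\<lambda>l. model_law (M l) (\<eta> l) (\<theta>0, h0))" by (rule P0_def)
    show "prob_space.indep_vars P (\<lambda>(l, i). M l) (\<lambda>(l, i). X l i) ({1..m} \<times> {1..})" by (rule indep)
    show "open (Nth \<times> Nh)" by (rule open_Times[OF Nth(1) Nh(1)])
    show "(\<theta>0, h0) \<in> Nth \<times> Nh" using Nth(2) Nh(2) by simp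
    show "convex (Nth \<times> Nh)" by (rule A6_convex)
    show "0 < C1" "0 < C2" "0 < C3" "0 < C4" by fact+
    show "AE \<omega> in P. convex_on UNIV (sum_loglik m M \<eta> (n 0) (\<lambda>l i. X l i \<omega>))"
      by (rule convex_loglik[THEN spec])
    show "semi_inner_product J" by (rule A1_J)
    show "0 < c\<delta>" by (rule c\<delta>)
    show "closure (span (\<phi> ` {1..})) = UNIV" by (rule A7_complete)
    show "sum_var m P0 (\<lambda>l. Lh l h) + J h h \<le> M2 * (norm h)\<^sup>2" for h by (rule M2)
    show "c\<delta> < sum_var m P0 (\<lambda>l x. Lth l \<zeta> x - Lh l h x)" if "norm \<zeta> = 1" for \<zeta> h
      using c\<delta>(2)[THEN spec, THEN spec, THEN mp, OF that] .
    show "sum_cov m P0 (\<lambda>l. Lh l (\<phi> \<nu>)) (\<lambda>l. Lh l (\<phi> \<mu>)) = (if \<nu> = \<mu> then 1 else 0)"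
      "J (\<phi> \<nu>) (\<phi> \<mu>) = (if \<nu> = \<mu> then \<rho> \<nu> else 0)" if "1 \<le> \<nu>" "1 \<le> \<mu>" for \<nu> \<mu>
      by (rule A7_V[THEN spec, THEN mp, OF that(1), THEN spec, THEN mp, OF that(2)],
          rule A7_J[THEN spec, THEN mp, OF that(1), THEN spec, THEN mp, OF that(2)])
    fix \<tau> assume \<tau>: "\<tau> \<in> Nth \<times> Nh"
    show "C1 * sum_var m P0 (\<lambda>l x. Lth l \<zeta> x + Lh l g x)
          \<le> sum_var m P0 (\<lambda>l x. D_theta (\<eta> l) \<tau> \<zeta> x + D_h (\<eta> l) \<tau> g x)"
      "sum_var m P0 (\<lambda>l x. D_theta (\<eta> l) \<tau> \<zeta> x + D_h (\<eta> l) \<tau> g x)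
          \<le> C2 * sum_var m P0 (\<lambda>l x. Lth l \<zeta> x + Lh l g x)" for \<zeta> g
      by (rule conjunct1[OF A4[THEN bspec, OF \<tau>, THEN spec, THEN spec]],
          rule conjunct2[OF A4[THEN bspec, OF \<tau>, THEN spec, THEN spec]])
    fix f :: "nat \<Rightarrow> 'x \<Rightarrow> real" assume "\<And>l. l \<in> {1..m} \<Longrightarrow> f l \<in> L2_0 (P0 l)"
    then have "\<forall>l\<in>{1..m}. f l \<in> L2_0 (P0 l)" by (intro ballI)
    note A6' = A6[THEN bspec, OF \<tau>, THEN spec, THEN mp, OF this]
    show "C3 * sum_var m P0 f \<le> sum_var m (\<lambda>l. model_law (M l) (\<eta> l) \<tau>) f"
      "sum_var m (\<lambda>l. model_law (M l) (\<eta> l) \<tau>) f \<le> C4 * sum_var m P0 f" by (fact conjunct1[OF A6'] conjunct2[OF A6'])+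
  next
    fix l assume l: "l \<in> {1..m}"
    show "integrable (M l) (\<lambda>x. exp (\<eta> l \<tau> x))" "\<eta> l \<tau> \<in> L2_0 (P0 l)" for \<tau>
      by (rule norm_const[THEN bspec, OF l, THEN spec], rule eta_L2_0[THEN bspec, OF l, THEN spec])
    show "distr P (M l) (X l i) = P0 l" if "1 \<le> i" for i
      using law_X[THEN bspec, OF l, THEN spec, THEN mp, OF that] .
    show "L2_bounded_linear (P0 l) (Lth l)" "L2_zero_null_space (P0 l) (Lth l)" "L2_bounded_linear (P0 l) (Lh l)"
      by (insert A2_L[THEN bspec, OF l], elim conjE, assumption)+
    show "L2_Ck_on (P0 l) 3 (Nth \<times> Nh) (\<eta> l)" using A3_C3[THEN bspec, OF l] .
    show "AE x in P0 l. \<forall>\<tau>\<in>Nth \<times> Nh. (\<lambda>\<sigma>. \<eta> l \<sigma> x) differentiable (at \<tau>)" using A3_point[THEN bspec, OF l] .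
    show "L2_bounded_linear (P0 l) (D_theta (\<eta> l) \<tau>) \<and> L2_bounded_linear (P0 l) (D_h (\<eta> l) \<tau>)" if "\<tau> \<in> Nth \<times> Nh" for \<tau>
      using A4_lin[THEN bspec, OF l, THEN bspec, OF that] .
    show "1 \<le> n 0 l" using n_pos[THEN spec, THEN bspec, OF l] .
  qed
  define Q where "Q = (\<lambda>k \<tau> \<sigma>. sum_var m P0 (\<lambda>l x. Lth l (fst \<tau> - fst \<sigma>) x + Lh l (snd \<tau> - snd \<sigma>) x)
      + lam k * J (snd \<tau> - snd \<sigma>) (snd \<tau> - snd \<sigma>))"
  define a where "a = (\<lambda>k. 1 / real (nmin k) * lam k powr (- 1 / r) + lam k)"
  have Q: "model.W (\<tau> - \<sigma>) + lam k * model.J' (\<tau> - \<sigma>) (\<tau> - \<sigma>) = Q k \<tau> \<sigma>" for k \<tau> \<sigma>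
    unfolding Q_def model.W_def model.L_def[abs_def] model.J'_def fst_diff snd_diff ..
  have \<rho>: "\<beta>1 * real \<nu> powr r \<le> \<rho> \<nu>" if "1 \<le> \<nu>" for \<nu>
  proof -
    have "\<rho> \<nu> = \<kappa> \<nu> * real \<nu> powr r" "\<beta>1 < \<kappa> \<nu>" using A8 that by auto
    then show ?thesis by (simp add: mult_right_mono)
  qed
  obtain G where G: "\<forall>k. G k \<in> sets P \<and> (\<forall>\<omega>\<in>G k.
        let F = pen_crit m M \<eta> J (lam k) (n k) (\<lambda>l i. X l i \<omega>);
            G = quad_crit m M \<eta> J (\<theta>0, h0) (lam k) (n k) (\<lambda>l i. X l i \<omega>)
        in \<tau>hat k \<omega> \<in> Nth \<times> Nh \<and>
           (\<forall>\<tau>\<in>Nth \<times> Nh. local_minimum F \<tau> \<longleftrightarrow> \<tau> = \<tau>hat k \<omega>) \<and>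
           (\<forall>\<tau>\<in>Nth \<times> Nh. critical_point F \<tau> \<longleftrightarrow> \<tau> = \<tau>hat k \<omega>) \<and>
           \<tau>til k \<omega> \<in> Nth \<times> Nh \<and>
           (\<forall>\<tau>. G (\<tau>til k \<omega>) \<le> G \<tau>))"
    and G_lim: "(\<lambda>k. measure P (G k)) \<longlonglongrightarrow> 1"
    using estimators unfolding with_prob_tendsto_1_def by (elim exE conjE)
  have est: "\<tau>hat k \<omega> \<in> Nth \<times> Nh" "local_minimum (pen_crit m M \<eta> J (lam k) (n k) (\<lambda>l i. X l i \<omega>)) (\<tau>hat k \<omega>)"
    "quad_crit m M \<eta> J (\<theta>0, h0) (lam k) (n k) (\<lambda>l i. X l i \<omega>) (\<tau>til k \<omega>) \<le>
      quad_crit m M \<eta> J (\<theta>0, h0) (lam k) (n k) (\<lambda>l i. X l i \<omega>) (\<theta>0, h0)" if "\<omega> \<in> G k" for k \<omega>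
    using G[THEN spec[of _ k], THEN conjunct2, THEN bspec, OF that] unfolding Let_def by auto
  \<comment> \<open>Both bounds are obtained on the same event with the same constant; the two
    claims are its projections.\<close>
  have main: "\<exists>C. \<forall>\<^sub>F k in sequentially. \<exists>E\<in>sets P. measure P E \<ge> 1 - \<epsilon> \<and>
      (\<forall>\<omega>\<in>E. \<bar>Q k (\<tau>hat k \<omega>) (\<tau>til k \<omega>)\<bar> \<le> C * a k \<and> \<bar>Q k (\<tau>hat k \<omega>) (\<theta>0, h0)\<bar> \<le> C * a k)" if \<epsilon>: "0 < \<epsilon>" for \<epsilon>
  proof -
    \<comment> \<open>One half of \<open>\<epsilon>\<close> goes to the event of the rates, the
      other to the event \<open>G k\<close> on which the estimators have their defining
      properties.\<close>
    have \<epsilon>2: "0 < \<epsilon> / 2" using \<epsilon> by simp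
    obtain C where C: "\<forall>n nn lam. 0 < nn \<longrightarrow> 0 < lam \<longrightarrow> lam \<le> 1 \<longrightarrow> (\<forall>l\<in>{1..m}. 1 \<le> n l \<and> nn \<le> real (n l)) \<longrightarrow>
      (AE \<omega> in P. convex_on UNIV (sum_loglik m M \<eta> n (\<lambda>l i. X l i \<omega>))) \<longrightarrow>
      (\<exists>E\<in>sets P. 1 - \<epsilon> / 2 \<le> P.prob E \<and> (\<forall>\<omega>\<in>E. \<forall>\<tau> \<tau>'. \<tau> \<in> Nth \<times> Nh \<longrightarrow>
        local_minimum (pen_crit m M \<eta> J lam n (\<lambda>l i. X l i \<omega>)) \<tau> \<longrightarrow>
        quad_crit m M \<eta> J (\<theta>0, h0) lam n (\<lambda>l i. X l i \<omega>) \<tau>' \<le> quad_crit m M \<eta> J (\<theta>0, h0) lam n (\<lambda>l i. X l i \<omega>) (\<theta>0, h0) \<longrightarrow>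
        \<bar>model.W (\<tau> - \<tau>') + lam * model.J' (\<tau> - \<tau>') (\<tau> - \<tau>')\<bar> \<le> C * (1 / nn * lam powr (- 1 / r) + lam) \<and>
        \<bar>model.W (\<tau> - (\<theta>0, h0)) + lam * model.J' (\<tau> - (\<theta>0, h0)) (\<tau> - (\<theta>0, h0))\<bar> \<le> C * (1 / nn * lam powr (- 1 / r) + lam)))"
      by (rule exE[OF model.estimator_rates[OF A8_const(1,2) _ \<epsilon>2]]) (rule \<rho>, assumption, rule that)
    have "\<forall>\<^sub>F k in sequentially. 1 \<le> nmin k" using n_lim unfolding filterlim_at_top by (elim allE)
    moreover have "\<forall>\<^sub>F k in sequentially. lam k < 1" by (rule order_tendstoD(2)[OF lam_lim]) simp
    moreover have "\<forall>\<^sub>F k in sequentially. 1 - \<epsilon> / 2 < measure P (G k)" by (rule order_tendstoD(1)[OF G_lim]) (use \<epsilon> in simp)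
    ultimately have "\<forall>\<^sub>F k in sequentially. \<exists>E\<in>sets P. measure P E \<ge> 1 - \<epsilon> \<and>
      (\<forall>\<omega>\<in>E. \<bar>Q k (\<tau>hat k \<omega>) (\<tau>til k \<omega>)\<bar> \<le> C * a k \<and> \<bar>Q k (\<tau>hat k \<omega>) (\<theta>0, h0)\<bar> \<le> C * a k)"
    proof eventually_elim
      fix k assume k: "1 \<le> nmin k" "lam k < 1" "1 - \<epsilon> / 2 < measure P (G k)"
      have nn: "0 < real (nmin k)" and lam: "0 < lam k" "lam k \<le> 1" using k lam_pos by auto
      have nk: "\<forall>l\<in>{1..m}. 1 \<le> n k l \<and> real (nmin k) \<le> real (n k l)"
        unfolding nmin_def using n_pos by auto
      obtain E where E: "E \<in> sets P" "1 - \<epsilon> / 2 \<le> P.prob E" and E': "\<forall>\<omega>\<in>E. \<forall>\<tau> \<tau>'. \<tau> \<in> Nth \<times> Nh \<longrightarrow>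
        local_minimum (pen_crit m M \<eta> J (lam k) (n k) (\<lambda>l i. X l i \<omega>)) \<tau> \<longrightarrow>
        quad_crit m M \<eta> J (\<theta>0, h0) (lam k) (n k) (\<lambda>l i. X l i \<omega>) \<tau>' \<le> quad_crit m M \<eta> J (\<theta>0, h0) (lam k) (n k) (\<lambda>l i. X l i \<omega>) (\<theta>0, h0) \<longrightarrow>
        \<bar>Q k \<tau> \<tau>'\<bar> \<le> C * a k \<and> \<bar>Q k \<tau> (\<theta>0, h0)\<bar> \<le> C * a k"
        using C[THEN spec[of _ "n k"], THEN spec[of _ "real (nmin k)"], THEN spec[of _ "lam k"], THEN mp, OF nn,
          THEN mp, OF lam(1), THEN mp, OF lam(2), THEN mp, OF nk, THEN mp, OF convex_loglik[THEN spec]]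
        unfolding Q a_def by (elim bexE conjE)
      have Gk: "G k \<in> sets P" using G by blast
      have pr: "1 - \<epsilon> \<le> measure P (E \<inter> G k)" using P.prob_Int_ge[OF E(1) Gk] E(2) k(3) by simp
      have bd: "\<bar>Q k (\<tau>hat k \<omega>) (\<tau>til k \<omega>)\<bar> \<le> C * a k \<and> \<bar>Q k (\<tau>hat k \<omega>) (\<theta>0, h0)\<bar> \<le> C * a k" if \<omega>: "\<omega> \<in> E \<inter> G k" for \<omega>
        using E'[THEN bspec, OF IntD1[OF \<omega>], THEN spec, THEN spec, THEN mp, OF est(1)[OF IntD2[OF \<omega>]],
          THEN mp, OF est(2)[OF IntD2[OF \<omega>]], THEN mp, OF est(3)[OF IntD2[OF \<omega>]]] .
      show "\<exists>E\<in>sets P. measure P E \<ge> 1 - \<epsilon> \<and>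
          (\<forall>\<omega>\<in>E. \<bar>Q k (\<tau>hat k \<omega>) (\<tau>til k \<omega>)\<bar> \<le> C * a k \<and> \<bar>Q k (\<tau>hat k \<omega>) (\<theta>0, h0)\<bar> \<le> C * a k)"
        by (intro bexI[of _ "E \<inter> G k"] conjI[OF pr] ballI bd sets.Int E(1) Gk)
    qed
    then show ?thesis by (rule exI)
  qed
  have "bigO_prob P (\<lambda>k \<omega>. Q k (\<tau>hat k \<omega>) (\<tau>til k \<omega>)) a"
    unfolding bigO_prob_def
  proof (intro allI impI)
    fix \<epsilon> :: real assume "0 < \<epsilon>"
    then obtain C where "\<forall>\<^sub>F k in sequentially. \<exists>E\<in>sets P. measure P E \<ge> 1 - \<epsilon> \<and>
      (\<forall>\<omega>\<in>E. \<bar>Q k (\<tau>hat k \<omega>) (\<tau>til k \<omega>)\<bar> \<le> C * a k \<and> \<bar>Q k (\<tau>hat k \<omega>) (\<theta>0, h0)\<bar> \<le> C * a k)"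
      using main by blast
    then have "\<forall>\<^sub>F k in sequentially. \<exists>E\<in>sets P. measure P E \<ge> 1 - \<epsilon> \<and> (\<forall>\<omega>\<in>E. \<bar>Q k (\<tau>hat k \<omega>) (\<tau>til k \<omega>)\<bar> \<le> C * a k)"
      by eventually_elim blast
    then show "\<exists>C. \<forall>\<^sub>F k in sequentially. \<exists>E\<in>sets P. measure P E \<ge> 1 - \<epsilon> \<and> (\<forall>\<omega>\<in>E. \<bar>Q k (\<tau>hat k \<omega>) (\<tau>til k \<omega>)\<bar> \<le> C * a k)"
      by (rule exI)
  qed
  moreover have "bigO_prob P (\<lambda>k \<omega>. Q k (\<tau>hat k \<omega>) (\<theta>0, h0)) a"
    unfolding bigO_prob_def
  proof (intro allI impI)
    fix \<epsilon> :: real assume "0 < \<epsilon>"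
    then obtain C where "\<forall>\<^sub>F k in sequentially. \<exists>E\<in>sets P. measure P E \<ge> 1 - \<epsilon> \<and>
      (\<forall>\<omega>\<in>E. \<bar>Q k (\<tau>hat k \<omega>) (\<tau>til k \<omega>)\<bar> \<le> C * a k \<and> \<bar>Q k (\<tau>hat k \<omega>) (\<theta>0, h0)\<bar> \<le> C * a k)"
      using main by blast
    then have "\<forall>\<^sub>F k in sequentially. \<exists>E\<in>sets P. measure P E \<ge> 1 - \<epsilon> \<and> (\<forall>\<omega>\<in>E. \<bar>Q k (\<tau>hat k \<omega>) (\<theta>0, h0)\<bar> \<le> C * a k)"
      by eventually_elim blast
    then show "\<exists>C. \<forall>\<^sub>F k in sequentially. \<exists>E\<in>sets P. measure P E \<ge> 1 - \<epsilon> \<and> (\<forall>\<omega>\<in>E. \<bar>Q k (\<tau>hat k \<omega>) (\<theta>0, h0)\<bar> \<le> C * a k)"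
      by (rule exI)
  qed
  ultimately show ?thesis unfolding Q_def a_def fst_conv snd_conv by (rule conjI)
qed

end
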